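(* Let $\mathbb{I}$ be a set of cardinality strictly greater than $2^{\aleph_0}$, and let $\mathcal{T}_{\mathbb{I}}$ be the category of finitary $\mathbb{I}$-trees and embeddings. Then $\mathrm{Sh}(\mathcal{T}_{\mathbb{I}}^{\mathrm{op}},J_{\mathrm{at}})$ is a connected locally finitely presentable atomic topos with no points.
   Context: "Topos" means Grothendieck (sheaf) topos. A point of a topos $\mathcal{E}$ is a geometric morphism $\mathrm{Set}\to\mathcal{E}$. A full binary tree is a pointed oriented graph $(X, r_X\in X, {\prec}\subseteq X^2)$ such that: (1) for each $x\in X$, the set $\{y\in X : x\prec y\}$ is either empty or of cardinality $2$; (2) for each node $y$, there is exactly one path $r_X=x_0\prec x_1\prec\cdots\prec x_n=y$. When $x\prec y$, $x$ is the parent of $y$. An embedding of trees $f:X\to Y$ is an (injective) graph embedding preserving the root. A branch of $X$ is an infinite sequence $r_X=x_0\prec x_1\prec x_2\prec\cdots$; $B_X$ denotes the set of branches of $X$. An $\mathbb{I}$-tree is a full binary tree $X$ equipped with a partial function $c_X:B_X\to\mathbb{I}$ (the labeling function). An embedding of $\mathbb{I}$-trees is an embedding of full binary trees that preserves the labeling function (if a branch of $X$ has a label, its image is a branch of $Y$ with the same label). An $\mathbb{I}$-tree is finitary if it has a finite number of branches, a finite number of elements whose parent is not on a branch, and a total labeling function. $\mathcal{T}_{\mathbb{I}}$ is the (essentially small) category of finitary $\mathbb{I}$-trees and embeddings of $\mathbb{I}$-trees. The atomic topology $J_{\mathrm{at}}$ on $\mathcal{C}^{\mathrm{op}}$ is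 the Grothendieck topology generated by declaring all non-empty sieves covering; when every span in $\mathcal{C}$ admits a cocone, the covering sieves are exactly the non-empty sieves. Sheaves on $\mathcal{C}^{\mathrm{op}}$ are functors $\mathcal{C}\to\mathrm{Set}$. *)

theory Defs
  imports Main "HOL-Library.FuncSet" "HOL-Library.Equipollence"
begin

section \<open>Size\<close>

text \<open>
  HOL has no type of all sets, so the role of the ambient set-theoretic universe is played by a
  type \<^typ>\<open>'u\<close> whose cardinality is strongly inaccessible. A set, over any type, is small if it
  has fewer elements than \<^typ>\<open>'u\<close>; up to bijection the small sets are exactly the elements
  of the Grothendieck universe belonging to that cardinal.
\<close>

definition small :: "'u itself \<Rightarrow> 'x set \<Rightarrow> bool" where
  "small U A \<longleftrightarrow> A \<prec> (UNIV :: 'u set)"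

definition inaccessible :: "'u itself \<Rightarrow> bool" where
  "inaccessible U \<longleftrightarrow>
     small U (UNIV :: nat set) \<and>
     (\<forall>A :: 'u set. small U A \<longrightarrow> small U (Pow A)) \<and>
     (\<forall>(A :: 'u set) (B :: 'u \<Rightarrow> 'u set).
        small U A \<and> (\<forall>a\<in>A. small U (B a)) \<longrightarrow> small U (\<Union>a\<in>A. B a))"


section \<open>Categories, functors, natural transformations\<close>

record ('o, 'a) cat =
  obj :: "'o set"
  arr :: "'a set"
  src :: "'a \<Rightarrow> 'o"
  tgt :: "'a \<Rightarrow> 'o"
  idn :: "'o \<Rightarrow> 'a"
  cmp :: "'a \<Rightarrow> 'a \<Rightarrow> 'a"  \<comment> \<open>\<open>cmp C g f\<close> is \<open>g\<close> after \<open>f\<close>\<close>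

definition hom :: "('o, 'a) cat \<Rightarrow> 'o \<Rightarrow> 'o \<Rightarrow> 'a set" where
  "hom C X Y = {f \<in> arr C. src C f = X \<and> tgt C f = Y}"

locale category =
  fixes C :: "('o, 'a) cat"
  assumes src_obj: "f \<in> arr C \<Longrightarrow> src C f \<in> obj C"
    and tgt_obj: "f \<in> arr C \<Longrightarrow> tgt C f \<in> obj C"
    and idn_hom: "X \<in> obj C \<Longrightarrow> idn C X \<in> hom C X X"
    and cmp_hom: "f \<in> hom C X Y \<Longrightarrow> g \<in> hom C Y Z \<Longrightarrow> cmp C g f \<in> hom C X Z"
    and cmp_idn_right: "f \<in> hom C X Y \<Longrightarrow> cmp C f (idn C X) = f"
    and cmp_idn_left: "f \<in> hom C X Y \<Longrightarrow> cmp C (idn C Y) f = f"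
    and cmp_assoc: "f \<in> hom C W X \<Longrightarrow> g \<in> hom C X Y \<Longrightarrow> h \<in> hom C Y Z \<Longrightarrow>
      cmp C h (cmp C g f) = cmp C (cmp C h g) f"

definition small_category :: "'u itself \<Rightarrow> ('o, 'a) cat \<Rightarrow> bool" where
  "small_category U C \<longleftrightarrow> category C \<and> small U (obj C) \<and> small U (arr C)"

definition locally_small :: "'u itself \<Rightarrow> ('o, 'a) cat \<Rightarrow> bool" where
  "locally_small U C \<longleftrightarrow> (\<forall>X\<in>obj C. \<forall>Y\<in>obj C. small U (hom C X Y))"

definition opp :: "('o, 'a) cat \<Rightarrow> ('o, 'a) cat" where
  "opp C = C\<lparr>src := tgt C, tgt := src C, cmp := (\<lambda>g f. cmp C f g)\<rparr>"

definition full_subcat :: "('o, 'a) cat \<Rightarrow> ('o \<Rightarrow> bool) \<Rightarrow> ('o, 'a) cat" where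
  "full_subcat C P =
     C\<lparr>obj := {X \<in> obj C. P X}, arr := {f \<in> arr C. P (src C f) \<and> P (tgt C f)}\<rparr>"

definition iso :: "('o, 'a) cat \<Rightarrow> 'a \<Rightarrow> bool" where
  "iso C f \<longleftrightarrow> f \<in> arr C \<and>
     (\<exists>g\<in>hom C (tgt C f) (src C f). cmp C g f = idn C (src C f) \<and> cmp C f g = idn C (tgt C f))"

record ('o, 'a, 'p, 'b) fctr =
  onobj :: "'o \<Rightarrow> 'p"
  onarr :: "'a \<Rightarrow> 'b"

text \<open>
  Functors and natural transformations are \<open>undefined\<close> off their domains, so that equality of
  the HOL objects is equality of the functors and transformations they represent.
\<close>

definition is_functor :: "('o, 'a) cat \<Rightarrow> ('p, 'b) cat \<Rightarrow> ('o, 'a, 'p, 'b) fctr \<Rightarrow> bool" where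
  "is_functor C D F \<longleftrightarrow>
     onobj F \<in> obj C \<rightarrow>\<^sub>E obj D \<and>
     onarr F \<in> arr C \<rightarrow>\<^sub>E arr D \<and>
     (\<forall>f\<in>arr C. onarr F f \<in> hom D (onobj F (src C f)) (onobj F (tgt C f))) \<and>
     (\<forall>X\<in>obj C. onarr F (idn C X) = idn D (onobj F X)) \<and>
     (\<forall>f\<in>arr C. \<forall>g\<in>arr C. src C g = tgt C f \<longrightarrow>
        onarr F (cmp C g f) = cmp D (onarr F g) (onarr F f))"

definition id_functor :: "('o, 'a) cat \<Rightarrow> ('o, 'a, 'o, 'a) fctr" where
  "id_functor C = \<lparr>onobj = (\<lambda>X\<in>obj C. X), onarr = (\<lambda>f\<in>arr C. f)\<rparr>"

text \<open>\<open>comp_functor C G F\<close> is \<open>G\<close> after \<open>F\<close>, where \<open>C\<close> is the domain of \<open>F\<close>.\<close>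

definition comp_functor ::
  "('o, 'a) cat \<Rightarrow> ('p, 'b, 'q, 'c) fctr \<Rightarrow> ('o, 'a, 'p, 'b) fctr \<Rightarrow> ('o, 'a, 'q, 'c) fctr" where
  "comp_functor C G F =
     \<lparr>onobj = (\<lambda>X\<in>obj C. onobj G (onobj F X)), onarr = (\<lambda>f\<in>arr C. onarr G (onarr F f))\<rparr>"

definition nat_trans ::
  "('o, 'a) cat \<Rightarrow> ('p, 'b) cat \<Rightarrow> ('o, 'a, 'p, 'b) fctr \<Rightarrow> ('o, 'a, 'p, 'b) fctr
     \<Rightarrow> ('o \<Rightarrow> 'b) \<Rightarrow> bool" where
  "nat_trans C D F G \<eta> \<longleftrightarrow>
     \<eta> \<in> extensional (obj C) \<and>
     (\<forall>X\<in>obj C. \<eta> X \<in> hom D (onobj F X) (onobj G X)) \<and>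
     (\<forall>f\<in>arr C. cmp D (\<eta> (tgt C f)) (onarr F f) = cmp D (onarr G f) (\<eta> (src C f)))"

definition nat_iso ::
  "('o, 'a) cat \<Rightarrow> ('p, 'b) cat \<Rightarrow> ('o, 'a, 'p, 'b) fctr \<Rightarrow> ('o, 'a, 'p, 'b) fctr
     \<Rightarrow> ('o \<Rightarrow> 'b) \<Rightarrow> bool" where
  "nat_iso C D F G \<eta> \<longleftrightarrow> nat_trans C D F G \<eta> \<and> (\<forall>X\<in>obj C. iso D (\<eta> X))"

type_synonym ('o, 'a, 'p, 'b) nat_arr =
  "('o, 'a, 'p, 'b) fctr \<times> ('o \<Rightarrow> 'b) \<times> ('o, 'a, 'p, 'b) fctr"

definition functor_cat ::
  "('o, 'a) cat \<Rightarrow> ('p, 'b) cat \<Rightarrow> (('o, 'a, 'p, 'b) fctr, ('o, 'a, 'p, 'b) nat_arr) cat" where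
  "functor_cat C D =
     \<lparr>obj = {F. is_functor C D F},
      arr = {(F, \<eta>, G). is_functor C D F \<and> is_functor C D G \<and> nat_trans C D F G \<eta>},
      src = (\<lambda>(F, \<eta>, G). F),
      tgt = (\<lambda>(F, \<eta>, G). G),
      idn = (\<lambda>F. (F, (\<lambda>X\<in>obj C. idn D (onobj F X)), F)),
      cmp = (\<lambda>(G', \<theta>, H) (F, \<eta>, G). (F, (\<lambda>X\<in>obj C. cmp D (\<theta> X) (\<eta> X)), H))\<rparr>"

definition equivalent_cat :: "('o, 'a) cat \<Rightarrow> ('p, 'b) cat \<Rightarrow> bool" where
  "equivalent_cat C D \<longleftrightarrow>
     (\<exists>F G \<eta> \<epsilon>. is_functor C D F \<and> is_functor D C G \<and>
        nat_iso C C (id_functor C) (comp_functor C G F) \<eta> \<and>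
        nat_iso D D (comp_functor D F G) (id_functor D) \<epsilon>)"

definition fully_faithful ::
  "('o, 'a) cat \<Rightarrow> ('p, 'b) cat \<Rightarrow> ('o, 'a, 'p, 'b) fctr \<Rightarrow> bool" where
  "fully_faithful C D F \<longleftrightarrow>
     (\<forall>X\<in>obj C. \<forall>Y\<in>obj C. bij_betw (onarr F) (hom C X Y) (hom D (onobj F X) (onobj F Y)))"

text \<open>\<open>adjunction C D L R\<close>: the functor \<open>L : C \<rightarrow> D\<close> is left adjoint to \<open>R : D \<rightarrow> C\<close>.\<close>

definition adjunction ::
  "('o, 'a) cat \<Rightarrow> ('p, 'b) cat \<Rightarrow> ('o, 'a, 'p, 'b) fctr \<Rightarrow> ('p, 'b, 'o, 'a) fctr \<Rightarrow> bool" where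
  "adjunction C D L R \<longleftrightarrow>
     is_functor C D L \<and> is_functor D C R \<and>
     (\<exists>\<eta> \<epsilon>. nat_trans C C (id_functor C) (comp_functor C R L) \<eta> \<and>
        nat_trans D D (comp_functor D L R) (id_functor D) \<epsilon> \<and>
        (\<forall>X\<in>obj C. cmp D (\<epsilon> (onobj L X)) (onarr L (\<eta> X)) = idn D (onobj L X)) \<and>
        (\<forall>Y\<in>obj D. cmp C (onarr R (\<epsilon> Y)) (\<eta> (onobj R Y)) = idn C (onobj R Y)))"


section \<open>The category of sets\<close>

type_synonym 'x set_arr = "'x set \<times> ('x \<Rightarrow> 'x) \<times> 'x set"

definition app :: "'x set_arr \<Rightarrow> 'x \<Rightarrow> 'x" where
  "app m = fst (snd m)"

text \<open>
  \<open>Set_cat U\<close> is the category of those small sets whose elements are taken from the type \<^typ>\<open>'x\<close>.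
  It is (equivalent to) the category of all small sets as soon as \<^typ>\<open>'x\<close> is at least as large as
  the universe, in particular for \<^typ>\<open>'u\<close> itself. Other choices of \<^typ>\<open>'x\<close> are used only as
  targets of hom functors.
\<close>

definition Set_cat :: "'u itself \<Rightarrow> ('x set, 'x set_arr) cat" where
  "Set_cat U =
     \<lparr>obj = {A. small U A},
      arr = {(A, f, B). small U A \<and> small U B \<and> f \<in> A \<rightarrow>\<^sub>E B},
      src = (\<lambda>(A, f, B). A),
      tgt = (\<lambda>(A, f, B). B),
      idn = (\<lambda>A. (A, (\<lambda>x\<in>A. x), A)),
      cmp = (\<lambda>(B', g, D) (A, f, B). (A, compose A g f, D))\<rparr>"

definition hom_functor :: "('o, 'a) cat \<Rightarrow> 'o \<Rightarrow> ('o, 'a, 'a set, 'a set_arr) fctr" where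
  "hom_functor C X =
     \<lparr>onobj = (\<lambda>Y\<in>obj C. hom C X Y),
      onarr = (\<lambda>f\<in>arr C. (hom C X (src C f), (\<lambda>g\<in>hom C X (src C f). cmp C f g), hom C X (tgt C f)))\<rparr>"


section \<open>Limits and colimits\<close>

definition is_cone ::
  "('j, 'k) cat \<Rightarrow> ('o, 'a) cat \<Rightarrow> ('j, 'k, 'o, 'a) fctr \<Rightarrow> 'o \<Rightarrow> ('j \<Rightarrow> 'a) \<Rightarrow> bool" where
  "is_cone J C D L p \<longleftrightarrow>
     L \<in> obj C \<and> (\<forall>j\<in>obj J. p j \<in> hom C L (onobj D j)) \<and>
     (\<forall>u\<in>arr J. cmp C (onarr D u) (p (src J u)) = p (tgt J u))"

definition is_limit ::
  "('j, 'k) cat \<Rightarrow> ('o, 'a) cat \<Rightarrow> ('j, 'k, 'o, 'a) fctr \<Rightarrow> 'o \<Rightarrow> ('j \<Rightarrow> 'a) \<Rightarrow> bool" where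
  "is_limit J C D L p \<longleftrightarrow>
     is_cone J C D L p \<and>
     (\<forall>M q. is_cone J C D M q \<longrightarrow> (\<exists>!m. m \<in> hom C M L \<and> (\<forall>j\<in>obj J. cmp C (p j) m = q j)))"

definition is_cocone ::
  "('j, 'k) cat \<Rightarrow> ('o, 'a) cat \<Rightarrow> ('j, 'k, 'o, 'a) fctr \<Rightarrow> 'o \<Rightarrow> ('j \<Rightarrow> 'a) \<Rightarrow> bool" where
  "is_cocone J C D L p \<longleftrightarrow>
     L \<in> obj C \<and> (\<forall>j\<in>obj J. p j \<in> hom C (onobj D j) L) \<and>
     (\<forall>u\<in>arr J. cmp C (p (tgt J u)) (onarr D u) = p (src J u))"

definition is_colimit ::
  "('j, 'k) cat \<Rightarrow> ('o, 'a) cat \<Rightarrow> ('j, 'k, 'o, 'a) fctr \<Rightarrow> 'o \<Rightarrow> ('j \<Rightarrow> 'a) \<Rightarrow> bool" where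
  "is_colimit J C D L p \<longleftrightarrow>
     is_cocone J C D L p \<and>
     (\<forall>M q. is_cocone J C D M q \<longrightarrow> (\<exists>!m. m \<in> hom C L M \<and> (\<forall>j\<in>obj J. cmp C m (p j) = q j)))"

text \<open>
  Every finite category is isomorphic to one whose objects and arrows are natural numbers, and
  every small category to one whose objects and arrows are elements of \<^typ>\<open>'u\<close>; it therefore
  suffices to let diagram shapes (and below, sites) range over these types.
\<close>

definition preserves_finite_limits ::
  "('o, 'a) cat \<Rightarrow> ('p, 'b) cat \<Rightarrow> ('o, 'a, 'p, 'b) fctr \<Rightarrow> bool" where
  "preserves_finite_limits C D F \<longleftrightarrow>
     (\<forall>(J :: (nat, nat) cat) G L p.
        category J \<and> finite (obj J) \<and> finite (arr J) \<and> is_functor J C G \<and> is_limit J C G L p \<longrightarrow>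
        is_limit J D (comp_functor J F G) (onobj F L) (\<lambda>j. onarr F (p j)))"

definition cocomplete :: "'u itself \<Rightarrow> ('o, 'a) cat \<Rightarrow> bool" where
  "cocomplete U C \<longleftrightarrow>
     (\<forall>(J :: ('u, 'u) cat) G. small_category U J \<and> is_functor J C G \<longrightarrow>
        (\<exists>L p. is_colimit J C G L p))"

definition filtered :: "('o, 'a) cat \<Rightarrow> bool" where
  "filtered J \<longleftrightarrow>
     obj J \<noteq> {} \<and>
     (\<forall>i\<in>obj J. \<forall>j\<in>obj J. \<exists>k\<in>obj J. hom J i k \<noteq> {} \<and> hom J j k \<noteq> {}) \<and>
     (\<forall>i\<in>obj J. \<forall>j\<in>obj J. \<forall>u\<in>hom J i j. \<forall>v\<in>hom J i j.
        \<exists>k\<in>obj J. \<exists>w\<in>hom J j k. cmp J w u = cmp J w v)"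

definition preserves_filtered_colimits ::
  "'u itself \<Rightarrow> ('o, 'a) cat \<Rightarrow> ('p, 'b) cat \<Rightarrow> ('o, 'a, 'p, 'b) fctr \<Rightarrow> bool" where
  "preserves_filtered_colimits U C D F \<longleftrightarrow>
     (\<forall>(J :: ('u, 'u) cat) G L p.
        small_category U J \<and> filtered J \<and> is_functor J C G \<and> is_colimit J C G L p \<longrightarrow>
        is_colimit J D (comp_functor J F G) (onobj F L) (\<lambda>j. onarr F (p j)))"


section \<open>Locally finitely presentable categories\<close>

definition finitely_presentable :: "'u itself \<Rightarrow> ('o, 'a) cat \<Rightarrow> 'o \<Rightarrow> bool" where
  "finitely_presentable U C X \<longleftrightarrow>
     X \<in> obj C \<and> preserves_filtered_colimits U C (Set_cat U) (hom_functor C X)"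

definition locally_finitely_presentable :: "'u itself \<Rightarrow> ('o, 'a) cat \<Rightarrow> bool" where
  "locally_finitely_presentable U C \<longleftrightarrow>
     category C \<and> locally_small U C \<and> cocomplete U C \<and>
     (\<exists>A. small U A \<and> (\<forall>X\<in>A. finitely_presentable U C X) \<and>
        (\<forall>Y\<in>obj C. \<exists>(J :: ('u, 'u) cat) G p.
           small_category U J \<and> filtered J \<and> is_functor J C G \<and>
           (\<forall>j\<in>obj J. onobj G j \<in> A) \<and> is_colimit J C G Y p))"


section \<open>Sites and sheaves\<close>

definition sieve :: "('o, 'a) cat \<Rightarrow> 'o \<Rightarrow> 'a set \<Rightarrow> bool" where
  "sieve C X S \<longleftrightarrow>
     S \<subseteq> {f \<in> arr C. tgt C f = X} \<and>
     (\<forall>f\<in>S. \<forall>g\<in>arr C. tgt C g = src C f \<longrightarrow> cmp C f g \<in> S)"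

definition pullback_sieve :: "('o, 'a) cat \<Rightarrow> 'a \<Rightarrow> 'a set \<Rightarrow> 'a set" where
  "pullback_sieve C f S = {g \<in> arr C. tgt C g = src C f \<and> cmp C f g \<in> S}"

definition grothendieck_topology :: "('o, 'a) cat \<Rightarrow> ('o \<Rightarrow> 'a set set) \<Rightarrow> bool" where
  "grothendieck_topology C J \<longleftrightarrow>
     (\<forall>X\<in>obj C. \<forall>S\<in>J X. sieve C X S) \<and>
     (\<forall>X\<in>obj C. {f \<in> arr C. tgt C f = X} \<in> J X) \<and>
     (\<forall>f\<in>arr C. \<forall>S\<in>J (tgt C f). pullback_sieve C f S \<in> J (src C f)) \<and>
     (\<forall>X\<in>obj C. \<forall>S\<in>J X. \<forall>R. sieve C X R \<and> (\<forall>f\<in>S. pullback_sieve C f R \<in> J (src C f)) \<longrightarrow> R \<in> J X)"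

definition atomic_topology :: "('o, 'a) cat \<Rightarrow> 'o \<Rightarrow> 'a set set" where
  "atomic_topology C X =
     \<Inter>{J X | J. grothendieck_topology C J \<and>
                 (\<forall>Y\<in>obj C. \<forall>S. sieve C Y S \<and> S \<noteq> {} \<longrightarrow> S \<in> J Y)}"

type_synonym ('o, 'a, 'u) presheaf = "('o, 'a, 'u set, 'u set_arr) fctr"

definition matching_family ::
  "('o, 'a) cat \<Rightarrow> ('o, 'a, 'u) presheaf \<Rightarrow> 'a set \<Rightarrow> ('a \<Rightarrow> 'u) \<Rightarrow> bool" where
  "matching_family C F S x \<longleftrightarrow>
     (\<forall>f\<in>S. x f \<in> onobj F (src C f)) \<and>
     (\<forall>f\<in>S. \<forall>g\<in>arr C. tgt C g = src C f \<longrightarrow> x (cmp C f g) = app (onarr F g) (x f))"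

definition is_sheaf ::
  "('o, 'a) cat \<Rightarrow> ('o \<Rightarrow> 'a set set) \<Rightarrow> ('o, 'a, 'u) presheaf \<Rightarrow> bool" where
  "is_sheaf C J F \<longleftrightarrow>
     (\<forall>X\<in>obj C. \<forall>S\<in>J X. \<forall>x. matching_family C F S x \<longrightarrow>
        (\<exists>!a. a \<in> onobj F X \<and> (\<forall>f\<in>S. app (onarr F f) a = x f)))"

definition Sh ::
  "'u itself \<Rightarrow> ('o, 'a) cat \<Rightarrow> ('o \<Rightarrow> 'a set set)
     \<Rightarrow> (('o, 'a, 'u) presheaf, ('o, 'a, 'u set, 'u set_arr) nat_arr) cat" where
  "Sh U C J = full_subcat (functor_cat (opp C) (Set_cat U)) (is_sheaf C J)"


section \<open>Toposes and geometric morphisms\<close>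

definition grothendieck_topos :: "'u itself \<Rightarrow> ('o, 'a) cat \<Rightarrow> bool" where
  "grothendieck_topos U E \<longleftrightarrow>
     category E \<and>
     (\<exists>(C :: ('u, 'u) cat) J. small_category U C \<and> grothendieck_topology C J \<and>
        equivalent_cat E (Sh U C J))"

text \<open>
  \<open>geometric_morphism E F P Q\<close>: a geometric morphism \<open>E \<rightarrow> F\<close> with inverse image
  \<open>P : F \<rightarrow> E\<close> and direct image \<open>Q : E \<rightarrow> F\<close>.
\<close>

definition geometric_morphism ::
  "('o, 'a) cat \<Rightarrow> ('p, 'b) cat \<Rightarrow> ('p, 'b, 'o, 'a) fctr \<Rightarrow> ('o, 'a, 'p, 'b) fctr \<Rightarrow> bool" where
  "geometric_morphism E F P Q \<longleftrightarrow> adjunction F E P Q \<and> preserves_finite_limits F E P"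

definition is_point ::
  "'u itself \<Rightarrow> ('o, 'a) cat \<Rightarrow> ('o, 'a, 'u set, 'u set_arr) fctr
     \<Rightarrow> ('u set, 'u set_arr, 'o, 'a) fctr \<Rightarrow> bool" where
  "is_point U E P Q \<longleftrightarrow> geometric_morphism (Set_cat U) E P Q"

text \<open>
  A topos has, up to isomorphism, exactly one geometric morphism to the category of sets, so that
  the existential quantifiers in \<open>connected_topos\<close> and \<open>atomic_topos\<close> refer to that morphism.
\<close>

definition connected_topos :: "'u itself \<Rightarrow> ('o, 'a) cat \<Rightarrow> bool" where
  "connected_topos U E \<longleftrightarrow>
     (\<exists>P Q. geometric_morphism E (Set_cat U :: ('u set, 'u set_arr) cat) P Q \<and>
        fully_faithful (Set_cat U) E P)"

text \<open>
  A relation from \<open>B\<close> to \<open>A\<close>, that is a subobject of the product of \<open>B\<close> and \<open>A\<close>, is given by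
  its two legs \<open>r0 : R \<rightarrow> B\<close> and \<open>r1 : R \<rightarrow> A\<close>. In \<open>pulled_back_relation\<close> the square

    \<open>R \<rightarrow> M\<close> over \<open>\<chi> \<times> A : B \<times> A \<rightarrow> P \<times> A\<close>

  is required to be a pullback, where \<open>(m0, m1) : M \<rightarrow> P \<times> A\<close>; maps into the products are
  written as pairs of maps.
\<close>

definition is_relation :: "('o, 'a) cat \<Rightarrow> 'o \<Rightarrow> 'o \<Rightarrow> 'o \<Rightarrow> 'a \<Rightarrow> 'a \<Rightarrow> bool" where
  "is_relation C B A R r0 r1 \<longleftrightarrow>
     r0 \<in> hom C R B \<and> r1 \<in> hom C R A \<and>
     (\<forall>T\<in>obj C. \<forall>s\<in>hom C T R. \<forall>t\<in>hom C T R.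
        cmp C r0 s = cmp C r0 t \<and> cmp C r1 s = cmp C r1 t \<longrightarrow> s = t)"

definition pulled_back_relation ::
  "('o, 'a) cat \<Rightarrow> 'o \<Rightarrow> 'o \<Rightarrow> 'a \<Rightarrow> 'o \<Rightarrow> 'a \<Rightarrow> 'a \<Rightarrow> 'o \<Rightarrow> 'a \<Rightarrow> 'a \<Rightarrow> bool" where
  "pulled_back_relation C B A \<chi> M m0 m1 R r0 r1 \<longleftrightarrow>
     (\<exists>k\<in>hom C R M. cmp C m0 k = cmp C \<chi> r0 \<and> cmp C m1 k = r1 \<and>
        (\<forall>T\<in>obj C. \<forall>t0\<in>hom C T B. \<forall>t1\<in>hom C T A. \<forall>t\<in>hom C T M.
           cmp C m0 t = cmp C \<chi> t0 \<and> cmp C m1 t = t1 \<longrightarrow>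
           (\<exists>!n. n \<in> hom C T R \<and> cmp C r0 n = t0 \<and> cmp C r1 n = t1 \<and> cmp C k n = t)))"

definition is_power_object ::
  "('o, 'a) cat \<Rightarrow> 'o \<Rightarrow> 'o \<Rightarrow> 'o \<Rightarrow> 'a \<Rightarrow> 'a \<Rightarrow> bool" where
  "is_power_object C A P M m0 m1 \<longleftrightarrow>
     is_relation C P A M m0 m1 \<and>
     (\<forall>B R r0 r1. is_relation C B A R r0 r1 \<longrightarrow>
        (\<exists>!\<chi>. \<chi> \<in> hom C B P \<and> pulled_back_relation C B A \<chi> M m0 m1 R r0 r1))"

definition logical :: "('o, 'a) cat \<Rightarrow> ('p, 'b) cat \<Rightarrow> ('o, 'a, 'p, 'b) fctr \<Rightarrow> bool" where
  "logical C D F \<longleftrightarrow>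
     preserves_finite_limits C D F \<and>
     (\<forall>A P M m0 m1. is_power_object C A P M m0 m1 \<longrightarrow>
        is_power_object D (onobj F A) (onobj F P) (onobj F M) (onarr F m0) (onarr F m1))"

definition atomic_topos :: "'u itself \<Rightarrow> ('o, 'a) cat \<Rightarrow> bool" where
  "atomic_topos U E \<longleftrightarrow>
     (\<exists>P Q. geometric_morphism E (Set_cat U :: ('u set, 'u set_arr) cat) P Q \<and>
        logical (Set_cat U) E P)"


section \<open>Labelled full binary trees\<close>

record 'u itree =
  nodes :: "'u set"
  root :: "'u"
  edge :: "('u \<times> 'u) set"  \<comment> \<open>\<open>(x, y) \<in> edge X\<close> if \<open>x\<close> is the parent of \<open>y\<close>\<close>
  label :: "(nat \<Rightarrow> 'u) \<Rightarrow> 'u option"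

definition path_to :: "'u itree \<Rightarrow> 'u \<Rightarrow> 'u list \<Rightarrow> bool" where
  "path_to X y xs \<longleftrightarrow>
     xs \<noteq> [] \<and> hd xs = root X \<and> last xs = y \<and>
     (\<forall>i. Suc i < length xs \<longrightarrow> (xs ! i, xs ! Suc i) \<in> edge X)"

definition full_binary_tree :: "'u itree \<Rightarrow> bool" where
  "full_binary_tree X \<longleftrightarrow>
     root X \<in> nodes X \<and> edge X \<subseteq> nodes X \<times> nodes X \<and>
     (\<forall>x\<in>nodes X. {y \<in> nodes X. (x, y) \<in> edge X} = {} \<or> card {y \<in> nodes X. (x, y) \<in> edge X} = 2) \<and>
     (\<forall>y\<in>nodes X. \<exists>!xs. path_to X y xs)"

definition branches :: "'u itree \<Rightarrow> (nat \<Rightarrow> 'u) set" where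
  "branches X = {b. b 0 = root X \<and> (\<forall>n. (b n, b (Suc n)) \<in> edge X)}"

definition is_itree :: "'u set \<Rightarrow> 'u itree \<Rightarrow> bool" where
  "is_itree I X \<longleftrightarrow>
     full_binary_tree X \<and> Map.dom (label X) \<subseteq> branches X \<and> Map.ran (label X) \<subseteq> I"

definition finitary :: "'u itree \<Rightarrow> bool" where
  "finitary X \<longleftrightarrow>
     finite (branches X) \<and>
     finite {y \<in> nodes X. \<exists>x. (x, y) \<in> edge X \<and> \<not> (\<exists>b\<in>branches X. x \<in> range b)} \<and>
     Map.dom (label X) = branches X"

definition tree_embedding :: "'u itree \<Rightarrow> 'u itree \<Rightarrow> ('u \<Rightarrow> 'u) \<Rightarrow> bool" where
  "tree_embedding X Y f \<longleftrightarrow>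
     f \<in> nodes X \<rightarrow>\<^sub>E nodes Y \<and> inj_on f (nodes X) \<and> f (root X) = root Y \<and>
     (\<forall>x\<in>nodes X. \<forall>y\<in>nodes X. (x, y) \<in> edge X \<longleftrightarrow> (f x, f y) \<in> edge Y)"

definition itree_embedding :: "'u itree \<Rightarrow> 'u itree \<Rightarrow> ('u \<Rightarrow> 'u) \<Rightarrow> bool" where
  "itree_embedding X Y f \<longleftrightarrow>
     tree_embedding X Y f \<and>
     (\<forall>b\<in>branches X. \<forall>i. label X b = Some i \<longrightarrow> label Y (f \<circ> b) = Some i)"

text \<open>
  By the path condition a full binary tree is countable, so its set of nodes is automatically
  small. The category below is essentially small, though not small.
\<close>

definition T_cat :: "'u set \<Rightarrow> ('u itree, 'u itree \<times> ('u \<Rightarrow> 'u) \<times> 'u itree) cat" where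
  "T_cat I =
     \<lparr>obj = {X. is_itree I X \<and> finitary X},
      arr = {(X, f, Y). is_itree I X \<and> finitary X \<and> is_itree I Y \<and> finitary Y \<and> itree_embedding X Y f},
      src = (\<lambda>(X, f, Y). X),
      tgt = (\<lambda>(X, f, Y). Y),
      idn = (\<lambda>X. (X, (\<lambda>x\<in>nodes X. x), X)),
      cmp = (\<lambda>(Y', g, Z) (X, f, Y). (X, compose (nodes X) g f, Z))\<rparr>"

end

(*
A functor on the category of trees is a sheaf for the atomic topology iff it acts by injections and every element
equalized by all pairs of arrows that agree on f descends along f. Trees amalgamate: after a choice of sides,
nodes of a tree are bit lists, and before taking the union of two trees over a common subtree the new part of one of
them is twisted so that only branches of the common subtree get identified. This makes the topos atomic over the
site, and connected because the one-node tree is initial. Descent along an embedding needs only finitely many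
pairs of arrows: an embedding is composed of steps adding two leaves or one branch with its siblings, and for each step
one pair is universal. Hence filtered colimits are computed pointwise, which gives local finite presentability.
A point yields compatible families of elements, like a cocone of all finitary trees into one big tree: it has
a branch for every label in I. Comparing these branches with the finite full trees maps I injectively into
sequences of bit lists, so that I has at most the cardinality of the continuum.
*)

theory Submission
 imports Defs "HOL-Library.Countable"
begin

section \<open>Closure of small sets under the operations of a universe\<close>

section \<open>Small sets\<close>

text \<open>Two obstacles shape the proof. Along one arrow f the descent condition quantifies over
  all pairs g, h with g o f = h o f, whereas a stage of a filtered diagram can be made to satisfy
  only finitely many equations at once; so a finite list of pairs, uniform in the sheaf, must imply
  all the others. Finitary trees allow this: their finitely many branches can be added one at a
  time, after which only finitely many nodes remain. For one branch, arrows that diverge at its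
  first new node all overlap in the same pattern, and arrows that agree there are compared with a
  third one diverging from both. The other obstacle is size: the category of trees is only
  essentially small and its arrows are not elements of the universe type, so sheaves are built from
  elements of any type modulo a partial equivalence relation and only then named in the universe.
  For a point, left exactness enters through representables: every arrow acts surjectively there,
  distinct parallel arrows never agree on an element, and so the comparison of two nodes does not
  depend on the stage at which it is made.\<close>

lemma small_lepoll: "small U B ==> A \<lesssim> B ==> small U A"
 unfolding small_def by (rule lesspoll_trans1)

lemma small_subset: "small U B ==> A \<subseteq> B ==> small U A"
 by (rule small_lepoll[OF _ subset_imp_lepoll])

lemma small_image: "small U A ==> small U (f ` A)"
 by (rule small_lepoll[OF _ image_lepoll])

lemma small_inj_image: "inj_on f A ==> small U (f ` A) ==> small U A"
 by (rule small_lepoll) (auto simp: lepoll_def)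

lemma small_embed:
 assumes "small (U :: 'u itself) A"
 obtains i :: "'x => 'u" where "inj_on i A"
 using lesspoll_imp_lepoll[OF assms[unfolded small_def]] unfolding lepoll_def by blast

locale universe =
 fixes U :: "'u itself"
 assumes inaccessible: "inaccessible U"
begin

lemma inaccessible_UN:
 fixes A :: "'u set" and B :: "'u => 'u set"
 assumes "small U A" "\<forall>a\<in>A. small U (B a)"
 shows "small U (\<Union>a\<in>A. B a)"
proof -
 have "\<forall>(A :: 'u set) (B :: 'u => 'u set).
     small U A \<and> (\<forall>a\<in>A. small U (B a)) --> small U (\<Union>a\<in>A. B a)"
  using inaccessible unfolding inaccessible_def by (elim conjE)
 then show ?thesis using assms by simp
qed

lemma small_nat_set: "small U (A :: nat set)"
 using inaccessible unfolding inaccessible_def by (meson small_subset subset_UNIV)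

lemma small_countable:
 assumes "countable A" shows "small U A"
proof (rule small_lepoll)
 show "small U (UNIV :: nat set)" by (rule small_nat_set)
 show "A \<lesssim> (UNIV :: nat set)"
  using assms unfolding countable_def lepoll_def by auto
qed

lemma small_finite: "finite A ==> small U A"
 by (simp add: small_countable countable_finite)

lemma infinite_universe: "infinite (UNIV :: 'u set)"
proof
 assume "finite (UNIV :: 'u set)"
 moreover have "(UNIV :: nat set) \<lesssim> (UNIV :: 'u set)"
  using small_nat_set[of UNIV] unfolding small_def by (rule lesspoll_imp_lepoll)
 ultimately show False
  by (metis infinite_UNIV_nat lepoll_def finite_imageD finite_subset)
qed

lemma ex_pairing: "\<exists>h :: 'u \<times> 'u => 'u. inj h"
proof -
 have "(card_of ((UNIV :: 'u set) \<times> (UNIV :: 'u set)), card_of (UNIV :: 'u set)) \<in> ordLeq"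
  by (rule ordIso_imp_ordLeq[OF card_of_Times_same_infinite[OF infinite_universe]])
 then show ?thesis unfolding card_of_ordLeq[symmetric] by auto
qed

lemma small_Pow:
 assumes "small U A" shows "small U (Pow A)"
proof -
 obtain i :: "'a => 'u" where i: "inj_on i A" using assms by (rule small_embed)
 have "small U (Pow (i ` A))"
  using inaccessible small_image[OF assms, of i] unfolding inaccessible_def by blast
 moreover have "(\<lambda>B. i ` B) ` Pow A \<subseteq> Pow (i ` A)" by auto
 ultimately have "small U ((\<lambda>B. i ` B) ` Pow A)" by (rule small_subset)
 moreover have "inj_on (\<lambda>B. i ` B) (Pow A)"
  by (rule inj_onI) (metis PowD i inj_on_image_eq_iff)
 ultimately show ?thesis by (rule small_inj_image[rotated])
qed

text \<open>\<open>inaccessible_UN\<close> speaks only of sets over the universe type, so index set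
  and fibres are first injected into that type, and a pairing function keeps the fibres
  apart.\<close>

lemma small_Sigma:
 assumes A: "small U A" and B: "\<And>a. a \<in> A ==> small U (B a)"
 shows "small U (Sigma A B)"
proof -
 obtain i :: "'a => 'u" where i: "inj_on i A" using A by (rule small_embed)
 have "\<forall>a\<in>A. \<exists>j :: 'b => 'u. inj_on j (B a)" using B by (meson small_embed)
 then obtain j :: "'a => 'b => 'u" where j: "\<And>a. a \<in> A ==> inj_on (j a) (B a)" by metis
 obtain h :: "'u \<times> 'u => 'u" where h: "inj h" using ex_pairing by blast
 let ?B = "\<lambda>u. (\<lambda>b. h (u, j (the_inv_into A i u) b)) ` B (the_inv_into A i u)"
 have "\<And>u. u \<in> i ` A ==> small U (?B u)"
  by (auto intro!: small_image B simp: the_inv_into_f_f[OF i])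
 then have "small U (\<Union>u\<in>i ` A. ?B u)"
  by (intro inaccessible_UN small_image[OF A, of i] ballI)
 moreover have "(\<lambda>(a, b). h (i a, j a b)) ` Sigma A B \<subseteq> (\<Union>u\<in>i ` A. ?B u)"
  by (rule subsetI) (auto simp: the_inv_into_f_f[OF i])
 ultimately have "small U ((\<lambda>(a, b). h (i a, j a b)) ` Sigma A B)" by (rule small_subset)
 moreover have "inj_on (\<lambda>(a, b). h (i a, j a b)) (Sigma A B)"
 proof (rule inj_onI, clarsimp)
  fix a b a' b' assume ab: "a \<in> A" "b \<in> B a" "a' \<in> A" "b' \<in> B a'"
   and "h (i a, j a b) = h (i a', j a' b')"
  then have "i a = i a'" "j a b = j a' b'" using injD[OF h] by blast+
  then show "a = a' \<and> b = b'" using ab inj_onD[OF i] inj_onD[OF j] by metis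
 qed
 ultimately show ?thesis by (rule small_inj_image[rotated])
qed

lemma small_Times: "small U A ==> small U B ==> small U (A \<times> B)"
 by (rule small_Sigma)

lemma small_UN:
 assumes "small U A" "\<And>a. a \<in> A ==> small U (B a)"
 shows "small U (\<Union>a\<in>A. B a)"
proof -
 have "small U (snd ` Sigma A B)" by (intro small_image small_Sigma assms)
 then show ?thesis by (rule small_subset) force
qed

text \<open>A family whose members are determined by their values \<open>v f a\<close> embeds into
  \<open>Pow (A \<times> B)\<close> through its graphs. The abstract \<open>v\<close> lets one
  argument serve functions, lists, tree embeddings and sheaf morphisms.\<close>

lemma small_graph:
 assumes A: "small U A" and B: "small U B"
  and F: "\<And>f a. f \<in> F ==> a \<in> A ==> v f a \<in> B"
  and inj: "\<And>f g. f \<in> F ==> g \<in> F ==> (\<And>a. a \<in> A ==> v f a = v g a) ==> f = g"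
 shows "small U F"
proof (rule small_inj_image)
 show "inj_on (\<lambda>f. (\<lambda>a. (a, v f a)) ` A) F"
 proof (rule inj_onI)
  fix f g assume fg: "f \<in> F" "g \<in> F" "(\<lambda>a. (a, v f a)) ` A = (\<lambda>a. (a, v g a)) ` A"
  have "v f a = v g a" if "a \<in> A" for a
  proof -
   have "(a, v f a) \<in> (\<lambda>a. (a, v g a)) ` A" using that fg(3) by blast
   then show ?thesis by auto
  qed
  with fg show "f = g" using inj by blast
 qed
 have "(\<lambda>f. (\<lambda>a. (a, v f a)) ` A) ` F \<subseteq> Pow (A \<times> B)" using F by auto
 then show "small U ((\<lambda>f. (\<lambda>a. (a, v f a)) ` A) ` F)"
  by (rule small_subset[OF small_Pow[OF small_Times[OF A B]]])
qed

lemma small_PiE: "small U A ==> (\<And>a. a \<in> A ==> small U (B a)) ==> small U (\<Pi>\<^sub>E a\<in>A. B a)"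
 by (rule small_graph[of A "\<Union>a\<in>A. B a" _ "\<lambda>f a. f a"]) (auto intro: small_UN PiE_ext)

lemma small_lists:
 assumes "small U A" shows "small U (lists A)"
\<comment> \<open>A list is read as a function on all indices with value \<open>None\<close> past
  its end, so that the length is determined too.\<close>
proof (rule small_graph[of UNIV "insert None (Some ` A)" "lists A" "\<lambda>xs n :: nat. if n < length xs then Some (xs ! n) else None"])
 have "insert None (Some ` A) = {None} \<union> Some ` A" by simp
 also have "\<dots> = (\<Union>b\<in>(UNIV :: bool set). if b then {None} else Some ` A)"
  by (simp add: UNIV_bool Un_commute)
 also have "small U \<dots>" by (rule small_UN) (auto intro: small_finite small_image assms)
 finally show "small U (insert None (Some ` A))" .
next
 fix xs ys :: "'a list"
 assume eq: "\<And>n. n \<in> UNIV ==> (if n < length xs then Some (xs ! n) else None) =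
               (if n < length ys then Some (ys ! n) else None)"
 have "n < length xs \<longleftrightarrow> n < length ys" for n using eq[of n] by (auto split: if_splits)
 then have len: "length xs = length ys" by (meson linorder_neqE_nat order_less_irrefl)
 show "xs = ys"
 proof (rule nth_equalityI[OF len])
  fix i assume "i < length xs"
  then show "xs ! i = ys ! i" using eq[of i] len by simp
 qed
qed (auto intro: small_nat_set simp: in_lists_conv_set)

lemma small_Fpow: "small U A ==> small U {B. B \<subseteq> A \<and> finite B}"
 by (rule small_subset[OF small_Pow]) auto

end

section \<open>Categories, and the category of sets handled through elements\<close>

section \<open>Categories and sets\<close>

lemma homD: "f \<in> hom C X Y ==> f \<in> arr C" "f \<in> hom C X Y ==> src C f = X" "f \<in> hom C X Y ==> tgt C f = Y"
 by (simp_all add: hom_def)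

lemma arr_hom: "f \<in> arr C ==> f \<in> hom C (src C f) (tgt C f)"
 by (simp add: hom_def)

lemma (in category) hom_obj: "f \<in> hom C X Y ==> X \<in> obj C" "f \<in> hom C X Y ==> Y \<in> obj C"
 using src_obj tgt_obj by (auto simp: hom_def)

lemma opp_opp [simp]: "opp (opp C) = C"
 by (simp add: opp_def)

lemma opp_simps [simp]:
 "obj (opp C) = obj C" "arr (opp C) = arr C" "src (opp C) = tgt C" "tgt (opp C) = src C"
 "idn (opp C) = idn C" "cmp (opp C) g f = cmp C f g"
 by (simp_all add: opp_def)

lemma category_opp: "category C ==> category (opp C)"
 unfolding category_def hom_def by simp

text \<open>The restriction puts an arbitrary total function into the extensional form on which
  equality of arrows of \<open>Set_cat\<close> depends.\<close>

definition mk_set :: "'x set => ('x => 'x) => 'x set => 'x set_arr" where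
 "mk_set A f B = (A, restrict f A, B)"

lemma Set_obj [simp]: "A \<in> obj (Set_cat U) \<longleftrightarrow> small U A"
 by (simp add: Set_cat_def)

lemma Set_hom_iff:
 "m \<in> hom (Set_cat U) A B \<longleftrightarrow> small U A \<and> small U B \<and> (\<exists>f\<in>A \<rightarrow>\<^sub>E B. m = (A, f, B))"
 by (auto simp: hom_def Set_cat_def)

lemma Set_cmp_eq: "cmp (Set_cat U) (B', g, D) (A, f, B) = (A, compose A g f, D)"
 and Set_idn_eq: "idn (Set_cat U) A = (A, (\<lambda>x\<in>A. x), A)"
 by (simp_all add: Set_cat_def)

lemma Set_hom_app: "m \<in> hom (Set_cat U) A B ==> x \<in> A ==> app m x \<in> B"
 by (auto simp: Set_hom_iff app_def)

lemma Set_ext: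
 assumes "m \<in> hom (Set_cat U) A B" "m' \<in> hom (Set_cat U) A B" "\<And>x. x \<in> A ==> app m x = app m' x"
 shows "m = m'"
 using assms by (auto simp: Set_hom_iff app_def intro: PiE_ext)

lemma mk_set_hom: "small U A ==> small U B ==> (\<And>x. x \<in> A ==> f x \<in> B) ==> mk_set A f B \<in> hom (Set_cat U) A B"
 by (auto simp: Set_hom_iff mk_set_def)

lemma app_mk_set [simp]: "x \<in> A ==> app (mk_set A f B) x = f x"
 by (simp add: app_def mk_set_def)

lemma Set_cmp_hom:
 "f \<in> hom (Set_cat U) A B ==> g \<in> hom (Set_cat U) B D ==> cmp (Set_cat U) g f \<in> hom (Set_cat U) A D"
 by (auto simp: Set_hom_iff Set_cmp_eq compose_def) (meson PiE_mem)

lemma app_Set_cmp [simp]: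
 "f \<in> hom (Set_cat U) A B ==> g \<in> hom (Set_cat U) B' D ==> x \<in> A ==>
  app (cmp (Set_cat U) g f) x = app g (app f x)"
 by (auto simp: Set_hom_iff Set_cmp_eq compose_def app_def)

lemma Set_idn_hom: "small U A ==> idn (Set_cat U) A \<in> hom (Set_cat U) A A"
 by (auto simp: Set_hom_iff Set_idn_eq)

lemma app_Set_idn [simp]: "x \<in> A ==> app (idn (Set_cat U) A) x = x"
 by (simp add: Set_cat_def app_def)

lemma category_Set: "category (Set_cat U)"
proof
 show "f \<in> arr (Set_cat U) ==> src (Set_cat U) f \<in> obj (Set_cat U)" for f
  by (auto simp: Set_cat_def)
 show "f \<in> arr (Set_cat U) ==> tgt (Set_cat U) f \<in> obj (Set_cat U)" for f
  by (auto simp: Set_cat_def)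
 show "X \<in> obj (Set_cat U) ==> idn (Set_cat U) X \<in> hom (Set_cat U) X X" for X
  by (simp add: Set_idn_hom)
next
 fix f g X Y Z assume f: "f \<in> hom (Set_cat U) X Y" and g: "g \<in> hom (Set_cat U) Y Z"
 show "cmp (Set_cat U) g f \<in> hom (Set_cat U) X Z" using f g by (rule Set_cmp_hom)
next
 fix f X Y assume f: "f \<in> hom (Set_cat U) X Y"
 then have s: "small U X" "small U Y" by (auto simp: Set_hom_iff)
 show "cmp (Set_cat U) f (idn (Set_cat U) X) = f"
  by (rule Set_ext[OF Set_cmp_hom[OF Set_idn_hom[OF s(1)] f] f]) (simp add: app_Set_cmp[OF Set_idn_hom[OF s(1)] f])
 show "cmp (Set_cat U) (idn (Set_cat U) Y) f = f"
  by (rule Set_ext[OF Set_cmp_hom[OF f Set_idn_hom[OF s(2)]] f])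
   (simp add: app_Set_cmp[OF f Set_idn_hom[OF s(2)]] Set_hom_app[OF f])
next
 fix f g h W X Y Z
 assume f: "f \<in> hom (Set_cat U) W X" and g: "g \<in> hom (Set_cat U) X Y" and h: "h \<in> hom (Set_cat U) Y Z"
 note gf = Set_cmp_hom[OF f g] and hg = Set_cmp_hom[OF g h]
 show "cmp (Set_cat U) h (cmp (Set_cat U) g f) = cmp (Set_cat U) (cmp (Set_cat U) h g) f"
  by (rule Set_ext[OF Set_cmp_hom[OF gf h] Set_cmp_hom[OF f hg]])
   (simp add: app_Set_cmp[OF gf h] app_Set_cmp[OF f hg] app_Set_cmp[OF f g] app_Set_cmp[OF g h] Set_hom_app[OF f])
qed

lemma is_functorD:
 assumes "is_functor C D F"
 shows "X \<in> obj C ==> onobj F X \<in> obj D"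
  and "f \<in> hom C X Y ==> onarr F f \<in> hom D (onobj F X) (onobj F Y)"
  and "X \<in> obj C ==> onarr F (idn C X) = idn D (onobj F X)"
  and "f \<in> hom C X Y ==> g \<in> hom C Y Z ==> onarr F (cmp C g f) = cmp D (onarr F g) (onarr F f)"
 using assms unfolding is_functor_def hom_def by auto

lemma is_functorI:
 assumes "onobj F \<in> extensional (obj C)" "onarr F \<in> extensional (arr C)"
  and "\<And>X. X \<in> obj C ==> onobj F X \<in> obj D"
  and "\<And>f X Y. f \<in> hom C X Y ==> onarr F f \<in> hom D (onobj F X) (onobj F Y)"
  and "\<And>X. X \<in> obj C ==> onarr F (idn C X) = idn D (onobj F X)"
  and "\<And>f g X Y Z. f \<in> hom C X Y ==> g \<in> hom C Y Z ==>
   onarr F (cmp C g f) = cmp D (onarr F g) (onarr F f)"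
 shows "is_functor C D F"
 unfolding is_functor_def
proof (intro conjI ballI impI)
 show "onobj F \<in> obj C \<rightarrow>\<^sub>E obj D" using assms(1,3) by (simp add: PiE_iff)
 show "onarr F \<in> arr C \<rightarrow>\<^sub>E arr D" using assms(2) homD(1)[OF assms(4)[OF arr_hom]] by (simp add: PiE_iff)
qed (use assms in \<open>auto simp: hom_def\<close>)

lemma functor_ext:
 assumes "is_functor C D F" "is_functor C D G" "\<And>X. X \<in> obj C ==> onobj F X = onobj G X"
  "\<And>f. f \<in> arr C ==> onarr F f = onarr G f"
 shows "(F :: ('o,'a,'p,'b) fctr) = G"
proof -
 have "onobj F = onobj G" "onarr F = onarr G"
  using assms unfolding is_functor_def by (auto intro: PiE_ext)
 then show ?thesis by (intro fctr.equality) auto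
qed

lemma is_functor_comp:
 assumes F: "is_functor C D F" and G: "is_functor D E G" and "category C"
 shows "is_functor C E (comp_functor C G F)"
proof -
 interpret category C by fact
 show ?thesis
 proof (rule is_functorI)
  fix f g X Y Z assume f: "f \<in> hom C X Y" and g: "g \<in> hom C Y Z"
  note gf = cmp_hom[OF f g]
  show "onarr (comp_functor C G F) (cmp C g f) =
   cmp E (onarr (comp_functor C G F) g) (onarr (comp_functor C G F) f)"
   using homD(1)[OF f] homD(1)[OF g] homD(1)[OF gf] is_functorD(4)[OF F f g]
    is_functorD(4)[OF G is_functorD(2)[OF F f] is_functorD(2)[OF F g]]
   by (simp add: comp_functor_def)
 next
  fix f X Y assume f: "f \<in> hom C X Y"
  show "onarr (comp_functor C G F) f \<in> hom E (onobj (comp_functor C G F) X) (onobj (comp_functor C G F) Y)"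
   using homD(1)[OF f] hom_obj[OF f] is_functorD(2)[OF G is_functorD(2)[OF F f]]
   by (simp add: comp_functor_def)
 next
  fix X assume X: "X \<in> obj C"
  show "onobj (comp_functor C G F) X \<in> obj E"
   using X is_functorD(1)[OF F] is_functorD(1)[OF G] by (simp add: comp_functor_def)
  show "onarr (comp_functor C G F) (idn C X) = idn E (onobj (comp_functor C G F) X)"
   using X homD(1)[OF idn_hom[OF X]] is_functorD(1,3)[OF F X] is_functorD(3)[OF G]
   by (simp add: comp_functor_def)
 qed (auto simp: comp_functor_def)
qed

lemma full_subcat_simps [simp]:
 "obj (full_subcat C P) = {X \<in> obj C. P X}"
 "arr (full_subcat C P) = {f \<in> arr C. P (src C f) \<and> P (tgt C f)}"
 "src (full_subcat C P) = src C" "tgt (full_subcat C P) = tgt C"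
 "idn (full_subcat C P) = idn C" "cmp (full_subcat C P) = cmp C"
 by (simp_all add: full_subcat_def)

lemma functor_cat_simps:
 "obj (functor_cat C D) = {F. is_functor C D F}"
 "arr (functor_cat C D) = {(F, \<eta>, G). is_functor C D F \<and> is_functor C D G \<and> nat_trans C D F G \<eta>}"
 "src (functor_cat C D) (F, \<eta>, G) = F" "tgt (functor_cat C D) (F, \<eta>, G) = G"
 "idn (functor_cat C D) F = (F, (\<lambda>X\<in>obj C. idn D (onobj F X)), F)"
 "cmp (functor_cat C D) (G', \<theta>, H) (F, \<eta>, G) = (F, (\<lambda>X\<in>obj C. cmp D (\<theta> X) (\<eta> X)), H)"
 by (simp_all add: functor_cat_def)

section \<open>The sheaf condition as descent along single arrows, and sheaves by elements\<close>

section \<open>Sheaves for the atomic topology\<close>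

abbreviation act :: "('o, 'a, 'x set, 'x set_arr) fctr => 'a => 'x => 'x" where
 "act F f \<equiv> app (onarr F f)"

text \<open>The component of a natural transformation, acting on elements. All arguments about sheaf
  morphisms are elementwise and go through \<open>cm\<close>.\<close>

definition cm :: "('o, 'a, 'x set, 'x set_arr) nat_arr => 'o => 'x => 'x" where
 "cm m X = app (fst (snd m) X)"

text \<open>Sheaves live on the opposite category, so they are covariant on \<open>T\<close>, and
  amalgamation of spans is the Ore condition that makes nonempty sieves stable under
  pullback.\<close>

locale amalgamation_category = universe U + category T
 for U :: "'u itself" and T :: "('o, 'a) cat" +
 assumes amalgamation: "f \<in> hom T X Y ==> f' \<in> hom T X Y' ==>
  \<exists>Z. \<exists>g\<in>hom T Y Z. \<exists>g'\<in>hom T Y' Z. cmp T g f = cmp T g' f'"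
begin

abbreviation comp :: "'a => 'a => 'a" (infixr "\<odot>" 70) where "g \<odot> f \<equiv> cmp T g f"

lemma assoc: "f \<in> hom T W X ==> g \<in> hom T X Y ==> h \<in> hom T Y Z ==> h \<odot> (g \<odot> f) = (h \<odot> g) \<odot> f"
 by (rule cmp_assoc)

text \<open>Stability is the only axiom with content: completing f and a member k of the sieve to a
  commutative square produces an arrow in the pulled back sieve.\<close>

lemma nonempty_sieves_topology: "grothendieck_topology (opp T) (\<lambda>X. {R. sieve (opp T) X R \<and> R \<noteq> {}})"
 (is "grothendieck_topology _ ?J")
 unfolding grothendieck_topology_def
proof (intro conjI ballI allI impI)
 fix X assume X: "X \<in> obj (opp T)"
 then have "idn T X \<in> {f \<in> arr (opp T). tgt (opp T) f = X}"
  using idn_hom[of X] by (simp add: hom_def)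
 moreover have "sieve (opp T) X {f \<in> arr (opp T). tgt (opp T) f = X}"
  unfolding sieve_def using cmp_hom by (fastforce simp: hom_def)
 ultimately show "{f \<in> arr (opp T). tgt (opp T) f = X} \<in> ?J X" by blast
next
 fix f R assume f: "f \<in> arr (opp T)" and R: "R \<in> ?J (tgt (opp T) f)"
 then obtain k where k: "k \<in> R" by blast
 have f': "f \<in> hom T (src T f) (tgt T f)" and k': "k \<in> hom T (src T f) (tgt T k)"
  using f k R by (auto simp: hom_def sieve_def)
 from amalgamation[OF f' k'] obtain Z g g' where
  g: "g \<in> hom T (tgt T f) Z" and g': "g' \<in> hom T (tgt T k) Z" and eq: "g \<odot> f = g' \<odot> k" by blast
 have "g' \<odot> k \<in> R" using R k g' by (auto simp: sieve_def hom_def)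
 then have "g \<in> pullback_sieve (opp T) f R" using g eq by (simp add: pullback_sieve_def hom_def)
 moreover have "sieve (opp T) (src (opp T) f) (pullback_sieve (opp T) f R)"
  unfolding sieve_def
 proof (intro conjI ballI impI)
  show "pullback_sieve (opp T) f R \<subseteq> {fa \<in> arr (opp T). tgt (opp T) fa = src (opp T) f}"
   by (auto simp: pullback_sieve_def)
  fix h k assume h: "h \<in> pullback_sieve (opp T) f R" and k: "k \<in> arr (opp T)" "tgt (opp T) k = src (opp T) h"
  have hh: "h \<in> hom T (tgt T f) (src T k)" "h \<odot> f \<in> R" "k \<in> hom T (src T k) (tgt T k)"
   using h k by (auto simp: pullback_sieve_def hom_def)
  have "k \<odot> (h \<odot> f) \<in> R" using R k hh cmp_hom[OF f' hh(1)] by (auto simp: sieve_def hom_def)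
  then show "cmp (opp T) h k \<in> pullback_sieve (opp T) f R"
   using assoc[OF f' hh(1,3)] cmp_hom[OF hh(1,3)] by (simp add: pullback_sieve_def hom_def)
 qed
 ultimately show "pullback_sieve (opp T) f R \<in> ?J (src (opp T) f)" by blast
next
 fix X R Q assume X: "X \<in> obj (opp T)" and R: "R \<in> ?J X"
  and Q: "sieve (opp T) X Q \<and> (\<forall>f\<in>R. pullback_sieve (opp T) f Q \<in> ?J (src (opp T) f))"
 from R obtain f where "f \<in> R" by blast
 with Q have "pullback_sieve (opp T) f Q \<noteq> {}" by blast
 then have "Q \<noteq> {}" by (auto simp: pullback_sieve_def)
 with Q show "Q \<in> ?J X" by blast
qed auto

text \<open>The intersection is attained: the nonempty sieves form one of the topologies that are
  intersected, and each of the others contains them.\<close>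

lemma atomic_topology_eq:
 assumes "X \<in> obj T"
 shows "atomic_topology (opp T) X = {R. sieve (opp T) X R \<and> R \<noteq> {}}"
proof -
 let ?J = "\<lambda>X. {R. sieve (opp T) X R \<and> R \<noteq> {}}"
 have "grothendieck_topology (opp T) ?J" by (rule nonempty_sieves_topology)
 then have "atomic_topology (opp T) X \<subseteq> ?J X"
  unfolding atomic_topology_def by (intro Inter_lower CollectI) (rule exI[of _ ?J], auto)
 moreover have "?J X \<subseteq> atomic_topology (opp T) X"
  unfolding atomic_topology_def using assms by auto
 ultimately show ?thesis by blast
qed

text \<open>For the atomic topology the sheaf condition only involves single arrows: a covering sieve may
 be replaced by the one generated by any of its members.\<close>

definition descent :: "('o, 'a, 'x set, 'x set_arr) fctr => bool" where
 "descent F \<longleftrightarrow> (\<forall>X Y. \<forall>f\<in>hom T X Y. inj_on (act F f) (onobj F X) \<and>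
   (\<forall>y\<in>onobj F Y. (\<forall>Z. \<forall>g\<in>hom T Y Z. \<forall>h\<in>hom T Y Z. g \<odot> f = h \<odot> f --> act F g y = act F h y) -->
    (\<exists>x\<in>onobj F X. act F f x = y)))"

lemma functor_act:
 assumes F: "is_functor T (Set_cat U) F"
 shows "f \<in> hom T X Y ==> x \<in> onobj F X ==> act F f x \<in> onobj F Y"
  and "X \<in> obj T ==> x \<in> onobj F X ==> act F (idn T X) x = x"
  and "f \<in> hom T X Y ==> g \<in> hom T Y Z ==> x \<in> onobj F X ==> act F (g \<odot> f) x = act F g (act F f x)"
  and "X \<in> obj T ==> small U (onobj F X)"
proof -
 show 1: "act F f x \<in> onobj F Y" if "f \<in> hom T X Y" "x \<in> onobj F X"
  by (rule Set_hom_app[OF is_functorD(2)[OF F that(1)] that(2)])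
 show "act F (idn T X) x = x" if "X \<in> obj T" "x \<in> onobj F X"
  using is_functorD(3)[OF F that(1)] that(2) by simp
 show "act F (g \<odot> f) x = act F g (act F f x)" if f: "f \<in> hom T X Y" and g: "g \<in> hom T Y Z" and x: "x \<in> onobj F X"
  using is_functorD(4)[OF F f g] app_Set_cmp[OF is_functorD(2)[OF F f] is_functorD(2)[OF F g] x] by simp
 show "small U (onobj F X)" if "X \<in> obj T"
  using is_functorD(1)[OF F that] by simp
qed

text \<open>A matching family is determined by its value at any one member f of the sieve, and that
  value satisfies exactly the equations tested in \<open>descent\<close>. Conversely, such an
  element spreads out to a matching family on the sieve generated by f.\<close>

lemma is_sheaf_iff_descent:
 assumes F: "is_functor T (Set_cat U) F"
 shows "is_sheaf (opp T) (atomic_topology (opp T)) F \<longleftrightarrow> descent F"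
proof
 assume sh: "is_sheaf (opp T) (atomic_topology (opp T)) F"
 show "descent F"
  unfolding descent_def
 proof (intro allI ballI conjI impI)
  fix X Y f assume f: "f \<in> hom T X Y"
  \<comment> \<open>The sieve generated by f, consisting of the composites that start with
    f.\<close>
  define R where "R = {g \<odot> f |g Z. g \<in> hom T Y Z}"
  have X: "X \<in> obj T" using f by (rule hom_obj)
  have "sieve (opp T) X R"
   unfolding sieve_def
  proof (intro conjI ballI impI)
   show "R \<subseteq> {fa \<in> arr (opp T). tgt (opp T) fa = X}"
    using cmp_hom[OF f] by (auto simp: R_def hom_def)
   fix k h assume "k \<in> R" and h: "h \<in> arr (opp T)" "tgt (opp T) h = src (opp T) k"
   then obtain g Z where g: "g \<in> hom T Y Z" "k = g \<odot> f" by (auto simp: R_def)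
   have h': "h \<in> hom T Z (tgt T h)" using h g cmp_hom[OF f g(1)] by (simp add: hom_def)
   show "cmp (opp T) k h \<in> R"
    using assoc[OF f g(1) h'] g cmp_hom[OF g(1) h'] by (auto simp: R_def)
  qed
  moreover have "f \<in> R"
   using idn_hom[OF hom_obj(2)[OF f]] cmp_idn_left[OF f] unfolding R_def by force
  ultimately have R: "R \<in> atomic_topology (opp T) X" using atomic_topology_eq[OF X] by blast
  have sh': "\<exists>!a. a \<in> onobj F X \<and> (\<forall>f\<in>R. act F f a = x f)"
   if "matching_family (opp T) F R x" for x
   using sh X R that unfolding is_sheaf_def by simp
  {
   show "inj_on (act F f) (onobj F X)"
   proof (rule inj_onI)
    fix a b assume a: "a \<in> onobj F X" and b: "b \<in> onobj F X" and eq: "act F f a = act F f b"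
    have ab: "act F k a = act F k b" if "k \<in> R" for k
     using that eq a b functor_act(3)[OF F f] by (auto simp: R_def)
    have Rk: "k \<in> hom T X (tgt T k)" if "k \<in> R" for k
     using that cmp_hom[OF f] by (auto simp: R_def hom_def)
    have "matching_family (opp T) F R (\<lambda>k. act F k a)"
     unfolding matching_family_def
     using functor_act(1)[OF F Rk a] functor_act(3)[OF F Rk _ a] by (auto simp: hom_def)
    from sh'[OF this] show "a = b" using a b ab by metis
   qed
  next
   fix y assume y: "y \<in> onobj F Y"
    and gh: "\<forall>Z. \<forall>g\<in>hom T Y Z. \<forall>h\<in>hom T Y Z. g \<odot> f = h \<odot> f --> act F g y = act F h y"
   \<comment> \<open>The value at \<open>g \<odot> f\<close> has to be \<open>act F g y\<close>. The
     composite does not determine g, but \<open>gh\<close> says that the choice is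
     immaterial.\<close>
   define x where "x k = act F (SOME g. \<exists>Z. g \<in> hom T Y Z \<and> k = g \<odot> f) y" for k
   have x: "x (g \<odot> f) = act F g y" if g: "g \<in> hom T Y Z" for g Z
   proof -
    let ?g = "SOME g'. \<exists>Z'. g' \<in> hom T Y Z' \<and> g \<odot> f = g' \<odot> f"
    obtain Z' where Z': "?g \<in> hom T Y Z'" "g \<odot> f = ?g \<odot> f"
     using someI[of "\<lambda>g'. \<exists>Z'. g' \<in> hom T Y Z' \<and> g \<odot> f = g' \<odot> f" g] g by blast
    have "Z' = Z" using homD(3)[OF cmp_hom[OF f Z'(1)]] homD(3)[OF cmp_hom[OF f g]] Z'(2) by simp
    then have "?g \<in> hom T Y Z" using Z'(1) by simp
    then show ?thesis using gh[rule_format, of ?g Z g] g Z'(2) unfolding x_def by simp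
   qed
   have "matching_family (opp T) F R x"
    unfolding matching_family_def
   proof (intro conjI ballI impI)
    fix k assume "k \<in> R"
    then obtain g Z where g: "g \<in> hom T Y Z" "k = g \<odot> f" by (auto simp: R_def)
    show "x k \<in> onobj F (src (opp T) k)"
     using x[OF g(1)] functor_act(1)[OF F g(1) y] g homD(3)[OF cmp_hom[OF f g(1)]] by simp
    fix h assume h: "h \<in> arr (opp T)" "tgt (opp T) h = src (opp T) k"
    then have h': "h \<in> hom T Z (tgt T h)" using g cmp_hom[OF f g(1)] by (simp add: hom_def)
    show "x (cmp (opp T) k h) = act F h (x k)"
     using x[OF g(1)] x[OF cmp_hom[OF g(1) h']] functor_act(3)[OF F g(1) h' y] assoc[OF f g(1) h'] g
     by simp
   qed
   from sh'[OF this] obtain a where a: "a \<in> onobj F X" "act F f a = x f" using \<open>f \<in> R\<close> by blast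
   have "x f = y"
    using x[OF idn_hom[OF hom_obj(2)[OF f]]] cmp_idn_left[OF f] functor_act(2)[OF F hom_obj(2)[OF f] y]
    by simp
   then show "\<exists>x\<in>onobj F X. act F f x = y" using a by blast
  }
 qed
next
 assume d: "descent F"
 show "is_sheaf (opp T) (atomic_topology (opp T)) F"
  unfolding is_sheaf_def
 proof (intro ballI allI impI)
  fix X R x assume X: "X \<in> obj (opp T)" and R: "R \<in> atomic_topology (opp T) X"
   and x: "matching_family (opp T) F R x"
  have R': "sieve (opp T) X R" "R \<noteq> {}" using R atomic_topology_eq[of X] X by auto
  have RX: "k \<in> hom T X (tgt T k)" if "k \<in> R" for k using that R' by (auto simp: sieve_def hom_def)
  have xk: "x k \<in> onobj F (tgt T k)" if "k \<in> R" for k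
   using that x by (simp add: matching_family_def)
  have xg: "x (g \<odot> k) = act F g (x k)" if "k \<in> R" "g \<in> hom T (tgt T k) Z" for k g Z
   using that x by (simp add: matching_family_def hom_def)
  obtain f where f: "f \<in> R" using R' by blast
  have "act F g (x f) = act F h (x f)"
   if "g \<in> hom T (tgt T f) Z" "h \<in> hom T (tgt T f) Z" "g \<odot> f = h \<odot> f" for g h Z
   using that xg[OF f] by metis
  then obtain a where a: "a \<in> onobj F X" "act F f a = x f"
   using d RX[OF f] xk[OF f] unfolding descent_def by meson
  have "act F k a = x k" if k: "k \<in> R" for k
  proof -
   \<comment> \<open>Any other member k meets f in a square; on its diagonal both candidates agree,
     and injectivity of \<open>act F g'\<close> brings the equality back to k.\<close>
   obtain Z g g' where g: "g \<in> hom T (tgt T f) Z" and g': "g' \<in> hom T (tgt T k) Z" and eq: "g \<odot> f = g' \<odot> k"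
    using amalgamation[OF RX[OF f] RX[OF k]] by blast
   have "act F g' (act F k a) = act F g' (x k)"
    using functor_act(3)[OF F RX[OF k] g' a(1)] functor_act(3)[OF F RX[OF f] g a(1)]
     xg[OF k g'] xg[OF f g] a(2) eq by metis
   moreover have "inj_on (act F g') (onobj F (tgt T k))" using d g' unfolding descent_def by blast
   ultimately show ?thesis
    using functor_act(1)[OF F RX[OF k] a(1)] xk[OF k] by (meson inj_onD)
  qed
  moreover have "b = a" if "b \<in> onobj F X" "\<forall>k\<in>R. act F k b = x k" for b
  proof -
   have "inj_on (act F f) (onobj F X)" using d RX[OF f] unfolding descent_def by blast
   then show ?thesis using a that f by (metis inj_onD)
  qed
  ultimately show "\<exists>!a. a \<in> onobj F X \<and> (\<forall>f\<in>R. act F f a = x f)"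
   using a(1) by blast
 qed
qed

subsection \<open>The category of sheaves\<close>

definition E :: "(('o, 'a, 'u) presheaf, ('o, 'a, 'u set, 'u set_arr) nat_arr) cat" where
 "E = Sh U (opp T) (atomic_topology (opp T))"

lemma E_obj_iff: "F \<in> obj E \<longleftrightarrow> is_functor T (Set_cat U) F \<and> descent F"
 using is_sheaf_iff_descent by (auto simp: E_def Sh_def functor_cat_simps)

lemma E_functor: "F \<in> obj E ==> is_functor T (Set_cat U) F"
 by (simp add: E_obj_iff)

lemmas E_act = functor_act(1)[OF E_functor]
 and E_id = functor_act(2)[OF E_functor]
 and E_cmp = functor_act(3)[OF E_functor]
 and E_small = functor_act(4)[OF E_functor]

lemma E_inj: "F \<in> obj E ==> f \<in> hom T X Y ==> x \<in> onobj F X ==> y \<in> onobj F X ==> act F f x = act F f y ==> x = y"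
 unfolding E_obj_iff descent_def by (meson inj_onD)

lemma E_descent:
 assumes "F \<in> obj E" "f \<in> hom T X Y" "y \<in> onobj F Y"
  and "\<And>Z g h. g \<in> hom T Y Z ==> h \<in> hom T Y Z ==> g \<odot> f = h \<odot> f ==> act F g y = act F h y"
 obtains x where "x \<in> onobj F X" "act F f x = y"
proof -
 have "\<forall>y\<in>onobj F Y. (\<forall>Z. \<forall>g\<in>hom T Y Z. \<forall>h\<in>hom T Y Z. g \<odot> f = h \<odot> f --> act F g y = act F h y) -->
    (\<exists>x\<in>onobj F X. act F f x = y)"
  using assms(1,2) unfolding E_obj_iff descent_def by blast
 then show thesis using assms(3,4) that by blast
qed

lemma E_hom_iff:
 "m \<in> hom E F G \<longleftrightarrow> (\<exists>\<eta>. m = (F, \<eta>, G) \<and> F \<in> obj E \<and> G \<in> obj E \<and> nat_trans T (Set_cat U) F G \<eta>)"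
proof -
 have "m \<in> arr E \<longleftrightarrow> (\<exists>F \<eta> G. m = (F, \<eta>, G) \<and> F \<in> obj E \<and> G \<in> obj E \<and> nat_trans T (Set_cat U) F G \<eta>)"
  by (cases m) (auto simp: E_def Sh_def functor_cat_simps)
 moreover have "src E (F, \<eta>, G) = F" "tgt E (F, \<eta>, G) = G" for F \<eta> G
  by (auto simp: E_def Sh_def functor_cat_simps)
 ultimately show ?thesis unfolding hom_def by auto
qed

lemma E_hom_obj: "m \<in> hom E F G ==> F \<in> obj E" "m \<in> hom E F G ==> G \<in> obj E"
 by (auto simp: E_hom_iff)

lemma cm_in:
 assumes "m \<in> hom E F G" "X \<in> obj T" "x \<in> onobj F X"
 shows "cm m X x \<in> onobj G X"
proof -
 have "fst (snd m) X \<in> hom (Set_cat U) (onobj F X) (onobj G X)"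
  using assms by (auto simp: E_hom_iff nat_trans_def)
 then show ?thesis using assms(3) unfolding cm_def by (rule Set_hom_app)
qed

lemma cm_nat:
 assumes m: "m \<in> hom E F G" and f: "f \<in> hom T X Y" and x: "x \<in> onobj F X"
 shows "cm m Y (act F f x) = act G f (cm m X x)"
proof -
 from m obtain \<eta> where \<eta>: "m = (F, \<eta>, G)" "F \<in> obj E" "G \<in> obj E" "nat_trans T (Set_cat U) F G \<eta>"
  by (auto simp: E_hom_iff)
 have X: "\<eta> X \<in> hom (Set_cat U) (onobj F X) (onobj G X)" and Y: "\<eta> Y \<in> hom (Set_cat U) (onobj F Y) (onobj G Y)"
  and eq: "cmp (Set_cat U) (\<eta> Y) (onarr F f) = cmp (Set_cat U) (onarr G f) (\<eta> X)"
  using \<eta>(4) hom_obj[OF f] homD[OF f] unfolding nat_trans_def by auto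
 note Ff = is_functorD(2)[OF E_functor[OF \<eta>(2)] f] and Gf = is_functorD(2)[OF E_functor[OF \<eta>(3)] f]
 show ?thesis
  using app_Set_cmp[OF Ff Y x] app_Set_cmp[OF X Gf x] eq \<eta>(1) by (simp add: cm_def)
qed

lemma E_ext:
 assumes m: "m \<in> hom E F G" and m': "m' \<in> hom E F G"
  and eq: "\<And>X x. X \<in> obj T ==> x \<in> onobj F X ==> cm m X x = cm m' X x"
 shows "m = m'"
proof -
 from m m' obtain \<eta> \<eta>' where \<eta>: "m = (F, \<eta>, G)" "nat_trans T (Set_cat U) F G \<eta>"
  "m' = (F, \<eta>', G)" "nat_trans T (Set_cat U) F G \<eta>'" by (auto simp: E_hom_iff)
 have "\<eta> = \<eta>'"
 proof (rule extensionalityI[of _ "obj T"])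
  fix X assume X: "X \<in> obj T"
  show "\<eta> X = \<eta>' X"
   by (rule Set_ext[of _ U "onobj F X" "onobj G X"]) (use X \<eta> eq[OF X] in \<open>auto simp: nat_trans_def cm_def\<close>)
 qed (use \<eta> in \<open>auto simp: nat_trans_def\<close>)
 then show ?thesis using \<eta> by simp
qed

definition mk_hom :: "('o, 'a, 'u) presheaf => ('o => 'u => 'u) => ('o, 'a, 'u) presheaf
  => ('o, 'a, 'u set, 'u set_arr) nat_arr" where
 "mk_hom F c G = (F, (\<lambda>X\<in>obj T. mk_set (onobj F X) (c X) (onobj G X)), G)"

lemma cm_mk_hom [simp]: "X \<in> obj T ==> x \<in> onobj F X ==> cm (mk_hom F c G) X x = c X x"
 by (simp add: cm_def mk_hom_def)

lemma mk_hom: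
 assumes F: "F \<in> obj E" and G: "G \<in> obj E"
  and c: "\<And>X x. X \<in> obj T ==> x \<in> onobj F X ==> c X x \<in> onobj G X"
  and nat: "\<And>f X Y x. f \<in> hom T X Y ==> x \<in> onobj F X ==> c Y (act F f x) = act G f (c X x)"
 shows "mk_hom F c G \<in> hom E F G"
proof -
 have cX: "mk_set (onobj F X) (c X) (onobj G X) \<in> hom (Set_cat U) (onobj F X) (onobj G X)"
  if "X \<in> obj T" for X
  by (rule mk_set_hom) (use that c E_small F G in auto)
 have "nat_trans T (Set_cat U) F G (\<lambda>X\<in>obj T. mk_set (onobj F X) (c X) (onobj G X))"
  unfolding nat_trans_def
 proof (intro conjI ballI)
  fix f assume "f \<in> arr T"
  then obtain X Y where f: "f \<in> hom T X Y" by (blast intro: arr_hom)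
  note Ff = is_functorD(2)[OF E_functor[OF F] f] and Gf = is_functorD(2)[OF E_functor[OF G] f]
  note XY = hom_obj[OF f] note cX' = cX[OF XY(1)] and cY = cX[OF XY(2)]
  have "cmp (Set_cat U) (mk_set (onobj F Y) (c Y) (onobj G Y)) (onarr F f) =
   cmp (Set_cat U) (onarr G f) (mk_set (onobj F X) (c X) (onobj G X))"
   by (rule Set_ext[OF Set_cmp_hom[OF Ff cY] Set_cmp_hom[OF cX' Gf]])
    (simp add: app_Set_cmp[OF Ff cY] app_Set_cmp[OF cX' Gf] nat[OF f] Set_hom_app[OF Ff])
  then show "cmp (Set_cat U) ((\<lambda>X\<in>obj T. mk_set (onobj F X) (c X) (onobj G X)) (tgt T f)) (onarr F f) =
   cmp (Set_cat U) (onarr G f) ((\<lambda>X\<in>obj T. mk_set (onobj F X) (c X) (onobj G X)) (src T f))"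
   using XY homD[OF f] by simp
 qed (use cX in auto)
 then show ?thesis using F G by (simp add: E_hom_iff mk_hom_def)
qed

lemma E_cmp_eq: "cmp E (G', \<theta>, H) (F, \<eta>, G) = (F, (\<lambda>X\<in>obj T. cmp (Set_cat U) (\<theta> X) (\<eta> X)), H)"
 and E_idn_eq: "idn E F = (F, (\<lambda>X\<in>obj T. idn (Set_cat U) (onobj F X)), F)"
 unfolding E_def Sh_def full_subcat_simps functor_cat_simps opp_opp by (rule refl)+

lemma cm_idn [simp]: "X \<in> obj T ==> x \<in> onobj F X ==> cm (idn E F) X x = x"
 by (simp add: cm_def E_idn_eq)

lemma idn_eq_mk_hom: "idn E F = mk_hom F (\<lambda>_ x. x) F"
 by (simp add: E_idn_eq mk_hom_def mk_set_def Set_idn_eq fun_eq_iff restrict_def)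

lemma E_idn_hom: "F \<in> obj E ==> idn E F \<in> hom E F F"
 unfolding idn_eq_mk_hom by (rule mk_hom) auto

lemma cm_cmp:
 assumes "m \<in> hom E F G" "n \<in> hom E G H" "X \<in> obj T" "x \<in> onobj F X"
 shows "cm (cmp E n m) X x = cm n X (cm m X x)"
proof -
 from assms obtain \<eta> \<theta> where \<eta>: "m = (F, \<eta>, G)" "nat_trans T (Set_cat U) F G \<eta>"
  "n = (G, \<theta>, H)" "nat_trans T (Set_cat U) G H \<theta>" by (auto simp: E_hom_iff)
 then have "\<eta> X \<in> hom (Set_cat U) (onobj F X) (onobj G X)" "\<theta> X \<in> hom (Set_cat U) (onobj G X) (onobj H X)"
  using assms(3) by (auto simp: nat_trans_def)
 from app_Set_cmp[OF this assms(4)] show ?thesis using assms(3) \<eta> by (simp add: cm_def E_cmp_eq)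
qed

lemma E_cmp_hom:
 assumes m: "m \<in> hom E F G" and n: "n \<in> hom E G H"
 shows "cmp E n m \<in> hom E F H"
proof -
 have "cmp E n m = mk_hom F (\<lambda>X x. cm n X (cm m X x)) H"
 proof -
  from assms obtain \<eta> \<theta> where \<eta>: "m = (F, \<eta>, G)" "nat_trans T (Set_cat U) F G \<eta>"
   "n = (G, \<theta>, H)" "nat_trans T (Set_cat U) G H \<theta>" by (auto simp: E_hom_iff)
  have "cmp (Set_cat U) (\<theta> X) (\<eta> X) = mk_set (onobj F X) (\<lambda>x. cm n X (cm m X x)) (onobj H X)"
   if X: "X \<in> obj T" for X
  proof -
   have 1: "\<eta> X \<in> hom (Set_cat U) (onobj F X) (onobj G X)" "\<theta> X \<in> hom (Set_cat U) (onobj G X) (onobj H X)"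
    using X \<eta> by (auto simp: nat_trans_def)
   have sm: "small U (onobj F X)" "small U (onobj H X)" using 1 by (auto simp: Set_hom_iff)
   have c: "cm n X (cm m X x) = app (\<theta> X) (app (\<eta> X) x)" for x by (simp add: cm_def \<eta>)
   show ?thesis
    by (rule Set_ext[OF Set_cmp_hom[OF 1] mk_set_hom[OF sm]])
     (simp_all add: c Set_hom_app[OF 1(2)] Set_hom_app[OF 1(1)] app_Set_cmp[OF 1])
  qed
  then show ?thesis by (simp add: \<eta> E_cmp_eq mk_hom_def restrict_def fun_eq_iff)
 qed
 also have "\<dots> \<in> hom E F H"
 proof (rule mk_hom)
  show "F \<in> obj E" using m by (rule E_hom_obj)
  show "H \<in> obj E" using n by (rule E_hom_obj)
  fix X x assume "X \<in> obj T" "x \<in> onobj F X"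
  then show "cm n X (cm m X x) \<in> onobj H X" using m n by (meson cm_in)
 next
  fix f X Y x assume f: "f \<in> hom T X Y" "x \<in> onobj F X"
  then show "cm n Y (cm m Y (act F f x)) = act H f (cm n X (cm m X x))"
   using cm_nat[OF m f] cm_nat[OF n f(1) cm_in[OF m hom_obj(1)[OF f(1)] f(2)]] by simp
 qed
 finally show ?thesis .
qed

lemma category_E: "category E"
proof
 show "f \<in> arr E ==> src E f \<in> obj E" for f using E_hom_obj(1)[OF arr_hom] .
 show "f \<in> arr E ==> tgt E f \<in> obj E" for f using E_hom_obj(2)[OF arr_hom] .
 show "F \<in> obj E ==> idn E F \<in> hom E F F" for F by (rule E_idn_hom)
 show "m \<in> hom E F G ==> n \<in> hom E G H ==> cmp E n m \<in> hom E F H" for m n F G H by (rule E_cmp_hom)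
 show "m \<in> hom E F G ==> cmp E m (idn E F) = m" for m F G
  by (rule E_ext[of _ F G]) (auto intro: E_cmp_hom E_idn_hom E_hom_obj simp: cm_cmp[OF E_idn_hom[OF E_hom_obj(1)]])
 show "m \<in> hom E F G ==> cmp E (idn E G) m = m" for m F G
  by (rule E_ext[of _ F G]) (auto intro: E_cmp_hom E_idn_hom E_hom_obj simp: cm_in cm_cmp[OF _ E_idn_hom[OF E_hom_obj(2)]])
 show "cmp E k (cmp E n m) = cmp E (cmp E k n) m"
  if m: "m \<in> hom E F G" and n: "n \<in> hom E G H" and k: "k \<in> hom E H K" for m n k F G H K
  by (rule E_ext[OF E_cmp_hom[OF E_cmp_hom[OF m n] k] E_cmp_hom[OF m E_cmp_hom[OF n k]]])
   (simp add: cm_cmp[OF m n] cm_cmp[OF n k] cm_cmp[OF E_cmp_hom[OF m n] k] cm_cmp[OF m E_cmp_hom[OF n k]]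
    cm_in[OF m])
qed

definition mk_sheaf :: "('o => 'u set) => ('a => 'u => 'u) => ('o, 'a, 'u) presheaf" where
 "mk_sheaf V a = \<lparr>onobj = (\<lambda>X\<in>obj T. V X), onarr = (\<lambda>f\<in>arr T. mk_set (V (src T f)) (a f) (V (tgt T f)))\<rparr>"

lemma onobj_mk_sheaf [simp]: "X \<in> obj T ==> onobj (mk_sheaf V a) X = V X"
 by (simp add: mk_sheaf_def)

lemma act_mk_sheaf [simp]: "f \<in> hom T X Y ==> x \<in> V X ==> act (mk_sheaf V a) f x = a f x"
 by (auto simp: mk_sheaf_def hom_def)

lemma mk_functor:
 assumes sm: "\<And>X. X \<in> obj T ==> small U (V X)"
  and a: "\<And>f X Y x. f \<in> hom T X Y ==> x \<in> V X ==> a f x \<in> V Y"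
  and id: "\<And>X x. X \<in> obj T ==> x \<in> V X ==> a (idn T X) x = x"
  and cmp: "\<And>f g X Y Z x. f \<in> hom T X Y ==> g \<in> hom T Y Z ==> x \<in> V X ==> a (g \<odot> f) x = a g (a f x)"
 shows "is_functor T (Set_cat U) (mk_sheaf V a)"
proof (rule is_functorI)
 have fh: "onarr (mk_sheaf V a) f \<in> hom (Set_cat U) (V X) (V Y)" if f: "f \<in> hom T X Y" for f X Y
  using sm hom_obj[OF f] a[OF f] homD[OF f] by (auto simp: mk_sheaf_def intro!: mk_set_hom)
 show "onarr (mk_sheaf V a) f \<in> hom (Set_cat U) (onobj (mk_sheaf V a) X) (onobj (mk_sheaf V a) Y)"
  if f: "f \<in> hom T X Y" for f X Y
  using fh[OF f] hom_obj[OF f] by simp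
 show "onarr (mk_sheaf V a) (g \<odot> f) = cmp (Set_cat U) (onarr (mk_sheaf V a) g) (onarr (mk_sheaf V a) f)"
  if f: "f \<in> hom T X Y" and g: "g \<in> hom T Y Z" for f g X Y Z
  by (rule Set_ext[OF fh[OF cmp_hom[OF f g]] Set_cmp_hom[OF fh[OF f] fh[OF g]]])
   (simp add: app_Set_cmp[OF fh[OF f] fh[OF g]] act_mk_sheaf[OF f] act_mk_sheaf[OF g]
    act_mk_sheaf[OF cmp_hom[OF f g]] cmp[OF f g] a[OF f])
 show "onarr (mk_sheaf V a) (idn T X) = idn (Set_cat U) (onobj (mk_sheaf V a) X)" if X: "X \<in> obj T" for X
  using X by (intro Set_ext[OF fh[OF idn_hom[OF X]]])
   (auto simp: id act_mk_sheaf[OF idn_hom[OF X]] intro!: Set_idn_hom sm)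
qed (use sm in \<open>auto simp: mk_sheaf_def\<close>)

lemma mk_sheaf:
 assumes sm: "\<And>X. X \<in> obj T ==> small U (V X)"
  and a: "\<And>f X Y x. f \<in> hom T X Y ==> x \<in> V X ==> a f x \<in> V Y"
  and id: "\<And>X x. X \<in> obj T ==> x \<in> V X ==> a (idn T X) x = x"
  and cmp: "\<And>f g X Y Z x. f \<in> hom T X Y ==> g \<in> hom T Y Z ==> x \<in> V X ==> a (g \<odot> f) x = a g (a f x)"
  and inj: "\<And>f X Y x y. f \<in> hom T X Y ==> x \<in> V X ==> y \<in> V X ==> a f x = a f y ==> x = y"
  and desc: "\<And>f X Y y. f \<in> hom T X Y ==> y \<in> V Y ==>
   (\<And>Z g h. g \<in> hom T Y Z ==> h \<in> hom T Y Z ==> g \<odot> f = h \<odot> f ==> a g y = a h y) ==>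
   \<exists>x\<in>V X. a f x = y"
 shows "mk_sheaf V a \<in> obj E"
 unfolding E_obj_iff
proof
 show "is_functor T (Set_cat U) (mk_sheaf V a)" by (rule mk_functor[OF sm a id cmp])
 show "descent (mk_sheaf V a)"
  unfolding descent_def
 proof (intro allI ballI conjI impI)
  fix X Y f assume f: "f \<in> hom T X Y"
  note XY [simp] = hom_obj[OF f]
  show "inj_on (act (mk_sheaf V a) f) (onobj (mk_sheaf V a) X)"
   by (rule inj_onI) (use inj[OF f] in \<open>simp add: act_mk_sheaf[OF f]\<close>)
  fix y assume y: "y \<in> onobj (mk_sheaf V a) Y" and *: "\<forall>Z. \<forall>g\<in>hom T Y Z. \<forall>h\<in>hom T Y Z.
   g \<odot> f = h \<odot> f --> act (mk_sheaf V a) g y = act (mk_sheaf V a) h y"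
  have y': "y \<in> V Y" using y by simp
  have "\<exists>x\<in>V X. a f x = y"
  proof (rule desc[OF f y'])
   fix Z g h assume gh: "g \<in> hom T Y Z" "h \<in> hom T Y Z" "g \<odot> f = h \<odot> f"
   then have "act (mk_sheaf V a) g y = act (mk_sheaf V a) h y" using * by blast
   then show "a g y = a h y"
    using act_mk_sheaf[where V = V and a = a, OF gh(1) y'] act_mk_sheaf[where V = V and a = a, OF gh(2) y'] by simp
  qed
  then show "\<exists>x\<in>onobj (mk_sheaf V a) X. act (mk_sheaf V a) f x = y"
   using act_mk_sheaf[OF f] by auto
 qed
qed

text \<open>Sheaves may be described with elements of an arbitrary type, each set being presented as the
 quotient by a partial equivalence relation; \<open>N\<close> only serves to bound the size of the quotients.\<close>

lemma quotient_sheaf: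
 fixes Q :: "'o => 'x => 'x => bool" and a :: "'a => 'x => 'x" and N :: "'o => 'x => 'y"
 assumes sym: "\<And>X x y. Q X x y ==> Q X y x"
  and trans: "\<And>X x y z. Q X x y ==> Q X y z ==> Q X x z"
  and a: "\<And>f X Y x y. f \<in> hom T X Y ==> Q X x y ==> Q Y (a f x) (a f y)"
  and id: "\<And>X x. X \<in> obj T ==> Q X x x ==> Q X (a (idn T X) x) x"
  and cmp: "\<And>f g X Y Z x. f \<in> hom T X Y ==> g \<in> hom T Y Z ==> Q X x x ==> Q Z (a (g \<odot> f) x) (a g (a f x))"
  and inj: "\<And>f X Y x y. f \<in> hom T X Y ==> Q X x x ==> Q X y y ==> Q Y (a f x) (a f y) ==> Q X x y"
  and desc: "\<And>f X Y y. f \<in> hom T X Y ==> Q Y y y ==>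
   (\<And>Z g h. g \<in> hom T Y Z ==> h \<in> hom T Y Z ==> g \<odot> f = h \<odot> f ==> Q Z (a g y) (a h y)) ==>
   \<exists>x. Q X x x \<and> Q Y (a f x) y"
  and sm: "\<And>X. X \<in> obj T ==> small U (N X ` {x. Q X x x})"
  and N: "\<And>X x y. X \<in> obj T ==> Q X x x ==> Q X y y ==> N X x = N X y ==> Q X x y"
 obtains H kp where "H \<in> obj E" "\<And>X. X \<in> obj T ==> onobj H X = kp X ` {x. Q X x x}"
  "\<And>X x y. X \<in> obj T ==> Q X x x ==> Q X y y ==> kp X x = kp X y \<longleftrightarrow> Q X x y"
  "\<And>f X Y x. f \<in> hom T X Y ==> Q X x x ==> act H f (kp X x) = kp Y (a f x)"
proof -
 define cl where "cl X x = {y. Q X x y}" for X x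
 have cl_eq: "cl X x = cl X y \<longleftrightarrow> Q X x y" if "Q X x x" "Q X y y" for X x y
  unfolding cl_def using that sym trans by blast
 \<comment> \<open>By \<open>N\<close>, elements with the same N-value are equivalent, so a class is
   recovered from the N-value of any member and there are at most as many classes as values.\<close>
 have cl_small: "small U (cl X ` {x. Q X x x})" if X: "X \<in> obj T" for X
 proof (rule small_lepoll[OF sm[OF X]])
  have "cl X x = cl X (SOME y. Q X y y \<and> N X y = N X x)" if "Q X x x" for x
  proof -
   have "Q X (SOME y. Q X y y \<and> N X y = N X x) (SOME y. Q X y y \<and> N X y = N X x) \<and>
    N X (SOME y. Q X y y \<and> N X y = N X x) = N X x"
    by (rule someI[of _ x]) (use that in auto)
   then show ?thesis using cl_eq that N[OF X that] by metis
  qed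
  then have "cl X ` {x. Q X x x} \<subseteq> (\<lambda>n. cl X (SOME y. Q X y y \<and> N X y = n)) ` N X ` {x. Q X x x}"
   by blast
  then show "cl X ` {x. Q X x x} \<lesssim> N X ` {x. Q X x x}"
   by (rule lepoll_trans[OF subset_imp_lepoll image_lepoll])
 qed
 \<comment> \<open>The classes are sets over an arbitrary type; being few, they can be named by
   universe elements, which the values of a presheaf must be.\<close>
 have "\<forall>X\<in>obj T. \<exists>i :: 'x set => 'u. inj_on i (cl X ` {x. Q X x x})"
  using cl_small by (meson small_embed)
 then obtain i :: "'o => 'x set => 'u" where i: "\<And>X. X \<in> obj T ==> inj_on (i X) (cl X ` {x. Q X x x})"
  by metis
 define kp where "kp X x = i X (cl X x)" for X x
 have kp: "kp X x = kp X y \<longleftrightarrow> Q X x y" if "X \<in> obj T" "Q X x x" "Q X y y" for X x y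
  using cl_eq[OF that(2,3)] inj_on_eq_iff[OF i[OF that(1)], of "cl X x" "cl X y"] that
  unfolding kp_def by simp
 define V where "V X = kp X ` {x. Q X x x}" for X
 define b where "b f u = kp (tgt T f) (a f (SOME x. Q (src T f) x x \<and> kp (src T f) x = u))" for f u
 have b: "b f (kp X x) = kp Y (a f x)" if f: "f \<in> hom T X Y" and x: "Q X x x" for f X Y x
 proof -
  let ?x = "SOME x'. Q X x' x' \<and> kp X x' = kp X x"
  have x': "Q X ?x ?x \<and> kp X ?x = kp X x" by (rule someI[of _ x]) (use x in auto)
  then have "Q X ?x x" using kp[OF hom_obj(1)[OF f], of ?x x] x by simp
  then have "Q Y (a f ?x) (a f x)" by (rule a[OF f])
  then have "kp Y (a f ?x) = kp Y (a f x)"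
   using kp[OF hom_obj(2)[OF f] a[OF f] a[OF f]] x' x by simp
  then show ?thesis using homD[OF f] by (simp add: b_def)
 qed
 have H: "mk_sheaf V b \<in> obj E"
 proof (rule mk_sheaf)
  show "small U (V X)" if "X \<in> obj T" for X
   using small_image[OF cl_small[OF that], of "i X"] by (simp add: V_def kp_def image_image)
  show "b f x \<in> V Y" if "f \<in> hom T X Y" "x \<in> V X" for f X Y x
   using that b[OF that(1)] a[OF that(1)] by (auto simp: V_def)
  show "b (idn T X) x = x" if X: "X \<in> obj T" and x: "x \<in> V X" for X x
  proof -
   obtain z where z: "Q X z z" "x = kp X z" using x by (auto simp: V_def)
   have iz: "Q X (a (idn T X) z) z" using id[OF X z(1)] .
   have "kp X (a (idn T X) z) = kp X z"
    using kp[OF X trans[OF iz sym[OF iz]] z(1)] iz by simp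
   then show ?thesis using b[OF idn_hom[OF X] z(1)] z by simp
  qed
  show "b (g \<odot> f) x = b g (b f x)" if f: "f \<in> hom T X Y" and g: "g \<in> hom T Y Z" and x: "x \<in> V X" for f g X Y Z x
  proof -
   obtain z where z: "Q X z z" "x = kp X z" using x by (auto simp: V_def)
   have fz: "Q Y (a f z) (a f z)" using a[OF f z(1)] .
   have "kp Z (a (g \<odot> f) z) = kp Z (a g (a f z))"
    using kp[OF hom_obj(2)[OF g] a[OF cmp_hom[OF f g] z(1)] a[OF g fz]] cmp[OF f g z(1)] by simp
   then show ?thesis using b[OF f z(1)] b[OF g fz] b[OF cmp_hom[OF f g] z(1)] z by simp
  qed
  show "x = y" if f: "f \<in> hom T X Y" and xy: "x \<in> V X" "y \<in> V X" "b f x = b f y" for f X Y x y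
  proof -
   obtain w z where wz: "Q X w w" "x = kp X w" "Q X z z" "y = kp X z" using xy by (auto simp: V_def)
   have "Q Y (a f w) (a f z)"
    using xy b[OF f] wz kp[OF hom_obj(2)[OF f] a[OF f wz(1)] a[OF f wz(3)]] by simp
   then have "Q X w z" by (rule inj[OF f wz(1,3)])
   then show ?thesis using kp[OF hom_obj(1)[OF f] wz(1,3)] wz by simp
  qed
  show "\<exists>x\<in>V X. b f x = y" if f: "f \<in> hom T X Y" and y: "y \<in> V Y"
   and gh: "\<And>Z g h. g \<in> hom T Y Z ==> h \<in> hom T Y Z ==> g \<odot> f = h \<odot> f ==> b g y = b h y" for f X Y y
  proof -
   obtain z where z: "Q Y z z" "y = kp Y z" using y by (auto simp: V_def)
   obtain x where x: "Q X x x" "Q Y (a f x) z"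
   proof (atomize_elim, rule desc[OF f z(1)])
    fix Z g h assume *: "g \<in> hom T Y Z" "h \<in> hom T Y Z" "g \<odot> f = h \<odot> f"
    show "Q Z (a g z) (a h z)"
     using gh[OF *] b[OF *(1) z(1)] b[OF *(2) z(1)] z
      kp[OF hom_obj(2)[OF *(1)] a[OF *(1) z(1)] a[OF *(2) z(1)]] by simp
   qed
   have "kp Y (a f x) = y" using kp[OF hom_obj(2)[OF f] a[OF f x(1)] z(1)] x z by simp
   then show ?thesis using b[OF f x(1)] x by (auto simp: V_def)
  qed
 qed
 show ?thesis
 proof (rule that[OF H])
  show "onobj (mk_sheaf V b) X = kp X ` {x. Q X x x}" if "X \<in> obj T" for X using that by (simp add: V_def)
  show "kp X x = kp X y \<longleftrightarrow> Q X x y" if "X \<in> obj T" "Q X x x" "Q X y y" for X x y by (rule kp[OF that])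
  show "act (mk_sheaf V b) f (kp X x) = kp Y (a f x)" if "f \<in> hom T X Y" "Q X x x" for f X Y x
   using that b[OF that] act_mk_sheaf[OF that(1), of "kp X x" V b] by (simp add: V_def)
 qed
qed

end

section \<open>Sheaves presented by generators and relations\<close>

section \<open>Generators and relations\<close>

text \<open>\<open>Desc f t\<close> denotes the unique element sent to \<open>t\<close> by \<open>f\<close>. Adding it as a formal operation
 yields sheaves at once, without a separate sheafification.\<close>

datatype ('g, 'a) tm = Gen 'g | Act 'a "('g, 'a) tm" | Desc 'a "('g, 'a) tm"

context amalgamation_category
begin

text \<open>A partial equivalence relation whose diagonal says that a term is well formed at an
  object. Beyond functoriality, \<open>cancel\<close> is injectivity of the action, and
  \<open>glue\<close> with \<open>glue_wf\<close> is existence in the descent condition. The gluing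
  rules have one premise for every pair merged by f, so derivations are infinitely
  branching.\<close>

inductive eqv :: "'g set => ('g => 'o) => ('g \<times> 'a \<times> 'g \<times> 'a) set => 'o => ('g, 'a) tm => ('g, 'a) tm => bool"
 for Gs ty Rs where
 gen: "g \<in> Gs ==> ty g \<in> obj T ==> eqv Gs ty Rs (ty g) (Gen g) (Gen g)"
| rel: "(g, f, g', f') \<in> Rs ==> g \<in> Gs ==> g' \<in> Gs ==> f \<in> hom T (ty g) Z ==> f' \<in> hom T (ty g') Z ==>
  eqv Gs ty Rs Z (Act f (Gen g)) (Act f' (Gen g'))"
| sym: "eqv Gs ty Rs X t t' ==> eqv Gs ty Rs X t' t"
| trans: "eqv Gs ty Rs X t t' ==> eqv Gs ty Rs X t' t'' ==> eqv Gs ty Rs X t t''"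
| act: "f \<in> hom T X Y ==> eqv Gs ty Rs X t t' ==> eqv Gs ty Rs Y (Act f t) (Act f t')"
| idn: "eqv Gs ty Rs X t t ==> eqv Gs ty Rs X (Act (idn T X) t) t"
| cmp: "f \<in> hom T X Y ==> g \<in> hom T Y Z ==> eqv Gs ty Rs X t t ==>
  eqv Gs ty Rs Z (Act (g \<odot> f) t) (Act g (Act f t))"
| cancel: "f \<in> hom T X Y ==> eqv Gs ty Rs X t t ==> eqv Gs ty Rs X t' t' ==>
  eqv Gs ty Rs Y (Act f t) (Act f t') ==> eqv Gs ty Rs X t t'"
| glue: "f \<in> hom T X Y ==> eqv Gs ty Rs Y t t ==>
  (\<And>Z g h. g \<in> hom T Y Z ==> h \<in> hom T Y Z ==> g \<odot> f = h \<odot> f ==> eqv Gs ty Rs Z (Act g t) (Act h t)) ==>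
  eqv Gs ty Rs Y (Act f (Desc f t)) t"
| glue_wf: "f \<in> hom T X Y ==> eqv Gs ty Rs Y t t ==>
  (\<And>Z g h. g \<in> hom T Y Z ==> h \<in> hom T Y Z ==> g \<odot> f = h \<odot> f ==> eqv Gs ty Rs Z (Act g t) (Act h t)) ==>
  eqv Gs ty Rs X (Desc f t) (Desc f t)"

lemma eqv_obj: "eqv Gs ty Rs X t t' ==> X \<in> obj T"
 by (induction rule: eqv.induct) (auto dest: hom_obj)

lemma eqv_refl: "eqv Gs ty Rs X t t' ==> eqv Gs ty Rs X t t"
 by (meson eqv.sym eqv.trans)

primrec val :: "('o, 'a, 'u) presheaf => ('g => 'u) => ('g, 'a) tm => 'u" where
 "val M m (Gen g) = m g"
| "val M m (Act f t) = act M f (val M m t)"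
| "val M m (Desc f t) = (THE x. x \<in> onobj M (src T f) \<and> act M f x = val M m t)"

definition model :: "'g set => ('g => 'o) => ('g \<times> 'a \<times> 'g \<times> 'a) set => ('o, 'a, 'u) presheaf => ('g => 'u) => bool" where
 "model Gs ty Rs M m \<longleftrightarrow> (\<forall>g\<in>Gs. m g \<in> onobj M (ty g)) \<and>
   (\<forall>g f g' f'. (g, f, g', f') \<in> Rs --> act M f (m g) = act M f' (m g'))"

text \<open>Each rule mirrors a property of sheaves. In the two gluing cases the induction
  hypotheses are precisely the premises of \<open>E_descent\<close>, and injectivity then makes the
  \<open>THE\<close> in \<open>val\<close> denote.\<close>

lemma val_sound:
 assumes M: "M \<in> obj E" and m: "model Gs ty Rs M m"
 shows "eqv Gs ty Rs X t t' ==> val M m t \<in> onobj M X \<and> val M m t' \<in> onobj M X \<and> val M m t = val M m t'"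
proof (induction rule: eqv.induct)
 case (gen g)
 then show ?case using m by (simp add: model_def)
next
 case (rel g f g' f' Z)
 then have "m g \<in> onobj M (ty g)" "m g' \<in> onobj M (ty g')" "act M f (m g) = act M f' (m g')"
  using m by (auto simp: model_def)
 then show ?case using E_act[OF M rel(4)] E_act[OF M rel(5)] by simp
next
 case (act f X Y t t')
 then show ?case using E_act[OF M act(1)] by simp
next
 case (idn X t)
 then show ?case using E_id[OF M eqv_obj[OF idn(1)]] by simp
next
 case (cmp f X Y g Z t)
 then show ?case using E_cmp[OF M cmp(1,2)] E_act[OF M cmp(1)] E_act[OF M cmp(2)] by simp
next
 case (cancel f X Y t t')
 then show ?case using E_inj[OF M cancel(1)] by simp
next
 case (glue f X Y t)
 obtain x where x: "x \<in> onobj M X" "act M f x = val M m t"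
 proof (rule E_descent[OF M glue(1), of "val M m t"])
  show "val M m t \<in> onobj M Y" using glue.IH(1) by blast
  show "act M g (val M m t) = act M h (val M m t)"
   if "g \<in> hom T Y Z" "h \<in> hom T Y Z" "g \<odot> f = h \<odot> f" for Z g h
   using glue.IH(2)[OF that] by simp
 qed
 have "(THE x. x \<in> onobj M (src T f) \<and> act M f x = val M m t) = x"
  by (rule the_equality) (use x E_inj[OF M glue(1)] homD(2)[OF glue(1)] in auto)
 then show ?case using x glue.IH(1) by simp
next
 case (glue_wf f X Y t)
 obtain x where x: "x \<in> onobj M X" "act M f x = val M m t"
 proof (rule E_descent[OF M glue_wf(1), of "val M m t"])
  show "val M m t \<in> onobj M Y" using glue_wf.IH(1) by blast
  show "act M g (val M m t) = act M h (val M m t)"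
   if "g \<in> hom T Y Z" "h \<in> hom T Y Z" "g \<odot> f = h \<odot> f" for Z g h
   using glue_wf.IH(2)[OF that] by simp
 qed
 have "(THE x. x \<in> onobj M (src T f) \<and> act M f x = val M m t) = x"
  by (rule the_equality) (use x E_inj[OF M glue_wf(1)] homD(2)[OF glue_wf(1)] in auto)
 then show ?case using x by simp
qed auto

text \<open>Local surjectivity of the generators: some further arrow turns the term into an action
  on a generator. It is the source both of the size bound and of uniqueness in
  \<open>ex_presents\<close>.\<close>

definition locally_gen :: "'g set => ('g => 'o) => ('g \<times> 'a \<times> 'g \<times> 'a) set => 'o => ('g, 'a) tm => bool" where
 "locally_gen Gs ty Rs X t \<longleftrightarrow>
   (\<exists>Y f g a. f \<in> hom T X Y \<and> g \<in> Gs \<and> a \<in> hom T (ty g) Y \<and> eqv Gs ty Rs Y (Act f t) (Act a (Gen g)))"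

lemma locally_gen_Act:
 assumes t: "locally_gen Gs ty Rs X t" "eqv Gs ty Rs X t t" and u: "u \<in> hom T X X'"
  and ty: "\<And>g. g \<in> Gs ==> ty g \<in> obj T"
 shows "locally_gen Gs ty Rs X' (Act u t)"
proof -
 obtain Y f g a where f: "f \<in> hom T X Y" and g: "g \<in> Gs" and a: "a \<in> hom T (ty g) Y"
  and eq: "eqv Gs ty Rs Y (Act f t) (Act a (Gen g))" using t unfolding locally_gen_def by blast
 obtain Z w f' where w: "w \<in> hom T Y Z" and f': "f' \<in> hom T X' Z" and wf: "w \<odot> f = f' \<odot> u"
  using amalgamation[OF f u] by blast
 have "eqv Gs ty Rs Z (Act f' (Act u t)) (Act (w \<odot> f) t)"
  unfolding wf by (rule eqv.sym[OF eqv.cmp[OF u f' t(2)]])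
 moreover have "eqv Gs ty Rs Z (Act (w \<odot> f) t) (Act w (Act f t))" by (rule eqv.cmp[OF f w t(2)])
 moreover have "eqv Gs ty Rs Z (Act w (Act f t)) (Act w (Act a (Gen g)))" by (rule eqv.act[OF w eq])
 moreover have "eqv Gs ty Rs Z (Act w (Act a (Gen g))) (Act (w \<odot> a) (Gen g))"
  by (rule eqv.sym[OF eqv.cmp[OF a w eqv.gen[where ty = ty, OF g ty[OF g]]]])
 ultimately have "eqv Gs ty Rs Z (Act f' (Act u t)) (Act (w \<odot> a) (Gen g))" by (meson eqv.trans)
 then show ?thesis unfolding locally_gen_def using f' g cmp_hom[OF a w] by blast
qed

lemma eqv_locally_gen:
 assumes ty: "\<And>g. g \<in> Gs ==> ty g \<in> obj T"
 shows "eqv Gs ty Rs X t t' ==> locally_gen Gs ty Rs X t \<and> locally_gen Gs ty Rs X t'"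
proof (induction rule: eqv.induct)
 have Gen: "locally_gen Gs ty Rs (ty g) (Gen g)" if "g \<in> Gs" for g
  unfolding locally_gen_def
  using idn_hom[OF ty[OF that]] that eqv.act[OF idn_hom[OF ty[OF that]] eqv.gen[where ty = ty, OF that ty[OF that]]] by blast
 {
  case (gen g) then show ?case using Gen by blast
 next
  case (rel g f g' f' Z)
  then show ?case using locally_gen_Act[OF Gen eqv.gen _ ty] ty by meson
 next
  case (act f X Y t t')
  then show ?case
   using locally_gen_Act[OF _ eqv_refl[OF act(2)] act(1) ty]
    locally_gen_Act[OF _ eqv_refl[OF eqv.sym[OF act(2)]] act(1) ty] by blast
 next
  case (idn X t)
  then show ?case using locally_gen_Act[OF _ idn(1) idn_hom[OF eqv_obj[OF idn(1)]] ty] by blast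
 next
  case (cmp f X Y g Z t)
  have f: "locally_gen Gs ty Rs Y (Act f t)" using locally_gen_Act[OF _ cmp(3,1) ty] cmp by blast
  show ?case
   using locally_gen_Act[OF _ cmp(3) cmp_hom[OF cmp(1,2)] ty] cmp
    locally_gen_Act[OF f eqv.act[OF cmp(1,3)] cmp(2) ty] by blast
 next
  case (glue f X Y t)
  then obtain Z h g a where h: "h \<in> hom T Y Z" "g \<in> Gs" "a \<in> hom T (ty g) Z"
   and eq: "eqv Gs ty Rs Z (Act h t) (Act a (Gen g))" unfolding locally_gen_def by blast
  have "eqv Gs ty Rs Z (Act h (Act f (Desc f t))) (Act h t)"
   by (rule eqv.act[OF h(1) eqv.glue[OF glue(1,2)]]) (use glue in blast)
  then have "locally_gen Gs ty Rs Y (Act f (Desc f t))"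
   unfolding locally_gen_def using h eqv.trans[OF _ eq] by blast
  then show ?case using glue by blast
 next
  case (glue_wf f X Y t)
  then obtain Z h g a where h: "h \<in> hom T Y Z" "g \<in> Gs" "a \<in> hom T (ty g) Z"
   and eq: "eqv Gs ty Rs Z (Act h t) (Act a (Gen g))" unfolding locally_gen_def by blast
  have wf: "eqv Gs ty Rs X (Desc f t) (Desc f t)" by (rule eqv.glue_wf[OF glue_wf(1,2)]) (use glue_wf in blast)
  have "eqv Gs ty Rs Z (Act h (Act f (Desc f t))) (Act h t)"
   by (rule eqv.act[OF h(1) eqv.glue[OF glue_wf(1,2)]]) (use glue_wf in blast)
  \<comment> \<open>Since \<open>Act f (Desc f t)\<close> equals t, a witness h for t becomes one
    for \<open>Desc f t\<close> after composition with f.\<close>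
  then have "eqv Gs ty Rs Z (Act (h \<odot> f) (Desc f t)) (Act a (Gen g))"
   using eqv.cmp[OF glue_wf(1) h(1) wf] eq by (meson eqv.trans)
  then have "locally_gen Gs ty Rs X (Desc f t)"
   unfolding locally_gen_def using h cmp_hom[OF glue_wf(1) h(1)] by blast
  then show ?case by blast
 }
qed auto

text \<open>The universal model: H represents the functor that sends a sheaf to its models of the
  relations.\<close>

definition presents :: "('o, 'a, 'u) presheaf => ('g => 'u) => 'g set => ('g => 'o) => ('g \<times> 'a \<times> 'g \<times> 'a) set => bool" where
 "presents H q Gs ty Rs \<longleftrightarrow> H \<in> obj E \<and> model Gs ty Rs H q \<and>
   (\<forall>M m. M \<in> obj E \<and> model Gs ty Rs M m --> (\<exists>!k. k \<in> hom E H M \<and> (\<forall>g\<in>Gs. cm k (ty g) (q g) = m g)))"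

definition well_typed :: "'g set => ('g => 'o) => ('g \<times> 'a \<times> 'g \<times> 'a) set => bool" where
 "well_typed Gs ty Rs \<longleftrightarrow> (\<forall>g\<in>Gs. ty g \<in> obj T) \<and>
   (\<forall>g f g' f'. (g, f, g', f') \<in> Rs --> g \<in> Gs \<and> g' \<in> Gs \<and> (\<exists>Z. f \<in> hom T (ty g) Z \<and> f' \<in> hom T (ty g') Z))"

lemma presents_ex:
 assumes "presents H q Gs ty Rs" "M \<in> obj E" "model Gs ty Rs M m"
 obtains k where "k \<in> hom E H M" "\<And>g. g \<in> Gs ==> cm k (ty g) (q g) = m g"
proof -
 have "\<exists>!k. k \<in> hom E H M \<and> (\<forall>g\<in>Gs. cm k (ty g) (q g) = m g)"
  using assms unfolding presents_def by blast
 then show thesis using that by blast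
qed

lemma model_hom:
 assumes wt: "well_typed Gs ty Rs" and m: "model Gs ty Rs H q" and k: "k \<in> hom E H M"
 shows "model Gs ty Rs M (\<lambda>g. cm k (ty g) (q g))"
 unfolding model_def
proof (intro conjI ballI allI impI)
 show "cm k (ty g) (q g) \<in> onobj M (ty g)" if "g \<in> Gs" for g
  using cm_in[OF k] wt m that by (auto simp: well_typed_def model_def)
 fix g f g' f' assume R: "(g, f, g', f') \<in> Rs"
 then obtain Z where Z: "g \<in> Gs" "g' \<in> Gs" "f \<in> hom T (ty g) Z" "f' \<in> hom T (ty g') Z"
  using wt by (auto simp: well_typed_def) blast
 have "q g \<in> onobj H (ty g)" "q g' \<in> onobj H (ty g')" "act H f (q g) = act H f' (q g')"
  using m R Z by (auto simp: model_def)
 then show "act M f (cm k (ty g) (q g)) = act M f' (cm k (ty g') (q g'))"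
  using cm_nat[OF k Z(3)] cm_nat[OF k Z(4)] by metis
qed

lemma presents_unique:
 assumes "presents H q Gs ty Rs" "well_typed Gs ty Rs" "k \<in> hom E H M" "k' \<in> hom E H M"
  "\<And>g. g \<in> Gs ==> cm k (ty g) (q g) = cm k' (ty g) (q g)"
 shows "k = k'"
proof -
 have "model Gs ty Rs H q" using assms(1) by (simp add: presents_def)
 then have "model Gs ty Rs M (\<lambda>g. cm k (ty g) (q g))" using model_hom assms by blast
 then have "\<exists>!l. l \<in> hom E H M \<and> (\<forall>g\<in>Gs. cm l (ty g) (q g) = cm k (ty g) (q g))"
  using assms(1) E_hom_obj(2)[OF assms(3)] unfolding presents_def by blast
 then show ?thesis using assms(3-5) by metis
qed

end

text \<open>Essential smallness: S is a small set of representatives, and \<open>\<phi>\<close>,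
  \<open>\<psi>\<close> are chosen inverse isomorphisms between an object and its representative.
  Representatives represent themselves by identities; this makes one of the two composites in the
  later equivalence an identity on the nose.\<close>

locale site = amalgamation_category U T
 for U :: "'u itself" and T :: "('o, 'a) cat" +
 fixes S :: "'o set" and r :: "'o => 'o" and \<phi> \<psi> :: "'o => 'a"
 assumes S_obj: "X \<in> S ==> X \<in> obj T" and small_S: "small U S"
  and small_hom: "X \<in> obj T ==> Y \<in> obj T ==> small U (hom T X Y)"
  and r: "X \<in> obj T ==> r X \<in> S"
  and \<phi>: "X \<in> obj T ==> \<phi> X \<in> hom T X (r X)" and \<psi>: "X \<in> obj T ==> \<psi> X \<in> hom T (r X) X"
  and \<psi>\<phi>: "X \<in> obj T ==> \<psi> X \<odot> \<phi> X = idn T X" and \<phi>\<psi>: "X \<in> obj T ==> \<phi> X \<odot> \<psi> X = idn T (r X)"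
  and r_S: "X \<in> S ==> r X = X" and \<phi>_S: "X \<in> S ==> \<phi> X = idn T X"
begin

text \<open>The sheaf consists of the well-formed terms modulo \<open>eqv\<close>, whose rules are
  the hypotheses of \<open>quotient_sheaf\<close>. Terms contain arrows between arbitrary objects,
  so the point is to see that there are few classes; \<open>locally_gen\<close> and
  \<open>cancel\<close> bring everything back to arrows into S.\<close>

lemma ex_presents:
 fixes Gs :: "'g set"
 assumes sm: "small U Gs" and wt: "well_typed Gs ty Rs"
 obtains H q where "presents H q Gs ty Rs"
proof -
 have ty: "ty g \<in> obj T" if "g \<in> Gs" for g using wt that by (simp add: well_typed_def)
 \<comment> \<open>A key n = (f, g, a) for t, with the target of f and a in S. By
   \<open>cancel\<close>, terms with a common key are equivalent.\<close>
 define P where "P X t n \<longleftrightarrow> (\<exists>Y\<in>S. fst n \<in> hom T X Y \<and> fst (snd n) \<in> Gs \<and> snd (snd n) \<in> hom T (ty (fst (snd n))) Y \<and>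
  eqv Gs ty Rs Y (Act (fst n) t) (Act (snd (snd n)) (Gen (fst (snd n)))))" for X t n
 define N where "N X t = (SOME n. P X t n)" for X t
 have N: "P X t (N X t)" if t: "eqv Gs ty Rs X t t" for X t
 proof -
  obtain Y f g a where f: "f \<in> hom T X Y" and g: "g \<in> Gs" and a: "a \<in> hom T (ty g) Y"
   and eq: "eqv Gs ty Rs Y (Act f t) (Act a (Gen g))"
   using eqv_locally_gen[OF ty t] unfolding locally_gen_def by blast
  note p = \<phi>[OF hom_obj(2)[OF f]]
  have "eqv Gs ty Rs (r Y) (Act (\<phi> Y \<odot> f) t) (Act (\<phi> Y \<odot> a) (Gen g))"
   using eqv.cmp[OF f p t] eqv.act[OF p eq] eqv.sym[OF eqv.cmp[OF a p eqv.gen[where ty = ty, OF g ty[OF g]]]]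
   by (meson eqv.trans)
  then have "P X t (\<phi> Y \<odot> f, g, \<phi> Y \<odot> a)"
   unfolding P_def using r[OF hom_obj(2)[OF f]] cmp_hom[OF f p] cmp_hom[OF a p] g by auto
  then show ?thesis unfolding N_def by (rule someI)
 qed
 obtain H kp where H: "H \<in> obj E" and el: "\<And>X. X \<in> obj T ==> onobj H X = kp X ` {x. eqv Gs ty Rs X x x}"
  and kp: "\<And>X x y. X \<in> obj T ==> eqv Gs ty Rs X x x ==> eqv Gs ty Rs X y y ==> kp X x = kp X y \<longleftrightarrow> eqv Gs ty Rs X x y"
  and act: "\<And>f X Y x. f \<in> hom T X Y ==> eqv Gs ty Rs X x x ==> act H f (kp X x) = kp Y (Act f x)"
 proof (rule quotient_sheaf[of "eqv Gs ty Rs" Act N])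
  show "eqv Gs ty Rs X x y ==> eqv Gs ty Rs X y x" for X x y by (rule eqv.sym)
  show "eqv Gs ty Rs X x y ==> eqv Gs ty Rs X y z ==> eqv Gs ty Rs X x z" for X x y z by (rule eqv.trans)
  show "f \<in> hom T X Y ==> eqv Gs ty Rs X x y ==> eqv Gs ty Rs Y (Act f x) (Act f y)" for f X Y x y
   by (rule eqv.act)
  show "eqv Gs ty Rs X x x ==> eqv Gs ty Rs X (Act (idn T X) x) x" for X x by (rule eqv.idn)
  show "f \<in> hom T X Y ==> g \<in> hom T Y Z ==> eqv Gs ty Rs X x x ==>
    eqv Gs ty Rs Z (Act (g \<odot> f) x) (Act g (Act f x))" for f g X Y Z x by (rule eqv.cmp)
  show "f \<in> hom T X Y ==> eqv Gs ty Rs X x x ==> eqv Gs ty Rs X y y ==>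
    eqv Gs ty Rs Y (Act f x) (Act f y) ==> eqv Gs ty Rs X x y" for f X Y x y by (rule eqv.cancel)
  show "\<exists>x. eqv Gs ty Rs X x x \<and> eqv Gs ty Rs Y (Act f x) y"
   if "f \<in> hom T X Y" "eqv Gs ty Rs Y y y"
    "\<And>Z g h. g \<in> hom T Y Z ==> h \<in> hom T Y Z ==> g \<odot> f = h \<odot> f ==> eqv Gs ty Rs Z (Act g y) (Act h y)" for f X Y y
   using eqv.glue[OF that] eqv.glue_wf[OF that] by blast
  show "small U (N X ` {x. eqv Gs ty Rs X x x})" if X: "X \<in> obj T" for X
  proof (rule small_subset)
   show "small U ((\<Union>Y\<in>S. hom T X Y) \<times> (Gs \<times> (\<Union>g\<in>Gs. \<Union>Y\<in>S. hom T (ty g) Y)))"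
    by (intro small_Times small_UN small_S sm small_hom X ty S_obj)
   have "n \<in> (\<Union>Y\<in>S. hom T X Y) \<times> (Gs \<times> (\<Union>g\<in>Gs. \<Union>Y\<in>S. hom T (ty g) Y))" if "P X t n" for t n
    using that unfolding P_def by (cases n) auto
   then show "N X ` {x. eqv Gs ty Rs X x x} \<subseteq> (\<Union>Y\<in>S. hom T X Y) \<times> (Gs \<times> (\<Union>g\<in>Gs. \<Union>Y\<in>S. hom T (ty g) Y))"
    using N by blast
  qed
  show "eqv Gs ty Rs X x y" if xy: "eqv Gs ty Rs X x x" "eqv Gs ty Rs X y y" "N X x = N X y" for X x y
  proof -
   obtain f g a where n: "N X x = (f, g, a)" by (cases "N X x")
   obtain Y where Y: "f \<in> hom T X Y" "eqv Gs ty Rs Y (Act f x) (Act a (Gen g))"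
    using N[OF xy(1)] n unfolding P_def by auto
   obtain Y' where Y': "f \<in> hom T X Y'" "eqv Gs ty Rs Y' (Act f y) (Act a (Gen g))"
    using N[OF xy(2)] unfolding xy(3)[symmetric] n P_def by auto
   have "Y' = Y" using Y(1) Y'(1) by (simp add: hom_def)
   then show ?thesis using eqv.cancel[OF Y(1) xy(1,2)] Y(2) Y'(2) by (meson eqv.sym eqv.trans)
  qed
 qed auto
 define q where "q g = kp (ty g) (Gen g)" for g
 have gen: "eqv Gs ty Rs (ty g) (Gen g) (Gen g)" if "g \<in> Gs" for g using eqv.gen[where ty = ty, OF that ty[OF that]] .
 have qm: "model Gs ty Rs H q"
  unfolding model_def
 proof (intro conjI ballI allI impI)
  show "q g \<in> onobj H (ty g)" if "g \<in> Gs" for g using el[OF ty[OF that]] gen[OF that] by (auto simp: q_def)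
  fix g f g' f' assume R: "(g, f, g', f') \<in> Rs"
  then obtain Z where Z: "g \<in> Gs" "g' \<in> Gs" "f \<in> hom T (ty g) Z" "f' \<in> hom T (ty g') Z"
   using wt by (auto simp: well_typed_def) blast
  have e: "eqv Gs ty Rs Z (Act f (Gen g)) (Act f' (Gen g'))" by (rule eqv.rel[OF R Z])
  show "act H f (q g) = act H f' (q g')"
   using act[OF Z(3) gen[OF Z(1)]] act[OF Z(4) gen[OF Z(2)]]
    kp[OF eqv_obj[OF e] eqv_refl[OF e] eqv_refl[OF eqv.sym[OF e]]] e by (simp add: q_def)
 qed
 have "presents H q Gs ty Rs"
  unfolding presents_def
 proof (intro conjI allI impI H qm)
  fix M m assume "M \<in> obj E \<and> model Gs ty Rs M m"
  then have M: "M \<in> obj E" and m: "model Gs ty Rs M m" by auto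
  define c where "c X u = val M m (SOME t. eqv Gs ty Rs X t t \<and> kp X t = u)" for X u
  have c: "c X (kp X t) = val M m t" if t: "eqv Gs ty Rs X t t" for X t
  proof -
   let ?t = "SOME t'. eqv Gs ty Rs X t' t' \<and> kp X t' = kp X t"
   have t': "eqv Gs ty Rs X ?t ?t \<and> kp X ?t = kp X t" by (rule someI[of _ t]) (use t in auto)
   then have "eqv Gs ty Rs X ?t t" using kp[OF eqv_obj[OF t], of ?t t] t by simp
   then show ?thesis using val_sound[OF M m] unfolding c_def by blast
  qed
  have k: "mk_hom H c M \<in> hom E H M"
  proof (rule mk_hom[OF H M])
   fix X u assume X: "X \<in> obj T" and u: "u \<in> onobj H X"
   then obtain t where t: "eqv Gs ty Rs X t t" "u = kp X t" using el[OF X] by auto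
   show "c X u \<in> onobj M X" using c[OF t(1)] val_sound[OF M m t(1)] t(2) by simp
  next
   fix f X Y u assume f: "f \<in> hom T X Y" and u: "u \<in> onobj H X"
   then obtain t where t: "eqv Gs ty Rs X t t" "u = kp X t" using el[OF hom_obj(1)[OF f]] by auto
   show "c Y (act H f u) = act M f (c X u)"
    using act[OF f t(1)] c[OF t(1)] c[OF eqv.act[OF f t(1)]] t(2) by simp
  qed
  have kg: "cm (mk_hom H c M) (ty g) (q g) = m g" if "g \<in> Gs" for g
  proof -
   have "q g \<in> onobj H (ty g)" using qm that by (simp add: model_def)
   then show ?thesis using c[OF gen[OF that]] ty[OF that] by (simp add: q_def)
  qed
  moreover have "l = mk_hom H c M" if l: "l \<in> hom E H M" and lg: "\<forall>g\<in>Gs. cm l (ty g) (q g) = m g" for l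
  proof (rule E_ext[OF l k])
   fix X u assume X: "X \<in> obj T" and u: "u \<in> onobj H X"
   then obtain t where t: "eqv Gs ty Rs X t t" "u = kp X t" using el[OF X] by auto
   \<comment> \<open>Uniqueness: after f the element is an action on a generator, where both maps
     agree, and injectivity of \<open>act M f\<close> removes f again.\<close>
   obtain Y f g a where f: "f \<in> hom T X Y" and g: "g \<in> Gs" and a: "a \<in> hom T (ty g) Y"
    and eq: "eqv Gs ty Rs Y (Act f t) (Act a (Gen g))"
    using eqv_locally_gen[OF ty t(1)] unfolding locally_gen_def by blast
   have eq': "act H f u = act H a (q g)"
    using act[OF f t(1)] act[OF a gen[OF g]] kp[OF hom_obj(2)[OF f] eqv_refl[OF eq] eqv_refl[OF eqv.sym[OF eq]]] eq
    by (simp add: t(2) q_def)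
   have qg: "q g \<in> onobj H (ty g)" using qm g by (simp add: model_def)
   have "act M f (cm l X u) = act M f (cm (mk_hom H c M) X u)"
    using cm_nat[OF l f u] cm_nat[OF k f u] eq' cm_nat[OF l a qg] cm_nat[OF k a qg] kg[OF g] lg g by metis
   then show "cm l X u = cm (mk_hom H c M) X u"
    by (rule E_inj[OF M f cm_in[OF l X u] cm_in[OF k X u]])
  qed
  ultimately show "\<exists>!k. k \<in> hom E H M \<and> (\<forall>g\<in>Gs. cm k (ty g) (q g) = m g)"
   using k by blast
 qed
 then show ?thesis by (rule that)
qed

definition elts :: "('o, 'a, 'u) presheaf => ('o \<times> 'u) set" where
 "elts F = Sigma S (onobj F)"

text \<open>The canonical presentation of F: its elements over the skeleton, and every coincidence
  between two of them after arrows into S.\<close>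

definition rels :: "('o, 'a, 'u) presheaf => (('o \<times> 'u) \<times> 'a \<times> ('o \<times> 'u) \<times> 'a) set" where
 "rels F = {(g, f, g', f'). g \<in> elts F \<and> g' \<in> elts F \<and>
   (\<exists>Z\<in>S. f \<in> hom T (fst g) Z \<and> f' \<in> hom T (fst g') Z) \<and> act F f (snd g) = act F f' (snd g')}"

lemma well_typed_self: "well_typed (elts F) fst (rels F)"
 unfolding well_typed_def by (auto simp: elts_def rels_def S_obj)

lemma small_elts: "F \<in> obj E ==> small U (elts F)"
 unfolding elts_def by (intro small_Sigma small_S E_small S_obj)

lemma small_rels:
 assumes "F \<in> obj E" shows "small U (rels F)"
proof (rule small_subset)
 let ?A = "\<Union>g\<in>elts F. \<Union>Z\<in>S. hom T (fst g) Z"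
 have "small U ?A"
  by (intro small_UN small_elts assms small_S small_hom S_obj) (auto simp: elts_def)
 then show "small U (elts F \<times> ?A \<times> elts F \<times> ?A)" by (intro small_Times small_elts assms)
 show "rels F \<subseteq> elts F \<times> ?A \<times> elts F \<times> ?A" by (auto simp: rels_def)
qed

lemma act_\<psi>\<phi>: "F \<in> obj E ==> X \<in> obj T ==> x \<in> onobj F X ==> act F (\<psi> X) (act F (\<phi> X) x) = x"
 using E_cmp[OF _ \<phi> \<psi>] \<psi>\<phi> E_id by metis

lemma E_ext_S:
 assumes "m \<in> hom E F G" "m' \<in> hom E F G" "\<And>X x. X \<in> S ==> x \<in> onobj F X ==> cm m X x = cm m' X x"
 shows "m = m'"
proof (rule E_ext[OF assms(1,2)])
 fix X x assume X: "X \<in> obj T" and x: "x \<in> onobj F X"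
 note F = E_hom_obj(1)[OF assms(1)]
 have y: "act F (\<phi> X) x \<in> onobj F (r X)" using E_act[OF F \<phi>[OF X] x] .
 have "cm n X x = act G (\<psi> X) (cm n (r X) (act F (\<phi> X) x))" if "n \<in> hom E F G" for n
  using cm_nat[OF that \<psi>[OF X] y] act_\<psi>\<phi>[OF F X x] by simp
 then show "cm m X x = cm m' X x" using assms r[OF X] y by metis
qed

text \<open>A model is given over S only; transport along \<open>\<phi>\<close> and
  \<open>\<psi>\<close> extends it to all objects. Naturality for f amounts to the recorded relation
  between the conjugate of f by these isomorphisms and an identity.\<close>

lemma presents_self:
 assumes F: "F \<in> obj E"
 shows "presents F snd (elts F) fst (rels F)"
 unfolding presents_def
proof (intro conjI allI impI F)
 show "model (elts F) fst (rels F) F snd" by (auto simp: model_def elts_def rels_def)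
 fix M m assume "M \<in> obj E \<and> model (elts F) fst (rels F) M m"
 then have M: "M \<in> obj E" and m: "model (elts F) fst (rels F) M m" by auto
 define c where "c X x = act M (\<psi> X) (m (r X, act F (\<phi> X) x))" for X x
 have el: "(r X, act F (\<phi> X) x) \<in> elts F" if "X \<in> obj T" "x \<in> onobj F X" for X x
  using that r E_act[OF F \<phi>] by (simp add: elts_def)
 have mr: "m (r X, act F (\<phi> X) x) \<in> onobj M (r X)" if "X \<in> obj T" "x \<in> onobj F X" for X x
  using m el[OF that] by (fastforce simp: model_def)
 have k: "mk_hom F c M \<in> hom E F M"
 proof (rule mk_hom[OF F M])
  show "c X x \<in> onobj M X" if "X \<in> obj T" "x \<in> onobj F X" for X x
   unfolding c_def by (rule E_act[OF M \<psi>[OF that(1)] mr[OF that]])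
  fix f X Y x assume f: "f \<in> hom T X Y" and x: "x \<in> onobj F X"
  note X = hom_obj(1)[OF f] and Y = hom_obj(2)[OF f]
  let ?f = "\<phi> Y \<odot> (f \<odot> \<psi> X)"
  note f1 = cmp_hom[OF \<psi>[OF X] f]
  note f' = cmp_hom[OF f1 \<phi>[OF Y]]
  have fx: "act F f x \<in> onobj F Y" using E_act[OF F f x] .
  have y: "act F (\<phi> X) x \<in> onobj F (r X)" using E_act[OF F \<phi>[OF X] x] .
  have "act F ?f (act F (\<phi> X) x) = act F (\<phi> Y) (act F f x)"
   using E_cmp[OF F f1 \<phi>[OF Y] y] E_cmp[OF F \<psi>[OF X] f y] act_\<psi>\<phi>[OF F X x] by simp
  then have "((r X, act F (\<phi> X) x), ?f, (r Y, act F (\<phi> Y) (act F f x)), idn T (r Y)) \<in> rels F"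
   using el[OF X x] el[OF Y fx] f' r[OF Y] idn_hom[OF S_obj[OF r[OF Y]]]
    E_id[OF F S_obj[OF r[OF Y]] E_act[OF F \<phi>[OF Y] fx]]
   by (auto simp: rels_def)
  then have "act M ?f (m (r X, act F (\<phi> X) x)) = m (r Y, act F (\<phi> Y) (act F f x))"
   using m E_id[OF M S_obj[OF r[OF Y]] mr[OF Y fx]] by (simp add: model_def)
  moreover have "act M (\<psi> Y) (act M ?f (m (r X, act F (\<phi> X) x))) = act M f (c X x)"
  proof -
   have "\<psi> Y \<odot> ?f = f \<odot> \<psi> X"
    using assoc[OF f1 \<phi>[OF Y] \<psi>[OF Y]] \<psi>\<phi>[OF Y] cmp_idn_left[OF f1] by simp
   then show ?thesis
    unfolding c_def using E_cmp[OF M f' \<psi>[OF Y] mr[OF X x]] E_cmp[OF M \<psi>[OF X] f mr[OF X x]] by simp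
  qed
  ultimately show "c Y (act F f x) = act M f (c X x)" by (simp add: c_def)
 qed
 have \<psi>_S: "\<psi> X = idn T X" if "X \<in> S" for X
  using \<phi>\<psi>[OF S_obj[OF that]] \<phi>_S[OF that] r_S[OF that] cmp_idn_left[OF \<psi>[OF S_obj[OF that]]] by simp
 have kg: "cm (mk_hom F c M) X x = m (X, x)" if "X \<in> S" "x \<in> onobj F X" for X x
  using mr[OF S_obj[OF that(1)] that(2)] that E_id[OF F S_obj that(2)] E_id[OF M S_obj]
  by (simp add: c_def r_S \<phi>_S \<psi>_S S_obj)
 show "\<exists>!k. k \<in> hom E F M \<and> (\<forall>g\<in>elts F. cm k (fst g) (snd g) = m g)"
 proof (rule ex1I[of _ "mk_hom F c M"])
  show "mk_hom F c M \<in> hom E F M \<and> (\<forall>g\<in>elts F. cm (mk_hom F c M) (fst g) (snd g) = m g)"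
   using k kg by (auto simp: elts_def)
  fix l assume l: "l \<in> hom E F M \<and> (\<forall>g\<in>elts F. cm l (fst g) (snd g) = m g)"
  show "l = mk_hom F c M" by (rule E_ext_S[of l F M]) (use l k kg in \<open>auto simp: elts_def\<close>)
 qed
qed

lemma locally_small_E: "locally_small U E"
 unfolding locally_small_def
proof (intro ballI)
 fix F G assume F: "F \<in> obj E" and G: "G \<in> obj E"
 show "small U (hom E F G)"
 proof (rule small_graph[OF small_elts[OF F], of "\<Union>X\<in>S. onobj G X" _ "\<lambda>m g. cm m (fst g) (snd g)"])
  show "small U (\<Union>X\<in>S. onobj G X)" by (intro small_UN small_S E_small G S_obj)
  show "cm m (fst g) (snd g) \<in> (\<Union>X\<in>S. onobj G X)" if mg: "m \<in> hom E F G" "g \<in> elts F" for m g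
  proof -
   obtain X x where "g = (X, x)" "X \<in> S" "x \<in> onobj F X" using mg(2) by (auto simp: elts_def)
   then show ?thesis using cm_in[OF mg(1) S_obj] by auto
  qed
  show "m = m'" if "m \<in> hom E F G" "m' \<in> hom E F G"
   "\<And>g. g \<in> elts F ==> cm m (fst g) (snd g) = cm m' (fst g) (snd g)" for m m'
   by (rule E_ext_S[OF that(1,2)]) (use that(3) in \<open>force simp: elts_def\<close>)
 qed
qed

text \<open>The colimit is presented by all canonical presentations side by side
  (\<open>R1\<close>), with each element identified with its images under the transition maps
  (\<open>R2\<close>). Its models are exactly the cocones.\<close>

lemma cocomplete_E: "cocomplete U E"
 unfolding cocomplete_def
proof (intro allI impI)
 fix J :: "('u, 'u) cat" and G assume "small_category U J \<and> is_functor J E G"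
 then have J: "category J" and sJ: "small U (obj J)" and G: "is_functor J E G"
  by (auto simp: small_category_def)
 interpret J: category J by fact
 have Gj: "onobj G j \<in> obj E" if "j \<in> obj J" for j using is_functorD(1)[OF G that] .
 have Gu: "onarr G u \<in> hom E (onobj G j) (onobj G k)" if "u \<in> hom J j k" for u j k
  using is_functorD(2)[OF G that] .
 define Gs where "Gs = Sigma (obj J) (\<lambda>j. elts (onobj G j))"
 define ty :: "'u \<times> 'o \<times> 'u => 'o" where "ty = (\<lambda>(j, X, x). X)"
 define R1 where "R1 = {((j, g), f, (j, g'), f') |j g f g' f'. j \<in> obj J \<and> (g, f, g', f') \<in> rels (onobj G j)}"
 define R2 where "R2 = {((j, X, x), idn T X, (k, X, cm (onarr G u) X x), idn T X) |j k u X x.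
   u \<in> hom J j k \<and> X \<in> S \<and> x \<in> onobj (onobj G j) X}"
 have "small U Gs" unfolding Gs_def by (intro small_Sigma sJ small_elts Gj)
 moreover have wt: "well_typed Gs ty (R1 \<union> R2)"
  unfolding well_typed_def
 proof (intro conjI allI impI ballI)
  show "ty g \<in> obj T" if "g \<in> Gs" for g using that by (auto simp: Gs_def elts_def ty_def S_obj)
  fix g f g' f' assume "(g, f, g', f') \<in> R1 \<union> R2"
  then show "g \<in> Gs" "g' \<in> Gs" "\<exists>Z. f \<in> hom T (ty g) Z \<and> f' \<in> hom T (ty g') Z"
   using cm_in[OF Gu] J.hom_obj idn_hom S_obj
   by (fastforce simp: R1_def R2_def Gs_def ty_def rels_def elts_def)+
 qed
 ultimately obtain H q where H: "presents H q Gs ty (R1 \<union> R2)" by (rule ex_presents)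
 have HE: "H \<in> obj E" and qm: "model Gs ty (R1 \<union> R2) H q" using H by (auto simp: presents_def)
 have mj: "model (elts (onobj G j)) fst (rels (onobj G j)) M (\<lambda>g. m (j, g))"
  if "model Gs ty (R1 \<union> R2) M m" "j \<in> obj J" for M m j
  using that unfolding model_def by (fastforce simp: Gs_def R1_def ty_def)
 have "\<exists>p. p \<in> hom E (onobj G j) H \<and> (\<forall>g\<in>elts (onobj G j). cm p (fst g) (snd g) = q (j, g))"
  if j: "j \<in> obj J" for j
  using presents_self[OF Gj[OF j]] HE mj[OF qm j] unfolding presents_def by blast
 then obtain p where p: "\<And>j. j \<in> obj J ==> p j \<in> hom E (onobj G j) H"
  and pq: "\<And>j X x. j \<in> obj J ==> X \<in> S ==> x \<in> onobj (onobj G j) X ==> cm (p j) X x = q (j, X, x)"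
  unfolding elts_def by (metis (no_types, lifting) SigmaI fst_conv snd_conv)
 have "is_colimit J E G H p"
  unfolding is_colimit_def
 proof (intro conjI allI impI)
  show "is_cocone J E G H p"
   unfolding is_cocone_def
  proof (intro conjI ballI HE p)
   fix u assume "u \<in> arr J"
   then obtain j k where u: "u \<in> hom J j k" by (blast intro: arr_hom)
   note jk = J.hom_obj[OF u]
   have "cmp E (p k) (onarr G u) = p j"
   proof (rule E_ext_S[OF E_cmp_hom[OF Gu[OF u] p[OF jk(2)]] p[OF jk(1)]])
    fix X x assume X: "X \<in> S" and x: "x \<in> onobj (onobj G j) X"
    have ux: "cm (onarr G u) X x \<in> onobj (onobj G k) X" using cm_in[OF Gu[OF u] S_obj[OF X] x] .
    have "act H (idn T X) (q (j, X, x)) = act H (idn T X) (q (k, X, cm (onarr G u) X x))"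
    proof -
     have "((j, X, x), idn T X, (k, X, cm (onarr G u) X x), idn T X) \<in> R1 \<union> R2"
      using u X x unfolding R2_def by blast
     then show ?thesis using qm unfolding model_def by blast
    qed
    moreover have "q (j, X, x) \<in> onobj H X" "q (k, X, cm (onarr G u) X x) \<in> onobj H X"
     using qm X x ux jk unfolding model_def by (auto simp: Gs_def elts_def ty_def split: prod.splits)
    ultimately have "q (j, X, x) = q (k, X, cm (onarr G u) X x)"
     using E_id[OF HE S_obj[OF X]] by metis
    then show "cm (cmp E (p k) (onarr G u)) X x = cm (p j) X x"
     using cm_cmp[OF Gu[OF u] p[OF jk(2)] S_obj[OF X] x] pq[OF jk(1) X x] pq[OF jk(2) X ux] by simp
   qed
   then show "cmp E (p (tgt J u)) (onarr G u) = p (src J u)" using homD[OF u] by simp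
  qed
  fix M q' assume q': "is_cocone J E G M q'"
  have M: "M \<in> obj E" and q'j: "\<And>j. j \<in> obj J ==> q' j \<in> hom E (onobj G j) M"
   and q'u: "\<And>u j k. u \<in> hom J j k ==> cmp E (q' k) (onarr G u) = q' j"
   using q' unfolding is_cocone_def by (auto simp: hom_def)
  define m where "m = (\<lambda>(j, X, x). cm (q' j) X x)"
  have "model Gs ty (R1 \<union> R2) M m"
   unfolding model_def
  proof (intro conjI ballI allI impI)
   show "m g \<in> onobj M (ty g)" if "g \<in> Gs" for g
    using that cm_in[OF q'j S_obj] by (auto simp: Gs_def elts_def ty_def m_def)
   fix g f g' f' assume "(g, f, g', f') \<in> R1 \<union> R2"
   then consider j X x X' x' where "g = (j, X, x)" "g' = (j, X', x')" "j \<in> obj J" "((X, x), f, (X', x'), f') \<in> rels (onobj G j)"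
    | j k u X x where "u \<in> hom J j k" "X \<in> S" "x \<in> onobj (onobj G j) X" "g = (j, X, x)"
     "g' = (k, X, cm (onarr G u) X x)" "f = f'"
    unfolding R1_def R2_def by fast
   then show "act M f (m g) = act M f' (m g')"
   proof cases
    case 1
    then obtain Z where Z: "f \<in> hom T X Z" "f' \<in> hom T X' Z" "x \<in> onobj (onobj G j) X" "x' \<in> onobj (onobj G j) X'"
     "act (onobj G j) f x = act (onobj G j) f' x'" by (auto simp: rels_def elts_def)
    then show ?thesis
     using cm_nat[OF q'j[OF 1(3)] Z(1,3)] cm_nat[OF q'j[OF 1(3)] Z(2,4)] 1 by (simp add: m_def)
   next
    case 2
    have "cm (q' k) X (cm (onarr G u) X x) = cm (q' j) X x"
     using cm_cmp[OF Gu[OF 2(1)] q'j[OF J.hom_obj(2)[OF 2(1)]] S_obj[OF 2(2)] 2(3)] q'u[OF 2(1)] by simp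
    then show ?thesis using 2 by (simp add: m_def)
   qed
  qed
  from presents_ex[OF H M this] obtain k where k: "k \<in> hom E H M" "\<And>g. g \<in> Gs ==> cm k (ty g) (q g) = m g" by blast
  show "\<exists>!k. k \<in> hom E H M \<and> (\<forall>j\<in>obj J. cmp E k (p j) = q' j)"
  proof (rule ex1I[of _ k], intro conjI ballI k(1))
   fix j assume j: "j \<in> obj J"
   show "cmp E k (p j) = q' j"
   proof (rule E_ext_S[OF E_cmp_hom[OF p[OF j] k(1)] q'j[OF j]])
    fix X x assume X: "X \<in> S" and x: "x \<in> onobj (onobj G j) X"
    then have "(j, X, x) \<in> Gs" using j by (simp add: Gs_def elts_def)
    then show "cm (cmp E k (p j)) X x = cm (q' j) X x"
     using cm_cmp[OF p[OF j] k(1) S_obj[OF X] x] pq[OF j X x] k(2)[of "(j, X, x)"] by (simp add: ty_def m_def)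
   qed
  next
   fix l assume l: "l \<in> hom E H M \<and> (\<forall>j\<in>obj J. cmp E l (p j) = q' j)"
   show "l = k"
   proof (rule presents_unique[OF H wt _ k(1)])
    show "l \<in> hom E H M" using l by simp
    fix g assume g: "g \<in> Gs"
    then obtain j X x where x: "g = (j, X, x)" "j \<in> obj J" "X \<in> S" "x \<in> onobj (onobj G j) X"
     by (auto simp: Gs_def elts_def)
    have "cm l X (q g) = cm (q' j) X x"
     using cm_cmp[OF p[OF x(2)] _ S_obj[OF x(3)] x(4), of l M] pq[OF x(2-4)] l x by metis
    then show "cm l (ty g) (q g) = cm k (ty g) (q g)" using k(2)[OF g] x by (simp add: ty_def m_def)
   qed
  qed
 qed
 then show "\<exists>L p. is_colimit J E G L p" by blast
qed

end

section \<open>Limits and power objects read through elements\<close>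

section \<open>Limits, constant sheaves and power objects\<close>

text \<open>Elements at stages, each stage being represented by an object free on one element. Sets,
  with a single stage, and sheaves, with the objects of T as stages, both fit, so relations are
  analysed once for both.\<close>

locale concrete = category C
 for C :: "('o, 'a) cat" +
 fixes \<X> :: "'i set" and el :: "'o => 'i => 'x set" and ap :: "'a => 'i => 'x => 'x"
 assumes ap_in: "m \<in> hom C A B ==> X \<in> \<X> ==> x \<in> el A X ==> ap m X x \<in> el B X"
  and ap_cmp: "m \<in> hom C A B ==> n \<in> hom C B D ==> X \<in> \<X> ==> x \<in> el A X ==>
   ap (cmp C n m) X x = ap n X (ap m X x)"
  and free: "X \<in> \<X> ==> \<exists>H\<in>obj C. \<exists>q\<in>el H X. \<forall>M\<in>obj C. \<forall>x\<in>el M X. \<exists>!k. k \<in> hom C H M \<and> ap k X q = x"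
begin

text \<open>Joint monicity is tested on the free object: elements of R at stage X are arrows from it
  into R.\<close>

lemma relation_inj:
 assumes rel: "is_relation C B A R r0 r1" and X: "X \<in> \<X>" and s: "s \<in> el R X" and t: "t \<in> el R X"
  and eq: "ap r0 X s = ap r0 X t" "ap r1 X s = ap r1 X t"
 shows "s = t"
proof -
 have r0: "r0 \<in> hom C R B" and r1: "r1 \<in> hom C R A"
  and mono: "\<And>Y s t. Y \<in> obj C ==> s \<in> hom C Y R ==> t \<in> hom C Y R ==>
   cmp C r0 s = cmp C r0 t ==> cmp C r1 s = cmp C r1 t ==> s = t"
  using rel by (auto simp: is_relation_def)
 obtain H q where H: "H \<in> obj C" and q: "q \<in> el H X"
  and free: "\<And>M x. M \<in> obj C ==> x \<in> el M X ==> \<exists>!k. k \<in> hom C H M \<and> ap k X q = x"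
  using free[OF X] by blast
 note ob = hom_obj(1)[OF r0] hom_obj(2)[OF r0] hom_obj(2)[OF r1]
 obtain k l where k: "k \<in> hom C H R" "ap k X q = s" and l: "l \<in> hom C H R" "ap l X q = t"
  using free[OF ob(1) s] free[OF ob(1) t] by blast
 have eq': "cmp C g k = cmp C g l" if g: "g \<in> hom C R D" "ap g X s = ap g X t" for g D
  using free[OF hom_obj(2)[OF g(1)] ap_in[OF g(1) X s]] cmp_hom[OF k(1) g(1)] cmp_hom[OF l(1) g(1)]
   ap_cmp[OF k(1) g(1) X q] ap_cmp[OF l(1) g(1) X q] k(2) l(2) g(2) by metis
 have "k = l" by (rule mono[OF H k(1) l(1) eq'[OF r0 eq(1)] eq'[OF r1 eq(2)]])
 then show ?thesis using k l by simp
qed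

text \<open>Elementwise, the pullback square says that b is related to a exactly if
  \<open>\<chi>\<close> sends b to a name of a set containing a. The step from M to R feeds the free
  object into the universal property.\<close>

lemma pulled_back_elements:
 assumes pb: "pulled_back_relation C B A \<chi> M m0 m1 R r0 r1"
  and rel: "is_relation C B A R r0 r1" and M: "m0 \<in> hom C M P" "m1 \<in> hom C M A" and \<chi>: "\<chi> \<in> hom C B P"
  and X: "X \<in> \<X>" and b: "b \<in> el B X"
 shows "(\<exists>rh\<in>el R X. ap r0 X rh = b \<and> ap r1 X rh = a) \<longleftrightarrow> (\<exists>\<mu>\<in>el M X. ap m0 X \<mu> = ap \<chi> X b \<and> ap m1 X \<mu> = a)"
proof -
 have r0: "r0 \<in> hom C R B" and r1: "r1 \<in> hom C R A" using rel by (auto simp: is_relation_def)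
 from pb obtain k where k: "k \<in> hom C R M" "cmp C m0 k = cmp C \<chi> r0" "cmp C m1 k = r1"
  and univ: "\<And>Y t0 t1 t. Y \<in> obj C ==> t0 \<in> hom C Y B ==> t1 \<in> hom C Y A ==> t \<in> hom C Y M ==>
    cmp C m0 t = cmp C \<chi> t0 ==> cmp C m1 t = t1 ==>
    \<exists>n. n \<in> hom C Y R \<and> cmp C r0 n = t0 \<and> cmp C r1 n = t1"
  unfolding pulled_back_relation_def by metis
 show ?thesis
 proof
  assume "\<exists>rh\<in>el R X. ap r0 X rh = b \<and> ap r1 X rh = a"
  then obtain rh where rh: "rh \<in> el R X" "ap r0 X rh = b" "ap r1 X rh = a" by blast
  then show "\<exists>\<mu>\<in>el M X. ap m0 X \<mu> = ap \<chi> X b \<and> ap m1 X \<mu> = a"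
   using ap_in[OF k(1) X rh(1)] ap_cmp[OF k(1) M(1) X rh(1)] ap_cmp[OF k(1) M(2) X rh(1)]
    ap_cmp[OF r0 \<chi> X rh(1)] k by metis
 next
  assume "\<exists>\<mu>\<in>el M X. ap m0 X \<mu> = ap \<chi> X b \<and> ap m1 X \<mu> = a"
  then obtain \<mu> where \<mu>: "\<mu> \<in> el M X" "ap m0 X \<mu> = ap \<chi> X b" "ap m1 X \<mu> = a" by blast
  obtain H q where H: "H \<in> obj C" and q: "q \<in> el H X"
   and free: "\<And>M x. M \<in> obj C ==> x \<in> el M X ==> \<exists>!k. k \<in> hom C H M \<and> ap k X q = x"
   using free[OF X] by blast
  obtain t where t: "t \<in> hom C H M" "ap t X q = \<mu>" using free[OF hom_obj(1)[OF M(1)] \<mu>(1)] by blast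
  obtain t0 where t0: "t0 \<in> hom C H B" "ap t0 X q = b" using free[OF hom_obj(2)[OF r0] b] by blast
  have "cmp C m0 t = cmp C \<chi> t0"
   using free[OF hom_obj(2)[OF \<chi>] ap_in[OF \<chi> X b]] cmp_hom[OF t(1) M(1)] cmp_hom[OF t0(1) \<chi>]
    ap_cmp[OF t(1) M(1) X q] ap_cmp[OF t0(1) \<chi> X q] t t0 \<mu>(2) by metis
  then obtain n where n: "n \<in> hom C H R" "cmp C r0 n = t0" "cmp C r1 n = cmp C m1 t"
   using univ[OF H t0(1) cmp_hom[OF t(1) M(2)] t(1)] by blast
  have "ap r0 X (ap n X q) = b" "ap r1 X (ap n X q) = a"
   using ap_cmp[OF n(1) r0 X q] ap_cmp[OF n(1) r1 X q] ap_cmp[OF t(1) M(2) X q] n t t0 \<mu> by simp_all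
  then show "\<exists>rh\<in>el R X. ap r0 X rh = b \<and> ap r1 X rh = a" using ap_in[OF n(1) X q] by blast
 qed
qed

end

context universe
begin

lemma small_singleton: "small U {a}"
 by (simp add: small_finite)

lemma concrete_Set: "concrete (Set_cat U :: ('x set, 'x set_arr) cat) {()} (\<lambda>A _. A) (\<lambda>m _. app m)"
proof (intro concrete.intro category_Set concrete_axioms.intro)
 show "m \<in> hom (Set_cat U) A B ==> X \<in> {()} ==> x \<in> A ==> app m x \<in> B" for m :: "'x set_arr" and A B x X
  by (rule Set_hom_app)
 show "m \<in> hom (Set_cat U) A B ==> n \<in> hom (Set_cat U) B D ==> X \<in> {()} ==> x \<in> A ==>
  app (cmp (Set_cat U) n m) x = app n (app m x)" for m n :: "'x set_arr" and A B D x X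
  by (rule app_Set_cmp)
 show "\<exists>H\<in>obj (Set_cat U). \<exists>q\<in>H. \<forall>M\<in>obj (Set_cat U). \<forall>x\<in>M. \<exists>!k. k \<in> hom (Set_cat U) H M \<and> app k q = (x::'x)" for X :: unit
 proof (intro bexI ballI)
  fix M and x :: 'x assume M: "M \<in> obj (Set_cat U)" and x: "x \<in> M"
  show "\<exists>!k. k \<in> hom (Set_cat U) {undefined} M \<and> app k undefined = x"
  proof (rule ex1I[of _ "mk_set {undefined} (\<lambda>_. x) M"])
   show k: "mk_set {undefined} (\<lambda>_. x) M \<in> hom (Set_cat U) {undefined} M \<and> app (mk_set {undefined} (\<lambda>_. x) M) undefined = x"
    using M x by (auto intro!: mk_set_hom small_singleton)
   show "k = mk_set {undefined} (\<lambda>_. x) M"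
    if "k \<in> hom (Set_cat U) {undefined} M \<and> app k undefined = x" for k
    by (rule Set_ext[of _ U "{undefined}" M]) (use k that in auto)
  qed
 qed (auto simp: small_singleton)
qed

text \<open>A compatible family is a cone whose vertex is a singleton.\<close>

lemma Set_limitD:
 assumes lim: "is_limit J (Set_cat U :: ('x set, 'x set_arr) cat) G L p"
  and G: "is_functor J (Set_cat U) G" and J: "category J"
  and t: "\<And>j. j \<in> obj J ==> t j \<in> onobj G j"
  and tu: "\<And>u j k. u \<in> hom J j k ==> app (onarr G u) (t j) = t k"
 shows "\<exists>!x. x \<in> L \<and> (\<forall>j\<in>obj J. app (p j) x = t j)"
proof -
 interpret J: category J by fact
 have p: "\<And>j. j \<in> obj J ==> p j \<in> hom (Set_cat U) L (onobj G j)" and L: "small U L"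
  using lim by (auto simp: is_limit_def is_cone_def)
 let ?a = "undefined :: 'x"
 define q where "q j = mk_set {?a} (\<lambda>_. t j) (onobj G j)" for j
 have q: "q j \<in> hom (Set_cat U) {?a} (onobj G j)" if "j \<in> obj J" for j
  unfolding q_def using t[OF that] is_functorD(1)[OF G that] by (intro mk_set_hom small_singleton) auto
 have "is_cone J (Set_cat U) G {?a} q"
  unfolding is_cone_def
 proof (intro conjI ballI q)
  show "{?a} \<in> obj (Set_cat U)" by (simp add: small_singleton)
  fix u assume "u \<in> arr J"
  then obtain j k where u: "u \<in> hom J j k" by (blast intro: arr_hom)
  note jk = J.hom_obj[OF u] and Gu = is_functorD(2)[OF G u]
  have "cmp (Set_cat U) (onarr G u) (q j) = q k"
   by (rule Set_ext[OF Set_cmp_hom[OF q[OF jk(1)] Gu] q[OF jk(2)]])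
    (use app_Set_cmp[OF q[OF jk(1)] Gu] tu[OF u] in \<open>auto simp: q_def\<close>)
  then show "cmp (Set_cat U) (onarr G u) (q (src J u)) = q (tgt J u)" using homD[OF u] by simp
 qed
 then have ex1: "\<exists>!m. m \<in> hom (Set_cat U) {?a} L \<and> (\<forall>j\<in>obj J. cmp (Set_cat U) (p j) m = q j)"
  using lim unfolding is_limit_def by blast
 then obtain m where m: "m \<in> hom (Set_cat U) {?a} L" "\<And>j. j \<in> obj J ==> cmp (Set_cat U) (p j) m = q j" by blast
 show ?thesis
 proof (rule ex1I[of _ "app m ?a"])
  have "app (p j) (app m ?a) = t j" if "j \<in> obj J" for j
   using app_Set_cmp[OF m(1) p[OF that], of ?a] m(2)[OF that] by (simp add: q_def)
  then show "app m ?a \<in> L \<and> (\<forall>j\<in>obj J. app (p j) (app m ?a) = t j)" using Set_hom_app[OF m(1)] by simp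
  fix x assume x: "x \<in> L \<and> (\<forall>j\<in>obj J. app (p j) x = t j)"
  define n where "n = mk_set {?a} (\<lambda>_. x) L"
  have n: "n \<in> hom (Set_cat U) {?a} L" unfolding n_def using x L by (intro mk_set_hom small_singleton) auto
  have "cmp (Set_cat U) (p j) n = q j" if j: "j \<in> obj J" for j
   by (rule Set_ext[OF Set_cmp_hom[OF n p[OF j]] q[OF j]])
    (use app_Set_cmp[OF n p[OF j]] x j in \<open>auto simp: q_def n_def\<close>)
  then have "n = m" using ex1 m n by blast
  then show "x = app m ?a" by (auto simp: n_def)
 qed
qed

text \<open>The subset that the element p of a power object names.\<close>

definition subset_at :: "'x set => 'x set_arr => 'x set_arr => 'x => 'x set" where
 "subset_at M m0 m1 p = {a. \<exists>\<mu>\<in>M. app m0 \<mu> = p \<and> app m1 \<mu> = a}"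

text \<open>Applied to relations out of a singleton, the universal property classifies subsets of A
  by arrows from the singleton to P, that is by elements of P.\<close>

lemma Set_power_object:
 assumes po: "is_power_object (Set_cat U :: ('x set, 'x set_arr) cat) A P M m0 m1" and A': "A' \<subseteq> A"
 shows "\<exists>!p. p \<in> P \<and> subset_at M m0 m1 p = A'"
proof -
 interpret conc: concrete "Set_cat U :: ('x set, 'x set_arr) cat" "{()}" "\<lambda>A _. A" "\<lambda>m _. app m" by (rule concrete_Set)
 have relM: "is_relation (Set_cat U) P A M m0 m1" using po by (simp add: is_power_object_def)
 then have m0: "m0 \<in> hom (Set_cat U) M P" and m1: "m1 \<in> hom (Set_cat U) M A" by (auto simp: is_relation_def)
 have sm: "small U P" "small U A" "small U M" "small U A'"
  using m0 m1 small_subset[OF _ A'] by (auto simp: Set_hom_iff)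
 note M_inj = conc.relation_inj[OF relM, of "()", simplified]
 let ?b = "undefined :: 'x"
 define r0 where "r0 = mk_set A' (\<lambda>_. ?b) {?b}"
 define r1 where "r1 = mk_set A' (\<lambda>x. x) A"
 have r0: "r0 \<in> hom (Set_cat U) A' {?b}" unfolding r0_def by (intro mk_set_hom sm small_singleton) auto
 have r1: "r1 \<in> hom (Set_cat U) A' A" unfolding r1_def by (intro mk_set_hom sm) (use A' in auto)
 have relR: "is_relation (Set_cat U) {?b} A A' r0 r1"
  unfolding is_relation_def
 proof (intro conjI r0 r1 ballI impI)
  fix Y s t assume s: "s \<in> hom (Set_cat U) Y A'" and t: "t \<in> hom (Set_cat U) Y A'"
   and eq: "cmp (Set_cat U) r0 s = cmp (Set_cat U) r0 t \<and> cmp (Set_cat U) r1 s = cmp (Set_cat U) r1 t"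
  show "s = t"
  proof (rule Set_ext[OF s t])
   fix y assume y: "y \<in> Y"
   have "app r1 (app s y) = app r1 (app t y)" using app_Set_cmp[OF s r1 y] app_Set_cmp[OF t r1 y] eq by simp
   then show "app s y = app t y" using Set_hom_app[OF s y] Set_hom_app[OF t y] by (simp add: r1_def)
  qed
 qed
 define c where "c p = mk_set {?b} (\<lambda>_. p) P" for p
 have c: "c p \<in> hom (Set_cat U) {?b} P" if "p \<in> P" for p
  unfolding c_def using that by (intro mk_set_hom sm small_singleton) auto
 have c_surj: "\<exists>p\<in>P. \<chi> = c p" if "\<chi> \<in> hom (Set_cat U) {?b} P" for \<chi>
  by (rule bexI[of _ "app \<chi> ?b"], rule Set_ext[OF that c]) (use Set_hom_app[OF that] in \<open>auto simp: c_def\<close>)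
 have "pulled_back_relation (Set_cat U) {?b} A (c p) M m0 m1 A' r0 r1 \<longleftrightarrow> subset_at M m0 m1 p = A'" if p: "p \<in> P" for p
 proof
  assume pb: "pulled_back_relation (Set_cat U) {?b} A (c p) M m0 m1 A' r0 r1"
  have "(\<exists>rh\<in>A'. app r0 rh = ?b \<and> app r1 rh = a) \<longleftrightarrow> (\<exists>\<mu>\<in>M. app m0 \<mu> = app (c p) ?b \<and> app m1 \<mu> = a)" for a
   by (rule conc.pulled_back_elements[OF pb relR m0 m1 c[OF p], of "()"]) auto
  moreover have "(\<exists>rh\<in>A'. app r0 rh = ?b \<and> app r1 rh = a) \<longleftrightarrow> a \<in> A'" for a by (auto simp: r0_def r1_def)
  ultimately show "subset_at M m0 m1 p = A'" by (auto simp: subset_at_def c_def)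
 next
  assume eq: "subset_at M m0 m1 p = A'"
  then have "\<forall>a\<in>A'. \<exists>\<mu>\<in>M. app m0 \<mu> = p \<and> app m1 \<mu> = a" by (auto simp: subset_at_def)
  then obtain k where k: "\<And>a. a \<in> A' ==> k a \<in> M \<and> app m0 (k a) = p \<and> app m1 (k a) = a" by metis
  define K where "K = mk_set A' k M"
  have K: "K \<in> hom (Set_cat U) A' M" unfolding K_def by (intro mk_set_hom sm) (use k in auto)
  show "pulled_back_relation (Set_cat U) {?b} A (c p) M m0 m1 A' r0 r1"
   unfolding pulled_back_relation_def
  proof (intro bexI[OF _ K] conjI ballI impI)
   show "cmp (Set_cat U) m0 K = cmp (Set_cat U) (c p) r0"
    by (rule Set_ext[OF Set_cmp_hom[OF K m0] Set_cmp_hom[OF r0 c[OF p]]])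
     (use k app_Set_cmp[OF K m0] app_Set_cmp[OF r0 c[OF p]] in \<open>auto simp: K_def c_def r0_def\<close>)
   show "cmp (Set_cat U) m1 K = r1"
    by (rule Set_ext[OF Set_cmp_hom[OF K m1] r1])
     (use k app_Set_cmp[OF K m1] in \<open>auto simp: K_def r1_def\<close>)
   fix Y t0 t1 t assume Y: "Y \<in> obj (Set_cat U)" and t0: "t0 \<in> hom (Set_cat U) Y {?b}"
    and t1: "t1 \<in> hom (Set_cat U) Y A" and t: "t \<in> hom (Set_cat U) Y M"
    and h: "cmp (Set_cat U) m0 t = cmp (Set_cat U) (c p) t0 \<and> cmp (Set_cat U) m1 t = t1"
   have h0: "app m0 (app t y) = p" if "y \<in> Y" for y
    using h app_Set_cmp[OF t m0 that] app_Set_cmp[OF t0 c[OF p] that] Set_hom_app[OF t0 that] by (simp add: c_def)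
   have h1: "app m1 (app t y) = app t1 y" if "y \<in> Y" for y
    using h app_Set_cmp[OF t m1 that] by simp
   have t1A': "app t1 y \<in> A'" if "y \<in> Y" for y
    using h0[OF that] h1[OF that] Set_hom_app[OF t that] eq by (auto simp: subset_at_def)
   define n where "n = mk_set Y (app t1) A'"
   have n: "n \<in> hom (Set_cat U) Y A'" unfolding n_def by (intro mk_set_hom sm t1A') (use Y in auto)
   show "\<exists>!n. n \<in> hom (Set_cat U) Y A' \<and> cmp (Set_cat U) r0 n = t0 \<and> cmp (Set_cat U) r1 n = t1 \<and> cmp (Set_cat U) K n = t"
   proof (rule ex1I[of _ n], intro conjI n)
    show "cmp (Set_cat U) r0 n = t0"
     by (rule Set_ext[OF Set_cmp_hom[OF n r0] t0])
      (use app_Set_cmp[OF n r0] t1A' Set_hom_app[OF t0] in \<open>auto simp: n_def r0_def\<close>)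
    show "cmp (Set_cat U) r1 n = t1"
     by (rule Set_ext[OF Set_cmp_hom[OF n r1] t1])
      (use app_Set_cmp[OF n r1] t1A' in \<open>auto simp: n_def r1_def\<close>)
    show "cmp (Set_cat U) K n = t"
    proof (rule Set_ext[OF Set_cmp_hom[OF n K] t])
     fix y assume y: "y \<in> Y"
     show "app (cmp (Set_cat U) K n) y = app t y"
      by (rule M_inj) (use y k[OF t1A'[OF y]] h0[OF y] h1[OF y] t1A'[OF y] Set_hom_app[OF t y] app_Set_cmp[OF n K y] in
        \<open>auto simp: n_def K_def\<close>)
    qed
    fix n' assume n': "n' \<in> hom (Set_cat U) Y A' \<and> cmp (Set_cat U) r0 n' = t0 \<and> cmp (Set_cat U) r1 n' = t1 \<and> cmp (Set_cat U) K n' = t"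
    then have n'h: "n' \<in> hom (Set_cat U) Y A'" by simp
    show "n' = n"
    proof (rule Set_ext[OF n'h n])
     fix y assume y: "y \<in> Y"
     have "app r1 (app n' y) = app t1 y" using n' app_Set_cmp[OF n'h r1 y] by simp
     then show "app n' y = app n y" using y Set_hom_app[OF n'h y] by (simp add: n_def r1_def)
    qed
   qed
  qed
 qed
 moreover have "\<exists>!\<chi>. \<chi> \<in> hom (Set_cat U) {?b} P \<and> pulled_back_relation (Set_cat U) {?b} A \<chi> M m0 m1 A' r0 r1"
  using po relR unfolding is_power_object_def by blast
 moreover have "p = p'" if "c p = c p'" for p p'
 proof -
  have "app (c p) ?b = app (c p') ?b" using that by simp
  then show ?thesis by (simp add: c_def)
 qed
 ultimately show ?thesis using c c_surj by (smt (verit))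
qed

end

context amalgamation_category
begin

text \<open>Limits of sheaves are pointwise. The comparison map picks the unique element with the
  required projections, and that uniqueness also gives naturality.\<close>

lemma E_limitI:
 assumes J: "category J" and G: "is_functor J E G" and L: "L \<in> obj E"
  and p: "\<And>j. j \<in> obj J ==> p j \<in> hom E L (onobj G j)"
  and cone: "\<And>u j k X x. u \<in> hom J j k ==> X \<in> obj T ==> x \<in> onobj L X ==>
   cm (onarr G u) X (cm (p j) X x) = cm (p k) X x"
  and univ: "\<And>X t. X \<in> obj T ==> (\<And>j. j \<in> obj J ==> t j \<in> onobj (onobj G j) X) ==>
   (\<And>u j k. u \<in> hom J j k ==> cm (onarr G u) X (t j) = t k) ==>
   \<exists>!x. x \<in> onobj L X \<and> (\<forall>j\<in>obj J. cm (p j) X x = t j)"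
 shows "is_limit J E G L p"
 unfolding is_limit_def
proof (intro conjI allI impI)
 interpret J: category J by fact
 show "is_cone J E G L p"
  unfolding is_cone_def
 proof (intro conjI ballI L p)
  fix u assume "u \<in> arr J"
  then obtain j k where u: "u \<in> hom J j k" by (blast intro: arr_hom)
  note jk = J.hom_obj[OF u] and Gu = is_functorD(2)[OF G u]
  have "cmp E (onarr G u) (p j) = p k"
   by (rule E_ext[OF E_cmp_hom[OF p[OF jk(1)] Gu] p[OF jk(2)]])
    (simp add: cm_cmp[OF p[OF jk(1)] Gu] cone[OF u])
  then show "cmp E (onarr G u) (p (src J u)) = p (tgt J u)" using homD[OF u] by simp
 qed
 fix M q assume "is_cone J E G M q"
 then have M: "M \<in> obj E" and q: "\<And>j. j \<in> obj J ==> q j \<in> hom E M (onobj G j)"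
  and qu: "\<And>u j k. u \<in> hom J j k ==> cmp E (onarr G u) (q j) = q k"
  by (auto simp: is_cone_def hom_def)
 have qux: "cm (onarr G u) X (cm (q j) X x) = cm (q k) X x"
  if u: "u \<in> hom J j k" and "X \<in> obj T" "x \<in> onobj M X" for u j k X x
  using qu[OF u] cm_cmp[OF q[OF J.hom_obj(1)[OF u]] is_functorD(2)[OF G u] that(2,3)] by simp
 define c where "c X x = (THE y. y \<in> onobj L X \<and> (\<forall>j\<in>obj J. cm (p j) X y = cm (q j) X x))" for X x
 have ex1: "\<exists>!y. y \<in> onobj L X \<and> (\<forall>j\<in>obj J. cm (p j) X y = cm (q j) X x)" if "X \<in> obj T" "x \<in> onobj M X" for X x
  by (rule univ[OF that(1)]) (use cm_in[OF q that] qux that in auto)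
 have c: "c X x \<in> onobj L X" "\<And>j. j \<in> obj J ==> cm (p j) X (c X x) = cm (q j) X x"
  if "X \<in> obj T" "x \<in> onobj M X" for X x
  using theI'[OF ex1[OF that]] by (auto simp: c_def)
 have c_eq: "y = c X x" if "X \<in> obj T" "x \<in> onobj M X" "y \<in> onobj L X" "\<And>j. j \<in> obj J ==> cm (p j) X y = cm (q j) X x" for X x y
  using ex1[OF that(1,2)] c[OF that(1,2)] that(3,4) by blast
 have m: "mk_hom M c L \<in> hom E M L"
 proof (rule mk_hom[OF M L c(1)])
  fix f X Y x assume f: "f \<in> hom T X Y" and x: "x \<in> onobj M X"
  note XY = hom_obj[OF f] note cx = c[OF XY(1) x]
  have "act L f (c X x) = c Y (act M f x)"
  proof (rule c_eq[OF XY(2) E_act[OF M f x] E_act[OF L f cx(1)]])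
   fix j assume j: "j \<in> obj J"
   show "cm (p j) Y (act L f (c X x)) = cm (q j) Y (act M f x)"
    using cm_nat[OF p[OF j] f cx(1)] cm_nat[OF q[OF j] f x] cx(2)[OF j] by simp
  qed
  then show "c Y (act M f x) = act L f (c X x)" by simp
 qed
 show "\<exists>!m. m \<in> hom E M L \<and> (\<forall>j\<in>obj J. cmp E (p j) m = q j)"
 proof (rule ex1I[of _ "mk_hom M c L"], intro conjI ballI m)
  fix j assume j: "j \<in> obj J"
  show "cmp E (p j) (mk_hom M c L) = q j"
   by (rule E_ext[OF E_cmp_hom[OF m p[OF j]] q[OF j]]) (simp add: cm_cmp[OF m p[OF j]] c(2)[OF _ _ j])
 next
  fix l assume l: "l \<in> hom E M L \<and> (\<forall>j\<in>obj J. cmp E (p j) l = q j)"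
  then have l': "l \<in> hom E M L" by simp
  show "l = mk_hom M c L"
  proof (rule E_ext[OF l' m])
   fix X x assume X: "X \<in> obj T" and x: "x \<in> onobj M X"
   show "cm l X x = cm (mk_hom M c L) X x"
    using c_eq[OF X x cm_in[OF l' X x]] cm_cmp[OF l' p X x] l X x by simp
  qed
 qed
qed

end

context site
begin

text \<open>The free object at stage X is presented by one generator of type X and no
  relations.\<close>

lemma concrete_E: "concrete E (obj T) onobj cm"
proof (intro concrete.intro category_E concrete_axioms.intro)
 show "m \<in> hom E F G ==> X \<in> obj T ==> x \<in> onobj F X ==> cm m X x \<in> onobj G X" for m F G X x by (rule cm_in)
 show "m \<in> hom E F G ==> n \<in> hom E G H ==> X \<in> obj T ==> x \<in> onobj F X ==>
  cm (cmp E n m) X x = cm n X (cm m X x)" for m n F G H X x by (rule cm_cmp)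
 fix X assume X: "X \<in> obj T"
 obtain H q where H: "presents H q {()} (\<lambda>_. X) {}"
  by (rule ex_presents[of "{()}" "\<lambda>_. X" "{}"]) (use X in \<open>auto simp: small_finite well_typed_def\<close>)
 show "\<exists>H\<in>obj E. \<exists>q\<in>onobj H X. \<forall>M\<in>obj E. \<forall>x\<in>onobj M X. \<exists>!k. k \<in> hom E H M \<and> cm k X q = x"
 proof (intro bexI ballI)
  show "H \<in> obj E" "q () \<in> onobj H X" using H by (auto simp: presents_def model_def)
  fix M x assume "M \<in> obj E" "x \<in> onobj M X"
  then show "\<exists>!k. k \<in> hom E H M \<and> cm k X (q ()) = x"
   using H by (auto simp: presents_def model_def elim!: allE[of _ M] allE[of _ "\<lambda>_. x"])
 qed
qed

end

section \<open>The geometric morphism to sets: connectedness and atomicity\<close>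

locale based_site = site U T S r \<phi> \<psi>
 for U :: "'u itself" and T :: "('o, 'a) cat" and S r \<phi> \<psi> +
 fixes T0 :: 'o
 assumes T0: "T0 \<in> obj T" and T0_initial: "X \<in> obj T ==> \<exists>!f. f \<in> hom T T0 X"
begin

definition init :: "'o => 'a" where "init X = (THE f. f \<in> hom T T0 X)"

lemma init: "X \<in> obj T ==> init X \<in> hom T T0 X"
 unfolding init_def by (rule theI'[OF T0_initial])

lemma init_eq: "f \<in> hom T T0 X ==> f = init X"
 using T0_initial[OF hom_obj(2)] init[OF hom_obj(2)] by metis

abbreviation const :: "'u set => ('o, 'a, 'u) presheaf" where
 "const A \<equiv> mk_sheaf (\<lambda>_. A) (\<lambda>_ x. x)"

text \<open>All arrows act as the identity, so injectivity and descent are immediate: a constant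
  functor is already a sheaf.\<close>

lemma const: "small U A ==> const A \<in> obj E"
 by (rule mk_sheaf) auto

definition \<Delta> where
 "\<Delta> = \<lparr>onobj = (\<lambda>A\<in>obj (Set_cat U). const A),
   onarr = (\<lambda>m\<in>arr (Set_cat U). mk_hom (const (src (Set_cat U) m)) (\<lambda>_. app m) (const (tgt (Set_cat U) m)))\<rparr>"

text \<open>Global sections: \<open>T0\<close> is initial in T, hence terminal in the opposite
  category, so they are the elements at \<open>T0\<close>.\<close>

definition \<Gamma> where
 "\<Gamma> = \<lparr>onobj = (\<lambda>F\<in>obj E. onobj F T0),
   onarr = (\<lambda>m\<in>arr E. mk_set (onobj (src E m) T0) (cm m T0) (onobj (tgt E m) T0))\<rparr>"

lemma \<Delta>_obj [simp]: "small U A ==> onobj \<Delta> A = const A"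
 by (simp add: \<Delta>_def)

lemma \<Delta>_arr: "m \<in> hom (Set_cat U) A B ==> onarr \<Delta> m = mk_hom (const A) (\<lambda>_. app m) (const B)"
 by (auto simp: \<Delta>_def hom_def)

lemma \<Delta>_hom: "m \<in> hom (Set_cat U) A B ==> onarr \<Delta> m \<in> hom E (const A) (const B)"
 unfolding \<Delta>_arr
proof (rule mk_hom)
 assume m: "m \<in> hom (Set_cat U) A B"
 show "const A \<in> obj E" "const B \<in> obj E" using m const by (auto simp: Set_hom_iff)
 show "app m x \<in> onobj (const B) X" if "X \<in> obj T" "x \<in> onobj (const A) X" for X x
  using that Set_hom_app[OF m] by simp
 fix f X Y x assume f: "f \<in> hom T X Y" and "x \<in> onobj (const A) X"
 then have x: "x \<in> A" using hom_obj[OF f] by simp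
 show "app m (act (const A) f x) = act (const B) f (app m x)"
  using act_mk_sheaf[OF f, of x "\<lambda>_. A"] act_mk_sheaf[OF f, of "app m x" "\<lambda>_. B"] x Set_hom_app[OF m x] by simp
qed

lemma cm_\<Delta> [simp]: "m \<in> hom (Set_cat U) A B ==> X \<in> obj T ==> x \<in> A ==> cm (onarr \<Delta> m) X x = app m x"
 by (simp add: \<Delta>_arr)

lemma Set_hom_small: "m \<in> hom (Set_cat U) A B ==> small U A" "m \<in> hom (Set_cat U) A B ==> small U B"
 by (auto simp: Set_hom_iff)

lemma \<Delta>_functor: "is_functor (Set_cat U) E \<Delta>"
proof (rule is_functorI)
 show "onobj \<Delta> \<in> extensional (obj (Set_cat U))" "onarr \<Delta> \<in> extensional (arr (Set_cat U))" by (auto simp: \<Delta>_def)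
 show "onobj \<Delta> A \<in> obj E" if "A \<in> obj (Set_cat U)" for A using that const by simp
 show "onarr \<Delta> m \<in> hom E (onobj \<Delta> A) (onobj \<Delta> B)" if "m \<in> hom (Set_cat U) A B" for m A B
  using \<Delta>_hom[OF that] Set_hom_small[OF that] by simp
 show "onarr \<Delta> (idn (Set_cat U) A) = idn E (onobj \<Delta> A)" if "A \<in> obj (Set_cat U)" for A
  by (rule E_ext[of _ "const A" "const A"])
   (use that \<Delta>_hom[OF Set_idn_hom] E_idn_hom const in \<open>auto simp: cm_\<Delta>[OF Set_idn_hom]\<close>)
 show "onarr \<Delta> (cmp (Set_cat U) n m) = cmp E (onarr \<Delta> n) (onarr \<Delta> m)"
  if m: "m \<in> hom (Set_cat U) A B" and n: "n \<in> hom (Set_cat U) B D" for m n A B D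
  by (rule E_ext[OF \<Delta>_hom[OF Set_cmp_hom[OF m n]] E_cmp_hom[OF \<Delta>_hom[OF m] \<Delta>_hom[OF n]]])
   (simp add: cm_\<Delta>[OF Set_cmp_hom[OF m n]] cm_cmp[OF \<Delta>_hom[OF m] \<Delta>_hom[OF n]] cm_\<Delta>[OF m] cm_\<Delta>[OF n]
    app_Set_cmp[OF m n] Set_hom_app[OF m])
qed

lemma \<Gamma>_obj [simp]: "F \<in> obj E ==> onobj \<Gamma> F = onobj F T0"
 by (simp add: \<Gamma>_def)

lemma \<Gamma>_hom:
 assumes "m \<in> hom E F G" shows "onarr \<Gamma> m \<in> hom (Set_cat U) (onobj F T0) (onobj G T0)"
proof -
 have "onarr \<Gamma> m = mk_set (onobj F T0) (cm m T0) (onobj G T0)" using homD[OF assms] by (simp add: \<Gamma>_def)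
 then show ?thesis using cm_in[OF assms T0] E_small[OF _ T0] E_hom_obj[OF assms] by (simp add: mk_set_hom)
qed

lemma app_\<Gamma> [simp]: "m \<in> hom E F G ==> x \<in> onobj F T0 ==> app (onarr \<Gamma> m) x = cm m T0 x"
 by (auto simp: \<Gamma>_def homD)

lemma \<Gamma>_functor: "is_functor E (Set_cat U) \<Gamma>"
proof (rule is_functorI)
 show "onobj \<Gamma> \<in> extensional (obj E)" "onarr \<Gamma> \<in> extensional (arr E)" by (auto simp: \<Gamma>_def)
 show "onobj \<Gamma> F \<in> obj (Set_cat U)" if "F \<in> obj E" for F using that E_small[OF _ T0] by simp
 show "onarr \<Gamma> m \<in> hom (Set_cat U) (onobj \<Gamma> F) (onobj \<Gamma> G)" if "m \<in> hom E F G" for m F G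
  using \<Gamma>_hom[OF that] E_hom_obj[OF that] by simp
 show "onarr \<Gamma> (idn E F) = idn (Set_cat U) (onobj \<Gamma> F)" if F: "F \<in> obj E" for F
  unfolding \<Gamma>_obj[OF F]
  by (rule Set_ext[OF \<Gamma>_hom[OF E_idn_hom[OF F]] Set_idn_hom[OF E_small[OF F T0]]])
   (simp add: app_\<Gamma>[OF E_idn_hom[OF F]] T0)
 show "onarr \<Gamma> (cmp E n m) = cmp (Set_cat U) (onarr \<Gamma> n) (onarr \<Gamma> m)"
  if m: "m \<in> hom E F G" and n: "n \<in> hom E G H" for m n F G H
  by (rule Set_ext[OF \<Gamma>_hom[OF E_cmp_hom[OF m n]] Set_cmp_hom[OF \<Gamma>_hom[OF m] \<Gamma>_hom[OF n]]])
   (simp add: app_\<Gamma>[OF E_cmp_hom[OF m n]] app_Set_cmp[OF \<Gamma>_hom[OF m] \<Gamma>_hom[OF n]] cm_cmp[OF m n] T0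
    cm_in[OF m T0] app_\<Gamma>[OF m] app_\<Gamma>[OF n])
qed

lemma \<Delta>_\<Gamma>_adjunction: "adjunction (Set_cat U) E \<Delta> \<Gamma>"
 unfolding adjunction_def
proof (intro conjI \<Delta>_functor \<Gamma>_functor exI)
 define \<eta> where "\<eta> = (\<lambda>A\<in>obj (Set_cat U). idn (Set_cat U) A :: 'u set_arr)"
 \<comment> \<open>The counit transports an element at \<open>T0\<close> along the initial arrow;
   the unit is an identity because \<open>\<Gamma>\<close> undoes \<open>\<Delta>\<close>.\<close>
 define ep where "ep = (\<lambda>F\<in>obj E. mk_hom (const (onobj F T0)) (\<lambda>X. act F (init X)) F)"
 have \<eta>: "\<eta> A = idn (Set_cat U) A" if "small U A" for A using that by (simp add: \<eta>_def)
 have ep: "ep F \<in> hom E (const (onobj F T0)) F" if F: "F \<in> obj E" for F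
 proof -
  have "mk_hom (const (onobj F T0)) (\<lambda>X. act F (init X)) F \<in> hom E (const (onobj F T0)) F"
  proof (rule mk_hom)
   show "const (onobj F T0) \<in> obj E" by (rule const[OF E_small[OF F T0]])
   show "act F (init X) x \<in> onobj F X" if "X \<in> obj T" "x \<in> onobj (const (onobj F T0)) X" for X x
    using E_act[OF F init] that by simp
   fix f X Y x assume f: "f \<in> hom T X Y" and x: "x \<in> onobj (const (onobj F T0)) X"
   have "x \<in> onobj F T0" using x hom_obj[OF f] by simp
   then show "act F (init Y) (act (const (onobj F T0)) f x) = act F f (act F (init X) x)"
    using E_cmp[OF F init[OF hom_obj(1)[OF f]] f] init_eq[OF cmp_hom[OF init[OF hom_obj(1)[OF f]] f]]
    by (simp add: act_mk_sheaf[OF f])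
  qed (rule F)
  then show ?thesis using F by (simp add: ep_def)
 qed
 have cm_ep: "cm (ep F) X x = act F (init X) x" if "F \<in> obj E" "X \<in> obj T" "x \<in> onobj F T0" for F X x
  using that by (simp add: ep_def)
 show "nat_trans (Set_cat U) (Set_cat U) (id_functor (Set_cat U)) (comp_functor (Set_cat U) \<Gamma> \<Delta>) \<eta>"
  unfolding nat_trans_def
 proof (intro conjI ballI)
  show "\<eta> \<in> extensional (obj (Set_cat U))" by (simp add: \<eta>_def)
  fix A :: "'u set" assume "A \<in> obj (Set_cat U)"
  then show "\<eta> A \<in> hom (Set_cat U) (onobj (id_functor (Set_cat U)) A) (onobj (comp_functor (Set_cat U) \<Gamma> \<Delta>) A)"
   using Set_idn_hom const T0 by (simp add: \<eta> id_functor_def comp_functor_def)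
 next
  fix m :: "'u set_arr" assume m': "m \<in> arr (Set_cat U)"
  then obtain A B where m: "m \<in> hom (Set_cat U) A B" by (blast intro: arr_hom)
  note sm = Set_hom_small[OF m]
  have g: "onarr \<Gamma> (onarr \<Delta> m) \<in> hom (Set_cat U) A B" using \<Gamma>_hom[OF \<Delta>_hom[OF m]] T0 by simp
  have "cmp (Set_cat U) (idn (Set_cat U) B) m = cmp (Set_cat U) (onarr \<Gamma> (onarr \<Delta> m)) (idn (Set_cat U) A)"
   by (rule Set_ext[OF Set_cmp_hom[OF m Set_idn_hom[OF sm(2)]] Set_cmp_hom[OF Set_idn_hom[OF sm(1)] g]])
    (simp add: app_Set_cmp[OF m Set_idn_hom[OF sm(2)]] app_Set_cmp[OF Set_idn_hom[OF sm(1)] g] Set_hom_app[OF m]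
     app_\<Gamma>[OF \<Delta>_hom[OF m]] T0 cm_\<Delta>[OF m])
  then show "cmp (Set_cat U) (\<eta> (tgt (Set_cat U) m)) (onarr (id_functor (Set_cat U)) m) =
   cmp (Set_cat U) (onarr (comp_functor (Set_cat U) \<Gamma> \<Delta>) m) (\<eta> (src (Set_cat U) m))"
   using m' homD[OF m] sm by (simp add: \<eta> id_functor_def comp_functor_def)
 qed
 show "nat_trans E E (comp_functor E \<Delta> \<Gamma>) (id_functor E) ep"
  unfolding nat_trans_def
 proof (intro conjI ballI)
  show "ep \<in> extensional (obj E)" by (simp add: ep_def)
  fix F assume F: "F \<in> obj E"
  then show "ep F \<in> hom E (onobj (comp_functor E \<Delta> \<Gamma>) F) (onobj (id_functor E) F)"
   using ep[OF F] E_small[OF F T0] by (simp add: id_functor_def comp_functor_def)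
 next
  fix m assume m': "m \<in> arr E"
  then obtain F G where m: "m \<in> hom E F G" by (blast intro: arr_hom)
  note FG = E_hom_obj[OF m] note d = \<Delta>_hom[OF \<Gamma>_hom[OF m]]
  have "cmp E (ep G) (onarr \<Delta> (onarr \<Gamma> m)) = cmp E m (ep F)"
  proof (rule E_ext[OF E_cmp_hom[OF d ep[OF FG(2)]] E_cmp_hom[OF ep[OF FG(1)] m]])
   fix X x assume X: "X \<in> obj T" and x': "x \<in> onobj (const (onobj F T0)) X"
   then have x: "x \<in> onobj F T0" by simp
   show "cm (cmp E (ep G) (onarr \<Delta> (onarr \<Gamma> m))) X x = cm (cmp E m (ep F)) X x"
    using cm_cmp[OF d ep[OF FG(2)] X x'] cm_cmp[OF ep[OF FG(1)] m X x'] cm_ep[OF FG(1) X x]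
     cm_ep[OF FG(2) X cm_in[OF m T0 x]] cm_nat[OF m init[OF X] x] cm_\<Delta>[OF \<Gamma>_hom[OF m] X x] app_\<Gamma>[OF m x]
    by simp
  qed
  then show "cmp E (ep (tgt E m)) (onarr (comp_functor E \<Delta> \<Gamma>) m) = cmp E (onarr (id_functor E) m) (ep (src E m))"
   using m' homD[OF m] by (simp add: id_functor_def comp_functor_def)
 qed
 show "\<forall>A\<in>obj (Set_cat U). cmp E (ep (onobj \<Delta> A)) (onarr \<Delta> (\<eta> A)) = idn E (onobj \<Delta> A)"
 proof
  fix A :: "'u set" assume "A \<in> obj (Set_cat U)"
  then have A: "small U A" by simp
  have e: "ep (const A) \<in> hom E (const A) (const A)" using ep[OF const[OF A]] T0 by simp
  note d = \<Delta>_hom[OF Set_idn_hom[OF A]]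
  have "cmp E (ep (const A)) (onarr \<Delta> (idn (Set_cat U) A)) = idn E (const A)"
  proof (rule E_ext[OF E_cmp_hom[OF d e] E_idn_hom[OF const[OF A]]])
   fix X x assume X: "X \<in> obj T" and x: "x \<in> onobj (const A) X"
   then have "act (const A) (init X) x = x" using act_mk_sheaf[OF init[OF X], of x "\<lambda>_. A"] by simp
   then show "cm (cmp E (ep (const A)) (onarr \<Delta> (idn (Set_cat U) A))) X x = cm (idn E (const A)) X x"
    using X x cm_cmp[OF d e X x] cm_ep[OF const[OF A] X] T0 by (simp add: cm_\<Delta>[OF Set_idn_hom[OF A]])
  qed
  then show "cmp E (ep (onobj \<Delta> A)) (onarr \<Delta> (\<eta> A)) = idn E (onobj \<Delta> A)" using A by (simp add: \<eta>)
 qed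
 show "\<forall>F\<in>obj E. cmp (Set_cat U) (onarr \<Gamma> (ep F)) (\<eta> (onobj \<Gamma> F)) = idn (Set_cat U) (onobj \<Gamma> F)"
 proof
  fix F assume F: "F \<in> obj E"
  note sm = E_small[OF F T0]
  have g: "onarr \<Gamma> (ep F) \<in> hom (Set_cat U) (onobj F T0) (onobj F T0)" using \<Gamma>_hom[OF ep[OF F]] T0 by simp
  have "cmp (Set_cat U) (onarr \<Gamma> (ep F)) (idn (Set_cat U) (onobj F T0)) = idn (Set_cat U) (onobj F T0)"
  proof (rule Set_ext[OF Set_cmp_hom[OF Set_idn_hom[OF sm] g] Set_idn_hom[OF sm]])
   fix x assume x: "x \<in> onobj F T0"
   show "app (cmp (Set_cat U) (onarr \<Gamma> (ep F)) (idn (Set_cat U) (onobj F T0))) x = app (idn (Set_cat U) (onobj F T0)) x"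
    using app_Set_cmp[OF Set_idn_hom[OF sm] g x] x T0 cm_ep[OF F T0 x] init_eq[OF idn_hom[OF T0]] E_id[OF F T0 x]
    by (simp add: app_\<Gamma>[OF ep[OF F]])
  qed
  then show "cmp (Set_cat U) (onarr \<Gamma> (ep F)) (\<eta> (onobj \<Gamma> F)) = idn (Set_cat U) (onobj \<Gamma> F)"
   using F sm by (simp add: \<eta>)
 qed
qed

lemma \<Delta>_preserves_finite_limits: "preserves_finite_limits (Set_cat U) E \<Delta>"
 unfolding preserves_finite_limits_def
proof (intro allI impI)
 fix J :: "(nat, nat) cat" and G :: "(nat, nat, 'u set, 'u set_arr) fctr" and L p
 assume *: "category J \<and> finite (obj J) \<and> finite (arr J) \<and> is_functor J (Set_cat U) G \<and> is_limit J (Set_cat U) G L p"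
 then have J: "category J" and G: "is_functor J (Set_cat U) G" and lim: "is_limit J (Set_cat U) G L p" by auto
 interpret J: category J by fact
 have L: "small U L" and p: "\<And>j. j \<in> obj J ==> p j \<in> hom (Set_cat U) L (onobj G j)"
  and pu: "\<And>u. u \<in> arr J ==> cmp (Set_cat U) (onarr G u) (p (src J u)) = p (tgt J u)"
  using lim by (auto simp: is_limit_def is_cone_def)
 have Gj: "small U (onobj G j)" if "j \<in> obj J" for j using is_functorD(1)[OF G that] by simp
 have ob: "onobj (comp_functor J \<Delta> G) j = const (onobj G j)" if "j \<in> obj J" for j
  using that Gj by (simp add: comp_functor_def)
 have ar: "onarr (comp_functor J \<Delta> G) u = onarr \<Delta> (onarr G u)" if "u \<in> hom J j k" for u j k
  using that by (simp add: comp_functor_def hom_def)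
 have "is_limit J E (comp_functor J \<Delta> G) (const L) (\<lambda>j. onarr \<Delta> (p j))"
 proof (rule E_limitI[OF J is_functor_comp[OF G \<Delta>_functor J] const[OF L]])
  show "onarr \<Delta> (p j) \<in> hom E (const L) (onobj (comp_functor J \<Delta> G) j)" if "j \<in> obj J" for j
   using \<Delta>_hom[OF p[OF that]] ob[OF that] by simp
  fix u j k X x assume u: "u \<in> hom J j k" and X: "X \<in> obj T" and x': "x \<in> onobj (const L) X"
  have x: "x \<in> L" using X x' by simp
  note jk = J.hom_obj[OF u]
  show "cm (onarr (comp_functor J \<Delta> G) u) X (cm (onarr \<Delta> (p j)) X x) = cm (onarr \<Delta> (p k)) X x"
   using pu[OF homD(1)[OF u]] homD[OF u] ar[OF u] app_Set_cmp[OF p[OF jk(1)] is_functorD(2)[OF G u] x]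
    cm_\<Delta>[OF is_functorD(2)[OF G u] X Set_hom_app[OF p[OF jk(1)] x]] cm_\<Delta>[OF p[OF jk(1)] X x] cm_\<Delta>[OF p[OF jk(2)] X x]
   by simp
 next
  fix X t assume X: "X \<in> obj T" and t: "\<And>j. j \<in> obj J ==> t j \<in> onobj (onobj (comp_functor J \<Delta> G) j) X"
   and tu: "\<And>u j k. u \<in> hom J j k ==> cm (onarr (comp_functor J \<Delta> G) u) X (t j) = t k"
  have t': "t j \<in> onobj G j" if "j \<in> obj J" for j using t[OF that] ob[OF that] X by simp
  have "\<exists>!x. x \<in> L \<and> (\<forall>j\<in>obj J. app (p j) x = t j)"
  proof (rule Set_limitD[OF lim G J t'])
   fix u j k assume u: "u \<in> hom J j k"
   show "app (onarr G u) (t j) = t k"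
    using tu[OF u] ar[OF u] cm_\<Delta>[OF is_functorD(2)[OF G u] X t'[OF J.hom_obj(1)[OF u]]] by simp
  qed
  then show "\<exists>!x. x \<in> onobj (const L) X \<and> (\<forall>j\<in>obj J. cm (onarr \<Delta> (p j)) X x = t j)"
   using X cm_\<Delta>[OF p X] by (metis onobj_mk_sheaf)
 qed
 then show "is_limit J E (comp_functor J \<Delta> G) (onobj \<Delta> L) (\<lambda>j. onarr \<Delta> (p j))" using L by simp
qed

lemma geometric_morphism_\<Delta>: "geometric_morphism E (Set_cat U) \<Delta> \<Gamma>"
 by (simp add: geometric_morphism_def \<Delta>_\<Gamma>_adjunction \<Delta>_preserves_finite_limits)

text \<open>A morphism between constant sheaves is determined by its component at \<open>T0\<close>,
  since naturality along the initial arrows says that all components are the same function.\<close>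

theorem connected_topos_E: "connected_topos U E"
 unfolding connected_topos_def
proof (rule exI[of _ \<Delta>], rule exI[of _ \<Gamma>], intro conjI geometric_morphism_\<Delta>)
 show "fully_faithful (Set_cat U) E \<Delta>"
  unfolding fully_faithful_def
 proof (intro ballI)
  fix A B :: "'u set" assume "A \<in> obj (Set_cat U)" "B \<in> obj (Set_cat U)"
  then have A: "small U A" and B: "small U B" by auto
  have "bij_betw (onarr \<Delta>) (hom (Set_cat U) A B) (hom E (const A) (const B))"
   unfolding bij_betw_def
  proof
   show "inj_on (onarr \<Delta>) (hom (Set_cat U) A B)"
   proof (rule inj_onI)
    fix m n assume m: "m \<in> hom (Set_cat U) A B" and n: "n \<in> hom (Set_cat U) A B" and "onarr \<Delta> m = onarr \<Delta> n"
    then show "m = n" by (intro Set_ext[OF m n]) (metis cm_\<Delta> T0)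
   qed
   have "n \<in> onarr \<Delta> ` hom (Set_cat U) A B" if n: "n \<in> hom E (const A) (const B)" for n
   proof -
    define m where "m = mk_set A (cm n T0) B"
    have m: "m \<in> hom (Set_cat U) A B"
     unfolding m_def using cm_in[OF n T0] T0 by (intro mk_set_hom A B) auto
    have "n = onarr \<Delta> m"
    proof (rule E_ext[OF n \<Delta>_hom[OF m]])
     fix X x assume X: "X \<in> obj T" and "x \<in> onobj (const A) X"
     then have x: "x \<in> onobj (const A) T0" and x': "x \<in> A" using T0 by auto
     have "cm n T0 x \<in> B" using cm_in[OF n T0 x] T0 by simp
     then show "cm n X x = cm (onarr \<Delta> m) X x"
      using cm_nat[OF n init[OF X] x] act_mk_sheaf[OF init[OF X], of _ "\<lambda>_. A"] act_mk_sheaf[OF init[OF X], of _ "\<lambda>_. B"]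
       cm_\<Delta>[OF m X x'] x' by (simp add: m_def)
    qed
    then show ?thesis using m by blast
   qed
   then show "onarr \<Delta> ` hom (Set_cat U) A B = hom E (const A) (const B)" using \<Delta>_hom by blast
  qed
  then show "bij_betw (onarr \<Delta>) (hom (Set_cat U) A B) (hom E (onobj \<Delta> A) (onobj \<Delta> B))" using A B by simp
 qed
qed

text \<open>The crux is \<open>sub_act\<close>: for a relation from B to a constant sheaf, the set
  of elements related to b does not change when b moves along an arrow. Hence names of these sets in
  P form a natural map into the constant sheaf on P, although P was a power object only among
  sets.\<close>

theorem atomic_topos_E: "atomic_topos U E"
 unfolding atomic_topos_def logical_def
proof (rule exI[of _ \<Delta>], rule exI[of _ \<Gamma>], intro conjI geometric_morphism_\<Delta> \<Delta>_preserves_finite_limits allI impI)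
 interpret concS: concrete "Set_cat U :: ('u set, 'u set_arr) cat" "{()}" "\<lambda>A _. A" "\<lambda>m _. app m"
  by (rule concrete_Set)
 interpret concE: concrete E "obj T" onobj cm by (rule concrete_E)
 fix A P M :: "'u set" and m0 m1
 assume po: "is_power_object (Set_cat U) A P M m0 m1"
 then have relM: "is_relation (Set_cat U) P A M m0 m1" by (simp add: is_power_object_def)
 then have m0: "m0 \<in> hom (Set_cat U) M P" and m1: "m1 \<in> hom (Set_cat U) M A" by (auto simp: is_relation_def)
 note M_inj = concS.relation_inj[OF relM, of "()", simplified]
 have sm: "small U P" "small U A" "small U M" using m0 m1 by (auto simp: Set_hom_iff)
 note d0 = \<Delta>_hom[OF m0] and d1 = \<Delta>_hom[OF m1]
 have const_act: "act (const D) f x = x" if "f \<in> hom T X Y" "x \<in> D" for D f X Y x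
  using act_mk_sheaf[OF that(1), of x "\<lambda>_. D"] that(2) by simp
 have relD: "is_relation E (const P) (const A) (const M) (onarr \<Delta> m0) (onarr \<Delta> m1)"
  unfolding is_relation_def
 proof (intro conjI d0 d1 ballI impI)
  fix F s t assume s: "s \<in> hom E F (const M)" and t: "t \<in> hom E F (const M)"
   and eq: "cmp E (onarr \<Delta> m0) s = cmp E (onarr \<Delta> m0) t \<and> cmp E (onarr \<Delta> m1) s = cmp E (onarr \<Delta> m1) t"
  show "s = t"
  proof (rule E_ext[OF s t])
   fix X x assume X: "X \<in> obj T" and x: "x \<in> onobj F X"
   have sx: "cm s X x \<in> M" and tx: "cm t X x \<in> M" using cm_in[OF s X x] cm_in[OF t X x] X by auto
   have "app m0 (cm s X x) = app m0 (cm t X x)"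
    using cm_cmp[OF s d0 X x] cm_cmp[OF t d0 X x] conjunct1[OF eq] cm_\<Delta>[OF m0 X sx] cm_\<Delta>[OF m0 X tx] by metis
   moreover have "app m1 (cm s X x) = app m1 (cm t X x)"
    using cm_cmp[OF s d1 X x] cm_cmp[OF t d1 X x] conjunct2[OF eq] cm_\<Delta>[OF m1 X sx] cm_\<Delta>[OF m1 X tx] by metis
   ultimately show "cm s X x = cm t X x" by (rule M_inj[OF sx tx])
  qed
 qed
 have "is_power_object E (const A) (const P) (const M) (onarr \<Delta> m0) (onarr \<Delta> m1)"
  unfolding is_power_object_def
 proof (intro conjI relD allI impI)
  fix B R r0 r1 assume relR: "is_relation E B (const A) R r0 r1"
  then have r0: "r0 \<in> hom E R B" and r1: "r1 \<in> hom E R (const A)" by (auto simp: is_relation_def)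
  note R = E_hom_obj(1)[OF r0] and B = E_hom_obj(2)[OF r0]
  note R_inj = concE.relation_inj[OF relR]
  define sub where "sub X b = {a. \<exists>rh\<in>onobj R X. cm r0 X rh = b \<and> cm r1 X rh = a}" for X b
  have sub_A: "sub X b \<subseteq> A" if "X \<in> obj T" for X b
   using cm_in[OF r1 that] that by (auto simp: sub_def)
  have r1_act: "cm r1 Y (act R f rh) = cm r1 X rh" if f: "f \<in> hom T X Y" and "rh \<in> onobj R X" for f X Y rh
   using cm_nat[OF r1 that] const_act[OF f, of _ A] cm_in[OF r1 hom_obj(1)[OF f] that(2)] hom_obj[OF f] by simp
  have sub_act: "sub Y (act B f b) = sub X b" if f: "f \<in> hom T X Y" and b: "b \<in> onobj B X" for f X Y b
  proof
   note XY = hom_obj[OF f]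
   show "sub X b \<subseteq> sub Y (act B f b)"
    using cm_nat[OF r0 f] r1_act[OF f] E_act[OF R f] by (fastforce simp: sub_def)
   show "sub Y (act B f b) \<subseteq> sub X b"
   proof
    fix a assume "a \<in> sub Y (act B f b)"
    then obtain rh where rh: "rh \<in> onobj R Y" "cm r0 Y rh = act B f b" "cm r1 Y rh = a" by (auto simp: sub_def)
    \<comment> \<open>An element of R over \<open>act B f b\<close> descends along f: arrows merged
      by f send it to elements with the same two legs, which coincide by joint monicity.\<close>
    obtain rh' where rh': "rh' \<in> onobj R X" "act R f rh' = rh"
    proof (rule E_descent[OF R f rh(1)])
     fix Z g h assume g: "g \<in> hom T Y Z" and h: "h \<in> hom T Y Z" and gh: "g \<odot> f = h \<odot> f"
     show "act R g rh = act R h rh"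
     proof (rule R_inj[OF hom_obj(2)[OF g] E_act[OF R g rh(1)] E_act[OF R h rh(1)]])
      show "cm r0 Z (act R g rh) = cm r0 Z (act R h rh)"
       using cm_nat[OF r0 g rh(1)] cm_nat[OF r0 h rh(1)] rh(2) E_cmp[OF B f g b] E_cmp[OF B f h b] gh by simp
      show "cm r1 Z (act R g rh) = cm r1 Z (act R h rh)" using r1_act[OF g rh(1)] r1_act[OF h rh(1)] by simp
     qed
    qed
    have "act B f (cm r0 X rh') = act B f b" using cm_nat[OF r0 f rh'(1)] rh' rh by simp
    then have "cm r0 X rh' = b" by (rule E_inj[OF B f cm_in[OF r0 XY(1) rh'(1)] b])
    then show "a \<in> sub X b" using rh' r1_act[OF f rh'(1)] rh(3) by (auto simp: sub_def)
   qed
  qed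
  define c where "c X b = (THE p. p \<in> P \<and> subset_at M m0 m1 p = sub X b)" for X b
  have c: "c X b \<in> P" "subset_at M m0 m1 (c X b) = sub X b" if "X \<in> obj T" for X b
   using theI'[OF Set_power_object[OF po sub_A[OF that, of b]]] by (auto simp: c_def)
  have c_eq: "p = c X b" if "X \<in> obj T" "p \<in> P" "subset_at M m0 m1 p = sub X b" for X b p
   using Set_power_object[OF po sub_A[OF that(1), of b]] c[OF that(1), of b] that(2,3) by metis
  have \<chi>: "mk_hom B c (const P) \<in> hom E B (const P)"
  proof (rule mk_hom[OF B const[OF sm(1)]])
   show "c X b \<in> onobj (const P) X" if "X \<in> obj T" for X b using c[OF that] that by simp
   fix f X Y b assume f: "f \<in> hom T X Y" and b: "b \<in> onobj B X"
   show "c Y (act B f b) = act (const P) f (c X b)"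
    using const_act[OF f c(1)[OF hom_obj(1)[OF f]]] sub_act[OF f b] by (simp add: c_def)
  qed
  show "\<exists>!\<chi>. \<chi> \<in> hom E B (const P) \<and> pulled_back_relation E B (const A) \<chi> (const M) (onarr \<Delta> m0) (onarr \<Delta> m1) R r0 r1"
  proof (rule ex1I[of _ "mk_hom B c (const P)"], rule conjI[OF \<chi>])
   \<comment> \<open>Membership in the set named by \<open>c X (cm r0 X rh)\<close> provides this
     element of M, and joint monicity of the legs of M makes it unique.\<close>
   define k where "k X rh = (THE \<mu>. \<mu> \<in> M \<and> app m0 \<mu> = c X (cm r0 X rh) \<and> app m1 \<mu> = cm r1 X rh)" for X rh
   have k: "k X rh \<in> M \<and> app m0 (k X rh) = c X (cm r0 X rh) \<and> app m1 (k X rh) = cm r1 X rh"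
    if X: "X \<in> obj T" and rh: "rh \<in> onobj R X" for X rh
    unfolding k_def
   proof (rule theI')
    have "cm r1 X rh \<in> subset_at M m0 m1 (c X (cm r0 X rh))" unfolding c(2)[OF X] using rh by (auto simp: sub_def)
    then show "\<exists>!\<mu>. \<mu> \<in> M \<and> app m0 \<mu> = c X (cm r0 X rh) \<and> app m1 \<mu> = cm r1 X rh"
     using M_inj by (auto simp: subset_at_def)
   qed
   have K: "mk_hom R k (const M) \<in> hom E R (const M)"
   proof (rule mk_hom[OF R const[OF sm(3)]])
    show "k X rh \<in> onobj (const M) X" if "X \<in> obj T" "rh \<in> onobj R X" for X rh using k[OF that] that by simp
    fix f X Y rh assume f: "f \<in> hom T X Y" and rh: "rh \<in> onobj R X"
    note XY = hom_obj[OF f]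
    have "k Y (act R f rh) = k X rh"
    proof (rule M_inj)
     show "app m0 (k Y (act R f rh)) = app m0 (k X rh)"
      using k[OF XY(1) rh] k[OF XY(2) E_act[OF R f rh]] cm_nat[OF r0 f rh] sub_act[OF f cm_in[OF r0 XY(1) rh]]
      by (simp add: c_def)
     show "app m1 (k Y (act R f rh)) = app m1 (k X rh)"
      using k[OF XY(1) rh] k[OF XY(2) E_act[OF R f rh]] r1_act[OF f rh] by simp
    qed (use k[OF XY(1) rh] k[OF XY(2) E_act[OF R f rh]] in auto)
    then show "k Y (act R f rh) = act (const M) f (k X rh)" using const_act[OF f] k[OF XY(1) rh] by simp
   qed
   show "pulled_back_relation E B (const A) (mk_hom B c (const P)) (const M) (onarr \<Delta> m0) (onarr \<Delta> m1) R r0 r1"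
    unfolding pulled_back_relation_def
   proof (intro bexI[OF _ K] conjI ballI impI)
    show "cmp E (onarr \<Delta> m0) (mk_hom R k (const M)) = cmp E (mk_hom B c (const P)) r0"
    proof (rule E_ext[OF E_cmp_hom[OF K d0] E_cmp_hom[OF r0 \<chi>]])
     fix X rh assume X: "X \<in> obj T" and rh: "rh \<in> onobj R X"
     show "cm (cmp E (onarr \<Delta> m0) (mk_hom R k (const M))) X rh = cm (cmp E (mk_hom B c (const P)) r0) X rh"
      using cm_cmp[OF K d0 X rh] cm_cmp[OF r0 \<chi> X rh] k[OF X rh] X rh cm_in[OF r0 X rh] cm_\<Delta>[OF m0 X] by simp
    qed
    show "cmp E (onarr \<Delta> m1) (mk_hom R k (const M)) = r1"
    proof (rule E_ext[OF E_cmp_hom[OF K d1] r1])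
     fix X rh assume X: "X \<in> obj T" and rh: "rh \<in> onobj R X"
     show "cm (cmp E (onarr \<Delta> m1) (mk_hom R k (const M))) X rh = cm r1 X rh"
      using cm_cmp[OF K d1 X rh] k[OF X rh] X rh cm_\<Delta>[OF m1 X] by simp
    qed
    fix F t0 t1 t assume F: "F \<in> obj E" and t0: "t0 \<in> hom E F B" and t1: "t1 \<in> hom E F (const A)"
     and t: "t \<in> hom E F (const M)"
     and h: "cmp E (onarr \<Delta> m0) t = cmp E (mk_hom B c (const P)) t0 \<and> cmp E (onarr \<Delta> m1) t = t1"
    have tM: "cm t X x \<in> M" if "X \<in> obj T" "x \<in> onobj F X" for X x using cm_in[OF t that] that by simp
    have h0: "app m0 (cm t X x) = c X (cm t0 X x)" if "X \<in> obj T" "x \<in> onobj F X" for X x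
     using h cm_cmp[OF t d0 that] cm_cmp[OF t0 \<chi> that] cm_in[OF t0 that] tM[OF that] cm_\<Delta>[OF m0] that by simp
    have h1: "app m1 (cm t X x) = cm t1 X x" if "X \<in> obj T" "x \<in> onobj F X" for X x
     using h cm_cmp[OF t d1 that] tM[OF that] cm_\<Delta>[OF m1] that by simp
    define n where "n X x = (THE rh. rh \<in> onobj R X \<and> cm r0 X rh = cm t0 X x \<and> cm r1 X rh = cm t1 X x)" for X x
    have n: "n X x \<in> onobj R X \<and> cm r0 X (n X x) = cm t0 X x \<and> cm r1 X (n X x) = cm t1 X x"
     if X: "X \<in> obj T" and x: "x \<in> onobj F X" for X x
     unfolding n_def
    proof (rule theI')
     have "cm t1 X x \<in> subset_at M m0 m1 (c X (cm t0 X x))"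
      using h0[OF X x] h1[OF X x] tM[OF X x] by (auto simp: subset_at_def)
     then show "\<exists>!rh. rh \<in> onobj R X \<and> cm r0 X rh = cm t0 X x \<and> cm r1 X rh = cm t1 X x"
      unfolding c(2)[OF X] using R_inj[OF X] by (auto simp: sub_def)
    qed
    have N: "mk_hom F n R \<in> hom E F R"
    proof (rule mk_hom[OF F R])
     show "n X x \<in> onobj R X" if "X \<in> obj T" "x \<in> onobj F X" for X x using n[OF that] by simp
     fix f X Y x assume f: "f \<in> hom T X Y" and x: "x \<in> onobj F X"
     note XY = hom_obj[OF f] note nx = n[OF XY(1) x] and ny = n[OF XY(2) E_act[OF F f x]]
     show "n Y (act F f x) = act R f (n X x)"
     proof (rule R_inj[OF XY(2)])
      show "cm r0 Y (n Y (act F f x)) = cm r0 Y (act R f (n X x))"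
       using nx ny cm_nat[OF r0 f] cm_nat[OF t0 f x] by simp
      show "cm r1 Y (n Y (act F f x)) = cm r1 Y (act R f (n X x))"
       using nx ny r1_act[OF f] cm_nat[OF t1 f x] const_act[OF f] cm_in[OF t1 XY(1) x] XY by simp
     qed (use ny nx E_act[OF R f] in auto)
    qed
    show "\<exists>!n. n \<in> hom E F R \<and> cmp E r0 n = t0 \<and> cmp E r1 n = t1 \<and> cmp E (mk_hom R k (const M)) n = t"
    proof (rule ex1I[of _ "mk_hom F n R"], intro conjI N)
     show "cmp E r0 (mk_hom F n R) = t0"
      by (rule E_ext[OF E_cmp_hom[OF N r0] t0]) (simp add: cm_cmp[OF N r0] n)
     show "cmp E r1 (mk_hom F n R) = t1"
      by (rule E_ext[OF E_cmp_hom[OF N r1] t1]) (simp add: cm_cmp[OF N r1] n)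
     show "cmp E (mk_hom R k (const M)) (mk_hom F n R) = t"
     proof (rule E_ext[OF E_cmp_hom[OF N K] t])
      fix X x assume X: "X \<in> obj T" and x: "x \<in> onobj F X"
      note nx = n[OF X x]
      have "k X (n X x) = cm t X x"
       by (rule M_inj) (use k[OF X, of "n X x"] nx h0[OF X x] h1[OF X x] tM[OF X x] in auto)
      then show "cm (cmp E (mk_hom R k (const M)) (mk_hom F n R)) X x = cm t X x"
       using cm_cmp[OF N K X x] nx X x by simp
     qed
     fix l assume l: "l \<in> hom E F R \<and> cmp E r0 l = t0 \<and> cmp E r1 l = t1 \<and> cmp E (mk_hom R k (const M)) l = t"
     then have l': "l \<in> hom E F R" by simp
     show "l = mk_hom F n R"
     proof (rule E_ext[OF l' N])
      fix X x assume X: "X \<in> obj T" and x: "x \<in> onobj F X"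
      have "cm r0 X (cm l X x) = cm t0 X x" "cm r1 X (cm l X x) = cm t1 X x"
       using cm_cmp[OF l' r0 X x] cm_cmp[OF l' r1 X x] l by auto
      then have "cm l X x = n X x"
       using R_inj[OF X cm_in[OF l' X x], of "n X x"] n[OF X x] by metis
      then show "cm l X x = cm (mk_hom F n R) X x" using X x by simp
     qed
    qed
   qed
  next
   fix \<chi>' assume "\<chi>' \<in> hom E B (const P) \<and> pulled_back_relation E B (const A) \<chi>' (const M) (onarr \<Delta> m0) (onarr \<Delta> m1) R r0 r1"
   then have \<chi>': "\<chi>' \<in> hom E B (const P)"
    and pb: "pulled_back_relation E B (const A) \<chi>' (const M) (onarr \<Delta> m0) (onarr \<Delta> m1) R r0 r1" by auto
   show "\<chi>' = mk_hom B c (const P)"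
   proof (rule E_ext[OF \<chi>' \<chi>])
    fix X b assume X: "X \<in> obj T" and b: "b \<in> onobj B X"
    have "subset_at M m0 m1 (cm \<chi>' X b) = sub X b"
     using concE.pulled_back_elements[OF pb relR d0 d1 \<chi>' X b] X cm_\<Delta>[OF m0 X] cm_\<Delta>[OF m1 X]
     by (auto simp: subset_at_def sub_def)
    then show "cm \<chi>' X b = cm (mk_hom B c (const P)) X b"
     using c_eq[OF X] cm_in[OF \<chi>' X b] X b by simp
   qed
  qed
 qed
 then show "is_power_object E (onobj \<Delta> A) (onobj \<Delta> P) (onobj \<Delta> M) (onarr \<Delta> m0) (onarr \<Delta> m1)"
  using sm by simp
qed

end

section \<open>The equivalence with sheaves on a small skeleton\<close>

section \<open>Restriction to a small site\<close>

text \<open>A topology is a total function constrained only at objects, and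
  \<open>atomic_topology\<close> is computed only there.\<close>

lemma grothendieck_topology_cong:
 assumes "category C" and eq: "\<And>X. X \<in> obj C ==> J' X = J X" and J: "grothendieck_topology C J"
 shows "grothendieck_topology C J'"
 unfolding grothendieck_topology_def
proof (intro conjI ballI allI impI)
 interpret category C by fact
 note J' = J[unfolded grothendieck_topology_def]
 fix X assume X: "X \<in> obj C"
 show "{f \<in> arr C. tgt C f = X} \<in> J' X" using X eq J' by simp
 fix R assume R: "R \<in> J' X"
 then show sv: "sieve C X R" using X eq J' by simp
 fix Q assume Q: "sieve C X Q \<and> (\<forall>f\<in>R. pullback_sieve C f Q \<in> J' (src C f))"
 have "pullback_sieve C f Q \<in> J (src C f)" if f: "f \<in> R" for f
 proof -
  have "f \<in> arr C" using f sv by (auto simp: sieve_def)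
  then show ?thesis using conjunct2[OF Q, rule_format, OF f] eq[OF src_obj] by metis
 qed
 moreover have "R \<in> J X" using R X eq by simp
 ultimately have "Q \<in> J X" using J' X Q by blast
 then show "Q \<in> J' X" using X eq by simp
next
 interpret category C by fact
 fix f R assume f: "f \<in> arr C" and "R \<in> J' (tgt C f)"
 then show "pullback_sieve C f R \<in> J' (src C f)"
  using J eq[OF src_obj] eq[OF tgt_obj] unfolding grothendieck_topology_def by simp
qed

lemma (in amalgamation_category) grothendieck_topology_atomic:
 "grothendieck_topology (opp T) (atomic_topology (opp T))"
 by (rule grothendieck_topology_cong[OF category_opp[OF category_axioms] _ nonempty_sieves_topology])
  (simp add: atomic_topology_eq)

text \<open>The hypotheses of the comparison lemma in atomic form: K is fully faithful, and every
  object of D has an arrow into its image. Having such functors in both directions between T and its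
  skeleton avoids any extension of sheaves; restriction alone gives both halves of the
  equivalence.\<close>

locale dense_functor =
 C: amalgamation_category U C + D: amalgamation_category U D
 for U :: "'u itself" and C :: "('o, 'a) cat" and D :: "('p, 'b) cat" +
 fixes K :: "('o, 'a, 'p, 'b) fctr"
 assumes K: "is_functor C D K"
  and full: "X \<in> obj C ==> Y \<in> obj C ==> h \<in> hom D (onobj K X) (onobj K Y) ==> \<exists>f\<in>hom C X Y. onarr K f = h"
  and faithful: "f \<in> hom C X Y ==> g \<in> hom C X Y ==> onarr K f = onarr K g ==> f = g"
  and dense: "Z \<in> obj D ==> \<exists>X\<in>obj C. hom D Z (onobj K X) \<noteq> {}"
begin

abbreviation restr :: "('p, 'b, 'u) presheaf => ('o, 'a, 'u) presheaf" where
 "restr F \<equiv> comp_functor C F K"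

lemma act_restr: "f \<in> arr C ==> act (restr F) f = act F (onarr K f)"
 by (simp add: comp_functor_def)

lemma onobj_restr: "X \<in> obj C ==> onobj (restr F) X = onobj F (onobj K X)"
 by (simp add: comp_functor_def)

text \<open>Descent in D quantifies over pairs with arbitrary target. An arrow w moves the target
  into the image of K, fullness and faithfulness turn the pair into one of C, and injectivity of the
  action of w removes it again.\<close>

lemma restr: assumes F: "F \<in> obj D.E" shows "restr F \<in> obj C.E"
 unfolding C.E_obj_iff
proof
 show "is_functor C (Set_cat U) (restr F)" by (rule is_functor_comp[OF K D.E_functor[OF F] C.category_axioms])
 show "C.descent (restr F)"
  unfolding C.descent_def
 proof (intro allI ballI conjI impI)
  fix X Y f assume f: "f \<in> hom C X Y"
  note XY = C.hom_obj[OF f] note Kf = is_functorD(2)[OF K f] and fC = homD(1)[OF f]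
  show "inj_on (act (restr F) f) (onobj (restr F) X)"
   by (rule inj_onI) (use D.E_inj[OF F Kf] in \<open>simp add: act_restr[OF fC] onobj_restr[OF XY(1)]\<close>)
  fix y assume y: "y \<in> onobj (restr F) Y" and gh: "\<forall>Z. \<forall>g\<in>hom C Y Z. \<forall>h\<in>hom C Y Z.
   cmp C g f = cmp C h f --> act (restr F) g y = act (restr F) h y"
  have y': "y \<in> onobj F (onobj K Y)" using y XY by (simp add: onobj_restr)
  obtain x where x: "x \<in> onobj F (onobj K X)" "act F (onarr K f) x = y"
  proof (rule D.E_descent[OF F Kf y'])
   fix Z g h assume g: "g \<in> hom D (onobj K Y) Z" and h: "h \<in> hom D (onobj K Y) Z"
    and eq: "cmp D g (onarr K f) = cmp D h (onarr K f)"
   obtain W w where W: "W \<in> obj C" and w: "w \<in> hom D Z (onobj K W)" using dense[OF D.hom_obj(2)[OF g]] by blast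
   obtain g' h' where g': "g' \<in> hom C Y W" "onarr K g' = cmp D w g" and h': "h' \<in> hom C Y W" "onarr K h' = cmp D w h"
    using full[OF XY(2) W D.cmp_hom[OF g w]] full[OF XY(2) W D.cmp_hom[OF h w]] by blast
   have "onarr K (cmp C g' f) = onarr K (cmp C h' f)"
    using is_functorD(4)[OF K f g'(1)] is_functorD(4)[OF K f h'(1)] g' h' eq
     D.cmp_assoc[OF Kf g w] D.cmp_assoc[OF Kf h w] by simp
   then have "cmp C g' f = cmp C h' f" by (rule faithful[OF C.cmp_hom[OF f g'(1)] C.cmp_hom[OF f h'(1)]])
   then have "act (restr F) g' y = act (restr F) h' y" using gh g'(1) h'(1) by blast
   then have "act F w (act F g y) = act F w (act F h y)"
    using D.E_cmp[OF F g w y'] D.E_cmp[OF F h w y'] g' h' homD(1)[OF g'(1)] homD(1)[OF h'(1)]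
    by (simp add: act_restr)
   then show "act F g y = act F h y" by (rule D.E_inj[OF F w D.E_act[OF F g y'] D.E_act[OF F h y']])
  qed
  then show "\<exists>x\<in>onobj (restr F) X. act (restr F) f x = y"
   using XY by (auto simp: act_restr[OF fC] onobj_restr)
 qed
qed

definition Restr where
 "Restr = \<lparr>onobj = (\<lambda>F\<in>obj D.E. restr F),
   onarr = (\<lambda>m\<in>arr D.E. C.mk_hom (restr (src D.E m)) (\<lambda>X. cm m (onobj K X)) (restr (tgt D.E m)))\<rparr>"

lemma Restr_obj [simp]: "F \<in> obj D.E ==> onobj Restr F = restr F"
 by (simp add: Restr_def)

lemma Restr_arr: "m \<in> hom D.E F G ==> onarr Restr m = C.mk_hom (restr F) (\<lambda>X. cm m (onobj K X)) (restr G)"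
 by (auto simp: Restr_def hom_def)

lemma Restr_hom:
 assumes m: "m \<in> hom D.E F G"
 shows "onarr Restr m \<in> hom C.E (restr F) (restr G)"
 unfolding Restr_arr[OF m]
proof (rule C.mk_hom)
 show "restr F \<in> obj C.E" "restr G \<in> obj C.E" using restr D.E_hom_obj[OF m] by auto
 show "cm m (onobj K X) x \<in> onobj (restr G) X" if "X \<in> obj C" "x \<in> onobj (restr F) X" for X x
  using that D.cm_in[OF m is_functorD(1)[OF K that(1)]] by (simp add: onobj_restr)
 fix f X Y x assume f: "f \<in> hom C X Y" and x: "x \<in> onobj (restr F) X"
 then show "cm m (onobj K Y) (act (restr F) f x) = act (restr G) f (cm m (onobj K X) x)"
  using D.cm_nat[OF m is_functorD(2)[OF K f]] C.hom_obj[OF f] homD[OF f] by (simp add: onobj_restr act_restr)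
qed

lemma cm_Restr: "m \<in> hom D.E F G ==> X \<in> obj C ==> x \<in> onobj F (onobj K X) ==> cm (onarr Restr m) X x = cm m (onobj K X) x"
 by (simp add: Restr_arr onobj_restr)

lemma Restr_functor: "is_functor D.E C.E Restr"
proof (rule is_functorI)
 show "onobj Restr \<in> extensional (obj D.E)" "onarr Restr \<in> extensional (arr D.E)" by (auto simp: Restr_def)
 show "onobj Restr F \<in> obj C.E" if "F \<in> obj D.E" for F using restr[OF that] that by simp
 show "onarr Restr m \<in> hom C.E (onobj Restr F) (onobj Restr G)" if "m \<in> hom D.E F G" for m F G
  using Restr_hom[OF that] D.E_hom_obj[OF that] by simp
 show "onarr Restr (idn D.E F) = idn C.E (onobj Restr F)" if F: "F \<in> obj D.E" for F
  unfolding Restr_obj[OF F]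
  by (rule C.E_ext[OF Restr_hom[OF D.E_idn_hom[OF F]] C.E_idn_hom[OF restr[OF F]]])
   (simp add: cm_Restr[OF D.E_idn_hom[OF F]] onobj_restr is_functorD(1)[OF K])
 show "onarr Restr (cmp D.E n m) = cmp C.E (onarr Restr n) (onarr Restr m)"
  if m: "m \<in> hom D.E F G" and n: "n \<in> hom D.E G H" for m n F G H
  by (rule C.E_ext[OF Restr_hom[OF D.E_cmp_hom[OF m n]] C.E_cmp_hom[OF Restr_hom[OF m] Restr_hom[OF n]]])
   (simp add: cm_Restr[OF D.E_cmp_hom[OF m n]] C.cm_cmp[OF Restr_hom[OF m] Restr_hom[OF n]] onobj_restr
    cm_Restr[OF m] cm_Restr[OF n] D.cm_cmp[OF m n] D.cm_in[OF m] is_functorD(1)[OF K])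
qed

end

context site
begin

text \<open>C is the full subcategory on S written with universe elements. K decodes it, R sends X
  to the code of \<open>r X\<close>, and restriction along K and along R are the two halves of the
  equivalence.\<close>

theorem grothendieck_topos_E: "grothendieck_topos U E"
proof -
 define A where "A = (\<Union>X\<in>S. \<Union>Y\<in>S. hom T X Y)"
 have A: "f \<in> A" if "f \<in> hom T X Y" "X \<in> S" "Y \<in> S" for f X Y using that by (auto simp: A_def)
 have AD: "\<exists>X\<in>S. \<exists>Y\<in>S. f \<in> hom T X Y" if "f \<in> A" for f using that by (auto simp: A_def)
 have sA: "small U A" unfolding A_def by (intro small_UN small_S small_hom S_obj)
 obtain dl :: "'o => 'u" where dl: "inj_on dl S" using small_S by (rule small_embed)
 obtain ep :: "'a => 'u" where ep: "inj_on ep A" using sA by (rule small_embed)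
 define dl' where "dl' = the_inv_into S dl"
 define ep' where "ep' = the_inv_into A ep"
 have dl'[simp]: "dl' (dl X) = X" if "X \<in> S" for X using that by (simp add: dl'_def the_inv_into_f_f[OF dl])
 have ep'[simp]: "ep' (ep f) = f" if "f \<in> A" for f using that by (simp add: ep'_def the_inv_into_f_f[OF ep])
 define C where "C = \<lparr>obj = dl ` S, arr = ep ` A, src = (\<lambda>a. dl (src T (ep' a))), tgt = (\<lambda>a. dl (tgt T (ep' a))),
  idn = (\<lambda>x. ep (idn T (dl' x))), cmp = (\<lambda>g f. ep (cmp T (ep' g) (ep' f)))\<rparr>"
 have homC: "a \<in> hom C x y \<longleftrightarrow> (\<exists>X\<in>S. \<exists>Y\<in>S. \<exists>f\<in>hom T X Y. x = dl X \<and> y = dl Y \<and> a = ep f)" for a x y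
 proof
  assume "a \<in> hom C x y"
  then obtain f where f: "f \<in> A" "a = ep f" "x = dl (src T f)" "y = dl (tgt T f)"
   by (auto simp: hom_def C_def)
  then show "\<exists>X\<in>S. \<exists>Y\<in>S. \<exists>f\<in>hom T X Y. x = dl X \<and> y = dl Y \<and> a = ep f"
   using AD[OF f(1)] by (auto simp: hom_def)
 next
  assume "\<exists>X\<in>S. \<exists>Y\<in>S. \<exists>f\<in>hom T X Y. x = dl X \<and> y = dl Y \<and> a = ep f"
  then obtain X Y f where "X \<in> S" "Y \<in> S" "f \<in> hom T X Y" "x = dl X" "y = dl Y" "a = ep f" by blast
  then show "a \<in> hom C x y" using A[of f X Y] by (auto simp: hom_def C_def)
 qed
 have cmpC: "cmp C (ep g) (ep f) = ep (g \<odot> f)" if "f \<in> A" "g \<in> A" for f g using that by (simp add: C_def)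
 have idnC: "idn C (dl X) = ep (idn T X)" if "X \<in> S" for X using that by (simp add: C_def)
 have objC: "obj C = dl ` S" by (simp add: C_def)
 have homCE: thesis if "a \<in> hom C x y" "\<And>X Y f. X \<in> S ==> Y \<in> S ==> f \<in> hom T X Y ==> x = dl X ==> y = dl Y ==> a = ep f ==> f \<in> A ==> thesis" for a x y thesis
  using that A unfolding homC by blast
 have homCE': thesis if "a \<in> hom C (dl X) y" "X \<in> S" "\<And>Y f. Y \<in> S ==> f \<in> hom T X Y ==> y = dl Y ==> a = ep f ==> f \<in> A ==> thesis" for a X y thesis
  using that A inj_onD[OF dl] unfolding homC by metis
 have homCI: "ep f \<in> hom C (dl X) (dl Y)" if "X \<in> S" "Y \<in> S" "f \<in> hom T X Y" for X Y f using that homC by blast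
 have catC: "category C"
 proof
  fix f assume "f \<in> arr C"
  then have "f \<in> hom C (src C f) (tgt C f)" by (rule arr_hom)
  then show "src C f \<in> obj C" "tgt C f \<in> obj C" unfolding homC objC by auto
 next
  fix X assume "X \<in> obj C" then show "idn C X \<in> hom C X X" using idn_hom S_obj idnC homCI by (auto simp: objC)
 next
  fix f g X Y Z assume f: "f \<in> hom C X Y" and g: "g \<in> hom C Y Z"
  from f show "cmp C g f \<in> hom C X Z"
  proof (rule homCE)
   fix X' Y' f' assume f': "X' \<in> S" "Y' \<in> S" "f' \<in> hom T X' Y'" "X = dl X'" "Y = dl Y'" "f = ep f'" "f' \<in> A"
   from g[unfolded f'] f'(2) show ?thesis
    by (rule homCE') (use f' cmpC homCI cmp_hom in auto)
  qed
 next
  fix f X Y assume "f \<in> hom C X Y"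
  then show "cmp C f (idn C X) = f" "cmp C (idn C Y) f = f"
   by (rule homCE, use idnC cmpC A[OF idn_hom] S_obj cmp_idn_left cmp_idn_right in simp)+
 next
  fix f g h W X Y Z assume f: "f \<in> hom C W X" and g: "g \<in> hom C X Y" and h: "h \<in> hom C Y Z"
  from f show "cmp C h (cmp C g f) = cmp C (cmp C h g) f"
  proof (rule homCE)
   fix W' X' f' assume f': "W' \<in> S" "X' \<in> S" "f' \<in> hom T W' X'" "W = dl W'" "X = dl X'" "f = ep f'" "f' \<in> A"
   from g[unfolded f'] f'(2) show ?thesis
   proof (rule homCE')
    fix Y' g' assume g': "Y' \<in> S" "g' \<in> hom T X' Y'" "Y = dl Y'" "g = ep g'" "g' \<in> A"
    from h[unfolded g'] g'(1) show ?thesis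
     by (rule homCE') (simp add: f' g' cmpC A[OF cmp_hom[OF f'(3) g'(2)]] A[OF cmp_hom[OF g'(2)]] assoc[OF f'(3) g'(2)])
   qed
  qed
 qed
 interpret C: amalgamation_category U C
 proof (intro amalgamation_category.intro catC universe_axioms amalgamation_category_axioms.intro)
  fix f f' X Y Y' assume f: "f \<in> hom C X Y" and f': "f' \<in> hom C X Y'"
  from f show "\<exists>Z. \<exists>g\<in>hom C Y Z. \<exists>g'\<in>hom C Y' Z. cmp C g f = cmp C g' f'"
  proof (rule homCE)
   fix X0 Y0 f0 assume f0: "X0 \<in> S" "Y0 \<in> S" "f0 \<in> hom T X0 Y0" "X = dl X0" "Y = dl Y0" "f = ep f0" "f0 \<in> A"
   from f'[unfolded f0] f0(1) show ?thesis
   proof (rule homCE')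
    fix Y1 f1 assume f1: "Y1 \<in> S" "f1 \<in> hom T X0 Y1" "Y' = dl Y1" "f' = ep f1" "f1 \<in> A"
    obtain Z g g' where g: "g \<in> hom T Y0 Z" "g' \<in> hom T Y1 Z" "g \<odot> f0 = g' \<odot> f1"
     using amalgamation[OF f0(3) f1(2)] by blast
    note Z = hom_obj(2)[OF g(1)] note p = \<phi>[OF Z]
    note pg = cmp_hom[OF g(1) p] cmp_hom[OF g(2) p]
    have "cmp C (ep (\<phi> Z \<odot> g)) f = cmp C (ep (\<phi> Z \<odot> g')) f'"
     using f0 f1 cmpC A[OF pg(1) f0(2) r[OF Z]] A[OF pg(2) f1(1) r[OF Z]]
      assoc[OF f0(3) g(1) p] assoc[OF f1(2) g(2) p] g(3) by simp
    then show ?thesis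
     using homCI[OF f0(2) r[OF Z] pg(1)] homCI[OF f1(1) r[OF Z] pg(2)] f0 f1 by blast
   qed
  qed
 qed
 define K where "K = \<lparr>onobj = (\<lambda>x\<in>obj C. dl' x), onarr = (\<lambda>a\<in>arr C. ep' a)\<rparr>"
 have Ko: "onobj K (dl X) = X" if "X \<in> S" for X using that by (simp add: K_def objC)
 have Ka: "onarr K (ep f) = f" if "f \<in> A" for f using that by (simp add: K_def C_def)
 define R where "R = \<lparr>onobj = (\<lambda>X\<in>obj T. dl (r X)), onarr = (\<lambda>f\<in>arr T. ep (\<phi> (tgt T f) \<odot> (f \<odot> \<psi> (src T f))))\<rparr>"
 have Ro: "onobj R X = dl (r X)" if "X \<in> obj T" for X using that by (simp add: R_def)
 \<comment> \<open>Arrows are conjugated into the skeleton. Functoriality, fullness and faithfulness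
   of R all follow from \<open>rh X Y f\<close> being the only arrow that forms a commutative square
   with f and the \<open>\<phi>\<close>.\<close>
 define rh where "rh X Y f = \<phi> Y \<odot> (f \<odot> \<psi> X)" for X Y f
 have rh: "rh X Y f \<in> hom T (r X) (r Y)" if f: "f \<in> hom T X Y" for X Y f
  unfolding rh_def using cmp_hom[OF cmp_hom[OF \<psi> f] \<phi>] hom_obj[OF f] by blast
 have rhA: "rh X Y f \<in> A" if f: "f \<in> hom T X Y" for X Y f using A[OF rh[OF f]] r hom_obj[OF f] by blast
 have Ra: "onarr R f = ep (rh X Y f)" if "f \<in> hom T X Y" for f X Y using that by (simp add: R_def rh_def hom_def)
 have rh_\<phi>: "rh X Y f \<odot> \<phi> X = \<phi> Y \<odot> f" if f: "f \<in> hom T X Y" for X Y f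
 proof -
  note X = hom_obj(1)[OF f] and Y = hom_obj(2)[OF f]
  have "rh X Y f \<odot> \<phi> X = \<phi> Y \<odot> ((f \<odot> \<psi> X) \<odot> \<phi> X)"
   unfolding rh_def by (rule assoc[OF \<phi>[OF X] cmp_hom[OF \<psi>[OF X] f] \<phi>[OF Y], symmetric])
  also have "(f \<odot> \<psi> X) \<odot> \<phi> X = f"
   using assoc[OF \<phi>[OF X] \<psi>[OF X] f] \<psi>\<phi>[OF X] cmp_idn_right[OF f] by simp
  finally show ?thesis .
 qed
 have \<phi>_epi: "f = g" if "f \<in> hom T (r X) Y" "g \<in> hom T (r X) Y" "f \<odot> \<phi> X = g \<odot> \<phi> X" "X \<in> obj T" for f g X Y
  using assoc[OF \<psi>[OF that(4)] \<phi>[OF that(4)] that(1)] assoc[OF \<psi>[OF that(4)] \<phi>[OF that(4)] that(2)] that(3)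
   \<phi>\<psi>[OF that(4)] cmp_idn_right[OF that(1)] cmp_idn_right[OF that(2)] by metis
 have \<phi>_mono: "f = g" if "f \<in> hom T X Y" "g \<in> hom T X Y" "\<phi> Y \<odot> f = \<phi> Y \<odot> g" "Y \<in> obj T" for f g X Y
  using assoc[OF that(1) \<phi>[OF that(4)] \<psi>[OF that(4)]] assoc[OF that(2) \<phi>[OF that(4)] \<psi>[OF that(4)]] that(3)
   \<psi>\<phi>[OF that(4)] cmp_idn_left[OF that(1)] cmp_idn_left[OF that(2)] by metis
 have rh_eq: "f' = rh X Y f" if f: "f \<in> hom T X Y" and f': "f' \<in> hom T (r X) (r Y)" "f' \<odot> \<phi> X = \<phi> Y \<odot> f" for f f' X Y
  by (rule \<phi>_epi[OF f'(1) rh[OF f] _ hom_obj(1)[OF f]]) (simp add: f' rh_\<phi>[OF f])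
 have rh_S: "rh X Y f = f" if f: "f \<in> hom T X Y" and XY: "X \<in> S" "Y \<in> S" for X Y f
  using rh_eq[OF f, of f] f r_S XY \<phi>_S cmp_idn_left[OF f] cmp_idn_right[OF f] by simp
 interpret K: dense_functor U C T K
 proof (intro dense_functor.intro dense_functor_axioms.intro C.amalgamation_category_axioms amalgamation_category_axioms)
  show "is_functor C T K"
  proof (rule is_functorI)
   show "onobj K \<in> extensional (obj C)" "onarr K \<in> extensional (arr C)" by (auto simp: K_def)
   show "onobj K x \<in> obj T" if "x \<in> obj C" for x using that Ko S_obj by (auto simp: objC)
   show "onarr K f \<in> hom T (onobj K X) (onobj K Y)" if "f \<in> hom C X Y" for f X Y
    using that by (rule homCE) (simp add: Ko Ka)
   show "onarr K (idn C x) = idn T (onobj K x)" if "x \<in> obj C" for x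
    using that A[OF idn_hom] S_obj by (auto simp: objC idnC Ko Ka)
   fix f g X Y Z assume f: "f \<in> hom C X Y" and g: "g \<in> hom C Y Z"
   from f show "onarr K (cmp C g f) = onarr K g \<odot> onarr K f"
   proof (rule homCE)
    fix X' Y' f' assume f': "X' \<in> S" "Y' \<in> S" "f' \<in> hom T X' Y'" "X = dl X'" "Y = dl Y'" "f = ep f'" "f' \<in> A"
    from g[unfolded f'] f'(2) show ?thesis
     by (rule homCE') (use f' in \<open>simp add: cmpC Ka A[OF cmp_hom]\<close>)
   qed
  qed
  show "\<exists>f\<in>hom C X Y. onarr K f = h"
   if XYh: "X \<in> obj C" "Y \<in> obj C" "h \<in> hom T (onobj K X) (onobj K Y)" for X Y h
  proof -
   obtain X' Y' where XY: "X' \<in> S" "X = dl X'" "Y' \<in> S" "Y = dl Y'" using XYh(1,2) by (auto simp: objC)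
   then have h: "h \<in> hom T X' Y'" using XYh(3) Ko by simp
   show ?thesis by (rule bexI[of _ "ep h"]) (use XY homCI[OF XY(1,3) h] Ka A[OF h XY(1,3)] in auto)
  qed
  show "f = g" if "f \<in> hom C X Y" "g \<in> hom C X Y" "onarr K f = onarr K g" for f g X Y
   using that Ka A unfolding homC by metis
  show "\<exists>X\<in>obj C. hom T Z (onobj K X) \<noteq> {}" if "Z \<in> obj T" for Z
   using \<phi>[OF that] r[OF that] Ko by (auto simp: objC)
 qed
 interpret R: dense_functor U T C R
 proof (intro dense_functor.intro dense_functor_axioms.intro C.amalgamation_category_axioms amalgamation_category_axioms)
  show "is_functor T C R"
  proof (rule is_functorI)
   show "onobj R \<in> extensional (obj T)" "onarr R \<in> extensional (arr T)" by (auto simp: R_def)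
   show "onobj R x \<in> obj C" if "x \<in> obj T" for x using that Ro r by (auto simp: objC)
   show "onarr R f \<in> hom C (onobj R X) (onobj R Y)" if "f \<in> hom T X Y" for f X Y
    using homCI[OF r r rh[OF that]] hom_obj[OF that] by (simp add: Ro Ra[OF that])
   show "onarr R (idn T X) = idn C (onobj R X)" if X: "X \<in> obj T" for X
   proof -
    have "idn T (r X) = rh X X (idn T X)"
     using rh_eq[OF idn_hom[OF X] idn_hom[OF S_obj[OF r[OF X]]]] cmp_idn_left[OF \<phi>[OF X]] cmp_idn_right[OF \<phi>[OF X]] by simp
    then show ?thesis using X by (simp add: Ra[OF idn_hom[OF X]] Ro idnC r)
   qed
   fix f g X Y Z assume f: "f \<in> hom T X Y" and g: "g \<in> hom T Y Z"
   have "rh Y Z g \<odot> rh X Y f = rh X Z (g \<odot> f)"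
   proof (rule rh_eq[OF cmp_hom[OF f g] cmp_hom[OF rh[OF f] rh[OF g]]])
    note X = hom_obj(1)[OF f] and Y = hom_obj(2)[OF f] and Z = hom_obj(2)[OF g]
    show "(rh Y Z g \<odot> rh X Y f) \<odot> \<phi> X = \<phi> Z \<odot> (g \<odot> f)"
     using assoc[OF \<phi>[OF X] rh[OF f] rh[OF g]] assoc[OF f \<phi>[OF Y] rh[OF g]] assoc[OF f g \<phi>[OF Z]] rh_\<phi>[OF f] rh_\<phi>[OF g] by simp
   qed
   then show "onarr R (g \<odot> f) = cmp C (onarr R g) (onarr R f)"
    using cmpC[OF rhA[OF f] rhA[OF g]] by (simp add: Ra[OF f] Ra[OF g] Ra[OF cmp_hom[OF f g]])
  qed
  show "\<exists>f\<in>hom T X Y. onarr R f = h" if X: "X \<in> obj T" and Y: "Y \<in> obj T" and h: "h \<in> hom C (onobj R X) (onobj R Y)" for X Y h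
  proof -
   have "h \<in> hom C (dl (r X)) (dl (r Y))" using h X Y Ro by simp
   then obtain h' where h': "h' \<in> hom T (r X) (r Y)" "h = ep h'"
    using inj_onD[OF dl] r X Y unfolding homC by metis
   note f1 = cmp_hom[OF \<phi>[OF X] h'(1)] note f = cmp_hom[OF f1 \<psi>[OF Y]]
   have "h' = rh X Y (\<psi> Y \<odot> (h' \<odot> \<phi> X))"
    using rh_eq[OF f h'(1)] assoc[OF f1 \<psi>[OF Y] \<phi>[OF Y]] \<phi>\<psi>[OF Y] cmp_idn_left[OF f1] by simp
   then show ?thesis using Ra[OF f] f h' by auto
  qed
  show "f = g" if f: "f \<in> hom T X Y" and g: "g \<in> hom T X Y" and eq: "onarr R f = onarr R g" for f g X Y
  proof -
   have "rh X Y f = rh X Y g" using eq Ra[OF f] Ra[OF g] inj_onD[OF ep _ rhA[OF f] rhA[OF g]] by simp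
   then show ?thesis using rh_\<phi>[OF f] rh_\<phi>[OF g] \<phi>_mono[OF f g _ hom_obj(2)[OF f]] by simp
  qed
  show "\<exists>X\<in>obj T. hom C Z (onobj R X) \<noteq> {}" if "Z \<in> obj C" for Z
  proof -
   obtain X where X: "X \<in> S" "Z = dl X" using \<open>Z \<in> obj C\<close> by (auto simp: objC)
   then have "ep (idn T X) \<in> hom C Z (onobj R X)"
    using homCI[OF X(1,1) idn_hom[OF S_obj[OF X(1)]]] Ro[OF S_obj[OF X(1)]] r_S[OF X(1)] by simp
   then show ?thesis using S_obj[OF X(1)] by blast
  qed
 qed
 \<comment> \<open>Equality, not just isomorphism, because \<open>r\<close> and
   \<open>\<phi>\<close> are trivial on S.\<close>
 have RK: "K.restr (R.restr G) = G" if G: "G \<in> obj C.E" for G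
 proof (rule functor_ext[OF C.E_functor[OF K.restr[OF R.restr[OF G]]] C.E_functor[OF G]])
  show "onobj (K.restr (R.restr G)) x = onobj G x" if "x \<in> obj C" for x
   using that S_obj by (auto simp: objC K.onobj_restr R.onobj_restr Ko Ro r_S)
  fix a assume a': "a \<in> arr C"
  then have "a \<in> hom C (src C a) (tgt C a)" by (rule arr_hom)
  then show "onarr (K.restr (R.restr G)) a = onarr G a"
   by (rule homCE) (use a' in \<open>simp add: comp_functor_def Ka homD(1) Ra rh_S\<close>)
 qed
 define \<eta> where "\<eta> = (\<lambda>F\<in>obj E. mk_hom F (\<lambda>X. act F (\<phi> X)) (R.restr (K.restr F)))"
 have KR: "onobj (R.restr (K.restr F)) X = onobj F (r X)" if "X \<in> obj T" for F X
  using that r S_obj by (simp add: R.onobj_restr Ro K.onobj_restr objC Ko)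
 have KRa: "act (R.restr (K.restr F)) f = act F (rh X Y f)" if f: "f \<in> hom T X Y" for F f X Y
 proof -
  have "ep (rh X Y f) \<in> arr C" using rhA[OF f] by (simp add: C_def)
  then show ?thesis using homD(1)[OF f] Ka[OF rhA[OF f]] by (simp add: R.act_restr K.act_restr Ra[OF f])
 qed
 have \<eta>: "\<eta> F \<in> hom E F (R.restr (K.restr F))" if F: "F \<in> obj E" for F
 proof -
  have "mk_hom F (\<lambda>X. act F (\<phi> X)) (R.restr (K.restr F)) \<in> hom E F (R.restr (K.restr F))"
  proof (rule mk_hom[OF F R.restr[OF K.restr[OF F]]])
   show "act F (\<phi> X) x \<in> onobj (R.restr (K.restr F)) X" if "X \<in> obj T" "x \<in> onobj F X" for X x
    using E_act[OF F \<phi>[OF that(1)] that(2)] KR[OF that(1)] by simp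
   fix f X Y x assume f: "f \<in> hom T X Y" and x: "x \<in> onobj F X"
   show "act F (\<phi> Y) (act F f x) = act (R.restr (K.restr F)) f (act F (\<phi> X) x)"
    using E_cmp[OF F f \<phi>[OF hom_obj(2)[OF f]] x] E_cmp[OF F \<phi>[OF hom_obj(1)[OF f]] rh[OF f] x] rh_\<phi>[OF f] by (simp add: KRa[OF f])
  qed
  then show ?thesis using F by (simp add: \<eta>_def)
 qed
 have cm_\<eta>: "cm (\<eta> F) X x = act F (\<phi> X) x" if "F \<in> obj E" "X \<in> obj T" "x \<in> onobj F X" for F X x
  using that by (simp add: \<eta>_def)
 have \<eta>_iso: "iso E (\<eta> F)" if F: "F \<in> obj E" for F
  unfolding iso_def
 proof (intro conjI)
  show "\<eta> F \<in> arr E" by (rule homD(1)[OF \<eta>[OF F]])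
  let ?F = "R.restr (K.restr F)"
  note F' = R.restr[OF K.restr[OF F]]
  have inv: "mk_hom ?F (\<lambda>X. act F (\<psi> X)) F \<in> hom E ?F F"
  proof (rule mk_hom[OF F' F])
   show "act F (\<psi> X) x \<in> onobj F X" if "X \<in> obj T" "x \<in> onobj ?F X" for X x
    using E_act[OF F \<psi>[OF that(1)]] that KR by simp
   fix f X Y x assume f: "f \<in> hom T X Y" and x: "x \<in> onobj ?F X"
   note X = hom_obj(1)[OF f] and Y = hom_obj(2)[OF f]
   have "\<psi> Y \<odot> rh X Y f = f \<odot> \<psi> X"
    unfolding rh_def using assoc[OF cmp_hom[OF \<psi>[OF X] f] \<phi>[OF Y] \<psi>[OF Y]] \<psi>\<phi>[OF Y] cmp_idn_left[OF cmp_hom[OF \<psi>[OF X] f]] by simp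
   then show "act F (\<psi> Y) (act ?F f x) = act F f (act F (\<psi> X) x)"
    using E_cmp[OF F rh[OF f] \<psi>[OF Y]] E_cmp[OF F \<psi>[OF X] f] x KR[OF X] by (simp add: KRa[OF f])
  qed
  show "\<exists>g\<in>hom E (tgt E (\<eta> F)) (src E (\<eta> F)). cmp E g (\<eta> F) = idn E (src E (\<eta> F)) \<and> cmp E (\<eta> F) g = idn E (tgt E (\<eta> F))"
   unfolding homD(2,3)[OF \<eta>[OF F]]
  proof (intro bexI[OF _ inv] conjI)
   show "cmp E (mk_hom ?F (\<lambda>X. act F (\<psi> X)) F) (\<eta> F) = idn E F"
   proof (rule E_ext[OF E_cmp_hom[OF \<eta>[OF F] inv] E_idn_hom[OF F]])
    fix X x assume X: "X \<in> obj T" and x: "x \<in> onobj F X"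
    show "cm (cmp E (mk_hom ?F (\<lambda>X. act F (\<psi> X)) F) (\<eta> F)) X x = cm (idn E F) X x"
     using cm_cmp[OF \<eta>[OF F] inv X x] cm_\<eta>[OF F X x] X x KR[OF X] E_act[OF F \<phi>[OF X] x] act_\<psi>\<phi>[OF F X x] by simp
   qed
   show "cmp E (\<eta> F) (mk_hom ?F (\<lambda>X. act F (\<psi> X)) F) = idn E ?F"
   proof (rule E_ext[OF E_cmp_hom[OF inv \<eta>[OF F]] E_idn_hom[OF F']])
    fix X x assume X: "X \<in> obj T" and x: "x \<in> onobj ?F X"
    have x': "x \<in> onobj F (r X)" using x KR[OF X] by simp
    have "act F (\<phi> X) (act F (\<psi> X) x) = x"
     using E_cmp[OF F \<psi>[OF X] \<phi>[OF X] x'] \<phi>\<psi>[OF X] E_id[OF F S_obj[OF r[OF X]] x'] by simp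
    then show "cm (cmp E (\<eta> F) (mk_hom ?F (\<lambda>X. act F (\<psi> X)) F)) X x = cm (idn E ?F) X x"
     using cm_cmp[OF inv \<eta>[OF F] X x] X x cm_\<eta>[OF F X E_act[OF F \<psi>[OF X] x']] by simp
   qed
  qed
 qed
 have "equivalent_cat E C.E"
  unfolding equivalent_cat_def
 proof (rule exI[of _ K.Restr], rule exI[of _ R.Restr], rule exI[of _ \<eta>], rule exI[of _ "\<lambda>G\<in>obj C.E. idn C.E G"],
   intro conjI K.Restr_functor R.Restr_functor)
  show "nat_iso E E (id_functor E) (comp_functor E R.Restr K.Restr) \<eta>"
   unfolding nat_iso_def nat_trans_def
  proof (intro conjI ballI)
   show "\<eta> \<in> extensional (obj E)" by (simp add: \<eta>_def)
   show "\<eta> F \<in> hom E (onobj (id_functor E) F) (onobj (comp_functor E R.Restr K.Restr) F)" if F: "F \<in> obj E" for F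
    using \<eta>[OF F] F K.restr[OF F] by (simp add: id_functor_def comp_functor_def)
   show "iso E (\<eta> F)" if F: "F \<in> obj E" for F by (rule \<eta>_iso[OF F])
   fix m assume mE: "m \<in> arr E"
   then obtain F G where m: "m \<in> hom E F G" by (blast intro: arr_hom)
   note FG = E_hom_obj[OF m]
   note km = K.Restr_hom[OF m] note rm = R.Restr_hom[OF km]
   have "cmp E (\<eta> G) m = cmp E (onarr R.Restr (onarr K.Restr m)) (\<eta> F)"
   proof (rule E_ext[OF E_cmp_hom[OF m \<eta>[OF FG(2)]] E_cmp_hom[OF \<eta>[OF FG(1)] rm]])
    fix X x assume X: "X \<in> obj T" and x: "x \<in> onobj F X"
    note px = E_act[OF FG(1) \<phi>[OF X] x]
    have RX: "onobj R X \<in> obj C" "onobj K (onobj R X) = r X" using r[OF X] X by (auto simp: Ro objC Ko)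
    have "cm (onarr R.Restr (onarr K.Restr m)) X (act F (\<phi> X) x) = cm m (r X) (act F (\<phi> X) x)"
     using R.cm_Restr[OF km X] K.cm_Restr[OF m RX(1)] px RX by (simp add: K.onobj_restr)
    then show "cm (cmp E (\<eta> G) m) X x = cm (cmp E (onarr R.Restr (onarr K.Restr m)) (\<eta> F)) X x"
     using cm_cmp[OF m \<eta>[OF FG(2)] X x] cm_cmp[OF \<eta>[OF FG(1)] rm X x] cm_\<eta>[OF FG(1) X x] cm_\<eta>[OF FG(2) X cm_in[OF m X x]]
      cm_nat[OF m \<phi>[OF X] x] by simp
   qed
   then show "cmp E (\<eta> (tgt E m)) (onarr (id_functor E) m) = cmp E (onarr (comp_functor E R.Restr K.Restr) m) (\<eta> (src E m))"
    using homD[OF m] mE by (simp add: id_functor_def comp_functor_def)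
  qed
  have idn_iso: "iso C.E (idn C.E G)" if G: "G \<in> obj C.E" for G
   unfolding iso_def using C.E_idn_hom[OF G] homD[OF C.E_idn_hom[OF G]] category.cmp_idn_left[OF C.category_E C.E_idn_hom[OF G]] by auto
  show "nat_iso C.E C.E (comp_functor C.E K.Restr R.Restr) (id_functor C.E) (\<lambda>G\<in>obj C.E. idn C.E G)"
   unfolding nat_iso_def nat_trans_def
  proof (intro conjI ballI)
   show "(\<lambda>G\<in>obj C.E. idn C.E G) \<in> extensional (obj C.E)" by simp
   show "(\<lambda>G\<in>obj C.E. idn C.E G) G \<in> hom C.E (onobj (comp_functor C.E K.Restr R.Restr) G) (onobj (id_functor C.E) G)"
    if G: "G \<in> obj C.E" for G
    using RK[OF G] G R.restr[OF G] C.E_idn_hom[OF G] by (simp add: comp_functor_def id_functor_def)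
   show "iso C.E ((\<lambda>G\<in>obj C.E. idn C.E G) G)" if G: "G \<in> obj C.E" for G using G idn_iso by simp
   fix m assume mE: "m \<in> arr C.E"
   then obtain F G where m: "m \<in> hom C.E F G" by (blast intro: arr_hom)
   note FG = C.E_hom_obj[OF m]
   note rm = R.Restr_hom[OF m] note km = K.Restr_hom[OF rm]
   have "onarr K.Restr (onarr R.Restr m) = m"
   proof (rule C.E_ext[OF km[unfolded RK[OF FG(1)] RK[OF FG(2)]] m])
    fix x u assume x: "x \<in> obj C" and u: "u \<in> onobj F x"
    have Kx: "onobj K x \<in> obj T" "onobj R (onobj K x) = x" using x S_obj by (auto simp: objC Ko Ro r_S)
    show "cm (onarr K.Restr (onarr R.Restr m)) x u = cm m x u"
     using K.cm_Restr[OF rm x] R.cm_Restr[OF m Kx(1)] u Kx by (simp add: R.onobj_restr)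
   qed
   then show "cmp C.E ((\<lambda>G\<in>obj C.E. idn C.E G) (tgt C.E m)) (onarr (comp_functor C.E K.Restr R.Restr) m) =
    cmp C.E (onarr (id_functor C.E) m) ((\<lambda>G\<in>obj C.E. idn C.E G) (src C.E m))"
    using homD[OF m] mE FG category.cmp_idn_left[OF C.category_E m] category.cmp_idn_right[OF C.category_E m]
    by (simp add: id_functor_def comp_functor_def)
  qed
 qed
 moreover have "small_category U (opp C)"
  unfolding small_category_def
  using category_opp[OF catC] small_image[OF small_S, of dl] small_image[OF sA, of ep] by (simp add: C_def)
 ultimately show ?thesis
  unfolding grothendieck_topos_def using category_E C.grothendieck_topology_atomic unfolding C.E_def by blast
qed

end

section \<open>Filtered colimits of sheaves and finite presentability\<close>

section \<open>Filtered colimits and local finite presentability\<close>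

locale filtered_category = category J for J :: "('j, 'k) cat" +
 assumes filtered: "filtered J"
begin

lemma filtered_span:
 assumes v: "v \<in> hom J k l" and u: "u \<in> hom J k l'"
 obtains n w w' where "w \<in> hom J l n" "w' \<in> hom J l' n" "cmp J w v = cmp J w' u"
proof -
 obtain m a b where a: "a \<in> hom J l m" and b: "b \<in> hom J l' m"
  using filtered hom_obj(2)[OF v] hom_obj(2)[OF u] unfolding filtered_def by blast
 have "\<exists>n\<in>obj J. \<exists>w\<in>hom J m n. cmp J w (cmp J a v) = cmp J w (cmp J b u)"
  using filtered cmp_hom[OF v a] cmp_hom[OF u b] hom_obj(1)[OF v] hom_obj(2)[OF a] unfolding filtered_def by blast
 then obtain n w where w: "w \<in> hom J m n" "cmp J w (cmp J a v) = cmp J w (cmp J b u)" by blast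
 show thesis
  by (rule that[OF cmp_hom[OF a w(1)] cmp_hom[OF b w(1)]])
   (simp add: cmp_assoc[OF v a w(1), symmetric] cmp_assoc[OF u b w(1), symmetric] w(2))
qed

lemma filtered_equalize:
 assumes "u \<in> hom J j k" "v \<in> hom J j k"
 obtains l w where "w \<in> hom J k l" "cmp J w u = cmp J w v"
 using filtered assms hom_obj[OF assms(1)] unfolding filtered_def by blast

lemma filtered_upper_bound:
 assumes "finite A" "\<And>a. a \<in> A ==> c a \<in> obj J"
 shows "\<exists>l\<in>obj J. \<forall>a\<in>A. hom J (c a) l \<noteq> {}"
 using assms
proof (induction A)
 case empty
 then show ?case using filtered by (auto simp: filtered_def)
next
 case (insert a A)
 then obtain l where l: "l \<in> obj J" "\<forall>a\<in>A. hom J (c a) l \<noteq> {}" by auto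
 obtain m u v where u: "u \<in> hom J l m" and v: "v \<in> hom J (c a) m"
  using filtered l(1) insert.prems unfolding filtered_def by blast
 have "\<forall>b\<in>insert a A. hom J (c b) m \<noteq> {}"
 proof
  fix b assume b: "b \<in> insert a A"
  show "hom J (c b) m \<noteq> {}"
  proof (cases "b = a")
   case False
   then obtain w where "w \<in> hom J (c b) l" using b l by auto
   then show ?thesis using cmp_hom[OF _ u] by auto
  qed (use v in auto)
 qed
 then show ?case using hom_obj(2)[OF u] by blast
qed

text \<open>Finitely many conditions, each reached along some arrow and stable under further arrows,
  are reached along a common one. They are predicates of the arrow and not only of its
  target.\<close>

lemma filtered_finite:
 assumes "finite A" and j: "j \<in> obj J" and "\<And>a. a \<in> A ==> \<exists>k. \<exists>u\<in>hom J j k. P a u"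
  and P: "\<And>a u v k l. a \<in> A ==> u \<in> hom J j k ==> v \<in> hom J k l ==> P a u ==> P a (cmp J v u)"
 shows "\<exists>k. \<exists>u\<in>hom J j k. \<forall>a\<in>A. P a u"
 using assms(1,3,4)
proof (induction A)
 case empty
 then show ?case using idn_hom[OF j] by blast
next
 case (insert a A)
 then obtain k u where u: "u \<in> hom J j k" "\<forall>b\<in>A. P b u" by (metis insert_iff)
 obtain k' u' where u': "u' \<in> hom J j k'" "P a u'" using insert.prems(1) by blast
 obtain n w w' where w: "w \<in> hom J k n" "w' \<in> hom J k' n" "cmp J w u = cmp J w' u'"
  by (rule filtered_span[OF u(1) u'(1)])
 have "P b (cmp J w u)" if b: "b \<in> insert a A" for b
 proof (cases "b = a")
  case True
  then show ?thesis using insert.prems(2)[OF b u'(1) w(2)] u'(2) w(3) by simp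
 next
  case False
  then show ?thesis using insert.prems(2)[OF b u(1) w(1)] u(2) b by simp
 qed
 then show ?case using cmp_hom[OF u(1) w(1)] by blast
qed

end

text \<open>A cocone induces a well-defined map: elements of two stages with the same image in L are
  first brought to a common stage and then identified further on.\<close>

lemma (in universe) Set_filtered_colimitI:
 assumes J: "category J" "filtered J" and G: "is_functor J (Set_cat U :: ('x set, 'x set_arr) cat) G"
  and p: "\<And>j. j \<in> obj J ==> p j \<in> hom (Set_cat U) (onobj G j) L"
  and cocone: "\<And>u j k x. u \<in> hom J j k ==> x \<in> onobj G j ==> app (p k) (app (onarr G u) x) = app (p j) x"
  and surj: "\<And>x. x \<in> L ==> \<exists>j\<in>obj J. \<exists>y\<in>onobj G j. app (p j) y = x"
  and inj: "\<And>j x y. j \<in> obj J ==> x \<in> onobj G j ==> y \<in> onobj G j ==> app (p j) x = app (p j) y ==>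
   \<exists>k. \<exists>u\<in>hom J j k. app (onarr G u) x = app (onarr G u) y"
 shows "is_colimit J (Set_cat U) G L p"
 unfolding is_colimit_def
proof (intro conjI allI impI)
 interpret J: filtered_category J
  by (intro filtered_category.intro J filtered_category_axioms.intro)
 obtain j0 where "j0 \<in> obj J" using J(2) by (auto simp: filtered_def)
 then have L: "small U L" using p by (auto simp: Set_hom_iff)
 show "is_cocone J (Set_cat U) G L p"
  unfolding is_cocone_def
 proof (intro conjI ballI p)
  show "L \<in> obj (Set_cat U)" using L by simp
  fix u assume "u \<in> arr J"
  then obtain j k where u: "u \<in> hom J j k" by (blast intro: arr_hom)
  note jk = J.hom_obj[OF u] and Gu = is_functorD(2)[OF G u]
  have "cmp (Set_cat U) (p k) (onarr G u) = p j"
   by (rule Set_ext[OF Set_cmp_hom[OF Gu p[OF jk(2)]] p[OF jk(1)]])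
    (simp add: app_Set_cmp[OF Gu p[OF jk(2)]] cocone[OF u])
  then show "cmp (Set_cat U) (p (tgt J u)) (onarr G u) = p (src J u)" using homD[OF u] by simp
 qed
 fix M q assume "is_cocone J (Set_cat U) G M q"
 then have M: "small U M" and q: "\<And>j. j \<in> obj J ==> q j \<in> hom (Set_cat U) (onobj G j) M"
  and qu: "\<And>u j k. u \<in> hom J j k ==> cmp (Set_cat U) (q k) (onarr G u) = q j"
  by (auto simp: is_cocone_def hom_def)
 have qux: "app (q k) (app (onarr G u) x) = app (q j) x" if u: "u \<in> hom J j k" and x: "x \<in> onobj G j" for u j k x
  using app_Set_cmp[OF is_functorD(2)[OF G u] q[OF J.hom_obj(2)[OF u]] x] qu[OF u] by simp
 have wd: "app (q j) x = app (q k) y"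
  if jk: "j \<in> obj J" "k \<in> obj J" and xy: "x \<in> onobj G j" "y \<in> onobj G k" and eq: "app (p j) x = app (p k) y" for j k x y
 proof -
  obtain l u v where u: "u \<in> hom J j l" and v: "v \<in> hom J k l"
   using J(2) jk unfolding filtered_def by blast
  have x': "app (onarr G u) x \<in> onobj G l" "app (onarr G v) y \<in> onobj G l"
   using Set_hom_app[OF is_functorD(2)[OF G u] xy(1)] Set_hom_app[OF is_functorD(2)[OF G v] xy(2)] by auto
  have "app (p l) (app (onarr G u) x) = app (p l) (app (onarr G v) y)" using cocone[OF u xy(1)] cocone[OF v xy(2)] eq by simp
  from inj[OF J.hom_obj(2)[OF u] x' this] obtain m w where w: "w \<in> hom J l m"
   "app (onarr G w) (app (onarr G u) x) = app (onarr G w) (app (onarr G v) y)" by blast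
  then show ?thesis using qux[OF w(1) x'(1)] qux[OF w(1) x'(2)] qux[OF u xy(1)] qux[OF v xy(2)] by simp
 qed
 define c where "c x = (SOME z. \<exists>j\<in>obj J. \<exists>y\<in>onobj G j. app (p j) y = x \<and> z = app (q j) y)" for x
 have c: "c (app (p j) y) = app (q j) y" if "j \<in> obj J" "y \<in> onobj G j" for j y
  unfolding c_def by (rule some_equality) (use that wd in blast)+
 define m where "m = mk_set L c M"
 have m: "m \<in> hom (Set_cat U) L M"
  unfolding m_def
 proof (rule mk_set_hom[OF L M])
  fix x assume "x \<in> L"
  from surj[OF this] obtain j y where "j \<in> obj J" "y \<in> onobj G j" "x = app (p j) y" by blast
  then show "c x \<in> M" using c Set_hom_app[OF q] by simp
 qed
 show "\<exists>!m. m \<in> hom (Set_cat U) L M \<and> (\<forall>j\<in>obj J. cmp (Set_cat U) m (p j) = q j)"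
 proof (rule ex1I[of _ m], intro conjI ballI m)
  fix j assume j: "j \<in> obj J"
  show "cmp (Set_cat U) m (p j) = q j"
   by (rule Set_ext[OF Set_cmp_hom[OF p[OF j] m] q[OF j]])
    (use app_Set_cmp[OF p[OF j] m] in \<open>simp add: m_def Set_hom_app[OF p[OF j]] c[OF j]\<close>)
 next
  fix n assume n: "n \<in> hom (Set_cat U) L M \<and> (\<forall>j\<in>obj J. cmp (Set_cat U) n (p j) = q j)"
  then have n': "n \<in> hom (Set_cat U) L M" by simp
  show "n = m"
  proof (rule Set_ext[OF n' m])
   fix x assume x: "x \<in> L"
   from surj[OF this] obtain j y where j: "j \<in> obj J" "y \<in> onobj G j" "x = app (p j) y" by blast
   then show "app n x = app m x"
    using app_Set_cmp[OF p[OF j(1)] n' j(2)] n c[OF j(1,2)] x by (simp add: m_def)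
  qed
 qed
qed

text \<open>The diagrams in the definition of local presentability have shapes over the universe
  type. A directed preorder over any small set is recoded there, with pairs as arrows.\<close>

lemma (in universe) poset_diagram:
 fixes D :: "'d set"
 assumes sm: "small U D" and ne: "D \<noteq> {}"
  and refl: "\<And>d. d \<in> D ==> le d d" and trans: "\<And>d d' d''. le d d' ==> le d' d'' ==> le d d''"
  and dir: "\<And>d d'. d \<in> D ==> d' \<in> D ==> \<exists>d''\<in>D. le d d'' \<and> le d' d''"
  and H: "\<And>d. d \<in> D ==> H d \<in> obj C"
  and tr: "\<And>d d'. d \<in> D ==> d' \<in> D ==> le d d' ==> tr d d' \<in> hom C (H d) (H d')"
  and tr_id: "\<And>d. d \<in> D ==> tr d d = idn C (H d)"
  and tr_cmp: "\<And>d d' d''. d \<in> D ==> d' \<in> D ==> d'' \<in> D ==> le d d' ==> le d' d'' ==>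
   cmp C (tr d' d'') (tr d d') = tr d d''"
 obtains J :: "('u, 'u) cat" and G dl where "small_category U J" "filtered J" "is_functor J C G"
  "inj_on dl D" "obj J = dl ` D" "\<And>d. d \<in> D ==> onobj G (dl d) = H d"
  "\<And>a. a \<in> arr J ==> \<exists>d\<in>D. \<exists>d'\<in>D. le d d' \<and> src J a = dl d \<and> tgt J a = dl d' \<and> onarr G a = tr d d'"
  "\<And>d d'. d \<in> D ==> d' \<in> D ==> le d d' ==> \<exists>a\<in>hom J (dl d) (dl d'). onarr G a = tr d d'"
proof -
 obtain i :: "'d \<times> 'd => 'u" where i: "inj_on i (D \<times> D)" using small_Times[OF sm sm] by (rule small_embed)
 define s where "s a = fst (the_inv_into (D \<times> D) i a)" for a
 define t where "t a = snd (the_inv_into (D \<times> D) i a)" for a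
 have st[simp]: "s (i (d, d')) = d" "t (i (d, d')) = d'" if "d \<in> D" "d' \<in> D" for d d'
  using that by (simp_all add: s_def t_def the_inv_into_f_f[OF i])
 define dl where "dl d = i (d, d)" for d
 have sdl[simp]: "s (dl d) = d" if "d \<in> D" for d using that by (simp add: dl_def)
 \<comment> \<open>An object d is coded as the pair (d, d), so that each identity is the object
   itself.\<close>
 define J where "J = \<lparr>obj = dl ` D, arr = {i (d, d') |d d'. d \<in> D \<and> d' \<in> D \<and> le d d'}, src = (\<lambda>a. dl (s a)), tgt = (\<lambda>a. dl (t a)),
  idn = (\<lambda>x. x), cmp = (\<lambda>g f. i (s f, t g))\<rparr>"
 have dl: "inj_on dl D" by (rule inj_on_inverseI[of _ s]) simp
 have homI: "i (d, d') \<in> hom J (dl d) (dl d')" if "d \<in> D" "d' \<in> D" "le d d'" for d d'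
  using that by (auto simp: hom_def J_def)
 have homE: "\<exists>d\<in>D. \<exists>d'\<in>D. le d d' \<and> x = dl d \<and> y = dl d' \<and> a = i (d, d')" if axy: "a \<in> hom J x y" for a x y
 proof -
  obtain d d' where "d \<in> D" "d' \<in> D" "le d d'" "a = i (d, d')" using axy by (auto simp: hom_def J_def)
  moreover from this have "x = dl d" "y = dl d'" using axy by (auto simp: hom_def J_def)
  ultimately show ?thesis by blast
 qed
 have homE2: "\<exists>d'\<in>D. le d d' \<and> y = dl d' \<and> a = i (d, d')" if "a \<in> hom J (dl d) y" "d \<in> D" for a d y
  using homE[OF that(1)] inj_onD[OF dl] that(2) by metis
 have cmpJ: "cmp J (i (d', d'')) (i (d, d')) = i (d, d'')" if "d \<in> D" "d' \<in> D" "d'' \<in> D" for d d' d''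
  using that by (simp add: J_def)
 have idnJ: "idn J (dl d) = i (d, d)" for d by (simp add: J_def dl_def)
 have objJ: "obj J = dl ` D" by (simp add: J_def)
 have J: "category J"
 proof
  show "src J f \<in> obj J" "tgt J f \<in> obj J" if "f \<in> arr J" for f
   using homE[OF arr_hom[OF that]] objJ by auto
  show "idn J X \<in> hom J X X" if "X \<in> obj J" for X using that homI refl by (auto simp: objJ idnJ)
  show "cmp J g f \<in> hom J X Z" if f: "f \<in> hom J X Y" and g: "g \<in> hom J Y Z" for f g X Y Z
  proof -
   obtain d d' where d: "d \<in> D" "d' \<in> D" "le d d'" "X = dl d" "Y = dl d'" "f = i (d, d')" using homE[OF f] by blast
   obtain d'' where "d'' \<in> D" "le d' d''" "Z = dl d''" "g = i (d', d'')" using homE2[OF g[unfolded d] d(2)] by blast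
   then show ?thesis using d cmpJ homI trans by metis
  qed
  show "cmp J f (idn J X) = f" "cmp J (idn J Y) f = f" if "f \<in> hom J X Y" for f X Y
   using homE[OF that] cmpJ idnJ by metis+
  show "cmp J h (cmp J g f) = cmp J (cmp J h g) f"
   if f: "f \<in> hom J W X" and g: "g \<in> hom J X Y" and h: "h \<in> hom J Y Z" for f g h W X Y Z
  proof -
   obtain d0 d where d: "d0 \<in> D" "d \<in> D" "f = i (d0, d)" "X = dl d" using homE[OF f] by blast
   obtain d' where d': "d' \<in> D" "g = i (d, d')" "Y = dl d'" using homE2[OF g[unfolded d] d(2)] by blast
   obtain d'' where d'': "d'' \<in> D" "h = i (d', d'')" using homE2[OF h[unfolded d'] d'(1)] by blast
   show ?thesis using d d' d'' cmpJ by simp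
  qed
 qed
 define G where "G = \<lparr>onobj = (\<lambda>x\<in>obj J. H (s x)), onarr = (\<lambda>a\<in>arr J. tr (s a) (t a))\<rparr>"
 have Go: "onobj G (dl d) = H d" if "d \<in> D" for d using that by (simp add: G_def objJ)
 have Ga: "onarr G (i (d, d')) = tr d d'" if "d \<in> D" "d' \<in> D" "le d d'" for d d'
  using that homD(1)[OF homI[OF that]] by (simp add: G_def)
 have G: "is_functor J C G"
 proof (rule is_functorI)
  show "onobj G \<in> extensional (obj J)" "onarr G \<in> extensional (arr J)" by (auto simp: G_def)
  show "onobj G X \<in> obj C" if "X \<in> obj J" for X using that H Go by (auto simp: objJ)
  show "onarr G f \<in> hom C (onobj G X) (onobj G Y)" if f: "f \<in> hom J X Y" for f X Y
   using homE[OF f] tr Go Ga by metis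
  show "onarr G (idn J X) = idn C (onobj G X)" if "X \<in> obj J" for X
   using that idnJ Ga refl tr_id Go by (auto simp: objJ)
  show "onarr G (cmp J g f) = cmp C (onarr G g) (onarr G f)" if f: "f \<in> hom J X Y" and g: "g \<in> hom J Y Z" for f g X Y Z
  proof -
   obtain d0 d where d: "d0 \<in> D" "d \<in> D" "le d0 d" "f = i (d0, d)" "Y = dl d" using homE[OF f] by blast
   obtain d' where d': "d' \<in> D" "le d d'" "g = i (d, d')" using homE2[OF g[unfolded d] d(2)] by blast
   show ?thesis using d d' cmpJ Ga tr_cmp trans by metis
  qed
 qed
 show thesis
 proof (rule that[OF _ _ G dl objJ Go])
  have "arr J \<subseteq> i ` (D \<times> D)" by (auto simp: J_def)
  then show "small_category U J"
   unfolding small_category_def objJ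
   using J small_image[OF sm] small_subset[OF small_image[OF small_Times[OF sm sm]]] by blast
  show "filtered J"
   unfolding filtered_def objJ
  proof (intro conjI ballI)
   show "dl ` D \<noteq> {}" using ne by simp
   show "\<exists>k\<in>dl ` D. hom J x k \<noteq> {} \<and> hom J y k \<noteq> {}" if "x \<in> dl ` D" "y \<in> dl ` D" for x y
   proof -
    obtain d d' where d: "d \<in> D" "d' \<in> D" "x = dl d" "y = dl d'" using \<open>x \<in> dl ` D\<close> \<open>y \<in> dl ` D\<close> by blast
    obtain d'' where "d'' \<in> D" "le d d''" "le d' d''" using dir d by blast
    then show ?thesis using homI d by blast
   qed
   show "\<exists>k\<in>dl ` D. \<exists>w\<in>hom J y k. cmp J w u = cmp J w v"
    if "x \<in> dl ` D" "y \<in> dl ` D" "u \<in> hom J x y" "v \<in> hom J x y" for x y u v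
   proof -
    obtain d d' where d: "d \<in> D" "d' \<in> D" "le d d'" "x = dl d" "y = dl d'" "u = i (d, d')" using homE[OF \<open>u \<in> hom J x y\<close>] by blast
    obtain d'' where d'': "d'' \<in> D" "dl d' = dl d''" "v = i (d, d'')"
     using homE2[OF \<open>v \<in> hom J x y\<close>[unfolded d] d(1)] by blast
    have "d'' = d'" using inj_onD[OF dl d''(2)] d d'' by simp
    then show ?thesis using d d'' homI[OF d(2,2) refl[OF d(2)]] by blast
   qed
  qed
  show "\<exists>d\<in>D. \<exists>d'\<in>D. le d d' \<and> src J a = dl d \<and> tgt J a = dl d' \<and> onarr G a = tr d d'" if "a \<in> arr J" for a
   using homE[OF arr_hom[OF that]] Ga by metis
  show "\<exists>a\<in>hom J (dl d) (dl d'). onarr G a = tr d d'" if "d \<in> D" "d' \<in> D" "le d d'" for d d'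
   using homI[OF that] Ga[OF that] by blast
 qed
qed

lemma hom_functor_functor:
 assumes "category C" and ls: "locally_small U C" and X: "X \<in> obj C"
 shows "is_functor C (Set_cat U) (hom_functor C X)"
proof -
 interpret category C by fact
 have ob: "onobj (hom_functor C X) Y = hom C X Y" if "Y \<in> obj C" for Y using that by (simp add: hom_functor_def)
 have ar: "onarr (hom_functor C X) f = mk_set (hom C X Y) (cmp C f) (hom C X Z)" if "f \<in> hom C Y Z" for f Y Z
  using that by (simp add: hom_functor_def hom_def mk_set_def)
 have sm: "small U (hom C X Y)" if "Y \<in> obj C" for Y using ls X that by (simp add: locally_small_def)
 have ah: "onarr (hom_functor C X) f \<in> hom (Set_cat U) (hom C X Y) (hom C X Z)" if f: "f \<in> hom C Y Z" for f Y Z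
  unfolding ar[OF f] by (intro mk_set_hom sm hom_obj[OF f]) (rule cmp_hom[OF _ f])
 show ?thesis
 proof (rule is_functorI)
  show "onobj (hom_functor C X) \<in> extensional (obj C)" "onarr (hom_functor C X) \<in> extensional (arr C)"
   by (auto simp: hom_functor_def)
  show "onobj (hom_functor C X) Y \<in> obj (Set_cat U)" if "Y \<in> obj C" for Y using ob[OF that] sm[OF that] by simp
  show "onarr (hom_functor C X) f \<in> hom (Set_cat U) (onobj (hom_functor C X) Y) (onobj (hom_functor C X) Z)"
   if "f \<in> hom C Y Z" for f Y Z using ah[OF that] ob hom_obj[OF that] by simp
  show "onarr (hom_functor C X) (idn C Y) = idn (Set_cat U) (onobj (hom_functor C X) Y)" if Y: "Y \<in> obj C" for Y
   unfolding ob[OF Y]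
   by (rule Set_ext[OF ah[OF idn_hom[OF Y]] Set_idn_hom[OF sm[OF Y]]]) (simp add: ar[OF idn_hom[OF Y]] cmp_idn_left)
  show "onarr (hom_functor C X) (cmp C g f) = cmp (Set_cat U) (onarr (hom_functor C X) g) (onarr (hom_functor C X) f)"
   if f: "f \<in> hom C Y Z" and g: "g \<in> hom C Z W" for f g Y Z W
   by (rule Set_ext[OF ah[OF cmp_hom[OF f g]] Set_cmp_hom[OF ah[OF f] ah[OF g]]])
    (use app_Set_cmp[OF ah[OF f] ah[OF g]] in
     \<open>simp add: ar[OF cmp_hom[OF f g]] ar[OF f] ar[OF g] cmp_hom[OF _ f] cmp_assoc[OF _ f g]\<close>)
 qed
qed

context amalgamation_category
begin

text \<open>The list R is uniform in the sheaf and the element. It can therefore be chosen before a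
  stage of a diagram is, which is what filtered colimits require.\<close>

definition finite_descent :: "'a => bool" where
 "finite_descent f \<longleftrightarrow> (\<exists>R. finite R \<and>
   (\<forall>(g, h)\<in>R. \<exists>Z. g \<in> hom T (tgt T f) Z \<and> h \<in> hom T (tgt T f) Z \<and> g \<odot> f = h \<odot> f) \<and>
   (\<forall>F\<in>obj E. \<forall>y\<in>onobj F (tgt T f). (\<forall>(g, h)\<in>R. act F g y = act F h y) -->
    (\<exists>x\<in>onobj F (src T f). act F f x = y)))"

text \<open>The pairs for f start at Y, while pairs for the composite must start at Z; amalgamation
  with g replaces each (k, l) by a pair (k', l') out of Z whose restrictions along g it
  factors.\<close>

lemma finite_descent_cmp:
 assumes f: "f \<in> hom T X Y" and g: "g \<in> hom T Y Z" and ff: "finite_descent f" and fg: "finite_descent g"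
 shows "finite_descent (g \<odot> f)"
proof -
 obtain R where R: "finite R" "\<And>k l. (k, l) \<in> R ==> \<exists>W. k \<in> hom T Y W \<and> l \<in> hom T Y W \<and> k \<odot> f = l \<odot> f"
  and Rd: "\<And>F y. F \<in> obj E ==> y \<in> onobj F Y ==> (\<And>k l. (k, l) \<in> R ==> act F k y = act F l y) ==>
   \<exists>x\<in>onobj F X. act F f x = y"
  using ff homD[OF f] unfolding finite_descent_def by fast
 obtain Q where Q: "finite Q" "\<And>k l. (k, l) \<in> Q ==> \<exists>W. k \<in> hom T Z W \<and> l \<in> hom T Z W \<and> k \<odot> g = l \<odot> g"
  and Qd: "\<And>F y. F \<in> obj E ==> y \<in> onobj F Z ==> (\<And>k l. (k, l) \<in> Q ==> act F k y = act F l y) ==>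
   \<exists>x\<in>onobj F Y. act F g x = y"
  using fg homD[OF g] unfolding finite_descent_def by fast
 \<comment> \<open>Two amalgamations in a row: first k with g, then l, already moved to that target,
   with g.\<close>
 have "\<exists>W W' w k' l'. (k \<in> hom T Y W \<and> l \<in> hom T Y W) \<and> w \<in> hom T W W' \<and> k' \<in> hom T Z W' \<and> l' \<in> hom T Z W' \<and>
   w \<odot> k = k' \<odot> g \<and> w \<odot> l = l' \<odot> g" if kl: "(k, l) \<in> R" for k l
 proof -
  obtain W where k: "k \<in> hom T Y W" and l: "l \<in> hom T Y W" using R(2)[OF kl] by blast
  obtain W1 w1 k1 where w1: "w1 \<in> hom T W W1" and k1: "k1 \<in> hom T Z W1" and e1: "w1 \<odot> k = k1 \<odot> g"
   using amalgamation[OF k g] by blast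
  obtain W2 w2 l2 where w2: "w2 \<in> hom T W1 W2" and l2: "l2 \<in> hom T Z W2" and e2: "w2 \<odot> (w1 \<odot> l) = l2 \<odot> g"
   using amalgamation[OF cmp_hom[OF l w1] g] by blast
  have "(w2 \<odot> w1) \<odot> k = (w2 \<odot> k1) \<odot> g" using assoc[OF k w1 w2] assoc[OF g k1 w2] e1 by simp
  moreover have "(w2 \<odot> w1) \<odot> l = l2 \<odot> g" using assoc[OF l w1 w2] e2 by simp
  ultimately show ?thesis using k l cmp_hom[OF w1 w2] cmp_hom[OF k1 w2] l2 by blast
 qed
 then obtain V W w k' l' where kl: "\<And>k l. (k, l) \<in> R ==> k \<in> hom T Y (V k l) \<and> l \<in> hom T Y (V k l) \<and>
   w k l \<in> hom T (V k l) (W k l) \<and> k' k l \<in> hom T Z (W k l) \<and> l' k l \<in> hom T Z (W k l) \<and>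
   w k l \<odot> k = k' k l \<odot> g \<and> w k l \<odot> l = l' k l \<odot> g" by metis
 let ?R = "Q \<union> (\<lambda>(k, l). (k' k l, l' k l)) ` R"
 note gf = cmp_hom[OF f g]
 show ?thesis
  unfolding finite_descent_def homD(2,3)[OF gf]
 proof (intro exI[of _ ?R] conjI ballI impI)
  show "finite ?R" using R(1) Q(1) by simp
  fix e assume "e \<in> ?R"
  then consider a b where "e = (a, b)" "(a, b) \<in> Q" | k l where "(k, l) \<in> R" "e = (k' k l, l' k l)" by (cases e) auto
  then show "case e of (k, l) => \<exists>W. k \<in> hom T Z W \<and> l \<in> hom T Z W \<and> k \<odot> (g \<odot> f) = l \<odot> (g \<odot> f)"
  proof cases
   case 1
   then obtain W where "a \<in> hom T Z W" "b \<in> hom T Z W" "a \<odot> g = b \<odot> g" using Q(2) by blast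
   then show ?thesis using 1 assoc[OF f g] by auto
  next
   case 2
   note k = kl[OF 2(1)]
   have "k \<odot> f = l \<odot> f" using R(2)[OF 2(1)] by blast
   then have "k' k l \<odot> (g \<odot> f) = l' k l \<odot> (g \<odot> f)"
    using k assoc[OF f g, of "k' k l"] assoc[OF f g, of "l' k l"] assoc[OF f, of k _ "w k l"] assoc[OF f, of l _ "w k l"] by metis
   then show ?thesis using 2 k by auto
  qed
 next
  fix F z assume F: "F \<in> obj E" and z: "z \<in> onobj F Z" and eq: "\<forall>(a, b)\<in>?R. act F a z = act F b z"
  obtain y where y: "y \<in> onobj F Y" "act F g y = z" using Qd[OF F z] eq by auto
  have "act F k y = act F l y" if R: "(k, l) \<in> R" for k l
  proof -
   note h = kl[OF R]
   have "act F (k' k l) z = act F (l' k l) z" using eq R by auto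
   then have "act F (w k l) (act F k y) = act F (w k l) (act F l y)"
    using h y E_cmp[OF F g _ y(1), of "k' k l"] E_cmp[OF F g _ y(1), of "l' k l"]
     E_cmp[OF F _ _ y(1), of k _ "w k l"] E_cmp[OF F _ _ y(1), of l _ "w k l"] by metis
   then show ?thesis using E_inj[OF F] h E_act[OF F _ y(1)] by metis
  qed
  then obtain x where "x \<in> onobj F X" "act F f x = y" using Rd[OF F y(1)] by blast
  then show "\<exists>x\<in>onobj F X. act F (g \<odot> f) x = z" using E_cmp[OF F f g] y by auto
 qed
qed

text \<open>This replaces generators that are elements of a sheaf by positions in a list, so that
  all finite presentations together form a small set.\<close>

lemma presents_rename:
 assumes pr: "presents H q Gs ty Rs" and ix: "bij_betw ix Gs' Gs" and ty: "\<And>g. g \<in> Gs' ==> ty' g = ty (ix g)"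
  and Rs: "Rs = (\<lambda>(g, f, g', f'). (ix g, f, ix g', f')) ` Rs'"
  and Rs': "\<And>g f g' f'. (g, f, g', f') \<in> Rs' ==> g \<in> Gs' \<and> g' \<in> Gs'"
 shows "presents H (q \<circ> ix) Gs' ty' Rs'"
proof -
 define iy where "iy = the_inv_into Gs' ix"
 have iy: "iy (ix g) = g" if "g \<in> Gs'" for g
  using that ix by (auto simp: iy_def bij_betw_def the_inv_into_f_f)
 have Gs: "Gs = ix ` Gs'" using ix by (simp add: bij_betw_def)
 have m: "model Gs' ty' Rs' M (m \<circ> ix) \<longleftrightarrow> model Gs ty Rs M m" for M m
  unfolding model_def Gs Rs using ty Rs' by (auto simp: image_iff) (metis (mono_tags, lifting) case_prod_conv)+
 have m': "model Gs ty Rs M (m \<circ> iy)" if "model Gs' ty' Rs' M m" for M m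
 proof -
  have "model Gs' ty' Rs' M ((m \<circ> iy) \<circ> ix)"
   using that iy Rs' unfolding model_def by (auto simp: ty)
  then show ?thesis by (simp only: m)
 qed
 show ?thesis
  unfolding presents_def
 proof (intro conjI allI impI)
  show "H \<in> obj E" "model Gs' ty' Rs' H (q \<circ> ix)" using pr m by (auto simp: presents_def)
  fix M n assume Mn: "M \<in> obj E \<and> model Gs' ty' Rs' M n"
  then have ex1: "\<exists>!k. k \<in> hom E H M \<and> (\<forall>g\<in>Gs. cm k (ty g) (q g) = (n \<circ> iy) g)"
   using pr m' unfolding presents_def by blast
  have eq: "(\<forall>g\<in>Gs. cm k (ty g) (q g) = (n \<circ> iy) g) \<longleftrightarrow> (\<forall>g\<in>Gs'. cm k (ty' g) ((q \<circ> ix) g) = n g)" for k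
   unfolding Gs by (auto simp: iy ty)
  show "\<exists>!k. k \<in> hom E H M \<and> (\<forall>g\<in>Gs'. cm k (ty' g) ((q \<circ> ix) g) = n g)" using ex1 by (simp only: eq)
 qed
qed

end

locale finitary_site = based_site U T S r \<phi> \<psi> T0
 for U :: "'u itself" and T :: "('o, 'a) cat" and S r \<phi> \<psi> T0 +
 assumes finite_descent: "f \<in> hom T X Y ==> finite_descent f"
begin

text \<open>The pointwise colimit H is already a sheaf, by finite descent. Comparing it with the
  given colimit L through the universal property shows that L has no other elements and no other
  identifications.\<close>

lemma filtered_colimit_elements:
 fixes J :: "('j, 'k) cat"
 assumes J: "category J" "filtered J" "small U (obj J)" and G: "is_functor J E G" and colim: "is_colimit J E G L p"
 shows "X \<in> obj T ==> x \<in> onobj L X ==> \<exists>j\<in>obj J. \<exists>y\<in>onobj (onobj G j) X. cm (p j) X y = x" (is "_ ==> _ ==> ?surj X x")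
  and "X \<in> obj T ==> j \<in> obj J ==> x \<in> onobj (onobj G j) X ==> y \<in> onobj (onobj G j) X ==>
   cm (p j) X x = cm (p j) X y ==> \<exists>k. \<exists>u\<in>hom J j k. cm (onarr G u) X x = cm (onarr G u) X y"
proof -
 interpret J: filtered_category J
  by (intro filtered_category.intro J filtered_category_axioms.intro)
 have Gj: "onobj G j \<in> obj E" if "j \<in> obj J" for j using is_functorD(1)[OF G that] .
 have Gu: "onarr G u \<in> hom E (onobj G j) (onobj G k)" if "u \<in> hom J j k" for u j k using is_functorD(2)[OF G that] .
 define t where "t u X x = cm (onarr G u) X x" for u X x
 have t_in: "t u X x \<in> onobj (onobj G k) X" if "u \<in> hom J j k" "X \<in> obj T" "x \<in> onobj (onobj G j) X" for u j k X x
  unfolding t_def by (rule cm_in[OF Gu[OF that(1)] that(2,3)])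
 have t_cmp: "t (cmp J v u) X x = t v X (t u X x)"
  if "u \<in> hom J j k" "v \<in> hom J k l" "X \<in> obj T" "x \<in> onobj (onobj G j) X" for u v j k l X x
  unfolding t_def using is_functorD(4)[OF G that(1,2)] cm_cmp[OF Gu[OF that(1)] Gu[OF that(2)] that(3,4)] by simp
 have t_nat: "t u Y (act (onobj G j) f x) = act (onobj G k) f (t u X x)"
  if "u \<in> hom J j k" "f \<in> hom T X Y" "x \<in> onobj (onobj G j) X" for u j k f X Y x
  unfolding t_def by (rule cm_nat[OF Gu[OF that(1)] that(2,3)])
 \<comment> \<open>The germ relation: pairs of a stage and an element, related when they become
   equal at a common later stage.\<close>
 define Q where "Q X e e' \<longleftrightarrow> fst e \<in> obj J \<and> fst e' \<in> obj J \<and> snd e \<in> onobj (onobj G (fst e)) X \<and>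
  snd e' \<in> onobj (onobj G (fst e')) X \<and>
  (\<exists>l u v. u \<in> hom J (fst e) l \<and> v \<in> hom J (fst e') l \<and> t u X (snd e) = t v X (snd e'))" for X e e'
 have Q_refl: "Q X (j, x) (j, x) \<longleftrightarrow> j \<in> obj J \<and> x \<in> onobj (onobj G j) X" for X j x
  unfolding Q_def using J.idn_hom[of j] by auto
 have Q_same: "Q X (j, x) (j, y) \<longleftrightarrow> j \<in> obj J \<and> x \<in> onobj (onobj G j) X \<and> y \<in> onobj (onobj G j) X \<and>
   (\<exists>k. \<exists>u\<in>hom J j k. t u X x = t u X y)" if X: "X \<in> obj T" for X j x y
 proof
  assume "Q X (j, x) (j, y)"
  then obtain l u v where *: "j \<in> obj J" "x \<in> onobj (onobj G j) X" "y \<in> onobj (onobj G j) X"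
   "u \<in> hom J j l" "v \<in> hom J j l" "t u X x = t v X y" by (auto simp: Q_def)
  obtain m w where w: "w \<in> hom J l m" "cmp J w u = cmp J w v" by (rule J.filtered_equalize[OF *(4,5)])
  have "t (cmp J w u) X x = t (cmp J w u) X y"
   using t_cmp[OF *(4) w(1) X *(2)] t_cmp[OF *(5) w(1) X *(3)] *(6) w(2) by simp
  then show "j \<in> obj J \<and> x \<in> onobj (onobj G j) X \<and> y \<in> onobj (onobj G j) X \<and> (\<exists>k. \<exists>u\<in>hom J j k. t u X x = t u X y)"
   using * J.cmp_hom[OF *(4) w(1)] by blast
 qed (auto simp: Q_def)
 obtain H kp where H: "H \<in> obj E" and el: "\<And>X. X \<in> obj T ==> onobj H X = kp X ` {x. Q X x x}"
  and kp: "\<And>X x y. X \<in> obj T ==> Q X x x ==> Q X y y ==> kp X x = kp X y \<longleftrightarrow> Q X x y"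
  and act: "\<And>f X Y x. f \<in> hom T X Y ==> Q X x x ==> act H f (kp X x) = kp Y (fst x, act (onobj G (fst x)) f (snd x))"
 proof (rule quotient_sheaf[of "\<lambda>X e e'. X \<in> obj T \<and> Q X e e'" "\<lambda>f e. (fst e, act (onobj G (fst e)) f (snd e))" "\<lambda>X e. e"])
  show "X \<in> obj T \<and> Q X e e' ==> X \<in> obj T \<and> Q X e' e" for X e e' unfolding Q_def by metis
  show "X \<in> obj T \<and> Q X a c" if abc: "X \<in> obj T \<and> Q X a b" "X \<in> obj T \<and> Q X b c" for X a b c
  proof -
   have X: "X \<in> obj T" using abc by blast
   obtain l u v where 1: "fst a \<in> obj J" "snd a \<in> onobj (onobj G (fst a)) X" "snd b \<in> onobj (onobj G (fst b)) X"
    "u \<in> hom J (fst a) l" "v \<in> hom J (fst b) l" "t u X (snd a) = t v X (snd b)"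
    using abc(1) by (auto simp: Q_def)
   obtain l' u' v' where 2: "fst c \<in> obj J" "snd c \<in> onobj (onobj G (fst c)) X"
    "u' \<in> hom J (fst b) l'" "v' \<in> hom J (fst c) l'" "t u' X (snd b) = t v' X (snd c)"
    using abc(2) by (auto simp: Q_def)
   obtain n w w' where w: "w \<in> hom J l n" "w' \<in> hom J l' n" "cmp J w v = cmp J w' u'"
    by (rule J.filtered_span[OF 1(5) 2(3)])
   have "t (cmp J w u) X (snd a) = t (cmp J w' v') X (snd c)"
    using t_cmp[OF 1(4) w(1) X 1(2)] t_cmp[OF 1(5) w(1) X 1(3)] t_cmp[OF 2(3) w(2) X 1(3)] t_cmp[OF 2(4) w(2) X 2(2)]
     1(6) 2(5) w(3) by simp
   then show ?thesis using 1 2 X J.cmp_hom[OF 1(4) w(1)] J.cmp_hom[OF 2(4) w(2)] unfolding Q_def by blast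
  qed
  show "Y \<in> obj T \<and> Q Y (fst x, act (onobj G (fst x)) f (snd x)) (fst y, act (onobj G (fst y)) f (snd y))"
   if f: "f \<in> hom T X Y" and xy: "X \<in> obj T \<and> Q X x y" for f X Y x y
  proof -
   obtain l u v where 1: "fst x \<in> obj J" "fst y \<in> obj J" "snd x \<in> onobj (onobj G (fst x)) X" "snd y \<in> onobj (onobj G (fst y)) X"
    "u \<in> hom J (fst x) l" "v \<in> hom J (fst y) l" "t u X (snd x) = t v X (snd y)"
    using xy by (auto simp: Q_def)
   have "t u Y (act (onobj G (fst x)) f (snd x)) = t v Y (act (onobj G (fst y)) f (snd y))"
    using t_nat[OF 1(5) f 1(3)] t_nat[OF 1(6) f 1(4)] 1(7) by simp
   then show ?thesis
    using 1 E_act[OF Gj[OF 1(1)] f 1(3)] E_act[OF Gj[OF 1(2)] f 1(4)] hom_obj(2)[OF f]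
    unfolding Q_def fst_conv snd_conv by blast
  qed
  show "X \<in> obj T \<and> Q X (fst x, act (onobj G (fst x)) (idn T X) (snd x)) x" if X: "X \<in> obj T" and x: "X \<in> obj T \<and> Q X x x" for X x
  proof -
   have "act (onobj G (fst x)) (idn T X) (snd x) = snd x"
    by (rule E_id[OF Gj X]) (use x in \<open>auto simp: Q_def\<close>)
   then show ?thesis using x by simp
  qed
  show "Z \<in> obj T \<and> Q Z (fst x, act (onobj G (fst x)) (g \<odot> f) (snd x))
    (fst (fst x, act (onobj G (fst x)) f (snd x)), act (onobj G (fst (fst x, act (onobj G (fst x)) f (snd x)))) g (snd (fst x, act (onobj G (fst x)) f (snd x))))"
   if f: "f \<in> hom T X Y" and g: "g \<in> hom T Y Z" and x: "X \<in> obj T \<and> Q X x x" for f g X Y Z x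
  proof -
   have j: "fst x \<in> obj J" "snd x \<in> onobj (onobj G (fst x)) X" using x by (auto simp: Q_def)
   show ?thesis
    using E_cmp[OF Gj[OF j(1)] f g j(2)] E_act[OF Gj[OF j(1)] cmp_hom[OF f g] j(2)] hom_obj[OF g] j by (simp add: Q_refl)
  qed
  show "X \<in> obj T \<and> Q X x y"
   if f: "f \<in> hom T X Y" and x: "X \<in> obj T \<and> Q X x x" and y: "X \<in> obj T \<and> Q X y y"
    and fxy: "Y \<in> obj T \<and> Q Y (fst x, act (onobj G (fst x)) f (snd x)) (fst y, act (onobj G (fst y)) f (snd y))" for f X Y x y
  proof -
   have 1: "fst x \<in> obj J" "snd x \<in> onobj (onobj G (fst x)) X" "fst y \<in> obj J" "snd y \<in> onobj (onobj G (fst y)) X"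
    using x y by (auto simp: Q_def)
   obtain l u v where u: "u \<in> hom J (fst x) l" and v: "v \<in> hom J (fst y) l"
    and eq: "t u Y (act (onobj G (fst x)) f (snd x)) = t v Y (act (onobj G (fst y)) f (snd y))"
    using fxy by (auto simp: Q_def)
   have "t u X (snd x) = t v X (snd y)"
    by (rule E_inj[OF Gj[OF J.hom_obj(2)[OF u]] f])
     (use eq t_nat[OF u f 1(2)] t_nat[OF v f 1(4)] t_in[OF u _ 1(2)] t_in[OF v _ 1(4)] hom_obj[OF f] in auto)
   then show ?thesis using 1 x u v unfolding Q_def by blast
  qed
  show "\<exists>x. (X \<in> obj T \<and> Q X x x) \<and> Y \<in> obj T \<and> Q Y (fst x, act (onobj G (fst x)) f (snd x)) e"
   if f: "f \<in> hom T X Y" and e: "Y \<in> obj T \<and> Q Y e e"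
    and gh: "\<And>Z g h. g \<in> hom T Y Z ==> h \<in> hom T Y Z ==> g \<odot> f = h \<odot> f ==>
     Z \<in> obj T \<and> Q Z (fst e, act (onobj G (fst e)) g (snd e)) (fst e, act (onobj G (fst e)) h (snd e))" for f X Y e
  proof -
   obtain j y where jy: "e = (j, y)" by (cases e)
   have j: "j \<in> obj J" and y: "y \<in> onobj (onobj G j) Y" using e by (auto simp: jy Q_def)
   note X = hom_obj(1)[OF f] and Y = hom_obj(2)[OF f]
   obtain R where R: "finite R" and Rp: "\<And>g h. (g, h) \<in> R ==> \<exists>Z. g \<in> hom T Y Z \<and> h \<in> hom T Y Z \<and> g \<odot> f = h \<odot> f"
    and Rd: "\<And>F y. F \<in> obj E ==> y \<in> onobj F Y ==> (\<And>g h. (g, h) \<in> R ==> act F g y = act F h y) ==>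
     \<exists>x\<in>onobj F X. act F f x = y"
    using finite_descent[OF f] homD[OF f] unfolding finite_descent_def by fast
   \<comment> \<open>The test pair e is settled along u. The bound Z is nothing but the target of
     \<open>fst e\<close>, since an arrow has one target.\<close>
   define P where "P e u \<longleftrightarrow> (\<forall>Z. fst e \<in> hom T Y Z -->
    t u Z (act (onobj G j) (fst e) y) = t u Z (act (onobj G j) (snd e) y))" for e u
   have "\<exists>k. \<exists>u\<in>hom J j k. \<forall>e\<in>R. P e u"
   proof (rule J.filtered_finite[OF R j])
    fix e assume eR: "e \<in> R"
    obtain g h where e: "e = (g, h)" by (cases e)
    obtain Z where Z: "g \<in> hom T Y Z" "h \<in> hom T Y Z" "g \<odot> f = h \<odot> f" using Rp eR e by blast
    have "Q Z (j, act (onobj G j) g y) (j, act (onobj G j) h y)" using gh[OF Z] by (simp add: jy)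
    then obtain k u where "u \<in> hom J j k" "t u Z (act (onobj G j) g y) = t u Z (act (onobj G j) h y)"
     unfolding Q_same[OF hom_obj(2)[OF Z(1)]] by blast
    then show "\<exists>k. \<exists>u\<in>hom J j k. P e u" unfolding P_def e using homD(3)[OF Z(1)] by (auto simp: hom_def)
    fix u v k l assume u: "u \<in> hom J j k" and v: "v \<in> hom J k l" and P: "P e u"
    show "P e (cmp J v u)"
     unfolding P_def e fst_conv snd_conv
    proof (intro allI impI)
     fix Z' assume g': "g \<in> hom T Y Z'"
     then have "Z' = Z" using Z(1) by (auto simp: hom_def)
     then have h': "h \<in> hom T Y Z'" using Z by simp
     show "t (cmp J v u) Z' (act (onobj G j) g y) = t (cmp J v u) Z' (act (onobj G j) h y)"
      using t_cmp[OF u v hom_obj(2)[OF g'] E_act[OF Gj[OF j] g' y]] t_cmp[OF u v hom_obj(2)[OF g'] E_act[OF Gj[OF j] h' y]]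
       P g' unfolding P_def e by simp
    qed
   qed
   then obtain k u where u: "u \<in> hom J j k" and P: "\<And>e. e \<in> R ==> P e u" by blast
   note k = J.hom_obj(2)[OF u]
   \<comment> \<open>All test pairs are settled at stage k, so the representative there descends
     within the single sheaf \<open>onobj G k\<close>.\<close>
   have "\<exists>x\<in>onobj (onobj G k) X. act (onobj G k) f x = t u Y y"
   proof (rule Rd[OF Gj[OF k] t_in[OF u Y y]])
    fix g h assume R: "(g, h) \<in> R"
    then obtain Z where Z: "g \<in> hom T Y Z" "h \<in> hom T Y Z" using Rp by blast
    show "act (onobj G k) g (t u Y y) = act (onobj G k) h (t u Y y)"
     using P[OF R] Z(1) t_nat[OF u Z(1) y] t_nat[OF u Z(2) y] unfolding P_def by simp
   qed
   then obtain x where x: "x \<in> onobj (onobj G k) X" "act (onobj G k) f x = t u Y y" by blast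
   have "t (idn J k) Y (t u Y y) = t u Y y"
    using t_cmp[OF u J.idn_hom[OF k] Y y] J.cmp_idn_left[OF u] by simp
   then have "Q Y (k, act (onobj G k) f x) e"
    unfolding Q_def jy fst_conv snd_conv x(2) using k j t_in[OF u Y y] y J.idn_hom[OF k] u by blast
   then show ?thesis using X Y k x by (intro exI[of _ "(k, x)"]) (simp add: Q_refl)
  qed
  show "small U ((\<lambda>e. e) ` {x. X \<in> obj T \<and> Q X x x})" if X: "X \<in> obj T" for X
  proof (rule small_subset)
   show "small U (Sigma (obj J) (\<lambda>j. onobj (onobj G j) X))" by (intro small_Sigma J E_small[OF Gj X])
   show "(\<lambda>e. e) ` {x. X \<in> obj T \<and> Q X x x} \<subseteq> Sigma (obj J) (\<lambda>j. onobj (onobj G j) X)" by (auto simp: Q_def)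
  qed
  fix H kp assume 1: "H \<in> obj E" and 2: "\<And>X. X \<in> obj T ==> onobj H X = kp X ` {x. X \<in> obj T \<and> Q X x x}"
   and 3: "\<And>X x y. X \<in> obj T ==> X \<in> obj T \<and> Q X x x ==> X \<in> obj T \<and> Q X y y ==>
    kp X x = kp X y \<longleftrightarrow> X \<in> obj T \<and> Q X x y"
   and 4: "\<And>f X Y x. f \<in> hom T X Y ==> X \<in> obj T \<and> Q X x x ==>
    act H f (kp X x) = kp Y (fst x, act (onobj G (fst x)) f (snd x))"
  show thesis
  proof (rule that[of H kp])
   show "H \<in> obj E" by (rule 1)
   show "onobj H X = kp X ` {x. Q X x x}" if "X \<in> obj T" for X using 2[OF that] that by simp
   show "kp X x = kp X y \<longleftrightarrow> Q X x y" if "X \<in> obj T" "Q X x x" "Q X y y" for X x y using 3[of X x y] that by simp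
   show "act H f (kp X x) = kp Y (fst x, act (onobj G (fst x)) f (snd x))" if "f \<in> hom T X Y" "Q X x x" for f X Y x
    using 4[OF that(1)] that(2) hom_obj(1)[OF that(1)] by blast
  qed
 qed simp
 have p: "\<And>j. j \<in> obj J ==> p j \<in> hom E (onobj G j) L" and pu: "\<And>u j k. u \<in> hom J j k ==> cmp E (p k) (onarr G u) = p j"
  and L: "L \<in> obj E"
  and univ: "\<And>M q. is_cocone J E G M q ==> \<exists>!m. m \<in> hom E L M \<and> (\<forall>j\<in>obj J. cmp E m (p j) = q j)"
  using colim by (auto simp: is_colimit_def is_cocone_def hom_def)
 have put: "cm (p k) X (t u X x) = cm (p j) X x" if u: "u \<in> hom J j k" and "X \<in> obj T" "x \<in> onobj (onobj G j) X" for u j k X x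
  unfolding t_def using cm_cmp[OF Gu[OF u] p[OF J.hom_obj(2)[OF u]] that(2,3)] pu[OF u] by simp
 define q where "q j = mk_hom (onobj G j) (\<lambda>X x. kp X (j, x)) H" for j
 have q: "q j \<in> hom E (onobj G j) H" if j: "j \<in> obj J" for j
  unfolding q_def
 proof (rule mk_hom[OF Gj[OF j] H])
  show "kp X (j, x) \<in> onobj H X" if "X \<in> obj T" "x \<in> onobj (onobj G j) X" for X x
   using el[OF that(1)] that j by (auto simp: Q_refl)
  show "kp Y (j, act (onobj G j) f x) = act H f (kp X (j, x))" if "f \<in> hom T X Y" "x \<in> onobj (onobj G j) X" for f X Y x
   using act[OF that(1), of "(j, x)"] that j by (simp add: Q_refl)
 qed
 have "is_cocone J E G H q"
  unfolding is_cocone_def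
 proof (intro conjI ballI H q)
  fix u assume "u \<in> arr J"
  then obtain j k where u: "u \<in> hom J j k" by (blast intro: arr_hom)
  note jk = J.hom_obj[OF u]
  have "cmp E (q k) (onarr G u) = q j"
  proof (rule E_ext[OF E_cmp_hom[OF Gu[OF u] q[OF jk(2)]] q[OF jk(1)]])
   fix X x assume X: "X \<in> obj T" and x: "x \<in> onobj (onobj G j) X"
   have "t (idn J k) X (t u X x) = t u X x"
    using t_cmp[OF u J.idn_hom[OF jk(2)] X x] J.cmp_idn_left[OF u] by simp
   then have "Q X (k, t u X x) (j, x)"
    unfolding Q_def fst_conv snd_conv using jk x t_in[OF u X x] u J.idn_hom[OF jk(2)] by blast
   then have "kp X (k, t u X x) = kp X (j, x)"
    using kp[OF X, of "(k, t u X x)" "(j, x)"] jk x t_in[OF u X x] by (simp add: Q_refl)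
   then show "cm (cmp E (q k) (onarr G u)) X x = cm (q j) X x"
    using cm_cmp[OF Gu[OF u] q[OF jk(2)] X x] t_in[OF u X x] x X by (simp add: q_def t_def)
  qed
  then show "cmp E (q (tgt J u)) (onarr G u) = q (src J u)" using homD[OF u] by simp
 qed
 from univ[OF this] obtain m where m: "m \<in> hom E L H" "\<And>j. j \<in> obj J ==> cmp E m (p j) = q j" by blast
 define c where "c X w = (SOME z. \<exists>j x. Q X (j, x) (j, x) \<and> kp X (j, x) = w \<and> z = cm (p j) X x)" for X w
 have c: "c X (kp X (j, x)) = cm (p j) X x" if X: "X \<in> obj T" and jx: "j \<in> obj J" "x \<in> onobj (onobj G j) X" for X j x
  unfolding c_def
 proof (rule some_equality)
  show "\<exists>j' x'. Q X (j', x') (j', x') \<and> kp X (j', x') = kp X (j, x) \<and> cm (p j) X x = cm (p j') X x'"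
   using jx Q_refl by blast
  fix z assume "\<exists>j' x'. Q X (j', x') (j', x') \<and> kp X (j', x') = kp X (j, x) \<and> z = cm (p j') X x'"
  then obtain j' x' where *: "Q X (j', x') (j', x')" "kp X (j', x') = kp X (j, x)" "z = cm (p j') X x'" by blast
  then have "Q X (j', x') (j, x)" using kp[OF X *(1), of "(j, x)"] jx by (simp add: Q_refl)
  then obtain l u v where uv: "x' \<in> onobj (onobj G j') X" "u \<in> hom J j' l" "v \<in> hom J j l" "t u X x' = t v X x" by (auto simp: Q_def)
  then show "z = cm (p j) X x" using put[OF uv(2) X uv(1)] put[OF uv(3) X jx(2)] *(3) by simp
 qed
 have n: "mk_hom H c L \<in> hom E H L"
 proof (rule mk_hom[OF H L])
  fix X w assume X: "X \<in> obj T" and "w \<in> onobj H X"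
  then obtain j x where "j \<in> obj J" "x \<in> onobj (onobj G j) X" "w = kp X (j, x)" using el[OF X] by (auto simp: Q_refl)
  then show "c X w \<in> onobj L X" using c[OF X] cm_in[OF p X] by simp
 next
  fix f X Y w assume f: "f \<in> hom T X Y" and w: "w \<in> onobj H X"
  note X = hom_obj(1)[OF f] and Y = hom_obj(2)[OF f]
  obtain j x where x: "j \<in> obj J" "x \<in> onobj (onobj G j) X" "w = kp X (j, x)" using w el[OF X] by (auto simp: Q_refl)
  have "act H f w = kp Y (j, act (onobj G j) f x)" using act[OF f, of "(j, x)"] x by (simp add: Q_refl)
  then show "c Y (act H f w) = act L f (c X w)"
   using x c[OF X x(1,2)] c[OF Y x(1) E_act[OF Gj[OF x(1)] f x(2)]] cm_nat[OF p[OF x(1)] f x(2)] by simp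
 qed
 have mp: "cm m X (cm (p j) X x) = kp X (j, x)" if "X \<in> obj T" "j \<in> obj J" "x \<in> onobj (onobj G j) X" for X j x
  using cm_cmp[OF p[OF that(2)] m(1) that(1,3)] m(2)[OF that(2)] that by (simp add: q_def)
 \<comment> \<open>This one-sided inverse suffices for surjectivity; for the second claim, m turns
   an equality in L into an equality of germs.\<close>
 have nm: "cmp E (mk_hom H c L) m = idn E L"
 proof -
  have "cmp E (cmp E (mk_hom H c L) m) (p j) = p j" if j: "j \<in> obj J" for j
  proof (rule E_ext[OF E_cmp_hom[OF p[OF j] E_cmp_hom[OF m(1) n]] p[OF j]])
   fix X x assume X: "X \<in> obj T" and x: "x \<in> onobj (onobj G j) X"
   have px: "cm (p j) X x \<in> onobj L X" using cm_in[OF p[OF j] X x] .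
   have "kp X (j, x) \<in> onobj H X" using el[OF X] x j by (auto simp: Q_refl)
   then show "cm (cmp E (cmp E (mk_hom H c L) m) (p j)) X x = cm (p j) X x"
    using cm_cmp[OF p[OF j] E_cmp_hom[OF m(1) n] X x] cm_cmp[OF m(1) n X px] mp[OF X j x] c[OF X j x] X by simp
  qed
  moreover have "cmp E (idn E L) (p j) = p j" if j: "j \<in> obj J" for j
   by (rule category.cmp_idn_left[OF category_E p[OF j]])
  moreover have "is_cocone J E G L p" using colim by (simp add: is_colimit_def)
  ultimately show ?thesis using univ[of L p] E_cmp_hom[OF m(1) n] E_idn_hom[OF L] by blast
 qed
 show "\<exists>j\<in>obj J. \<exists>y\<in>onobj (onobj G j) X. cm (p j) X y = x" if X: "X \<in> obj T" and x: "x \<in> onobj L X"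
 proof -
  have mx: "cm m X x \<in> onobj H X" using cm_in[OF m(1) X x] .
  then obtain j y where y: "j \<in> obj J" "y \<in> onobj (onobj G j) X" "cm m X x = kp X (j, y)" using el[OF X] by (auto simp: Q_refl)
  have "x = cm (cmp E (mk_hom H c L) m) X x" using nm X x by simp
  also have "\<dots> = c X (cm m X x)" using cm_cmp[OF m(1) n X x] X mx by simp
  also have "\<dots> = cm (p j) X y" using y c[OF X y(1,2)] by simp
  finally show ?thesis using y by blast
 qed
 show "\<exists>k. \<exists>u\<in>hom J j k. cm (onarr G u) X x = cm (onarr G u) X y"
  if X: "X \<in> obj T" and j: "j \<in> obj J" and x: "x \<in> onobj (onobj G j) X" and y: "y \<in> onobj (onobj G j) X"
   and eq: "cm (p j) X x = cm (p j) X y"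
 proof -
  have "kp X (j, x) = kp X (j, y)" using mp[OF X j x] mp[OF X j y] eq by simp
  then have "Q X (j, x) (j, y)" using kp[OF X, of "(j, x)" "(j, y)"] j x y by (simp add: Q_refl)
  then show ?thesis unfolding Q_same[OF X] t_def by blast
 qed
qed

text \<open>A map out of H is a finite tuple of elements subject to finitely many equations. In a
  filtered colimit the tuple lives at one stage and the equations hold at a later one; two tuples
  with the same image agree at a later stage as well.\<close>

lemma finitely_presentable:
 assumes H: "presents H q Gs ty Rs" and wt: "well_typed Gs ty Rs" and fin: "finite Gs" "finite Rs"
 shows "finitely_presentable U E H"
 unfolding finitely_presentable_def preserves_filtered_colimits_def
proof (intro conjI allI impI)
 have HE: "H \<in> obj E" and Hm: "model Gs ty Rs H q" using H by (auto simp: presents_def)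
 show "H \<in> obj E" by (rule HE)
 have ty: "ty g \<in> obj T" if "g \<in> Gs" for g using wt that by (simp add: well_typed_def)
 have qg: "q g \<in> onobj H (ty g)" if "g \<in> Gs" for g using Hm that by (simp add: model_def)
 fix J :: "('u, 'u) cat" and G L p
 assume *: "small_category U J \<and> filtered J \<and> is_functor J E G \<and> is_colimit J E G L p"
 then have J: "category J" "filtered J" "small U (obj J)" and G: "is_functor J E G" and colim: "is_colimit J E G L p"
  by (auto simp: small_category_def)
 interpret J: filtered_category J by (intro filtered_category.intro J filtered_category_axioms.intro)
 have Gu: "onarr G u \<in> hom E (onobj G j) (onobj G k)" if "u \<in> hom J j k" for u j k using is_functorD(2)[OF G that] .
 have Gj: "onobj G j \<in> obj E" if "j \<in> obj J" for j using is_functorD(1)[OF G that] .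
 have p: "\<And>j. j \<in> obj J ==> p j \<in> hom E (onobj G j) L" and pu: "\<And>u j k. u \<in> hom J j k ==> cmp E (p k) (onarr G u) = p j"
  and L: "L \<in> obj E"
  using colim by (auto simp: is_colimit_def is_cocone_def hom_def)
 note surj = filtered_colimit_elements(1)[OF J G colim] and inj = filtered_colimit_elements(2)[OF J G colim]
 have Guu: "cm (onarr G (cmp J v u)) X x = cm (onarr G v) X (cm (onarr G u) X x)"
  if "u \<in> hom J j k" "v \<in> hom J k l" "X \<in> obj T" "x \<in> onobj (onobj G j) X" for u v j k l X x
  using is_functorD(4)[OF G that(1,2)] cm_cmp[OF Gu[OF that(1)] Gu[OF that(2)] that(3,4)] by simp
 have put: "cm (p k) X (cm (onarr G u) X x) = cm (p j) X x" if u: "u \<in> hom J j k" and "X \<in> obj T" "x \<in> onobj (onobj G j) X" for u j k X x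
  using cm_cmp[OF Gu[OF u] p[OF J.hom_obj(2)[OF u]] that(2,3)] pu[OF u] by simp
 define h where "h = hom_functor E H"
 have hF: "is_functor E (Set_cat U) h" unfolding h_def by (rule hom_functor_functor[OF category_E locally_small_E HE])
 have ho: "onobj h F = hom E H F" if "F \<in> obj E" for F using that by (simp add: h_def hom_functor_def)
 have ha: "app (onarr h m) k = cmp E m k" if "m \<in> hom E F F'" "k \<in> hom E H F" for m k F F'
  using that by (auto simp: h_def hom_functor_def hom_def app_def)
 have co: "onobj (comp_functor J h G) j = hom E H (onobj G j)" if "j \<in> obj J" for j
  using that ho[OF Gj[OF that]] by (simp add: comp_functor_def)
 have ca: "app (onarr (comp_functor J h G) u) k = cmp E (onarr G u) k" if "u \<in> hom J i j" "k \<in> hom E H (onobj G i)" for u i j k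
  using that ha[OF Gu[OF that(1)] that(2)] homD(1)[OF that(1)] by (simp add: comp_functor_def)
 have "is_colimit J (Set_cat U) (comp_functor J h G) (hom E H L) (\<lambda>j. onarr h (p j))"
 proof (rule Set_filtered_colimitI[OF J(1,2) is_functor_comp[OF G hF J(1)]])
  show "onarr h (p j) \<in> hom (Set_cat U) (onobj (comp_functor J h G) j) (hom E H L)" if j: "j \<in> obj J" for j
   using is_functorD(2)[OF hF p[OF j]] co[OF j] ho[OF Gj[OF j]] ho[OF L] by simp
  show "app (onarr h (p k)) (app (onarr (comp_functor J h G) u) x) = app (onarr h (p j)) x"
   if u: "u \<in> hom J j k" and x: "x \<in> onobj (comp_functor J h G) j" for u j k x
  proof -
   note jk = J.hom_obj[OF u]
   have x': "x \<in> hom E H (onobj G j)" using x co[OF jk(1)] by simp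
   show ?thesis
    using ca[OF u x'] ha[OF p[OF jk(2)] E_cmp_hom[OF x' Gu[OF u]]] ha[OF p[OF jk(1)] x'] pu[OF u]
     category.cmp_assoc[OF category_E x' Gu[OF u] p[OF jk(2)]] by simp
  qed
 next
  fix l assume l: "l \<in> hom E H L"
  have "\<forall>g\<in>Gs. \<exists>j\<in>obj J. \<exists>y\<in>onobj (onobj G j) (ty g). cm (p j) (ty g) y = cm l (ty g) (q g)"
   using surj[OF ty cm_in[OF l ty qg]] by blast
  then obtain c y where c: "\<And>g. g \<in> Gs ==> c g \<in> obj J"
   and y: "\<And>g. g \<in> Gs ==> y g \<in> onobj (onobj G (c g)) (ty g)"
   and py: "\<And>g. g \<in> Gs ==> cm (p (c g)) (ty g) (y g) = cm l (ty g) (q g)" by metis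
  obtain j where j: "j \<in> obj J" "\<And>g. g \<in> Gs ==> hom J (c g) j \<noteq> {}"
   using J.filtered_upper_bound[OF fin(1), of c] c by blast
  have "\<forall>g\<in>Gs. \<exists>u. u \<in> hom J (c g) j" using j(2) by blast
  then obtain u where u: "\<And>g. g \<in> Gs ==> u g \<in> hom J (c g) j" by metis
  define z where "z g = cm (onarr G (u g)) (ty g) (y g)" for g
  have z: "z g \<in> onobj (onobj G j) (ty g)" and pz: "cm (p j) (ty g) (z g) = cm l (ty g) (q g)" if g: "g \<in> Gs" for g
   unfolding z_def using cm_in[OF Gu[OF u[OF g]] ty[OF g] y[OF g]] put[OF u[OF g] ty[OF g] y[OF g]] py[OF g] by auto
  \<comment> \<open>The condition has to mention its own stage, which is read off as the target of
    w.\<close>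
  define P where "P = (\<lambda>(g, f, g', f') w. act (onobj G (tgt J w)) f (cm (onarr G w) (ty g) (z g)) =
    act (onobj G (tgt J w)) f' (cm (onarr G w) (ty g') (z g')))"
  have "\<exists>k. \<exists>w\<in>hom J j k. \<forall>rh\<in>Rs. P rh w"
  proof (rule J.filtered_finite[OF fin(2) j(1)])
   fix rh assume rhR: "rh \<in> Rs"
   obtain g f g' f' where rh: "rh = (g, f, g', f')" by (cases rh)
   obtain Z where g: "g \<in> Gs" "g' \<in> Gs" and f: "f \<in> hom T (ty g) Z" "f' \<in> hom T (ty g') Z"
    using wt rhR unfolding rh well_typed_def by blast
   have eq: "act L f (cm l (ty g) (q g)) = act L f' (cm l (ty g') (q g'))"
    using model_hom[OF wt Hm l] rhR unfolding rh model_def by blast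
   have "cm (p j) Z (act (onobj G j) f (z g)) = cm (p j) Z (act (onobj G j) f' (z g'))"
    using cm_nat[OF p[OF j(1)] f(1) z[OF g(1)]] cm_nat[OF p[OF j(1)] f(2) z[OF g(2)]] pz[OF g(1)] pz[OF g(2)] eq by simp
   then obtain k w where w: "w \<in> hom J j k"
    "cm (onarr G w) Z (act (onobj G j) f (z g)) = cm (onarr G w) Z (act (onobj G j) f' (z g'))"
    using inj[OF hom_obj(2)[OF f(1)] j(1) E_act[OF Gj[OF j(1)] f(1) z[OF g(1)]] E_act[OF Gj[OF j(1)] f(2) z[OF g(2)]]] by blast
   then have "P rh w"
    using cm_nat[OF Gu[OF w(1)] f(1) z[OF g(1)]] cm_nat[OF Gu[OF w(1)] f(2) z[OF g(2)]] homD(3)[OF w(1)]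
    by (simp add: P_def rh)
   then show "\<exists>k. \<exists>w\<in>hom J j k. P rh w" using w(1) by blast
   fix w v k m assume w: "w \<in> hom J j k" and v: "v \<in> hom J k m" and P: "P rh w"
   have zg: "cm (onarr G w) (ty g) (z g) \<in> onobj (onobj G k) (ty g)" "cm (onarr G w) (ty g') (z g') \<in> onobj (onobj G k) (ty g')"
    using cm_in[OF Gu[OF w] ty z] g by auto
   have "act (onobj G k) f (cm (onarr G w) (ty g) (z g)) = act (onobj G k) f' (cm (onarr G w) (ty g') (z g'))"
    using P homD(3)[OF w] by (simp add: P_def rh)
   then show "P rh (cmp J v w)"
    using cm_nat[OF Gu[OF v] f(1) zg(1)] cm_nat[OF Gu[OF v] f(2) zg(2)] Guu[OF w v ty z] g homD(3)[OF J.cmp_hom[OF w v]]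
    by (simp add: P_def rh)
  qed
  then obtain k w where w: "w \<in> hom J j k" and P: "\<And>rh. rh \<in> Rs ==> P rh w" by blast
  note k = J.hom_obj(2)[OF w]
  have "model Gs ty Rs (onobj G k) (\<lambda>g. cm (onarr G w) (ty g) (z g))"
   unfolding model_def
  proof (intro conjI ballI allI impI)
   show "cm (onarr G w) (ty g) (z g) \<in> onobj (onobj G k) (ty g)" if "g \<in> Gs" for g
    using cm_in[OF Gu[OF w] ty z] that by auto
   show "act (onobj G k) f (cm (onarr G w) (ty g) (z g)) = act (onobj G k) f' (cm (onarr G w) (ty g') (z g'))"
    if "(g, f, g', f') \<in> Rs" for g f g' f'
    using P[OF that] homD(3)[OF w] by (simp add: P_def)
  qed
  from presents_ex[OF H Gj[OF k] this] obtain y where y: "y \<in> hom E H (onobj G k)"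
   "\<And>g. g \<in> Gs ==> cm y (ty g) (q g) = cm (onarr G w) (ty g) (z g)" by blast
  have "cmp E (p k) y = l"
  proof (rule presents_unique[OF H wt E_cmp_hom[OF y(1) p[OF k]] l])
   fix g assume g: "g \<in> Gs"
   show "cm (cmp E (p k) y) (ty g) (q g) = cm l (ty g) (q g)"
    using cm_cmp[OF y(1) p[OF k] ty[OF g] qg[OF g]] y(2)[OF g] put[OF w ty[OF g] z[OF g]] pz[OF g] by simp
  qed
  then show "\<exists>j\<in>obj J. \<exists>y\<in>onobj (comp_functor J h G) j. app (onarr h (p j)) y = l"
   using k y(1) ha[OF p[OF k] y(1)] co[OF k] by auto
 next
  fix j x y assume j: "j \<in> obj J" and "x \<in> onobj (comp_functor J h G) j" "y \<in> onobj (comp_functor J h G) j"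
   and "app (onarr h (p j)) x = app (onarr h (p j)) y"
  then have x: "x \<in> hom E H (onobj G j)" and y: "y \<in> hom E H (onobj G j)" and eq: "cmp E (p j) x = cmp E (p j) y"
   using co[OF j] ha[OF p[OF j]] by auto
  define P where "P g u \<longleftrightarrow> cm (onarr G u) (ty g) (cm x (ty g) (q g)) = cm (onarr G u) (ty g) (cm y (ty g) (q g))" for g u
  have "\<exists>k. \<exists>u\<in>hom J j k. \<forall>g\<in>Gs. P g u"
  proof (rule J.filtered_finite[OF fin(1) j])
   fix g assume g: "g \<in> Gs"
   note xg = cm_in[OF x ty[OF g] qg[OF g]] and yg = cm_in[OF y ty[OF g] qg[OF g]]
   have "cm (p j) (ty g) (cm x (ty g) (q g)) = cm (p j) (ty g) (cm y (ty g) (q g))"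
    using cm_cmp[OF x p[OF j] ty[OF g] qg[OF g]] cm_cmp[OF y p[OF j] ty[OF g] qg[OF g]] eq by simp
   then show "\<exists>k. \<exists>u\<in>hom J j k. P g u" unfolding P_def using inj[OF ty[OF g] j xg yg] by blast
   fix u v k m assume u: "u \<in> hom J j k" and v: "v \<in> hom J k m" and "P g u"
   then show "P g (cmp J v u)" using Guu[OF u v ty[OF g] xg] Guu[OF u v ty[OF g] yg] by (simp add: P_def)
  qed
  then obtain k u where u: "u \<in> hom J j k" and P: "\<And>g. g \<in> Gs ==> P g u" by blast
  have "cmp E (onarr G u) x = cmp E (onarr G u) y"
  proof (rule presents_unique[OF H wt E_cmp_hom[OF x Gu[OF u]] E_cmp_hom[OF y Gu[OF u]]])
   fix g assume g: "g \<in> Gs"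
   show "cm (cmp E (onarr G u) x) (ty g) (q g) = cm (cmp E (onarr G u) y) (ty g) (q g)"
    using cm_cmp[OF x Gu[OF u] ty[OF g] qg[OF g]] cm_cmp[OF y Gu[OF u] ty[OF g] qg[OF g]] P[OF g] by (simp add: P_def)
  qed
  then have "app (onarr (comp_functor J h G) u) x = app (onarr (comp_functor J h G) u) y"
   using ca[OF u x] ca[OF u y] by simp
  then show "\<exists>k. \<exists>u\<in>hom J j k. app (onarr (comp_functor J h G) u) x = app (onarr (comp_functor J h G) u) y"
   using u by blast
 qed
 then show "is_colimit J (Set_cat U) (comp_functor J (hom_functor E H) G) (onobj (hom_functor E H) L) (\<lambda>j. onarr (hom_functor E H) (p j))"
  using ho[OF L] by (simp add: h_def)
qed

text \<open>Generators are the positions of a list of types from S. Only small data remain, so the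
  presented sheaves can form the small generating set.\<close>

definition presentations :: "('o list \<times> (nat \<times> 'a \<times> nat \<times> 'a) set) set" where
 "presentations = {(Xs, R). Xs \<in> lists S \<and>
   R \<subseteq> UNIV \<times> (\<Union>X\<in>S. \<Union>Y\<in>S. hom T X Y) \<times> UNIV \<times> (\<Union>X\<in>S. \<Union>Y\<in>S. hom T X Y) \<and> finite R \<and>
   well_typed {..<length Xs} (\<lambda>i. Xs ! i) R}"

lemma small_presentations: "small U presentations"
proof (rule small_subset)
 let ?A = "\<Union>X\<in>S. \<Union>Y\<in>S. hom T X Y"
 let ?B = "(UNIV :: nat set) \<times> ?A \<times> (UNIV :: nat set) \<times> ?A"
 have "small U ?A" by (intro small_UN small_S small_hom S_obj)
 then show "small U (lists S \<times> {R. R \<subseteq> ?B \<and> finite R})"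
  by (intro small_Times small_lists small_S small_Fpow small_nat_set)
 show "presentations \<subseteq> lists S \<times> {R. R \<subseteq> ?B \<and> finite R}" by (auto simp: presentations_def)
qed

text \<open>Each sheaf is the directed colimit of the sheaves presented by the finite parts of its
  canonical presentation.\<close>

theorem locally_finitely_presentable_E: "locally_finitely_presentable U E"
 unfolding locally_finitely_presentable_def
proof (intro conjI category_E locally_small_E cocomplete_E)
 define Pr where "Pr \<pi> H \<longleftrightarrow> (\<exists>q. presents H q {..<length (fst \<pi>)} (\<lambda>i. fst \<pi> ! i) (snd \<pi>))" for \<pi> :: "'o list \<times> (nat \<times> 'a \<times> nat \<times> 'a) set" and H
 define HH where "HH \<pi> = (SOME H. Pr \<pi> H)" for \<pi>
 have wt: "well_typed {..<length (fst \<pi>)} (\<lambda>i. fst \<pi> ! i) (snd \<pi>)" and fin: "finite (snd \<pi>)"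
  if "\<pi> \<in> presentations" for \<pi> using that by (auto simp: presentations_def)
 have HH: "Pr \<pi> (HH \<pi>)" if \<pi>: "\<pi> \<in> presentations" for \<pi>
 proof -
  obtain H q where "presents H q {..<length (fst \<pi>)} (\<lambda>i. fst \<pi> ! i) (snd \<pi>)"
   by (rule ex_presents[OF _ wt[OF \<pi>]]) (simp add: small_nat_set)
  then have "Pr \<pi> H" unfolding Pr_def by blast
  then show ?thesis unfolding HH_def by (rule someI)
 qed
 let ?A = "HH ` presentations"
 show "\<exists>A. small U A \<and> (\<forall>X\<in>A. finitely_presentable U E X) \<and>
    (\<forall>Y\<in>obj E. \<exists>(J :: ('u, 'u) cat) G p. small_category U J \<and> filtered J \<and> is_functor J E G \<and>
      (\<forall>j\<in>obj J. onobj G j \<in> A) \<and> is_colimit J E G Y p)"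
 proof (intro exI[of _ ?A] conjI ballI)
  show "small U ?A" by (rule small_image[OF small_presentations])
  show "finitely_presentable U E X" if XA: "X \<in> ?A" for X
  proof -
   obtain \<pi> where \<pi>: "\<pi> \<in> presentations" "X = HH \<pi>" using XA by blast
   obtain q where "presents X q {..<length (fst \<pi>)} (\<lambda>i. fst \<pi> ! i) (snd \<pi>)" using HH[OF \<pi>(1)] unfolding Pr_def \<pi>(2) by blast
   then show ?thesis by (rule finitely_presentable[OF _ wt[OF \<pi>(1)] finite_lessThan fin[OF \<pi>(1)]])
  qed
  fix F assume F: "F \<in> obj E"
  \<comment> \<open>A finite part contains the generators that its relations mention; unions of
    parts are again parts, which gives directedness.\<close>
  define D where "D = {(s, rh). s \<subseteq> elts F \<and> finite s \<and> rh \<subseteq> rels F \<and> finite rh \<and>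
   (\<forall>g f g' f'. (g, f, g', f') \<in> rh --> g \<in> s \<and> g' \<in> s)}"
  define le where "le d d' \<longleftrightarrow> fst d \<subseteq> fst d' \<and> snd d \<subseteq> snd d'" for d d' :: "('o \<times> 'u) set \<times> (('o \<times> 'u) \<times> 'a \<times> ('o \<times> 'u) \<times> 'a) set"
  have sD: "small U D"
  proof (rule small_subset)
   show "small U ({s. s \<subseteq> elts F \<and> finite s} \<times> {rh. rh \<subseteq> rels F \<and> finite rh})"
    by (intro small_Times small_Fpow small_elts small_rels F)
  qed (auto simp: D_def)
  have wtD: "well_typed (fst d) fst (snd d)" if "d \<in> D" for d
  proof -
   have "fst d \<subseteq> elts F" "snd d \<subseteq> rels F" using that unfolding D_def by auto
   moreover have "g \<in> fst d \<and> g' \<in> fst d" if "(g, f, g', f') \<in> snd d" for g f g' f'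
    using that \<open>d \<in> D\<close> unfolding D_def mem_Collect_eq case_prod_unfold by blast
   ultimately show ?thesis using well_typed_self[of F] unfolding well_typed_def by blast
  qed
  have "\<exists>H q. H \<in> ?A \<and> presents H q (fst d) fst (snd d)" if d: "d \<in> D" for d
  proof -
   obtain s rh where srh: "d = (s, rh)" by (cases d)
   have s: "s \<subseteq> elts F" "finite s" and rh: "rh \<subseteq> rels F" "finite rh"
    and gen: "\<And>g f g' f'. (g, f, g', f') \<in> rh ==> g \<in> s \<and> g' \<in> s"
    using d unfolding D_def srh mem_Collect_eq case_prod_conv by blast+
   obtain gs where gs: "set gs = s" "distinct gs" using finite_distinct_list[OF s(2)] by blast
   define ix where "ix = the_inv_into {..<length gs} (\<lambda>i. gs ! i)"
   have bij: "bij_betw (\<lambda>i. gs ! i) {..<length gs} s" using bij_betw_nth[OF gs(2)] gs(1) by blast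
   have ix: "bij_betw ix s {..<length gs}" unfolding ix_def by (rule bij_betw_the_inv_into[OF bij])
   have gs_ix: "gs ! ix g = g" if "g \<in> s" for g
    using f_the_inv_into_f_bij_betw[OF bij] that by (simp add: ix_def)
   have ix_lt: "ix g < length gs" if "g \<in> s" for g using ix that by (auto simp: bij_betw_def)
   define R where "R = (\<lambda>(g, f, g', f'). (ix g, f, ix g', f')) ` rh"
   have \<pi>: "(map fst gs, R) \<in> presentations"
    unfolding presentations_def mem_Collect_eq case_prod_conv
   proof (intro conjI)
    have "fst g \<in> S" if "g \<in> set gs" for g using subsetD[OF s(1), of g] that gs(1) by (auto simp: elts_def)
    then show "map fst gs \<in> lists S" by auto
    show "finite R" using rh by (simp add: R_def)
    have *: "\<exists>Z\<in>S. f \<in> hom T (fst g) Z \<and> f' \<in> hom T (fst g') Z \<and> g \<in> s \<and> g' \<in> s \<and> fst g \<in> S \<and> fst g' \<in> S" if "(g, f, g', f') \<in> rh" for g f g' f'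
    proof -
     have "(g, f, g', f') \<in> rels F" using subsetD[OF rh(1) that] .
     then show ?thesis using gen[OF that] by (auto simp: rels_def elts_def)
    qed
    show "R \<subseteq> UNIV \<times> (\<Union>X\<in>S. \<Union>Y\<in>S. hom T X Y) \<times> UNIV \<times> (\<Union>X\<in>S. \<Union>Y\<in>S. hom T X Y)"
    proof
     fix e assume "e \<in> R"
     then obtain g f g' f' where e: "(g, f, g', f') \<in> rh" "e = (ix g, f, ix g', f')" by (auto simp: R_def)
     then show "e \<in> UNIV \<times> (\<Union>X\<in>S. \<Union>Y\<in>S. hom T X Y) \<times> UNIV \<times> (\<Union>X\<in>S. \<Union>Y\<in>S. hom T X Y)"
      using *[OF e(1)] by blast
    qed
    show "well_typed {..<length (map fst gs)} (\<lambda>i. map fst gs ! i) R"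
     unfolding well_typed_def
    proof (intro conjI ballI allI impI)
     show "map fst gs ! i \<in> obj T" if "i \<in> {..<length (map fst gs)}" for i
     proof -
      have "gs ! i \<in> elts F" using that gs(1) subsetD[OF s(1), of "gs ! i"] nth_mem[of i gs] by simp
      then show ?thesis using that S_obj by (auto simp: elts_def)
     qed
     fix a f b f' assume "(a, f, b, f') \<in> R"
     then obtain g g' where e: "(g, f, g', f') \<in> rh" "a = ix g" "b = ix g'" by (auto simp: R_def)
     have gg: "g \<in> s" "g' \<in> s" using gen[OF e(1)] by auto
     show "a \<in> {..<length (map fst gs)}" "b \<in> {..<length (map fst gs)}"
      "\<exists>Z. f \<in> hom T (map fst gs ! a) Z \<and> f' \<in> hom T (map fst gs ! b) Z"
      using *[OF e(1)] ix_lt[OF gg(1)] ix_lt[OF gg(2)] gs_ix[OF gg(1)] gs_ix[OF gg(2)]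
      unfolding e(2,3) by auto
    qed
   qed
   then obtain q where q: "presents (HH (map fst gs, R)) q {..<length gs} (\<lambda>i. map fst gs ! i) R"
    using HH unfolding Pr_def by fastforce
   have "presents (HH (map fst gs, R)) (q \<circ> ix) s fst rh"
    by (rule presents_rename[OF q ix _ R_def gen]) (simp add: ix_lt gs_ix)
   then show ?thesis using \<pi> srh by auto
  qed
  then obtain H q where HA: "\<And>d. d \<in> D ==> H d \<in> ?A" and H: "\<And>d. d \<in> D ==> presents (H d) (q d) (fst d) fst (snd d)" by metis
  have HE: "H d \<in> obj E" and qm: "model (fst d) fst (snd d) (H d) (q d)" if "d \<in> D" for d
   using H[OF that] by (auto simp: presents_def)
  have m_le: "model (fst d) fst (snd d) M m" if "le d d'" "model (fst d') fst (snd d') M m" for d d' M m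
   using that unfolding le_def model_def by blast
  have "\<exists>k. k \<in> hom E (H d) (H d') \<and> (\<forall>g\<in>fst d. cm k (fst g) (q d g) = q d' g)" if "d \<in> D" "d' \<in> D" "le d d'" for d d'
   using H[OF that(1)] HE[OF that(2)] m_le[OF that(3) qm[OF that(2)]] unfolding presents_def by blast
  then obtain tr where tr: "\<And>d d'. d \<in> D ==> d' \<in> D ==> le d d' ==> tr d d' \<in> hom E (H d) (H d')"
   and trq: "\<And>d d' g. d \<in> D ==> d' \<in> D ==> le d d' ==> g \<in> fst d ==> cm (tr d d') (fst g) (q d g) = q d' g" by metis
  have ty: "fst g \<in> obj T" and qg: "q d g \<in> onobj (H d) (fst g)" if "d \<in> D" "g \<in> fst d" for d g
   using wtD[OF that(1)] qm[OF that(1)] that(2) by (auto simp: well_typed_def model_def)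
  have le_refl: "le d d" for d by (simp add: le_def)
  have le_trans: "le d d' ==> le d' d'' ==> le d d''" for d d' d'' unfolding le_def by blast
  obtain J :: "('u, 'u) cat" and G dl where J: "small_category U J" "filtered J" and G: "is_functor J E G"
   and dl: "inj_on dl D" and objJ: "obj J = dl ` D" and Go: "\<And>d. d \<in> D ==> onobj G (dl d) = H d"
   and arrJ: "\<And>a. a \<in> arr J ==> \<exists>d\<in>D. \<exists>d'\<in>D. le d d' \<and> src J a = dl d \<and> tgt J a = dl d' \<and> onarr G a = tr d d'"
   and arrI: "\<And>d d'. d \<in> D ==> d' \<in> D ==> le d d' ==> \<exists>a\<in>hom J (dl d) (dl d'). onarr G a = tr d d'"
  proof (rule poset_diagram[where D = D and le = le and C = E and H = H and tr = tr])
   show "small U D" by (rule sD)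
   show "D \<noteq> {}" by (auto simp: D_def)
   show "le d d" for d by (rule le_refl)
   show "le d d' ==> le d' d'' ==> le d d''" for d d' d'' by (rule le_trans)
   show "\<exists>d''\<in>D. le d d'' \<and> le d' d''" if "d \<in> D" "d' \<in> D" for d d'
   proof (rule bexI[of _ "(fst d \<union> fst d', snd d \<union> snd d')"])
    show "(fst d \<union> fst d', snd d \<union> snd d') \<in> D"
     using that unfolding D_def mem_Collect_eq case_prod_unfold fst_conv snd_conv
     by (intro conjI) (blast intro: finite_UnI)+
   qed (simp add: le_def)
   show "H d \<in> obj E" if "d \<in> D" for d by (rule HE[OF that])
   show "tr d d' \<in> hom E (H d) (H d')" if "d \<in> D" "d' \<in> D" "le d d'" for d d' by (rule tr[OF that])
   show "tr d d = idn E (H d)" if d: "d \<in> D" for d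
    by (rule presents_unique[OF H[OF d] wtD[OF d] tr[OF d d le_refl] E_idn_hom[OF HE[OF d]]])
     (simp add: trq[OF d d le_refl] ty[OF d] qg[OF d])
   show "cmp E (tr d' d'') (tr d d') = tr d d''"
    if d: "d \<in> D" and d': "d' \<in> D" and d'': "d'' \<in> D" and l: "le d d'" "le d' d''" for d d' d''
   proof (rule presents_unique[OF H[OF d] wtD[OF d] E_cmp_hom[OF tr[OF d d' l(1)] tr[OF d' d'' l(2)]] tr[OF d d'' le_trans[OF l]]])
    fix g assume g: "g \<in> fst d"
    then have g': "g \<in> fst d'" using l(1) by (auto simp: le_def)
    show "cm (cmp E (tr d' d'') (tr d d')) (fst g) (q d g) = cm (tr d d'') (fst g) (q d g)"
     using cm_cmp[OF tr[OF d d' l(1)] tr[OF d' d'' l(2)] ty[OF d g] qg[OF d g]] trq[OF d d' l(1) g] trq[OF d' d'' l(2) g']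
      trq[OF d d'' le_trans[OF l] g] by simp
   qed
  qed (rule that)
  have mF: "model (fst d) fst (snd d) F snd" if "d \<in> D" for d
  proof -
   have "fst d \<subseteq> elts F" "snd d \<subseteq> rels F" using that unfolding D_def by auto
   moreover have "model (elts F) fst (rels F) F snd" using presents_self[OF F] by (simp add: presents_def)
   ultimately show ?thesis unfolding model_def by blast
  qed
  have "\<exists>k. k \<in> hom E (H d) F \<and> (\<forall>g\<in>fst d. cm k (fst g) (q d g) = snd g)" if "d \<in> D" for d
   using H[OF that] F mF[OF that] unfolding presents_def by blast
  then obtain p where p: "\<And>d. d \<in> D ==> p d \<in> hom E (H d) F"
   and pq: "\<And>d g. d \<in> D ==> g \<in> fst d ==> cm (p d) (fst g) (q d g) = snd g" by metis
  define p' where "p' x = p (the_inv_into D dl x)" for x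
  have p': "p' (dl d) = p d" if "d \<in> D" for d using that by (simp add: p'_def the_inv_into_f_f[OF dl])
  have "is_colimit J E G F p'"
   unfolding is_colimit_def
  proof (intro conjI allI impI)
   show "is_cocone J E G F p'"
    unfolding is_cocone_def
   proof (intro conjI ballI F)
    show "p' j \<in> hom E (onobj G j) F" if "j \<in> obj J" for j using that p p' Go by (auto simp: objJ)
    fix a assume "a \<in> arr J"
    then obtain d d' where d: "d \<in> D" "d' \<in> D" "le d d'" and a: "src J a = dl d" "tgt J a = dl d'" "onarr G a = tr d d'"
     using arrJ by blast
    have "cmp E (p d') (tr d d') = p d"
    proof (rule presents_unique[OF H[OF d(1)] wtD[OF d(1)] E_cmp_hom[OF tr[OF d] p[OF d(2)]] p[OF d(1)]])
     fix g assume g: "g \<in> fst d"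
     then have g': "g \<in> fst d'" using d(3) by (auto simp: le_def)
     show "cm (cmp E (p d') (tr d d')) (fst g) (q d g) = cm (p d) (fst g) (q d g)"
      using cm_cmp[OF tr[OF d] p[OF d(2)] ty[OF d(1) g] qg[OF d(1) g]] trq[OF d g] pq[OF d(1) g] pq[OF d(2) g'] by simp
    qed
    then show "cmp E (p' (tgt J a)) (onarr G a) = p' (src J a)" using a p' d by simp
   qed
   fix M l assume co: "is_cocone J E G M l"
   have M: "M \<in> obj E" and l: "\<And>d. d \<in> D ==> l (dl d) \<in> hom E (H d) M"
    using co Go by (auto simp: is_cocone_def objJ)
   have ltr: "cmp E (l (dl d')) (tr d d') = l (dl d)" if "d \<in> D" "d' \<in> D" "le d d'" for d d'
   proof -
    obtain a where a: "a \<in> hom J (dl d) (dl d')" "onarr G a = tr d d'" using arrI[OF \<open>d \<in> D\<close> \<open>d' \<in> D\<close> \<open>le d d'\<close>] by blast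
    then show ?thesis using co homD[OF a(1)] unfolding is_cocone_def by metis
   qed
   \<comment> \<open>The parts with one generator and no relation: they read off from a cocone its
     value at each element of F.\<close>
   have sing: "({g}, {}) \<in> D" if "g \<in> elts F" for g using that by (simp add: D_def)
   define m where "m g = cm (l (dl ({g}, {}))) (fst g) (q ({g}, {}) g)" for g
   have lm: "cm (l (dl d)) (fst g) (q d g) = m g" if d: "d \<in> D" and g: "g \<in> fst d" for d g
   proof -
    have g': "g \<in> elts F" using d g by (auto simp: D_def)
    have le: "le ({g}, {}) d" using g by (simp add: le_def)
    note s = sing[OF g']
    have gs: "g \<in> fst ({g}, {} :: (('o \<times> 'u) \<times> 'a \<times> ('o \<times> 'u) \<times> 'a) set)" by simp
    show ?thesis
     unfolding m_def ltr[OF s d le, symmetric]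
     using cm_cmp[OF tr[OF s d le] l[OF d] ty[OF s gs] qg[OF s gs]] trq[OF s d le gs] by simp
   qed
   have "model (elts F) fst (rels F) M m"
    unfolding model_def
   proof (intro conjI ballI allI impI)
    show "m g \<in> onobj M (fst g)" if g: "g \<in> elts F" for g
    proof -
     have gs: "g \<in> fst ({g}, {} :: (('o \<times> 'u) \<times> 'a \<times> ('o \<times> 'u) \<times> 'a) set)" by simp
     show ?thesis unfolding m_def by (rule cm_in[OF l[OF sing[OF g]] ty[OF sing[OF g] gs] qg[OF sing[OF g] gs]])
    qed
    fix g f g' f' assume R: "(g, f, g', f') \<in> rels F"
    \<comment> \<open>The part consisting of this one relation. Being a model there transfers the
      relation to the values \<open>m\<close>.\<close>
    define d where "d = ({g, g'}, {(g, f, g', f')})"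
    have d: "d \<in> D" using R by (auto simp: d_def D_def rels_def)
    have "model (fst d) fst (snd d) M (\<lambda>g. cm (l (dl d)) (fst g) (q d g))"
     by (rule model_hom[OF wtD[OF d] qm[OF d] l[OF d]])
    then have "act M f (cm (l (dl d)) (fst g) (q d g)) = act M f' (cm (l (dl d)) (fst g') (q d g'))"
     unfolding model_def by (simp add: d_def)
    then show "act M f (m g) = act M f' (m g')" using lm[OF d] by (simp add: d_def)
   qed
   from presents_ex[OF presents_self[OF F] M this] obtain k where k: "k \<in> hom E F M"
    "\<And>g. g \<in> elts F ==> cm k (fst g) (snd g) = m g" by blast
   have el: "g \<in> elts F" if "d \<in> D" "g \<in> fst d" for d g using that by (auto simp: D_def)
   show "\<exists>!k. k \<in> hom E F M \<and> (\<forall>j\<in>obj J. cmp E k (p' j) = l j)"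
   proof (rule ex1I[of _ k], intro conjI ballI k(1))
    fix j assume "j \<in> obj J"
    then obtain d where d: "d \<in> D" "j = dl d" by (auto simp: objJ)
    have "cmp E k (p d) = l (dl d)"
    proof (rule presents_unique[OF H[OF d(1)] wtD[OF d(1)] E_cmp_hom[OF p[OF d(1)] k(1)] l[OF d(1)]])
     fix g assume g: "g \<in> fst d"
     show "cm (cmp E k (p d)) (fst g) (q d g) = cm (l (dl d)) (fst g) (q d g)"
      using cm_cmp[OF p[OF d(1)] k(1) ty[OF d(1) g] qg[OF d(1) g]] pq[OF d(1) g] k(2)[OF el[OF d(1) g]] lm[OF d(1) g] by simp
    qed
    then show "cmp E k (p' j) = l j" using d p' by simp
   next
    fix k' assume k': "k' \<in> hom E F M \<and> (\<forall>j\<in>obj J. cmp E k' (p' j) = l j)"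
    then have k'h: "k' \<in> hom E F M" by simp
    show "k' = k"
    proof (rule presents_unique[OF presents_self[OF F] well_typed_self k'h k(1)])
     fix g assume g: "g \<in> elts F"
     note s = sing[OF g]
     have gs: "g \<in> fst ({g}, {} :: (('o \<times> 'u) \<times> 'a \<times> ('o \<times> 'u) \<times> 'a) set)" by simp
     have "cmp E k' (p ({g}, {})) = l (dl ({g}, {}))" using k' s p' by (auto simp: objJ)
     then have "cm k' (fst g) (snd g) = m g"
      using cm_cmp[OF p[OF s] k'h ty[OF s gs] qg[OF s gs]] pq[OF s gs] lm[OF s gs] by simp
     then show "cm k' (fst g) (snd g) = cm k (fst g) (snd g)" using k(2)[OF g] by simp
    qed
   qed
  qed
  then show "\<exists>(J :: ('u, 'u) cat) G p. small_category U J \<and> filtered J \<and> is_functor J E G \<and>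
      (\<forall>j\<in>obj J. onobj G j \<in> ?A) \<and> is_colimit J E G F p"
   using J G HA Go by (intro exI[of _ J] exI[of _ G] exI[of _ p']) (auto simp: objJ)
 qed
qed

end

section \<open>Full binary trees coded by sets of bit lists\<close>

section \<open>Trees and their codes\<close>

abbreviation kids :: "'u itree => 'u => 'u set" where
 "kids X x \<equiv> {y. (x, y) \<in> edge X}"

lemma path_to_snoc:
 "zs \<noteq> [] ==> path_to X y (zs @ [z]) \<longleftrightarrow> z = y \<and> path_to X (last zs) zs \<and> (last zs, y) \<in> edge X"
proof -
 assume zs: "zs \<noteq> []"
 have "(\<forall>i. Suc i < length (zs @ [z]) --> ((zs @ [z]) ! i, (zs @ [z]) ! Suc i) \<in> edge X) \<longleftrightarrow>
  (\<forall>i. Suc i < length zs --> (zs ! i, zs ! Suc i) \<in> edge X) \<and> (last zs, z) \<in> edge X"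
 proof (intro iffI conjI allI impI)
  assume *: "\<forall>i. Suc i < length (zs @ [z]) --> ((zs @ [z]) ! i, (zs @ [z]) ! Suc i) \<in> edge X"
  show "(zs ! i, zs ! Suc i) \<in> edge X" if "Suc i < length zs" for i
   using *[rule_format, of i] that by (simp add: nth_append)
  show "(last zs, z) \<in> edge X"
   using *[rule_format, of "length zs - 1"] zs by (simp add: nth_append last_conv_nth)
 next
  fix i assume *: "(\<forall>i. Suc i < length zs --> (zs ! i, zs ! Suc i) \<in> edge X) \<and> (last zs, z) \<in> edge X"
   and i: "Suc i < length (zs @ [z])"
  show "((zs @ [z]) ! i, (zs @ [z]) ! Suc i) \<in> edge X"
  proof (cases "Suc i < length zs")
   case False
   then have "Suc i = length zs" using i by simp
   then have i': "length zs - 1 = i" "i < length zs" by simp_all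
   have "(zs ! i, z) \<in> edge X" using * zs i' by (simp add: last_conv_nth)
   then show ?thesis using i' \<open>Suc i = length zs\<close> by (simp add: nth_append)
  qed (use * in \<open>simp add: nth_append\<close>)
 qed
 note eq = this
 show ?thesis unfolding path_to_def eq using zs by (auto simp: hd_append)
qed

lemma path_to_single [simp]: "path_to X y [z] \<longleftrightarrow> z = root X \<and> z = y"
 by (auto simp: path_to_def)

text \<open>A depth function that grows by one along edges replaces the path condition: it gives
  existence of paths by induction and keeps edges away from the root, while uniqueness of parents
  gives uniqueness of paths.\<close>

lemma full_binary_treeI:
 fixes d :: "'u => nat"
 assumes "root X \<in> nodes X" and edges: "\<And>x y. (x, y) \<in> edge X ==> x \<in> nodes X \<and> y \<in> nodes X"
  and kids: "\<And>x. x \<in> nodes X ==> kids X x = {} \<or> card (kids X x) = 2"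
  and d0: "d (root X) = 0" and dS: "\<And>x y. (x, y) \<in> edge X ==> d y = Suc (d x)"
  and uniq: "\<And>x x' y. (x, y) \<in> edge X ==> (x', y) \<in> edge X ==> x = x'"
  and par: "\<And>y. y \<in> nodes X ==> y \<noteq> root X ==> \<exists>x. (x, y) \<in> edge X"
 shows "full_binary_tree X"
 unfolding full_binary_tree_def
proof (intro conjI ballI)
 show "edge X \<subseteq> nodes X \<times> nodes X" using edges by auto
 fix x assume "x \<in> nodes X"
 moreover have "{y \<in> nodes X. (x, y) \<in> edge X} = kids X x" using edges by auto
 ultimately show "{y \<in> nodes X. (x, y) \<in> edge X} = {} \<or> card {y \<in> nodes X. (x, y) \<in> edge X} = 2"
  using kids by simp
next
 fix y assume y: "y \<in> nodes X"
 have "\<exists>xs. path_to X y xs" if "y \<in> nodes X" for y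
  using that
 proof (induction "d y" arbitrary: y rule: less_induct)
  case less
  show ?case
  proof (cases "y = root X")
   case True
   then have "path_to X y [y]" by simp
   then show ?thesis by blast
  next
   case False
   then obtain x where x: "(x, y) \<in> edge X" using par less.prems by blast
   then obtain xs where xs: "path_to X x xs" using less.hyps[of x] dS edges by force
   then have "xs \<noteq> []" "last xs = x" by (auto simp: path_to_def)
   then have "path_to X y (xs @ [y])" using xs x path_to_snoc by metis
   then show ?thesis by blast
  qed
 qed
 moreover have "xs = ys" if "path_to X y xs" "path_to X y ys" for xs ys y
  using that
 proof (induction xs arbitrary: y ys rule: rev_induct)
  case Nil then show ?case by (simp add: path_to_def)
 next
  case (snoc z zs)
  have ys: "ys \<noteq> []" using snoc.prems(2) by (simp add: path_to_def)
  then obtain ws w where w: "ys = ws @ [w]" by (metis rev_exhaust)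
  have noroot: "(v, root X) \<notin> edge X" for v using d0 dS by fastforce
  show ?case
  proof (cases "zs = []")
   case True
   then have y: "y = root X" "z = y" using snoc.prems(1) by auto
   have "ws = []"
   proof (rule ccontr)
    assume "ws \<noteq> []"
    then show False using snoc.prems(2) noroot y unfolding w path_to_snoc[OF \<open>ws \<noteq> []\<close>] by blast
   qed
   then show ?thesis using snoc.prems(2) y True by (simp add: w)
  next
   case False
   then have z: "z = y" "path_to X (last zs) zs" "(last zs, y) \<in> edge X"
    using snoc.prems(1) unfolding path_to_snoc[OF False] by blast+
   have ws: "ws \<noteq> []"
   proof
    assume "ws = []"
    then have "y = root X" using snoc.prems(2) by (auto simp: w)
    then show False using z noroot by blast
   qed
   then have "w = y" "path_to X (last ws) ws" "(last ws, y) \<in> edge X"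
    using snoc.prems(2) unfolding w path_to_snoc[OF ws] by blast+
   then show ?thesis using z snoc.IH uniq w by metis
  qed
 qed
 ultimately show "\<exists>!xs. path_to X y xs" using y by blast
qed (rule assms(1))

definition pth :: "'u itree => 'u => 'u list" where "pth X y = (THE xs. path_to X y xs)"
definition depth :: "'u itree => 'u => nat" where "depth X y = length (pth X y) - 1"
text \<open>The root has no side, hence the \<open>tl\<close>.\<close>

definition code :: "'u itree => ('u => bool) => 'u => bool list" where "code X s y = map s (tl (pth X y))"

text \<open>A choice of sides distinguishes the two children of every inner node, and so embeds the tree
 into the complete binary tree of bit lists.\<close>

definition sides :: "'u itree => ('u => bool) => bool" where
 "sides X s \<longleftrightarrow> (\<forall>x y y'. (x, y) \<in> edge X --> (x, y') \<in> edge X --> y \<noteq> y' --> s y \<noteq> s y')"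

text \<open>The shift by one skips the root, so that the first n entries are the code of the node
  \<open>b n\<close>.\<close>

definition bcode :: "('u => bool) => (nat => 'u) => nat => bool" where "bcode s b n = s (b (Suc n))"

locale fbt = fixes X :: "'u itree" assumes full: "full_binary_tree X"
begin

lemma root_node: "root X \<in> nodes X" using full by (simp add: full_binary_tree_def)

lemma edge_nodes: "(x, y) \<in> edge X ==> x \<in> nodes X" "(x, y) \<in> edge X ==> y \<in> nodes X"
 using full by (auto simp: full_binary_tree_def)

lemma kids_card: "kids X x = {} \<or> card (kids X x) = 2"
proof (cases "x \<in> nodes X")
 case True
 have eq: "{y \<in> nodes X. (x, y) \<in> edge X} = kids X x" using edge_nodes by auto
 have "\<forall>x\<in>nodes X. {y \<in> nodes X. (x, y) \<in> edge X} = {} \<or> card {y \<in> nodes X. (x, y) \<in> edge X} = 2"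
  using full unfolding full_binary_tree_def by (elim conjE)
 from bspec[OF this True] show ?thesis unfolding eq .
qed (use edge_nodes in auto)

lemma pth: "y \<in> nodes X ==> path_to X y (pth X y)"
 unfolding pth_def by (rule theI') (use full in \<open>simp add: full_binary_tree_def\<close>)

lemma pth_eq: "y \<in> nodes X ==> path_to X y xs ==> pth X y = xs"
 using full pth unfolding full_binary_tree_def by blast

lemma pth_root: "pth X (root X) = [root X]"
 by (rule pth_eq[OF root_node]) simp

lemma pth_edge: assumes e: "(x, y) \<in> edge X" shows "pth X y = pth X x @ [y]"
proof (rule pth_eq[OF edge_nodes(2)[OF e]])
 have "pth X x \<noteq> []" "last (pth X x) = x" using pth[OF edge_nodes(1)[OF e]] by (auto simp: path_to_def)
 then show "path_to X y (pth X x @ [y])" using pth[OF edge_nodes(1)[OF e]] e by (simp add: path_to_snoc)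
qed

lemma pth_ne: "y \<in> nodes X ==> pth X y \<noteq> []" using pth by (auto simp: path_to_def)

lemma parent_unique: "(x, y) \<in> edge X ==> (x', y) \<in> edge X ==> x = x'"
 using pth_edge pth edge_nodes(1) unfolding path_to_def by (metis append_same_eq)

lemma no_edge_root: "(x, root X) \<notin> edge X"
proof
 assume e: "(x, root X) \<in> edge X"
 have "pth X x = []" using pth_edge[OF e] pth_root by simp
 then show False using pth_ne edge_nodes(1)[OF e] by blast
qed

lemma parent_ex: assumes y: "y \<in> nodes X" "y \<noteq> root X" shows "\<exists>x. (x, y) \<in> edge X"
proof -
 obtain zs z where zs: "pth X y = zs @ [z]" using pth_ne[OF y(1)] by (metis rev_exhaust)
 have ne: "zs \<noteq> []" using pth[OF y(1)] y(2) zs by auto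
 then show ?thesis using pth[OF y(1)] unfolding zs path_to_snoc[OF ne] by blast
qed

lemma depth_root: "depth X (root X) = 0" by (simp add: depth_def pth_root)

lemma depth_edge: "(x, y) \<in> edge X ==> depth X y = Suc (depth X x)"
 using pth_ne[OF edge_nodes(1)] by (simp add: depth_def pth_edge)

lemma tree_induct [consumes 1, case_names root edge]:
 assumes "y \<in> nodes X" "P (root X)" "\<And>x y. (x, y) \<in> edge X ==> P x ==> P y"
 shows "P y"
 using assms(1)
proof (induction "depth X y" arbitrary: y rule: less_induct)
 case less
 show ?case
 proof (cases "y = root X")
  case False
  then obtain x where x: "(x, y) \<in> edge X" using parent_ex less.prems by blast
  then show ?thesis using less.hyps[of x] depth_edge[OF x] edge_nodes(1)[OF x] assms(3) by simp
 qed (use assms in simp)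
qed

lemma code_root [simp]: "code X s (root X) = []" by (simp add: code_def pth_root)

lemma code_edge: "(x, y) \<in> edge X ==> code X s y = code X s x @ [s y]"
 using pth_ne[OF edge_nodes(1)] by (simp add: code_def pth_edge tl_append2)

lemma code_inj:
 assumes s: "sides X s" shows "inj_on (code X s) (nodes X)"
proof (rule inj_onI)
 fix y y' assume "y \<in> nodes X" "y' \<in> nodes X" "code X s y = code X s y'"
 then show "y = y'"
 proof (induction arbitrary: y' rule: tree_induct)
  case root
  then show ?case using parent_ex[of y'] code_edge by (metis code_root snoc_eq_iff_butlast)
 next
  case (edge x y)
  then have "y' \<noteq> root X" using code_edge[OF edge(1)] by auto
  then obtain x' where x': "(x', y') \<in> edge X" using parent_ex edge.prems by blast
  have "code X s x = code X s x'" "s y = s y'" using edge.prems(2) code_edge[OF edge(1)] code_edge[OF x'] by auto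
  then show ?case using edge.IH[OF edge_nodes(1)[OF x']] s edge.hyps x' unfolding sides_def by blast
 qed
qed

lemma ex_sides: "\<exists>s. sides X s"
proof -
 define s where "s y \<longleftrightarrow> (\<exists>x. (x, y) \<in> edge X \<and> y = (SOME z. z \<in> kids X x))" for y
 have "s y \<noteq> s y'" if e: "(x, y) \<in> edge X" "(x, y') \<in> edge X" "y \<noteq> y'" for x y y'
 proof -
  define z where "z = (SOME z. z \<in> kids X x)"
  have s: "s w \<longleftrightarrow> w = z" if "w \<in> kids X x" for w
   using that parent_unique unfolding s_def z_def by blast
  have "z \<in> kids X x" unfolding z_def by (rule someI[of _ y]) (use e in simp)
  moreover have yy: "y \<in> kids X x" "y' \<in> kids X x" using e by auto
  moreover have "card (kids X x) = 2" using kids_card[of x] e by auto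
  then obtain u v where "kids X x = {u, v}" by (meson card_2_iff)
  ultimately have "z = y \<or> z = y'" using e(3) by auto
  then show ?thesis using s[OF yy(1)] s[OF yy(2)] e(3) by auto
 qed
 then show ?thesis unfolding sides_def by blast
qed

lemma kid_side:
 assumes s: "sides X s" and e: "(x, y) \<in> edge X"
 shows "\<exists>z. (x, z) \<in> edge X \<and> s z = b"
proof -
 have "card (kids X x) = 2" using kids_card[of x] e by auto
 then obtain u v where uv: "kids X x = {u, v}" "u \<noteq> v" by (meson card_2_iff)
 then have xuv: "(x, u) \<in> edge X" "(x, v) \<in> edge X" by auto
 then have "s u \<noteq> s v" using s uv(2) unfolding sides_def by blast
 then have "s u = b \<or> s v = b" by blast
 then show ?thesis using xuv by blast
qed

lemma branch_root: "b \<in> branches X ==> b 0 = root X"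
 and branch_edge: "b \<in> branches X ==> (b n, b (Suc n)) \<in> edge X"
 by (auto simp: branches_def)

lemma branch_node: "b \<in> branches X ==> b n \<in> nodes X"
 using edge_nodes(1)[OF branch_edge] .

lemma depth_branch: "b \<in> branches X ==> depth X (b n) = n"
 by (induction n) (simp_all add: branch_root depth_root depth_edge[OF branch_edge])

lemma code_branch: "b \<in> branches X ==> code X s (b n) = map (bcode s b) [0..<n]"
 by (induction n) (simp_all add: branch_root code_edge[OF branch_edge] bcode_def)

lemma bcode_inj: "sides X s ==> b \<in> branches X ==> b' \<in> branches X ==> bcode s b = bcode s b' ==> b = b'"
proof
 fix n assume s: "sides X s" and b: "b \<in> branches X" "b' \<in> branches X" "bcode s b = bcode s b'"
 have "code X s (b n) = code X s (b' n)" using code_branch[OF b(1), of s n] code_branch[OF b(2), of s n] b(3) by simp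
 then show "b n = b' n" by (rule inj_onD[OF code_inj[OF s] _ branch_node[OF b(1)] branch_node[OF b(2)]])
qed

lemma branch_parent: "b \<in> branches X ==> (x, b (Suc n)) \<in> edge X ==> x = b n"
 using parent_unique by (auto simp: branches_def)

end

text \<open>These sets of bit lists are the codes of full binary trees: closure under siblings
  expresses that a node has no child or two. See \<open>tree_set_code\<close> and
  \<open>can_full\<close>.\<close>

definition tree_set :: "bool list set => bool" where
 "tree_set N \<longleftrightarrow> [] \<in> N \<and> (\<forall>xs b. xs @ [b] \<in> N --> xs \<in> N \<and> xs @ [\<not> b] \<in> N)"

definition ends :: "bool list set => (nat => bool) set" where
 "ends N = {sg. \<forall>n. map sg [0..<n] \<in> N}"

lemma (in fbt) tree_set_code: "sides X s ==> tree_set (code X s ` nodes X)"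
 unfolding tree_set_def
proof (intro conjI allI impI)
 show "[] \<in> code X s ` nodes X" by (rule image_eqI[of _ _ "root X"]) (simp_all add: root_node)
 fix xs b assume s: "sides X s" and "xs @ [b] \<in> code X s ` nodes X"
 then obtain y where y: "y \<in> nodes X" "code X s y = xs @ [b]" by auto
 then have "y \<noteq> root X" by auto
 then obtain x where x: "(x, y) \<in> edge X" using parent_ex y by blast
 then have c: "code X s x = xs" using y code_edge[OF x] by simp
 show "xs \<in> code X s ` nodes X" by (rule image_eqI[of _ _ x]) (simp_all add: c edge_nodes(1)[OF x])
 obtain z where "(x, z) \<in> edge X" "s z = (\<not> b)" using kid_side[OF s x] by blast
 then show "xs @ [\<not> b] \<in> code X s ` nodes X"
  using code_edge[of x z s] c edge_nodes(2)[of x z] by (intro image_eqI[of _ _ z]) auto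
qed

lemma (in fbt) ends_code:
 assumes s: "sides X s" and sg: "\<And>n. map sg [0..<n] \<in> code X s ` nodes X"
 shows "\<exists>b\<in>branches X. bcode s b = sg"
proof -
 have "\<exists>y. y \<in> nodes X \<and> code X s y = map sg [0..<n]" for n using sg[of n] unfolding image_iff by fastforce
 then obtain b where b: "\<And>n. b n \<in> nodes X" "\<And>n. code X s (b n) = map sg [0..<n]" by metis
 have e: "(b n, b (Suc n)) \<in> edge X" for n
 proof -
  have "b (Suc n) \<noteq> root X" using b(2)[of "Suc n"] by auto
  then obtain x where x: "(x, b (Suc n)) \<in> edge X" using parent_ex b(1) by blast
  have "code X s x = code X s (b n)" using b(2)[of "Suc n"] b(2)[of n] code_edge[OF x] by simp
  then show ?thesis using inj_onD[OF code_inj[OF s]] edge_nodes(1)[OF x] b(1) x by metis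
 qed
 have "b 0 = root X" using inj_onD[OF code_inj[OF s], of "b 0" "root X"] b root_node by simp
 then have "b \<in> branches X" using e by (simp add: branches_def)
 moreover have "bcode s b = sg"
 proof
  fix n
  have "code X s (b n) @ [s (b (Suc n))] = map sg [0..<Suc n]" using code_edge[OF e] b(2) by metis
  then show "bcode s b n = sg n" by (simp add: bcode_def)
 qed
 ultimately show ?thesis by blast
qed

text \<open>The tree with code set N, realised in the universe type through \<open>e\<close>. Labels
  are prescribed on bit sequences, and the \<open>THE\<close> recovers the sequence from the
  branch.\<close>

definition can :: "(bool list => 'u) => bool list set => ((nat => bool) => 'u option) => 'u itree" where
 "can e N l = \<lparr>nodes = e ` N, root = e [], edge = {(e xs, e (xs @ [b])) |xs b. xs @ [b] \<in> N},
   label = (\<lambda>\<beta>. if \<exists>sg\<in>ends N. \<beta> = (\<lambda>n. e (map sg [0..<n])) then l (THE sg. \<beta> = (\<lambda>n. e (map sg [0..<n]))) else None)\<rparr>"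

lemma map_upt_inj: "(\<And>n. map sg [0..<n] = map \<tau> [0..<n]) ==> sg = \<tau>"
proof
 fix n assume "\<And>n. map sg [0..<n] = map \<tau> [0..<n]"
 from this[of "Suc n"] show "sg n = \<tau> n" by simp
qed

context
 fixes e :: "bool list => 'u" assumes e: "inj e"
begin

lemma can_branch_eq: "(\<lambda>n. e (map sg [0..<n])) = (\<lambda>n. e (map \<tau> [0..<n])) \<longleftrightarrow> sg = \<tau>"
 using map_upt_inj injD[OF e] by (metis (no_types, lifting))

lemma can_full: assumes N: "tree_set N" shows "full_binary_tree (can e N l)"
proof (rule full_binary_treeI[where d = "\<lambda>y. length (inv e y)"])
 show "kids (can e N l) x = {} \<or> card (kids (can e N l) x) = 2" if xN: "x \<in> nodes (can e N l)" for x
 proof -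
  obtain xs where x: "x = e xs" using xN by (auto simp: can_def)
  have k: "kids (can e N l) x = {e (xs @ [b]) |b. xs @ [b] \<in> N}" using injD[OF e] by (auto simp: can_def x)
  show ?thesis
  proof (cases "xs @ [True] \<in> N \<or> xs @ [False] \<in> N")
   case True
   then have "xs @ [b] \<in> N" for b using N unfolding tree_set_def by (metis (full_types))
   then have "kids (can e N l) x = {e (xs @ [True]), e (xs @ [False])}" unfolding k by (auto, metis (full_types))
   moreover have "e (xs @ [True]) \<noteq> e (xs @ [False])" using injD[OF e] by blast
   ultimately show ?thesis by simp
  next
   case False
   then have "xs @ [b] \<notin> N" for b by (cases b) auto
   then show ?thesis unfolding k by simp
  qed
 qed
 show "root (can e N l) \<in> nodes (can e N l)" using N by (auto simp: can_def tree_set_def)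
 show "x \<in> nodes (can e N l) \<and> y \<in> nodes (can e N l)" if "(x, y) \<in> edge (can e N l)" for x y
  using that N by (auto simp: can_def tree_set_def)
 show "length (inv e (root (can e N l))) = 0" using e by (simp add: can_def)
 show "length (inv e y) = Suc (length (inv e x))" if "(x, y) \<in> edge (can e N l)" for x y
  using that e by (auto simp: can_def)
 show "x = x'" if "(x, y) \<in> edge (can e N l)" "(x', y) \<in> edge (can e N l)" for x x' y
  using that injD[OF e] by (fastforce simp: can_def)
 show "\<exists>x. (x, y) \<in> edge (can e N l)" if y: "y \<in> nodes (can e N l)" "y \<noteq> root (can e N l)" for y
 proof -
  obtain ys where ys: "ys \<in> N" "y = e ys" using y by (auto simp: can_def)
  then have "ys \<noteq> []" using y by (auto simp: can_def)
  then obtain xs b where "ys = xs @ [b]" by (metis rev_exhaust)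
  then show ?thesis using ys by (auto simp: can_def)
 qed
qed

lemma can_branches: "branches (can e N l) = (\<lambda>sg n. e (map sg [0..<n])) ` {sg. \<forall>n. map sg [0..<Suc n] \<in> N}"
proof
 show "(\<lambda>sg n. e (map sg [0..<n])) ` {sg. \<forall>n. map sg [0..<Suc n] \<in> N} \<subseteq> branches (can e N l)"
 proof (rule image_subsetI)
  fix sg assume "sg \<in> {sg. \<forall>n. map sg [0..<Suc n] \<in> N}"
  then have "(e (map sg [0..<n]), e (map sg [0..<n] @ [sg n])) \<in> edge (can e N l)" for n
   unfolding can_def by auto
  then show "(\<lambda>n. e (map sg [0..<n])) \<in> branches (can e N l)" by (simp add: branches_def can_def)
 qed
 show "branches (can e N l) \<subseteq> (\<lambda>sg n. e (map sg [0..<n])) ` {sg. \<forall>n. map sg [0..<Suc n] \<in> N}"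
 proof
  fix \<beta> assume "\<beta> \<in> branches (can e N l)"
  then have \<beta>0: "\<beta> 0 = e []" and "\<forall>n. \<exists>xs b. \<beta> n = e xs \<and> \<beta> (Suc n) = e (xs @ [b]) \<and> xs @ [b] \<in> N"
   unfolding branches_def can_def by auto
  then obtain xs sg where xs: "\<And>n. \<beta> n = e (xs n)" "\<And>n. \<beta> (Suc n) = e (xs n @ [sg n])" "\<And>n. xs n @ [sg n] \<in> N"
   by metis
  have x: "xs n = map sg [0..<n]" for n
  proof (induction n)
   case 0
   then show ?case using \<beta>0 xs(1)[of 0] injD[OF e] by auto
  next
   case (Suc n)
   have "xs (Suc n) = xs n @ [sg n]" using xs(1)[of "Suc n"] xs(2)[of n] injD[OF e] by metis
   then show ?case using Suc by simp
  qed
  have "\<beta> = (\<lambda>n. e (map sg [0..<n]))" using xs(1) x by auto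
  moreover have "\<forall>n. map sg [0..<Suc n] \<in> N" using xs(3) x by auto
  ultimately show "\<beta> \<in> (\<lambda>sg n. e (map sg [0..<n])) ` {sg. \<forall>n. map sg [0..<Suc n] \<in> N}" by blast
 qed
qed

lemma ends_eq: "tree_set N ==> ends N = {sg. \<forall>n. map sg [0..<Suc n] \<in> N}"
proof -
 assume N: "tree_set N"
 have "map sg [0..<n] \<in> N" if "\<forall>n. map sg [0..<Suc n] \<in> N" for sg n
  using N that by (cases n) (auto simp: tree_set_def)
 then show ?thesis unfolding ends_def by blast
qed

lemma can_label: "sg \<in> ends N ==> label (can e N l) (\<lambda>n. e (map sg [0..<n])) = l sg"
proof -
 assume "sg \<in> ends N"
 moreover have "(THE \<tau>. (\<lambda>n. e (map sg [0..<n])) = (\<lambda>n. e (map \<tau> [0..<n]))) = sg"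
  by (rule the_equality) (simp_all add: can_branch_eq)
 ultimately show ?thesis by (auto simp: can_def)
qed

lemma can_obj:
 assumes N: "tree_set N" and fin: "finite (ends N)"
  and off: "finite {xs @ [b] |xs b. xs @ [b] \<in> N \<and> \<not> (\<exists>sg\<in>ends N. \<exists>n. xs = map sg [0..<n])}"
  and l: "\<And>sg. sg \<in> ends N ==> \<exists>i\<in>I. l sg = Some i"
 shows "is_itree I (can e N l) \<and> finitary (can e N l)"
proof -
 have br: "branches (can e N l) = (\<lambda>sg n. e (map sg [0..<n])) ` ends N" using can_branches ends_eq[OF N] by simp
 have dom: "Map.dom (label (can e N l)) = branches (can e N l)"
 proof
  show "Map.dom (label (can e N l)) \<subseteq> branches (can e N l)" unfolding br by (auto simp: can_def dom_def split: if_splits)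
  show "branches (can e N l) \<subseteq> Map.dom (label (can e N l))" unfolding br using can_label l by fastforce
 qed
 have "Map.ran (label (can e N l)) \<subseteq> I"
 proof
  fix i assume "i \<in> Map.ran (label (can e N l))"
  then obtain \<beta> where \<beta>: "label (can e N l) \<beta> = Some i" by (auto simp: ran_def)
  then have "\<beta> \<in> branches (can e N l)" using dom by auto
  then obtain sg where "sg \<in> ends N" "\<beta> = (\<lambda>n. e (map sg [0..<n]))" unfolding br by auto
  then show "i \<in> I" using \<beta> can_label l by fastforce
 qed
 moreover have "finite {y \<in> nodes (can e N l). \<exists>x. (x, y) \<in> edge (can e N l) \<and> \<not> (\<exists>b\<in>branches (can e N l). x \<in> range b)}"
 proof (rule finite_subset)
  let ?O = "{xs @ [b] |xs b. xs @ [b] \<in> N \<and> \<not> (\<exists>sg\<in>ends N. \<exists>n. xs = map sg [0..<n])}"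
  show "finite (e ` ?O)" using off by simp
  show "{y \<in> nodes (can e N l). \<exists>x. (x, y) \<in> edge (can e N l) \<and> \<not> (\<exists>b\<in>branches (can e N l). x \<in> range b)} \<subseteq> e ` ?O"
  proof
   fix y assume "y \<in> {y \<in> nodes (can e N l). \<exists>x. (x, y) \<in> edge (can e N l) \<and> \<not> (\<exists>b\<in>branches (can e N l). x \<in> range b)}"
   then obtain x where x: "(x, y) \<in> edge (can e N l)" "\<not> (\<exists>b\<in>branches (can e N l). x \<in> range b)" by blast
   then obtain xs b where xs: "x = e xs" "y = e (xs @ [b])" "xs @ [b] \<in> N" by (auto simp: can_def)
   have "\<not> (\<exists>sg\<in>ends N. \<exists>n. xs = map sg [0..<n])"
   proof
    assume "\<exists>sg\<in>ends N. \<exists>n. xs = map sg [0..<n]"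
    then obtain sg n where sg: "sg \<in> ends N" "xs = map sg [0..<n]" by blast
    have 1: "x \<in> range (\<lambda>n. e (map sg [0..<n]))" unfolding xs(1) sg(2) by (rule rangeI)
    have 2: "(\<lambda>n. e (map sg [0..<n])) \<in> branches (can e N l)"
     unfolding br using imageI[OF sg(1), of "\<lambda>sg n. e (map sg [0..<n])"] .
    show False by (rule notE[OF x(2) bexI[where P = "\<lambda>b. x \<in> range b", OF 1 2]])
   qed
   then show "y \<in> e ` ?O" using xs by blast
  qed
 qed
 ultimately show ?thesis
  using can_full[OF N] dom fin unfolding is_itree_def finitary_def br by blast
qed

end


section \<open>Embeddings, twisting of sides and amalgamation\<close>

section \<open>Embeddings and amalgamation of trees\<close>

text \<open>The possible ranges of embeddings of full binary trees; see
  \<open>full_sub_range\<close> and \<open>incl\<close>.\<close>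

definition full_sub :: "'u itree => 'u set => bool" where
 "full_sub X A \<longleftrightarrow> root X \<in> A \<and> A \<subseteq> nodes X \<and> (\<forall>x y. (x, y) \<in> edge X --> y \<in> A --> x \<in> A \<and> kids X x \<subseteq> A)"

context fbt
begin

lemma full_sub_branch: "full_sub X A ==> c \<in> branches X ==> c m \<notin> A ==> m \<le> n ==> c n \<notin> A"
proof (induction n)
 case (Suc n)
 then show ?case using branch_edge[OF Suc.prems(2), of n] unfolding full_sub_def
  by (metis le_SucE)
qed simp

text \<open>Siblings have the same depth and lie both inside or both outside A. A change of sides
  outside A that depends on depth alone therefore keeps them distinct.\<close>

lemma sides_flip:
 assumes A: "full_sub X A" and s: "sides X s" and "\<And>y y'. y \<notin> A ==> y' \<notin> A ==> depth X y = depth X y' ==> s y \<noteq> s y' ==> s' y \<noteq> s' y'"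
  and "\<And>y. y \<in> A ==> s' y = s y"
 shows "sides X s'"
 unfolding sides_def
proof (intro allI impI)
 fix x y y' assume e: "(x, y) \<in> edge X" "(x, y') \<in> edge X" "y \<noteq> y'"
 have "y \<in> A \<longleftrightarrow> y' \<in> A" using A e unfolding full_sub_def by blast
 moreover have "s y \<noteq> s y'" using s e unfolding sides_def by blast
 ultimately show "s' y \<noteq> s' y'" using assms(3,4) e depth_edge by metis
qed

end

text \<open>Reflection of edges comes for free: the parent of y exists in X, and its image is the
  only parent of the image of y.\<close>

lemma tree_embeddingI:
 assumes X: "full_binary_tree X" and Y: "full_binary_tree Y"
  and g: "\<And>x. x \<in> nodes X ==> g x \<in> nodes Y" "inj_on g (nodes X)" "g (root X) = root Y"
  and fwd: "\<And>x y. (x, y) \<in> edge X ==> (g x, g y) \<in> edge Y"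
 shows "tree_embedding X Y (restrict g (nodes X))"
 unfolding tree_embedding_def
proof (intro conjI ballI)
 interpret X: fbt X by (rule fbt.intro[OF X])
 interpret Y: fbt Y by (rule fbt.intro[OF Y])
 show "restrict g (nodes X) \<in> nodes X \<rightarrow>\<^sub>E nodes Y" using g(1) by auto
 show "inj_on (restrict g (nodes X)) (nodes X)" using g(2) by (simp add: inj_on_restrict_eq)
 show "restrict g (nodes X) (root X) = root Y" using g(3) X.root_node by simp
 fix x y assume x: "x \<in> nodes X" and y: "y \<in> nodes X"
 have "(x, y) \<in> edge X" if e: "(g x, g y) \<in> edge Y"
 proof -
  have "y \<noteq> root X" using e Y.no_edge_root g(3) by auto
  then obtain x' where x': "(x', y) \<in> edge X" using X.parent_ex y by blast
  then have "g x' = g x" using Y.parent_unique[OF fwd[OF x'] e] by simp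
  then show ?thesis using x' inj_onD[OF g(2)] X.edge_nodes(1)[OF x'] x by metis
 qed
 then show "(x, y) \<in> edge X \<longleftrightarrow> (restrict g (nodes X) x, restrict g (nodes X) y) \<in> edge Y"
  using fwd x y by auto
qed

locale embedding = X: fbt X + Y: fbt Y for X Y :: "'u itree" +
 fixes f :: "'u => 'u"
 assumes emb: "tree_embedding X Y f"
begin

lemma node: "x \<in> nodes X ==> f x \<in> nodes Y" using emb by (auto simp: tree_embedding_def)
lemma inj: "inj_on f (nodes X)" using emb by (auto simp: tree_embedding_def)
lemma root: "f (root X) = root Y" using emb by (auto simp: tree_embedding_def)
lemma edge: "(x, y) \<in> edge X ==> (f x, f y) \<in> edge Y"
 using emb X.edge_nodes unfolding tree_embedding_def by blast

lemma kids_image: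
 assumes e: "(x, y) \<in> edge X" shows "kids Y (f x) = f ` kids X x"
proof -
 have c: "card (kids X x) = 2" "card (kids Y (f x)) = 2" using X.kids_card[of x] Y.kids_card[of "f x"] e edge[OF e] by auto
 have "inj_on f (kids X x)" by (rule inj_on_subset[OF inj]) (use X.edge_nodes(2) in auto)
 then have "card (f ` kids X x) = card (kids Y (f x))" using c by (simp add: card_image)
 moreover have "finite (kids Y (f x))" using c(2) by (intro card_ge_0_finite) simp
 moreover have "f ` kids X x \<subseteq> kids Y (f x)" using edge by auto
 ultimately show ?thesis by (intro card_subset_eq[symmetric])
qed

lemma depth: "x \<in> nodes X ==> depth Y (f x) = depth X x"
 by (induction rule: X.tree_induct) (simp_all add: root X.depth_root Y.depth_root X.depth_edge Y.depth_edge[OF edge])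

lemma parent:
 assumes x: "x \<in> nodes X" and e: "(z, f x) \<in> edge Y"
 obtains x' where "(x', x) \<in> edge X" "z = f x'"
proof -
 have "x \<noteq> root X" using e root Y.no_edge_root by auto
 then obtain x' where x': "(x', x) \<in> edge X" using X.parent_ex x by blast
 then show thesis using that Y.parent_unique[OF e edge[OF x']] by blast
qed

lemma full_sub_range: "full_sub Y (f ` nodes X)"
 unfolding full_sub_def
proof (intro conjI allI impI)
 show "root Y \<in> f ` nodes X" using root X.root_node by force
 show "f ` nodes X \<subseteq> nodes Y" using node by auto
 fix z y assume e: "(z, y) \<in> edge Y" and "y \<in> f ` nodes X"
 then obtain x where x: "x \<in> nodes X" "y = f x" by auto
 obtain x' where x': "(x', x) \<in> edge X" "z = f x'" using parent[OF x(1)] e x(2) by blast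
 show "z \<in> f ` nodes X" using x' X.edge_nodes(1) by blast
 show "kids Y z \<subseteq> f ` nodes X" using kids_image[OF x'(1)] x'(2) X.edge_nodes(2) by auto
qed

lemma branch: "b \<in> branches X ==> f \<circ> b \<in> branches Y"
 using edge root by (auto simp: branches_def)

lemma branch_pre:
 assumes c: "c \<in> branches Y" and A: "\<And>n. c n \<in> f ` nodes X"
 obtains b where "b \<in> branches X" "c = f \<circ> b"
proof -
 have "\<exists>x. x \<in> nodes X \<and> c n = f x" for n using A[of n] by blast
 then obtain b where b: "\<And>n. b n \<in> nodes X" "\<And>n. c n = f (b n)" by metis
 have "(b n, b (Suc n)) \<in> edge X" for n
  using Y.branch_edge[OF c, of n] emb b unfolding tree_embedding_def by simp
 moreover have "b 0 = root X" using Y.branch_root[OF c] b root inj_onD[OF inj] X.root_node by metis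
 ultimately have "b \<in> branches X" by (simp add: branches_def)
 moreover have "c = f \<circ> b" using b(2) by auto
 ultimately show thesis by (rule that)
qed

end

lemma code_eq:
 assumes "embedding A B f" "embedding A V g" and s: "\<And>a. a \<in> nodes A ==> a \<noteq> root A ==> sB (f a) = sV (g a)"
  and a: "a \<in> nodes A"
 shows "code B sB (f a) = code V sV (g a)"
proof -
 interpret f: embedding A B f by fact
 interpret g: embedding A V g by fact
 show ?thesis using a
 proof (induction rule: f.X.tree_induct)
  case root then show ?case by (simp add: f.root g.root)
 next
  case (edge x y)
  have "y \<noteq> root A" using edge(1) f.X.no_edge_root by auto
  then show ?case
   using edge(2) s[OF f.X.edge_nodes(2)[OF edge(1)]] f.Y.code_edge[OF f.edge[OF edge(1)]] g.Y.code_edge[OF g.edge[OF edge(1)]] by simp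
 qed
qed

text \<open>Diagonalisation in rotation: beyond d, the value at n contradicts the sequence whose
  list index is n modulo the length, so each sequence is contradicted infinitely often.\<close>

lemma ex_twist:
 assumes "finite R"
 shows "\<exists>t :: nat => bool. (\<forall>n\<le>d. \<not> t n) \<and> (\<forall>r\<in>R. \<forall>m. \<exists>n\<ge>m. n > d \<and> t n \<noteq> r n)"
proof -
 obtain rs where rs: "set rs = R" using finite_list[OF assms] by blast
 define t where "t n \<longleftrightarrow> n > d \<and> \<not> (rs ! (n mod length rs)) n" for n
 have "\<exists>n\<ge>m. n > d \<and> t n \<noteq> r n" if r: "r \<in> R" for r m
 proof -
  obtain i where i: "i < length rs" "rs ! i = r" using r rs by (metis in_set_conv_nth)
  \<comment> \<open>Congruent to i modulo the length, at least m and larger than d.\<close>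
  define n where "n = i + length rs * (m + d + 1)"
  have "length rs * (m + d + 1) \<ge> 1 * (m + d + 1)" using i by (intro mult_le_mono1) linarith
  then have "n \<ge> m" "n > d" by (simp_all add: n_def)
  moreover have "n mod length rs = i"
   unfolding n_def using i(1) by (simp only: mod_mult_self2 mod_less)
  ultimately show ?thesis using i by (auto simp: t_def)
 qed
 moreover have "\<forall>n\<le>d. \<not> t n" by (simp add: t_def)
 ultimately show ?thesis by blast
qed

locale trees =
 fixes I :: "'u set" and e :: "bool list => 'u"
 assumes e: "inj e"
begin

definition ob :: "'u itree => bool" where "ob X \<longleftrightarrow> is_itree I X \<and> finitary X"

lemma ob_fbt: "ob X ==> fbt X"
 by (simp add: ob_def is_itree_def fbt_def)

lemma ob_finite: "ob X ==> finite (branches X)"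
 by (simp add: ob_def finitary_def)

lemma ob_label: assumes X: "ob X" and b: "b \<in> branches X" obtains i where "i \<in> I" "label X b = Some i"
proof -
 have "b \<in> Map.dom (label X)" "Map.ran (label X) \<subseteq> I" using X b by (auto simp: ob_def finitary_def is_itree_def)
 then obtain i where "label X b = Some i" by blast
 then show thesis using that \<open>Map.ran (label X) \<subseteq> I\<close> by (auto simp: ran_def)
qed

lemma emb_embedding: "ob X ==> ob Y ==> itree_embedding X Y f ==> embedding X Y f"
 by (intro embedding.intro embedding_axioms.intro ob_fbt) (simp_all add: itree_embedding_def)

lemma emb_label:
 assumes "ob X" "itree_embedding X Y f" "b \<in> branches X"
 shows "label Y (f \<circ> b) = label X b"
 using ob_label[OF assms(1,3)] assms(2,3) unfolding itree_embedding_def by metis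

lemma embI:
 assumes X: "ob X" and Y: "ob Y" and "\<And>x. x \<in> nodes X ==> g x \<in> nodes Y" "inj_on g (nodes X)" "g (root X) = root Y"
  and "\<And>x y. (x, y) \<in> edge X ==> (g x, g y) \<in> edge Y"
  and lab: "\<And>b. b \<in> branches X ==> label Y (g \<circ> b) = label X b"
 shows "itree_embedding X Y (restrict g (nodes X))"
 unfolding itree_embedding_def
proof (intro conjI ballI allI impI)
 show "tree_embedding X Y (restrict g (nodes X))"
  by (rule tree_embeddingI[OF fbt.full[OF ob_fbt[OF X]] fbt.full[OF ob_fbt[OF Y]] assms(3-6)])
 fix b i assume b: "b \<in> branches X" "label X b = Some i"
 have "restrict g (nodes X) \<circ> b = g \<circ> b" using fbt.branch_node[OF ob_fbt[OF X] b(1)] by auto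
 then show "label Y (restrict g (nodes X) \<circ> b) = Some i" using lab b by simp
qed

lemma emb_can:
 assumes X: "ob X" and s: "sides X s" and N: "code X s ` nodes X \<subseteq> N" and W: "ob (can e N l)"
  and l: "\<And>b. b \<in> branches X ==> l (bcode s b) = label X b"
 shows "itree_embedding X (can e N l) (restrict (e \<circ> code X s) (nodes X))"
proof -
 interpret X: fbt X by (rule ob_fbt[OF X])
 show ?thesis
 proof (rule embI[OF X W])
  show "(e \<circ> code X s) x \<in> nodes (can e N l)" if "x \<in> nodes X" for x using that N by (auto simp: can_def)
  show "inj_on (e \<circ> code X s) (nodes X)"
   by (rule comp_inj_on[OF X.code_inj[OF s]]) (rule inj_on_subset[OF e], simp)
  show "(e \<circ> code X s) (root X) = root (can e N l)" by (simp add: can_def)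
  show "((e \<circ> code X s) x, (e \<circ> code X s) y) \<in> edge (can e N l)" if xy: "(x, y) \<in> edge X" for x y
  proof -
   have "code X s x @ [s y] \<in> N" using N X.edge_nodes(2)[OF xy] X.code_edge[OF xy, of s] by force
   then show ?thesis using X.code_edge[OF xy, of s] by (auto simp: can_def)
  qed
  show "label (can e N l) ((e \<circ> code X s) \<circ> b) = label X b" if b: "b \<in> branches X" for b
  proof -
   have "(e \<circ> code X s) \<circ> b = (\<lambda>n. e (map (bcode s b) [0..<n]))" using X.code_branch[OF b] by auto
   moreover have "bcode s b \<in> ends N"
    unfolding ends_def using X.code_branch[OF b, of s, symmetric] X.branch_node[OF b] N by auto
   ultimately show ?thesis using can_label[OF e] l[OF b] by simp
  qed
 qed
qed

lemma ob_off:
 assumes X: "ob X" and s: "sides X s" and E: "bcode s ` branches X \<subseteq> E"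
 shows "finite {xs @ [b] |xs b. xs @ [b] \<in> code X s ` nodes X \<and> \<not> (\<exists>sg\<in>E. \<exists>n. xs = map sg [0..<n])}"
proof (rule finite_subset)
 interpret X: fbt X by (rule ob_fbt[OF X])
 let ?O = "{y \<in> nodes X. \<exists>x. (x, y) \<in> edge X \<and> \<not> (\<exists>b\<in>branches X. x \<in> range b)}"
 show "finite (code X s ` ?O)" using X by (simp add: ob_def finitary_def)
 show "{xs @ [b] |xs b. xs @ [b] \<in> code X s ` nodes X \<and> \<not> (\<exists>sg\<in>E. \<exists>n. xs = map sg [0..<n])} \<subseteq> code X s ` ?O"
 proof
  fix z assume "z \<in> {xs @ [b] |xs b. xs @ [b] \<in> code X s ` nodes X \<and> \<not> (\<exists>sg\<in>E. \<exists>n. xs = map sg [0..<n])}"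
  then obtain xs b where zx: "z = xs @ [b]" "xs @ [b] \<in> code X s ` nodes X" and no: "\<not> (\<exists>sg\<in>E. \<exists>n. xs = map sg [0..<n])"
   by blast
  from zx(2) obtain y where "xs @ [b] = code X s y" "y \<in> nodes X" by (rule imageE)
  then have z: "z = xs @ [b]" "y \<in> nodes X" "code X s y = xs @ [b]" using zx(1) by simp_all
  have "y \<noteq> root X" using z(3) by auto
  then obtain x where x: "(x, y) \<in> edge X" using X.parent_ex z(2) by blast
  then have cx: "code X s x = xs" using z(3) X.code_edge[OF x, of s] by simp
  have "\<not> (\<exists>b\<in>branches X. x \<in> range b)"
  proof
   assume "\<exists>b\<in>branches X. x \<in> range b"
   then obtain c n where c: "c \<in> branches X" "x = c n" by auto
   then have "xs = map (bcode s c) [0..<n]" using X.code_branch[OF c(1), of s n] cx by simp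
   then show False using no E c(1) by blast
  qed
  then have "y \<in> ?O" using z(2) x by blast
  then show "z \<in> code X s ` ?O" unfolding z(1) z(3)[symmetric] by (rule imageI)
 qed
qed

text \<open>The code sets are united. Both are closed under prefixes, so a sequence with all
  prefixes in the union has them all in one of the two sets: no new branches arise, and
  \<open>lab\<close> makes the labelling consistent.\<close>

lemma union_tree:
 assumes X: "ob X" and Y: "ob Y" and s: "sides X s" and s': "sides Y s'"
  and lab: "\<And>b c. b \<in> branches X ==> c \<in> branches Y ==> bcode s b = bcode s' c ==> label X b = label Y c"
 obtains W where "ob W" "itree_embedding X W (restrict (e \<circ> code X s) (nodes X))"
  "itree_embedding Y W (restrict (e \<circ> code Y s') (nodes Y))"
  "nodes W = e ` code X s ` nodes X \<union> e ` code Y s' ` nodes Y"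
proof -
 interpret X: fbt X by (rule ob_fbt[OF X])
 interpret Y: fbt Y by (rule ob_fbt[OF Y])
 define A where "A = code X s ` nodes X"
 define B where "B = code Y s' ` nodes Y"
 have A: "tree_set A" and B: "tree_set B" unfolding A_def B_def using X.tree_set_code[OF s] Y.tree_set_code[OF s'] by auto
 then have N: "tree_set (A \<union> B)" unfolding tree_set_def by blast
 define l where "l sg = (if \<exists>b\<in>branches X. bcode s b = sg then label X (SOME b. b \<in> branches X \<and> bcode s b = sg)
  else label Y (SOME c. c \<in> branches Y \<and> bcode s' c = sg))" for sg
 have lX: "l (bcode s b) = label X b" if b: "b \<in> branches X" for b
 proof -
  have "(SOME b'. b' \<in> branches X \<and> bcode s b' = bcode s b) = b"
   by (rule some_equality) (use b X.bcode_inj[OF s] in auto)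
  then show ?thesis using b by (auto simp: l_def)
 qed
 have lY: "l (bcode s' c) = label Y c" if c: "c \<in> branches Y" for c
 proof (cases "\<exists>b\<in>branches X. bcode s b = bcode s' c")
  case True
  then obtain b where b: "b \<in> branches X" "bcode s b = bcode s' c" by blast
  then show ?thesis using lX[OF b(1)] lab[OF b(1) c b(2)] by simp
 next
  case False
  have "(SOME c'. c' \<in> branches Y \<and> bcode s' c' = bcode s' c) = c"
   by (rule some_equality) (use c Y.bcode_inj[OF s'] in auto)
  then show ?thesis using False by (simp add: l_def)
 qed
 have pre: "map sg [0..<n] \<in> C" if C: "tree_set C" "map sg [0..<m] \<in> C" "n \<le> m" for C sg n m
  using C(2,3)
 proof (induction m)
  case (Suc m)
  have "map sg [0..<m] \<in> C" using C(1) Suc.prems(1) by (auto simp: tree_set_def)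
  then show ?case using Suc by (cases "n = Suc m") auto
 qed simp
 have ends: "ends (A \<union> B) = bcode s ` branches X \<union> bcode s' ` branches Y"
 proof
  show "bcode s ` branches X \<union> bcode s' ` branches Y \<subseteq> ends (A \<union> B)"
  proof (rule Un_least; rule image_subsetI)
   fix b assume b: "b \<in> branches X"
   have "map (bcode s b) [0..<n] \<in> A" for n
    unfolding X.code_branch[OF b, symmetric] A_def by (rule imageI[OF X.branch_node[OF b]])
   then show "bcode s b \<in> ends (A \<union> B)" by (simp add: ends_def)
  next
   fix c assume c: "c \<in> branches Y"
   have "map (bcode s' c) [0..<n] \<in> B" for n
    unfolding Y.code_branch[OF c, symmetric] B_def by (rule imageI[OF Y.branch_node[OF c]])
   then show "bcode s' c \<in> ends (A \<union> B)" by (simp add: ends_def)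
  qed
  show "ends (A \<union> B) \<subseteq> bcode s ` branches X \<union> bcode s' ` branches Y"
  proof
   fix sg assume sg: "sg \<in> ends (A \<union> B)"
   have "(\<forall>n. map sg [0..<n] \<in> A) \<or> (\<forall>n. map sg [0..<n] \<in> B)"
   proof (rule ccontr)
    assume "\<not> ?thesis"
    then obtain n m where nm: "map sg [0..<n] \<notin> A" "map sg [0..<m] \<notin> B" by blast
    then have "map sg [0..<max n m] \<notin> A" "map sg [0..<max n m] \<notin> B"
     using pre[OF A, of sg "max n m" n] pre[OF B, of sg "max n m" m] by auto
    moreover have "map sg [0..<max n m] \<in> A \<union> B" using sg by (simp add: ends_def)
    ultimately show False by simp
   qed
   then show "sg \<in> bcode s ` branches X \<union> bcode s' ` branches Y"
    using X.ends_code[OF s, of sg] Y.ends_code[OF s', of sg] unfolding A_def B_def by blast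
  qed
 qed
 define W where "W = can e (A \<union> B) l"
 have W: "ob W"
  unfolding ob_def W_def
 proof (rule can_obj[OF e N])
  show "finite (ends (A \<union> B))" unfolding ends using ob_finite[OF X] ob_finite[OF Y] by simp
  show "\<exists>i\<in>I. l sg = Some i" if "sg \<in> ends (A \<union> B)" for sg
   using that ob_label[OF X] ob_label[OF Y] lX lY unfolding ends by (metis UnE imageE)
  let ?off = "\<lambda>C. {xs @ [b] |xs b. xs @ [b] \<in> C \<and> \<not> (\<exists>sg\<in>ends (A \<union> B). \<exists>n. xs = map sg [0..<n])}"
  have "finite (?off A)" "finite (?off B)"
   unfolding A_def B_def by (rule ob_off[OF X s] ob_off[OF Y s'], use ends in \<open>simp add: A_def B_def\<close>)+
  then have "finite (?off A \<union> ?off B)" by simp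
  moreover have "?off (A \<union> B) \<subseteq> ?off A \<union> ?off B"
  proof
   fix z assume "z \<in> ?off (A \<union> B)"
   then obtain xs b where z: "z = xs @ [b]" "xs @ [b] \<in> A \<or> xs @ [b] \<in> B"
    "\<not> (\<exists>sg\<in>ends (A \<union> B). \<exists>n. xs = map sg [0..<n])" by blast
   then show "z \<in> ?off A \<union> ?off B" by (elim disjE) blast+
  qed
  ultimately show "finite (?off (A \<union> B))" by (rule finite_subset[rotated])
 qed
 show thesis
 proof (rule that[OF W])
  show "itree_embedding X W (restrict (e \<circ> code X s) (nodes X))"
   unfolding W_def by (rule emb_can[OF X s _ W[unfolded W_def] lX]) (auto simp: A_def)
  show "itree_embedding Y W (restrict (e \<circ> code Y s') (nodes Y))"
   unfolding W_def by (rule emb_can[OF Y s' _ W[unfolded W_def] lY]) (auto simp: B_def)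
  show "nodes W = e ` code X s ` nodes X \<union> e ` code Y s' ` nodes Y"
   by (simp add: W_def can_def A_def B_def image_Un)
 qed
qed

text \<open>The sides of \<open>B\<close> outside the image of \<open>A\<close> are twisted below depth \<open>d\<close> by a sequence that differs
 infinitely often from each of the finitely many sequences comparing a branch of \<open>B\<close> with a branch of \<open>V\<close>;
 afterwards only branches coming from \<open>A\<close> are identified.\<close>

lemma amalgam:
 assumes A: "ob A" and B: "ob B" and V: "ob V" and f: "itree_embedding A B f" and g: "itree_embedding A V g"
  and sB: "sides B sB" and sV: "sides V sV"
  and s: "\<And>a. a \<in> nodes A ==> a \<noteq> root A ==> sB (f a) = sV (g a)"
 obtains W h k where "ob W" "itree_embedding B W h" "itree_embedding V W k"
  "\<And>a. a \<in> nodes A ==> h (f a) = k (g a)"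
  "\<And>x y. x \<in> nodes B ==> y \<in> nodes V ==> depth B x \<le> d ==> h x = k y ==> code B sB x = code V sV y"
proof -
 interpret f: embedding A B f by (rule emb_embedding[OF A B f])
 interpret g: embedding A V g by (rule emb_embedding[OF A V g])
 \<comment> \<open>For each branch of B and each branch of V, the sequence of places at which their
   sides differ.\<close>
 let ?R = "(\<lambda>(c, b) n. sB (c n) \<noteq> sV (b n)) ` (branches B \<times> branches V)"
 have "finite ?R" using ob_finite[OF B] ob_finite[OF V] by simp
 from ex_twist[OF this, of d] obtain t
  where tw: "(\<forall>n\<le>d. \<not> t n) \<and> (\<forall>r\<in>?R. \<forall>m. \<exists>n\<ge>m. n > d \<and> t n \<noteq> r n)" by (elim exE)
 have t0: "\<not> t n" if "n \<le> d" for n using conjunct1[OF tw] that by (elim allE impE)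
 have t: "\<exists>n\<ge>m. n > d \<and> t n \<noteq> r n" if "r \<in> ?R" for r m using bspec[OF conjunct2[OF tw] that] by (rule spec)
 \<comment> \<open>Outside the image of A, a side is flipped exactly at the depths selected by
   t.\<close>
 define st where "st y = (if y \<in> f ` nodes A then sB y else sB y \<noteq> t (depth B y))" for y
 have st: "sides B st"
  by (rule f.Y.sides_flip[OF f.full_sub_range sB]) (auto simp: st_def)
 have st_f: "st (f a) = sV (g a)" if "a \<in> nodes A" "a \<noteq> root A" for a
  using s[OF that] that by (simp add: st_def)
 have lab: "label B c = label V b" if c: "c \<in> branches B" and b: "b \<in> branches V" and eq: "bcode st c = bcode sV b" for c b
 proof -
  \<comment> \<open>Once c leaves the image of A it stays outside. There equality of the twisted
    codes would force t to coincide with the comparison sequence of c and b from then on.\<close>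
  have "c n \<in> f ` nodes A" for n
  proof (rule ccontr)
   assume "c n \<notin> f ` nodes A"
   then have out: "c m \<notin> f ` nodes A" if "m \<ge> n" for m using f.Y.full_sub_branch[OF f.full_sub_range c] that by blast
   have "(\<lambda>n. sB (c n) \<noteq> sV (b n)) \<in> ?R" using b c by force
   from t[OF this, of n] obtain m where m: "m \<ge> n" "m > d" "t m \<noteq> (sB (c m) \<noteq> sV (b m))" by blast
   obtain m' where m': "m = Suc m'" using m(2) by (cases m) auto
   have "st (c m) = sV (b m)" using fun_cong[OF eq, of m'] by (simp add: bcode_def m')
   then show False using out[OF m(1)] m(3) f.Y.depth_branch[OF c, of m] by (auto simp: st_def)
  qed
  then obtain a where a: "a \<in> branches A" "c = f \<circ> a" using f.branch_pre[OF c] by blast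
  have "bcode sV (g \<circ> a) = bcode st c"
  proof
   fix n
   have "a (Suc n) \<noteq> root A" using f.X.branch_edge[OF a(1), of n] f.X.no_edge_root by auto
   then show "bcode sV (g \<circ> a) n = bcode st c n"
    using st_f[OF f.X.branch_node[OF a(1), of "Suc n"]] by (simp add: bcode_def a(2))
  qed
  then have "bcode sV b = bcode sV (g \<circ> a)" using eq by (simp only:)
  then have "b = g \<circ> a" by (rule g.Y.bcode_inj[OF sV b g.branch[OF a(1)]])
  then show ?thesis using emb_label[OF A f a(1)] emb_label[OF A g a(1)] a(2) by simp
 qed
 obtain W where W: "ob W" "itree_embedding B W (restrict (e \<circ> code B st) (nodes B))"
  "itree_embedding V W (restrict (e \<circ> code V sV) (nodes V))"
  by (rule union_tree[OF B V st sV lab]) blast+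
 \<comment> \<open>The sequence t is off up to depth d, so nodes no deeper than d keep the code
   given by \<open>sB\<close>.\<close>
 have code_st: "depth B x \<le> d ==> code B st x = code B sB x" if "x \<in> nodes B" for x
  using that
 proof (induction rule: f.Y.tree_induct)
  case (edge x y)
  have "st y = sB y" using edge(3) t0[of "depth B y"] by (simp add: st_def)
  moreover have "depth B x \<le> d" using edge(3) f.Y.depth_edge[OF edge(1)] by simp
  ultimately show ?case using edge f.Y.code_edge[OF edge(1)] by simp
 qed simp
 show thesis
 proof (rule that[OF W])
  show "restrict (e \<circ> code B st) (nodes B) (f a) = restrict (e \<circ> code V sV) (nodes V) (g a)" if a: "a \<in> nodes A" for a
   using code_eq[where sB = st and sV = sV, OF f.embedding_axioms g.embedding_axioms st_f a] f.node[OF a] g.node[OF a] by simp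
  show "code B sB x = code V sV y" if "x \<in> nodes B" "y \<in> nodes V" "depth B x \<le> d"
   "restrict (e \<circ> code B st) (nodes B) x = restrict (e \<circ> code V sV) (nodes V) y" for x y
   using that code_st injD[OF e] by auto
 qed
qed

end

section \<open>Points evaluated on representable sheaves\<close>

section \<open>Points\<close>

text \<open>Left adjoints preserve jointly epic families: the transposes of f and g agree on the
  family, so they are equal, and transposition is injective.\<close>

lemma left_adjoint_epi:
 assumes C: "category C" and D: "category D" and adj: "adjunction C D L R" and X: "X \<in> obj C"
  and f: "f \<in> hom D (onobj L X) Y" and g: "g \<in> hom D (onobj L X) Y"
  and epi: "\<And>W \<alpha> \<beta>. \<alpha> \<in> hom C X W ==> \<beta> \<in> hom C X W ==> (\<And>x. x \<in> Fam ==> cmp C \<alpha> x = cmp C \<beta> x) ==> \<alpha> = \<beta>"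
  and Fam: "\<And>x. x \<in> Fam ==> \<exists>Z. x \<in> hom C Z X"
  and eq: "\<And>x. x \<in> Fam ==> cmp D f (onarr L x) = cmp D g (onarr L x)"
 shows "f = g"
proof -
 interpret C: category C by fact
 interpret D: category D by fact
 obtain \<eta> ep where L: "is_functor C D L" and R: "is_functor D C R"
  and \<eta>: "nat_trans C C (id_functor C) (comp_functor C R L) \<eta>"
  and ep: "nat_trans D D (comp_functor D L R) (id_functor D) ep"
  and tri: "\<And>X. X \<in> obj C ==> cmp D (ep (onobj L X)) (onarr L (\<eta> X)) = idn D (onobj L X)"
  using adj unfolding adjunction_def by blast
 have Y: "Y \<in> obj D" using f by (rule D.hom_obj)
 have LX: "onobj L X \<in> obj D" by (rule is_functorD(1)[OF L X])
 have \<eta>h: "\<eta> Z \<in> hom C Z (onobj R (onobj L Z))" if "Z \<in> obj C" for Z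
  using \<eta> that by (auto simp: nat_trans_def id_functor_def comp_functor_def)
 have eph: "ep Z \<in> hom D (onobj L (onobj R Z)) Z" if "Z \<in> obj D" for Z
  using ep that by (auto simp: nat_trans_def id_functor_def comp_functor_def)
 have \<eta>n: "cmp C (\<eta> X) x = cmp C (onarr R (onarr L x)) (\<eta> Z)" if x: "x \<in> hom C Z X" for x Z
  using \<eta> homD[OF x] unfolding nat_trans_def by (auto simp: id_functor_def comp_functor_def)
 have epn: "cmp D (ep Y) (onarr L (onarr R h)) = cmp D h (ep (onobj L X))" if h: "h \<in> hom D (onobj L X) Y" for h
  using ep homD[OF h] unfolding nat_trans_def by (auto simp: id_functor_def comp_functor_def)
 define tr where "tr h = cmp C (onarr R h) (\<eta> X)" for h
 have tr_hom: "tr h \<in> hom C X (onobj R Y)" if h: "h \<in> hom D (onobj L X) Y" for h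
  unfolding tr_def by (rule C.cmp_hom[OF \<eta>h[OF X] is_functorD(2)[OF R h]])
 have untr: "cmp D (ep Y) (onarr L (tr h)) = h" if h: "h \<in> hom D (onobj L X) Y" for h
 proof -
  note Rh = is_functorD(2)[OF R h]
  note LRh = is_functorD(2)[OF L Rh] and Leta = is_functorD(2)[OF L \<eta>h[OF X]]
  have "cmp D (ep Y) (onarr L (tr h)) = cmp D (cmp D (ep Y) (onarr L (onarr R h))) (onarr L (\<eta> X))"
   unfolding tr_def is_functorD(4)[OF L \<eta>h[OF X] Rh] by (rule D.cmp_assoc[OF Leta LRh eph[OF Y]])
  also have "\<dots> = cmp D h (cmp D (ep (onobj L X)) (onarr L (\<eta> X)))"
   unfolding epn[OF h] by (rule D.cmp_assoc[OF Leta eph[OF LX] h, symmetric])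
  finally show ?thesis using tri[OF X] D.cmp_idn_right[OF h] by simp
 qed
 have trx: "cmp C (tr h) x = cmp C (onarr R (cmp D h (onarr L x))) (\<eta> Z)"
  if h: "h \<in> hom D (onobj L X) Y" and x: "x \<in> hom C Z X" for h x Z
 proof -
  note Rh = is_functorD(2)[OF R h] and Lx = is_functorD(2)[OF L x]
  note RLx = is_functorD(2)[OF R Lx]
  have "cmp C (tr h) x = cmp C (onarr R h) (cmp C (\<eta> X) x)"
   unfolding tr_def by (rule C.cmp_assoc[OF x \<eta>h[OF X] Rh, symmetric])
  also have "\<dots> = cmp C (cmp C (onarr R h) (onarr R (onarr L x))) (\<eta> Z)"
   unfolding \<eta>n[OF x] by (rule C.cmp_assoc[OF \<eta>h[OF C.hom_obj(1)[OF x]] RLx Rh])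
  finally show ?thesis unfolding is_functorD(4)[OF R Lx h] .
 qed
 have eq: "tr f = tr g"
 proof (rule epi[OF tr_hom[OF f] tr_hom[OF g]])
  fix x assume x: "x \<in> Fam"
  then obtain Z where Z: "x \<in> hom C Z X" using Fam by blast
  show "cmp C (tr f) x = cmp C (tr g) x" unfolding trx[OF f Z] trx[OF g Z] eq[OF x] ..
 qed
 show ?thesis by (rule trans[OF untr[OF f, symmetric] untr[OF g, unfolded eq[symmetric]]])
qed

context amalgamation_category
begin

text \<open>Compatible families form a sheaf: components descend one by one, and injectivity makes
  the results compatible. The equivalence relation is equality; \<open>quotient_sheaf\<close> merely
  names the families by universe elements.\<close>

lemma E_limit_ex:
 fixes J :: "('j, 'k) cat"
 assumes J: "category J" "small U (obj J)" and G: "is_functor J E G"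
 obtains H p where "is_limit J E G H p"
proof -
 interpret J: category J by fact
 have Gj: "onobj G j \<in> obj E" if "j \<in> obj J" for j using is_functorD(1)[OF G that] .
 have Gu: "onarr G u \<in> hom E (onobj G j) (onobj G k)" if "u \<in> hom J j k" for u j k using is_functorD(2)[OF G that] .
 define V where "V X = {t \<in> \<Pi>\<^sub>E j\<in>obj J. onobj (onobj G j) X. \<forall>u j k. u \<in> hom J j k --> cm (onarr G u) X (t j) = t k}" for X
 define a where "a f t = (\<lambda>j\<in>obj J. act (onobj G j) f (t j))" for f and t :: "'j => 'u"
 have Vj: "t j \<in> onobj (onobj G j) X" if "t \<in> V X" "j \<in> obj J" for t j X using that by (auto simp: V_def)
 have Vu: "cm (onarr G u) X (t j) = t k" if "t \<in> V X" "u \<in> hom J j k" for t u j k X using that by (auto simp: V_def)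
 have VI: "t \<in> V X" if "t \<in> extensional (obj J)" "\<And>j. j \<in> obj J ==> t j \<in> onobj (onobj G j) X"
  "\<And>u j k. u \<in> hom J j k ==> cm (onarr G u) X (t j) = t k" for t X using that by (auto simp: V_def PiE_iff)
 have Vext: "t = t'" if "t \<in> V X" "t' \<in> V X" "\<And>j. j \<in> obj J ==> t j = t' j" for t t' X
  using that by (auto simp: V_def intro: PiE_ext)
 have aV: "a f t \<in> V Y" if f: "f \<in> hom T X Y" and t: "t \<in> V X" for f X Y t
 proof (rule VI)
  show "a f t \<in> extensional (obj J)" by (simp add: a_def)
  show "a f t j \<in> onobj (onobj G j) Y" if "j \<in> obj J" for j
   using that E_act[OF Gj[OF that] f Vj[OF t that]] by (simp add: a_def)
  show "cm (onarr G u) Y (a f t j) = a f t k" if u: "u \<in> hom J j k" for u j k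
   using J.hom_obj[OF u] cm_nat[OF Gu[OF u] f Vj[OF t J.hom_obj(1)[OF u]]] Vu[OF t u] by (simp add: a_def)
 qed
 obtain H kp where H: "H \<in> obj E" and el: "\<And>X. X \<in> obj T ==> onobj H X = kp X ` {x. x \<in> V X \<and> x = x}"
  and kp: "\<And>X x y. X \<in> obj T ==> x \<in> V X \<and> x = x ==> y \<in> V X \<and> y = y ==> kp X x = kp X y \<longleftrightarrow> (x \<in> V X \<and> x = y)"
  and act: "\<And>f X Y x. f \<in> hom T X Y ==> x \<in> V X \<and> x = x ==> act H f (kp X x) = kp Y (a f x)"
 proof (rule quotient_sheaf[of "\<lambda>X x y. x \<in> V X \<and> x = y" a "\<lambda>X x. x"])
  show "a f x \<in> V Y \<and> a f x = a f y" if "f \<in> hom T X Y" "x \<in> V X \<and> x = y" for f X Y x y using that aV by auto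
  show "a (idn T X) x \<in> V X \<and> a (idn T X) x = x" if X: "X \<in> obj T" and x: "x \<in> V X \<and> x = x" for X x
  proof -
   have "a (idn T X) x \<in> V X" using aV[OF idn_hom[OF X]] x by blast
   moreover have "a (idn T X) x = x"
    by (rule Vext[OF calculation]) (use x Vj E_id[OF Gj X] in \<open>auto simp: a_def\<close>)
   ultimately show ?thesis by blast
  qed
  show "a (g \<odot> f) x \<in> V Z \<and> a (g \<odot> f) x = a g (a f x)"
   if f: "f \<in> hom T X Y" and g: "g \<in> hom T Y Z" and x: "x \<in> V X \<and> x = x" for f g X Y Z x
  proof -
   have 1: "a (g \<odot> f) x \<in> V Z" "a g (a f x) \<in> V Z" using aV[OF cmp_hom[OF f g]] aV[OF g aV[OF f]] x by auto
   have "a (g \<odot> f) x = a g (a f x)"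
    by (rule Vext[OF 1]) (use x Vj E_cmp[OF Gj f g] in \<open>auto simp: a_def\<close>)
   then show ?thesis using 1 by blast
  qed
  show "x \<in> V X \<and> x = y" if f: "f \<in> hom T X Y" and x: "x \<in> V X \<and> x = x" and y: "y \<in> V X \<and> y = y"
   and eq: "a f x \<in> V Y \<and> a f x = a f y" for f X Y x y
  proof -
   have "x = y"
   proof (rule Vext[of _ X])
    fix j assume j: "j \<in> obj J"
    have "act (onobj G j) f (x j) = act (onobj G j) f (y j)" using fun_cong[OF conjunct2[OF eq], of j] j by (simp add: a_def)
    then show "x j = y j" using E_inj[OF Gj[OF j] f] Vj x y j by blast
   qed (use x y in auto)
   then show ?thesis using x by blast
  qed
  show "\<exists>x. (x \<in> V X \<and> x = x) \<and> a f x \<in> V Y \<and> a f x = y"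
   if f: "f \<in> hom T X Y" and y: "y \<in> V Y \<and> y = y"
    and gh: "\<And>Z g h. g \<in> hom T Y Z ==> h \<in> hom T Y Z ==> g \<odot> f = h \<odot> f ==> a g y \<in> V Z \<and> a g y = a h y" for f X Y y
  proof -
   have "\<exists>x. x \<in> onobj (onobj G j) X \<and> act (onobj G j) f x = y j" if j: "j \<in> obj J" for j
   proof -
    have yj: "y j \<in> onobj (onobj G j) Y" using Vj y j by blast
    obtain x where "x \<in> onobj (onobj G j) X" "act (onobj G j) f x = y j"
    proof (rule E_descent[OF Gj[OF j] f yj])
     fix Z g h assume "g \<in> hom T Y Z" "h \<in> hom T Y Z" "g \<odot> f = h \<odot> f"
     from fun_cong[OF conjunct2[OF gh[OF this]], of j] show "act (onobj G j) g (y j) = act (onobj G j) h (y j)"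
      using j by (simp add: a_def)
    qed
    then show ?thesis by blast
   qed
   then obtain x where x: "\<And>j. j \<in> obj J ==> x j \<in> onobj (onobj G j) X" "\<And>j. j \<in> obj J ==> act (onobj G j) f (x j) = y j" by metis
   have xV: "restrict x (obj J) \<in> V X"
   proof (rule VI)
    show "cm (onarr G u) X (restrict x (obj J) j) = restrict x (obj J) k" if u: "u \<in> hom J j k" for u j k
    proof -
     note jk = J.hom_obj[OF u]
     have "act (onobj G k) f (cm (onarr G u) X (x j)) = act (onobj G k) f (x k)"
      using cm_nat[OF Gu[OF u] f x(1)[OF jk(1)]] x(2)[OF jk(1)] x(2)[OF jk(2)] Vu[OF conjunct1[OF y] u] by simp
     then have "cm (onarr G u) X (x j) = x k"
      by (rule E_inj[OF Gj[OF jk(2)] f cm_in[OF Gu[OF u] hom_obj(1)[OF f] x(1)[OF jk(1)]] x(1)[OF jk(2)]])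
     then show ?thesis using jk by simp
    qed
   qed (use x in auto)
   have "a f (restrict x (obj J)) = y"
    by (rule Vext[OF aV[OF f xV] conjunct1[OF y]]) (simp add: a_def x(2))
   then show ?thesis using xV y by blast
  qed
  show "small U ((\<lambda>x. x) ` {x. x \<in> V X \<and> x = x})" if X: "X \<in> obj T" for X
  proof (rule small_subset)
   show "small U (\<Pi>\<^sub>E j\<in>obj J. onobj (onobj G j) X)" by (intro small_PiE J(2) E_small[OF Gj X])
  qed (auto simp: V_def)
 qed auto
 define p where "p j = mk_hom H (\<lambda>X w. (SOME t. t \<in> V X \<and> kp X t = w) j) (onobj G j)" for j
 have inv: "(SOME t'. t' \<in> V X \<and> kp X t' = kp X t) = t" if X: "X \<in> obj T" and t: "t \<in> V X" for X t
  by (rule some_equality) (use t kp[OF X] in auto)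
 have el': "onobj H X = kp X ` V X" if "X \<in> obj T" for X using el[OF that] by simp
 have act': "act H f (kp X x) = kp Y (a f x)" if "f \<in> hom T X Y" "x \<in> V X" for f X Y x using act[OF that(1)] that(2) by simp
 have p: "p j \<in> hom E H (onobj G j)" if j: "j \<in> obj J" for j
  unfolding p_def
 proof (rule mk_hom[OF H Gj[OF j]])
  show "(SOME t. t \<in> V X \<and> kp X t = w) j \<in> onobj (onobj G j) X" if "X \<in> obj T" "w \<in> onobj H X" for X w
   using that el' inv Vj j by auto
  fix f X Y w assume f: "f \<in> hom T X Y" and w: "w \<in> onobj H X"
  then obtain t where t: "t \<in> V X" "w = kp X t" using el' hom_obj[OF f] by auto
  show "(SOME t. t \<in> V Y \<and> kp Y t = act H f w) j = act (onobj G j) f ((SOME t. t \<in> V X \<and> kp X t = w) j)"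
   unfolding t(2) act'[OF f t(1)] inv[OF hom_obj(1)[OF f] t(1)] inv[OF hom_obj(2)[OF f] aV[OF f t(1)]] using j by (simp add: a_def)
 qed
 have pk: "cm (p j) X (kp X t) = t j" if "X \<in> obj T" "t \<in> V X" for j X t
  using that el' inv by (simp add: p_def)
 have "is_limit J E G H p"
 proof (rule E_limitI[OF J(1) G H p])
  show "cm (onarr G u) X (cm (p j) X w) = cm (p k) X w" if u: "u \<in> hom J j k" and X: "X \<in> obj T" and w: "w \<in> onobj H X" for u j k X w
  proof -
   obtain t where t: "t \<in> V X" "w = kp X t" using w el'[OF X] by auto
   show ?thesis using pk[OF X t(1)] Vu[OF t(1) u] t(2) by simp
  qed
  fix X t assume X: "X \<in> obj T" and t: "\<And>j. j \<in> obj J ==> t j \<in> onobj (onobj G j) X"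
   "\<And>u j k. u \<in> hom J j k ==> cm (onarr G u) X (t j) = t k"
  have tV: "restrict t (obj J) \<in> V X"
   by (rule VI) (use t J.hom_obj in auto)
  show "\<exists>!w. w \<in> onobj H X \<and> (\<forall>j\<in>obj J. cm (p j) X w = t j)"
  proof (rule ex1I[of _ "kp X (restrict t (obj J))"])
   show "kp X (restrict t (obj J)) \<in> onobj H X \<and> (\<forall>j\<in>obj J. cm (p j) X (kp X (restrict t (obj J))) = t j)"
    using tV el'[OF X] pk[OF X tV] by simp
   fix w assume w: "w \<in> onobj H X \<and> (\<forall>j\<in>obj J. cm (p j) X w = t j)"
   then obtain t' where t': "t' \<in> V X" "w = kp X t'" using el'[OF X] by auto
   have "t' = restrict t (obj J)" by (rule Vext[OF t'(1) tV]) (use w pk[OF X t'(1)] t'(2) in auto)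
   then show "w = kp X (restrict t (obj J))" using t' by simp
  qed
 qed
 then show thesis by (rule that)
qed

end

text \<open>The two assumptions are the injectivity and existence halves of descent for
  representable functors.\<close>

locale subcanonical_site = site U T S r \<phi> \<psi>
 for U :: "'u itself" and T :: "('o, 'a) cat" and S r \<phi> \<psi> +
 assumes mono: "f \<in> hom T Y Z ==> a \<in> hom T X Y ==> b \<in> hom T X Y ==> f \<odot> a = f \<odot> b ==> a = b"
  and subcanonical: "f \<in> hom T Y Z ==> a \<in> hom T X Z ==>
   (\<And>W g h. g \<in> hom T Z W ==> h \<in> hom T Z W ==> g \<odot> f = h \<odot> f ==> g \<odot> a = h \<odot> a) ==> \<exists>b\<in>hom T X Y. f \<odot> b = a"
begin

text \<open>Arrows of T are not universe elements, so a representable sheaf comes with a map that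
  names them; \<open>yo\<close> and \<open>kap\<close> below are a chosen such pair.\<close>

definition rep :: "'o => ('o, 'a, 'u) presheaf \<times> ('o => 'a => 'u) => bool" where
 "rep X H \<longleftrightarrow> fst H \<in> obj E \<and> (\<forall>Z\<in>obj T. onobj (fst H) Z = snd H Z ` hom T X Z \<and> inj_on (snd H Z) (hom T X Z)) \<and>
   (\<forall>Z W f a. f \<in> hom T Z W --> a \<in> hom T X Z --> act (fst H) f (snd H Z a) = snd H W (f \<odot> a))"

lemma ex_rep: assumes X: "X \<in> obj T" shows "\<exists>H. rep X H"
proof -
 obtain H kp where H: "H \<in> obj E" and el: "\<And>Z. Z \<in> obj T ==> onobj H Z = kp Z ` {x. x \<in> hom T X Z \<and> x = x}"
  and kp: "\<And>Z x y. Z \<in> obj T ==> x \<in> hom T X Z \<and> x = x ==> y \<in> hom T X Z \<and> y = y ==> kp Z x = kp Z y \<longleftrightarrow> (x \<in> hom T X Z \<and> x = y)"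
  and act: "\<And>f Z W x. f \<in> hom T Z W ==> x \<in> hom T X Z \<and> x = x ==> act H f (kp Z x) = kp W (f \<odot> x)"
 proof (rule quotient_sheaf[of "\<lambda>Z x y. x \<in> hom T X Z \<and> x = y" "\<lambda>f x. f \<odot> x" "\<lambda>Z x. x"])
  show "f \<odot> x \<in> hom T X W \<and> f \<odot> x = f \<odot> y" if "f \<in> hom T Z W" "x \<in> hom T X Z \<and> x = y" for f Z W x y
   using that cmp_hom by auto
  show "idn T Z \<odot> x \<in> hom T X Z \<and> idn T Z \<odot> x = x" if "Z \<in> obj T" "x \<in> hom T X Z \<and> x = x" for Z x
   using cmp_idn_left[of x X Z] that(2) by simp
  show "(g \<odot> f) \<odot> x \<in> hom T X W \<and> (g \<odot> f) \<odot> x = g \<odot> (f \<odot> x)"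
   if f: "f \<in> hom T Y Z" and g: "g \<in> hom T Z W" and x: "x \<in> hom T X Y \<and> x = x" for f g Y Z W x
   using cmp_hom[OF conjunct1[OF x] cmp_hom[OF f g]] assoc[OF conjunct1[OF x] f g] by simp
  show "x \<in> hom T X Y \<and> x = y"
   if "f \<in> hom T Y Z" "x \<in> hom T X Y \<and> x = x" "y \<in> hom T X Y \<and> y = y" "f \<odot> x \<in> hom T X Z \<and> f \<odot> x = f \<odot> y" for f Y Z x y
   using mono[OF that(1)] that by blast
  show "\<exists>x. (x \<in> hom T X Y \<and> x = x) \<and> f \<odot> x \<in> hom T X Z \<and> f \<odot> x = y"
   if f: "f \<in> hom T Y Z" and y: "y \<in> hom T X Z \<and> y = y"
    and gh: "\<And>W g h. g \<in> hom T Z W ==> h \<in> hom T Z W ==> g \<odot> f = h \<odot> f ==> g \<odot> y \<in> hom T X W \<and> g \<odot> y = h \<odot> y" for f Y Z y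
   using subcanonical[OF f conjunct1[OF y]] gh y by blast
  show "small U ((\<lambda>x. x) ` {x. x \<in> hom T X Z \<and> x = x})" if "Z \<in> obj T" for Z using small_hom[OF X that] by simp
 qed auto
 have "rep X (H, kp)"
  unfolding rep_def fst_conv snd_conv
 proof (intro conjI ballI allI impI H)
  fix Z assume Z: "Z \<in> obj T"
  show "onobj H Z = kp Z ` hom T X Z" using el[OF Z] by simp
  show "inj_on (kp Z) (hom T X Z)" using kp[OF Z] by (intro inj_onI) blast
 next
  fix Z W f a assume "f \<in> hom T Z W" "a \<in> hom T X Z"
  then show "act H f (kp Z a) = kp W (f \<odot> a)" using act by simp
 qed
 then show ?thesis by blast
qed

definition yo where "yo X = fst (SOME H. rep X H)"
definition kap where "kap X = snd (SOME H. rep X H)"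

lemma yo: assumes X: "X \<in> obj T"
 shows "yo X \<in> obj E" and "Z \<in> obj T ==> onobj (yo X) Z = kap X Z ` hom T X Z"
  and "Z \<in> obj T ==> inj_on (kap X Z) (hom T X Z)"
  and "f \<in> hom T Z W ==> a \<in> hom T X Z ==> act (yo X) f (kap X Z a) = kap X W (f \<odot> a)"
 using someI_ex[OF ex_rep[OF X]] unfolding rep_def yo_def kap_def by blast+

lemma kap_in: "a \<in> hom T X Z ==> kap X Z a \<in> onobj (yo X) Z"
 using yo(2)[OF hom_obj(1) hom_obj(2)] by blast

text \<open>The morphism that corresponds to the element x under the Yoneda lemma.\<close>

definition yoh where "yoh X M x = mk_hom (yo X) (\<lambda>Z w. act M (the_inv_into (hom T X Z) (kap X Z) w) x) M"

lemma yoh_eq: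
 assumes X: "X \<in> obj T" and a: "a \<in> hom T X Z"
 shows "cm (yoh X M x) Z (kap X Z a) = act M a x"
 using hom_obj(2)[OF a] kap_in[OF a] the_inv_into_f_f[OF yo(3)[OF X hom_obj(2)[OF a]] a] by (simp add: yoh_def)

lemma yoh:
 assumes X: "X \<in> obj T" and M: "M \<in> obj E" and x: "x \<in> onobj M X"
 shows "yoh X M x \<in> hom E (yo X) M"
 unfolding yoh_def
proof (rule mk_hom[OF yo(1)[OF X] M])
 have inv: "the_inv_into (hom T X Z) (kap X Z) (kap X Z a) = a" if "a \<in> hom T X Z" for a Z
  by (rule the_inv_into_f_f[OF yo(3)[OF X hom_obj(2)[OF that]] that])
 show "act M (the_inv_into (hom T X Z) (kap X Z) w) x \<in> onobj M Z" if "Z \<in> obj T" "w \<in> onobj (yo X) Z" for Z w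
  using that yo(2)[OF X] inv E_act[OF M _ x] by auto
 fix f Z W w assume f: "f \<in> hom T Z W" and w: "w \<in> onobj (yo X) Z"
 then obtain a where a: "a \<in> hom T X Z" "w = kap X Z a" using yo(2)[OF X hom_obj(1)[OF f]] by auto
 show "act M (the_inv_into (hom T X W) (kap X W) (act (yo X) f w)) x = act M f (act M (the_inv_into (hom T X Z) (kap X Z) w) x)"
  unfolding a(2) yo(4)[OF X f a(1)] inv[OF a(1)] inv[OF cmp_hom[OF a(1) f]] by (rule E_cmp[OF M a(1) f x])
qed

lemma yo_ext:
 assumes X: "X \<in> obj T" and k: "k \<in> hom E (yo X) M" and l: "l \<in> hom E (yo X) M"
  and eq: "cm k X (kap X X (idn T X)) = cm l X (kap X X (idn T X))"
 shows "k = l"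
proof (rule E_ext[OF k l])
 fix Z w assume Z: "Z \<in> obj T" and "w \<in> onobj (yo X) Z"
 then obtain a where a: "a \<in> hom T X Z" "w = kap X Z a" using yo(2)[OF X Z] by auto
 have w: "w = act (yo X) a (kap X X (idn T X))" using yo(4)[OF X a(1) idn_hom[OF X]] cmp_idn_right[OF a(1)] a(2) by simp
 show "cm k Z w = cm l Z w"
  unfolding w using cm_nat[OF k a(1) kap_in[OF idn_hom[OF X]]] cm_nat[OF l a(1) kap_in[OF idn_hom[OF X]]] eq by simp
qed

lemma yoh_idn: "X \<in> obj T ==> M \<in> obj E ==> x \<in> onobj M X ==> cm (yoh X M x) X (kap X X (idn T X)) = x"
 using yoh_eq[OF _ idn_hom] E_id by simp

lemma yoh_cmp:
 assumes X: "X \<in> obj T" and m: "m \<in> hom E F G" and x: "x \<in> onobj F X"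
 shows "cmp E m (yoh X F x) = yoh X G (cm m X x)"
proof -
 note F = E_hom_obj(1)[OF m] and G = E_hom_obj(2)[OF m]
 note mx = cm_in[OF m X x]
 show ?thesis
  by (rule yo_ext[OF X E_cmp_hom[OF yoh[OF X F x] m] yoh[OF X G mx]])
   (simp add: cm_cmp[OF yoh[OF X F x] m X kap_in[OF idn_hom[OF X]]] yoh_idn X F G x mx)
qed

end

locale pointed_site = subcanonical_site U T S r \<phi> \<psi>
 for U :: "'u itself" and T :: "('o, 'a) cat" and S r \<phi> \<psi> +
 fixes P Q
 assumes point: "is_point U E P Q"
begin

lemma adj: "adjunction E (Set_cat U) P Q" and lex: "preserves_finite_limits E (Set_cat U) P"
 using point by (auto simp: is_point_def geometric_morphism_def)

lemma P: "is_functor E (Set_cat U) P"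
 using adj by (simp add: adjunction_def)

text \<open>The fibre of the point at a representable. An element x of \<open>F X\<close> then turns
  an element of \<open>p X\<close> into an element of \<open>P F\<close>, which is the pairing
  \<open>pnt\<close>.\<close>

definition p :: "'o => 'u set" where "p X = onobj P (yo X)"
definition pnt where "pnt F X x d = app (onarr P (yoh X F x)) d"

lemma pnt_in: "X \<in> obj T ==> F \<in> obj E ==> x \<in> onobj F X ==> d \<in> p X ==> pnt F X x d \<in> onobj P F"
 unfolding pnt_def p_def by (rule Set_hom_app[OF is_functorD(2)[OF P yoh]])

lemma pnt_nat:
 assumes X: "X \<in> obj T" and m: "m \<in> hom E F G" and x: "x \<in> onobj F X" and d: "d \<in> p X"
 shows "app (onarr P m) (pnt F X x d) = pnt G X (cm m X x) d"
proof -
 note y = yoh[OF X E_hom_obj(1)[OF m] x]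
 show ?thesis
  unfolding pnt_def yoh_cmp[OF X m x, symmetric] is_functorD(4)[OF P y m]
  using app_Set_cmp[OF is_functorD(2)[OF P y] is_functorD(2)[OF P m]] d by (simp add: p_def)
qed

text \<open>P turns jointly epic families into jointly surjective ones. A missed t could be
  separated from the rest by two functions into a two-element set, against
  \<open>left_adjoint_epi\<close>.\<close>

lemma pnt_cover:
 assumes F: "F \<in> obj E" and Fam: "\<And>Z x. (Z, x) \<in> Fam ==> Z \<in> obj T \<and> x \<in> onobj F Z"
  and epi: "\<And>K \<alpha> \<beta>. \<alpha> \<in> hom E F K ==> \<beta> \<in> hom E F K ==> (\<And>Z x. (Z, x) \<in> Fam ==> cm \<alpha> Z x = cm \<beta> Z x) ==> \<alpha> = \<beta>"
  and t: "t \<in> onobj P F"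
 shows "\<exists>Z x d. (Z, x) \<in> Fam \<and> d \<in> p Z \<and> t = pnt F Z x d"
proof (rule ccontr)
 assume no: "\<not> ?thesis"
 obtain u0 u1 :: 'u where u: "u0 \<noteq> u1"
  using infinite_universe by (metis (full_types) UNIV_eq_I finite.emptyI finite_insert singletonI)
 define A where "A = {u0, u1}"
 have A: "small U A" by (simp add: A_def small_finite)
 have PF: "small U (onobj P F)" using is_functorD(1)[OF P F] by simp
 define f where "f = mk_set (onobj P F) (\<lambda>_. u0) A"
 define g where "g = mk_set (onobj P F) (\<lambda>s. if \<exists>Z x d. (Z, x) \<in> Fam \<and> d \<in> p Z \<and> s = pnt F Z x d then u0 else u1) A"
 have f: "f \<in> hom (Set_cat U) (onobj P F) A" and g: "g \<in> hom (Set_cat U) (onobj P F) A"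
  unfolding f_def g_def by (intro mk_set_hom PF A; simp add: A_def)+
 have "f = g"
 proof (rule left_adjoint_epi[OF category_E category_Set adj F f g, where Fam = "{yoh Z F x |Z x. (Z, x) \<in> Fam}"])
  show "\<exists>Z. y \<in> hom E Z F" if "y \<in> {yoh Z F x |Z x. (Z, x) \<in> Fam}" for y
   using that yoh[OF _ F] Fam by blast
  show "\<alpha> = \<beta>" if \<alpha>: "\<alpha> \<in> hom E F W" and \<beta>: "\<beta> \<in> hom E F W"
   and eq: "\<And>x. x \<in> {yoh Z F x |Z x. (Z, x) \<in> Fam} ==> cmp E \<alpha> x = cmp E \<beta> x" for W \<alpha> \<beta>
  proof (rule epi[OF \<alpha> \<beta>])
   fix Z x assume Zx: "(Z, x) \<in> Fam"
   then have Z: "Z \<in> obj T" and x: "x \<in> onobj F Z" using Fam by auto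
   have "cmp E \<alpha> (yoh Z F x) = cmp E \<beta> (yoh Z F x)" using eq Zx by blast
   then have "yoh Z W (cm \<alpha> Z x) = yoh Z W (cm \<beta> Z x)" unfolding yoh_cmp[OF Z \<alpha> x] yoh_cmp[OF Z \<beta> x] .
   from arg_cong[OF this, of "\<lambda>m. cm m Z (kap Z Z (idn T Z))"] show "cm \<alpha> Z x = cm \<beta> Z x"
    unfolding yoh_idn[OF Z E_hom_obj(2)[OF \<alpha>] cm_in[OF \<alpha> Z x]] yoh_idn[OF Z E_hom_obj(2)[OF \<alpha>] cm_in[OF \<beta> Z x]] .
  qed
  fix y assume "y \<in> {yoh Z F x |Z x. (Z, x) \<in> Fam}"
  then obtain Z x where y: "y = yoh Z F x" and Zx: "(Z, x) \<in> Fam" by blast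
  have h: "onarr P y \<in> hom (Set_cat U) (p Z) (onobj P F)"
   unfolding y p_def using is_functorD(2)[OF P yoh[OF _ F]] Fam[OF Zx] by blast
  show "cmp (Set_cat U) f (onarr P y) = cmp (Set_cat U) g (onarr P y)"
  proof (rule Set_ext[OF Set_cmp_hom[OF h f] Set_cmp_hom[OF h g]])
   fix d assume d: "d \<in> p Z"
   have "app (onarr P y) d = pnt F Z x d" unfolding pnt_def y ..
   note dt = Set_hom_app[OF h d]
   have "\<exists>Z x d'. (Z, x) \<in> Fam \<and> d' \<in> p Z \<and> app (onarr P y) d = pnt F Z x d'"
    by (intro exI conjI) (rule Zx, rule d, fact)
   then have "app g (app (onarr P y) d) = u0" "app f (app (onarr P y) d) = u0"
    using dt by (simp_all only: g_def f_def app_mk_set if_True)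
   then show "app (cmp (Set_cat U) f (onarr P y)) d = app (cmp (Set_cat U) g (onarr P y)) d"
    unfolding app_Set_cmp[OF h f d] app_Set_cmp[OF h g d] by argo
  qed
 qed
 then have "app f t = app g t" by (rule arg_cong)
 moreover have "app f t = u0" unfolding f_def using t by (rule app_mk_set)
 moreover have "app g t = u1" unfolding g_def app_mk_set[OF t] by (rule if_not_P[OF no])
 ultimately show False using u by metis
qed

text \<open>Flatness of \<open>p\<close>: as P preserves finite limits, a compatible family in the
  fibres is one element over the limit sheaf. That element is of the form \<open>pnt\<close>, and
  its projections lift the family to a single stage Z.\<close>

lemma joint_element:
 fixes J :: "(nat, nat) cat"
 assumes J: "category J" "finite (obj J)" "finite (arr J)" and G: "is_functor J E G"
  and t: "\<And>j. j \<in> obj J ==> t j \<in> onobj P (onobj G j)"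
  and tu: "\<And>u j k. u \<in> hom J j k ==> app (onarr P (onarr G u)) (t j) = t k"
 shows "\<exists>Z d x. Z \<in> obj T \<and> d \<in> p Z \<and> (\<forall>j\<in>obj J. x j \<in> onobj (onobj G j) Z \<and> pnt (onobj G j) Z (x j) d = t j) \<and>
  (\<forall>u j k. u \<in> hom J j k --> cm (onarr G u) Z (x j) = x k)"
proof -
 interpret J: category J by fact
 obtain H \<pi> where lim: "is_limit J E G H \<pi>" by (rule E_limit_ex[OF J(1) small_nat_set G])
 then have H: "H \<in> obj E" and \<pi>: "\<And>j. j \<in> obj J ==> \<pi> j \<in> hom E H (onobj G j)"
  and \<pi>u: "\<And>u j k. u \<in> hom J j k ==> cmp E (onarr G u) (\<pi> j) = \<pi> k"
  by (auto simp: is_limit_def is_cone_def hom_def)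
 have PG: "is_functor J (Set_cat U) (comp_functor J P G)" by (rule is_functor_comp[OF G P J(1)])
 have "is_limit J (Set_cat U) (comp_functor J P G) (onobj P H) (\<lambda>j. onarr P (\<pi> j))"
  using lex J G lim unfolding preserves_finite_limits_def by blast
 moreover have "app (onarr (comp_functor J P G) u) (t j) = t k" if u: "u \<in> hom J j k" for u j k
  using tu[OF u] homD(1)[OF u] by (simp add: comp_functor_def)
 moreover have "t j \<in> onobj (comp_functor J P G) j" if "j \<in> obj J" for j using t that by (simp add: comp_functor_def)
 ultimately have "\<exists>!s. s \<in> onobj P H \<and> (\<forall>j\<in>obj J. app (onarr P (\<pi> j)) s = t j)"
  using Set_limitD[OF _ PG J(1), of "onobj P H" "\<lambda>j. onarr P (\<pi> j)" t] by blast
 then obtain s where s: "s \<in> onobj P H" "\<And>j. j \<in> obj J ==> app (onarr P (\<pi> j)) s = t j" by blast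
 have "\<exists>Z x d. (Z, x) \<in> Sigma (obj T) (onobj H) \<and> d \<in> p Z \<and> s = pnt H Z x d"
 proof (rule pnt_cover[OF H _ _ s(1)])
  show "Z \<in> obj T \<and> x \<in> onobj H Z" if "(Z, x) \<in> Sigma (obj T) (onobj H)" for Z x using that by blast
  fix K \<alpha> \<beta> assume \<alpha>: "\<alpha> \<in> hom E H K" and \<beta>: "\<beta> \<in> hom E H K"
   and eq: "\<And>Z x. (Z, x) \<in> Sigma (obj T) (onobj H) ==> cm \<alpha> Z x = cm \<beta> Z x"
  show "\<alpha> = \<beta>" by (rule E_ext[OF \<alpha> \<beta>]) (use eq in blast)
 qed
 then obtain Z w d where Z: "Z \<in> obj T" and w: "w \<in> onobj H Z" and d: "d \<in> p Z" and sw: "s = pnt H Z w d" by blast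
 have "pnt (onobj G j) Z (cm (\<pi> j) Z w) d = t j" if j: "j \<in> obj J" for j
  using pnt_nat[OF Z \<pi>[OF j] w d] s(2)[OF j] sw by simp
 moreover have "cm (onarr G u) Z (cm (\<pi> j) Z w) = cm (\<pi> k) Z w" if u: "u \<in> hom J j k" for u j k
  using cm_cmp[OF \<pi>[OF J.hom_obj(1)[OF u]] is_functorD(2)[OF G u] Z w] \<pi>u[OF u] by simp
 ultimately show ?thesis
  using Z d cm_in[OF \<pi> Z w] by (intro exI[of _ Z] exI[of _ d] exI[of _ "\<lambda>j. cm (\<pi> j) Z w"]) blast
qed

text \<open>The case of the empty diagram, whose limit is terminal.\<close>

lemma p_nonempty: "\<exists>Z\<in>obj T. p Z \<noteq> {}"
proof -
 define J :: "(nat, nat) cat" where "J = \<lparr>obj = {}, arr = {}, src = id, tgt = id, idn = id, cmp = (\<lambda>_ _. 0)\<rparr>"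
 define G :: "(nat, nat, ('o, 'a, 'u) presheaf, ('o, 'a, 'u set, 'u set_arr) nat_arr) fctr"
  where "G = \<lparr>onobj = (\<lambda>_. undefined), onarr = (\<lambda>_. undefined)\<rparr>"
 have "category J" by unfold_locales (auto simp: J_def hom_def)
 moreover have "is_functor J E G" by (rule is_functorI) (auto simp: J_def G_def hom_def extensional_def)
 ultimately show ?thesis using joint_element[of J G "\<lambda>_. undefined"] by (auto simp: J_def hom_def)
qed

text \<open>With empty K this is the case of a product, with K = {2, 3} that of a parallel pair. The
  numbers 0 and 1 are taken by the identities.\<close>

lemma pair_element:
 assumes A: "A \<in> obj E" and B: "B \<in> obj E" and K: "K \<subseteq> {2, 3 :: nat}" and m: "\<And>u. u \<in> K ==> m u \<in> hom E A B"
  and t: "t0 \<in> onobj P A" "t1 \<in> onobj P B" and mt: "\<And>u. u \<in> K ==> app (onarr P (m u)) t0 = t1"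
 shows "\<exists>Z d x0 x1. Z \<in> obj T \<and> d \<in> p Z \<and> x0 \<in> onobj A Z \<and> x1 \<in> onobj B Z \<and>
  pnt A Z x0 d = t0 \<and> pnt B Z x1 d = t1 \<and> (\<forall>u\<in>K. cm (m u) Z x0 = x1)"
proof -
 define J :: "(nat, nat) cat" where "J = \<lparr>obj = {0, 1}, arr = {0, 1} \<union> K, src = (\<lambda>u. if u = 1 then 1 else 0),
  tgt = (\<lambda>u. if u = 0 then 0 else 1), idn = id, cmp = (\<lambda>g f. if f = 0 \<or> f = 1 then g else f)\<rparr>"
 define G where "G = \<lparr>onobj = (\<lambda>j\<in>{0, 1 :: nat}. if j = 0 then A else B),
  onarr = (\<lambda>u\<in>{0, 1} \<union> K. if u = 0 then idn E A else if u = 1 then idn E B else m u)\<rparr>"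
 have K01: "0 \<notin> K" "1 \<notin> K" using K[THEN subsetD, of 0] K[THEN subsetD, of 1] by auto
 have homJ: "u \<in> hom J j k \<longleftrightarrow> (u = 0 \<and> j = 0 \<and> k = 0) \<or> (u = 1 \<and> j = 1 \<and> k = 1) \<or> (u \<in> K \<and> j = 0 \<and> k = 1)" for u j k
  using K01 by (auto simp: J_def hom_def split: if_splits)
 have J: "category J"
 proof
  show "f \<in> arr J ==> src J f \<in> obj J" "f \<in> arr J ==> tgt J f \<in> obj J" for f by (auto simp: J_def)
  show "X \<in> obj J ==> idn J X \<in> hom J X X" for X by (auto simp: J_def hom_def)
 qed (use K01 in \<open>unfold homJ, auto simp: J_def\<close>)
 note idA = E_idn_hom[OF A] and idB = E_idn_hom[OF B]
 note left = category.cmp_idn_left[OF category_E] and right = category.cmp_idn_right[OF category_E]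
 have Go: "onobj G 0 = A" "onobj G 1 = B" by (simp_all add: G_def)
 have Ga: "onarr G 0 = idn E A" "onarr G 1 = idn E B" "\<And>u. u \<in> K ==> onarr G u = m u"
  using K01 by (auto simp: G_def)
 have G: "is_functor J E G"
 proof (rule is_functorI)
  show "onobj G \<in> extensional (obj J)" "onarr G \<in> extensional (arr J)" by (auto simp: G_def J_def)
  show "onobj G X \<in> obj E" if "X \<in> obj J" for X using that A B by (auto simp: J_def G_def)
  show "onarr G f \<in> hom E (onobj G X) (onobj G Y)" if "f \<in> hom J X Y" for f X Y
   using that idA idB m Go Ga unfolding homJ by auto
  show "onarr G (idn J X) = idn E (onobj G X)" if "X \<in> obj J" for X using that Go Ga by (auto simp: J_def)
  fix f g X Y Z assume "f \<in> hom J X Y" "g \<in> hom J Y Z"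
  then consider "f = 0" "g = 0" | "f = 1" "g = 1" | "f = 0" "g \<in> K" | "f \<in> K" "g = 1" unfolding homJ by auto
  then show "onarr G (cmp J g f) = cmp E (onarr G g) (onarr G f)"
  proof cases
   case 1 then show ?thesis using left[OF idA] by (simp add: J_def Ga)
  next
   case 2 then show ?thesis using left[OF idB] by (simp add: J_def Ga(2)[unfolded One_nat_def])
  next
   case 3 then show ?thesis using right[OF m] by (simp add: J_def Ga)
  next
   case 4
   then have "f \<noteq> 0" "f \<noteq> 1" using K01 by metis+
   then show ?thesis using 4 left[OF m] Ga by (simp add: J_def)
  qed
 qed
 have "\<exists>Z d x. Z \<in> obj T \<and> d \<in> p Z \<and> (\<forall>j\<in>obj J. x j \<in> onobj (onobj G j) Z \<and> pnt (onobj G j) Z (x j) d = (if j = 0 then t0 else t1)) \<and>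
  (\<forall>u j k. u \<in> hom J j k --> cm (onarr G u) Z (x j) = x k)"
 proof (rule joint_element[OF J _ _ G])
  show "finite (obj J)" "finite (arr J)" using finite_subset[OF K] by (auto simp: J_def)
  show "(if j = 0 then t0 else t1) \<in> onobj P (onobj G j)" if "j \<in> obj J" for j using that t by (auto simp: J_def G_def)
  have Pid: "app (onarr P (idn E F)) s = s" if "F \<in> obj E" "s \<in> onobj P F" for F s
   using is_functorD(3)[OF P that(1)] that(2) by simp
  show "app (onarr P (onarr G u)) (if j = 0 then t0 else t1) = (if k = 0 then t0 else t1)" if "u \<in> hom J j k" for u j k
   using that Pid[OF A t(1)] Pid[OF B t(2)] mt Ga unfolding homJ by auto
 qed
 then obtain Z d x where *: "Z \<in> obj T" "d \<in> p Z" "\<And>j. j \<in> obj J ==> x j \<in> onobj (onobj G j) Z \<and> pnt (onobj G j) Z (x j) d = (if j = 0 then t0 else t1)"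
  "\<And>u j k. u \<in> hom J j k ==> cm (onarr G u) Z (x j) = x k" by blast
 have "x 0 \<in> onobj A Z" "pnt A Z (x 0) d = t0" "x 1 \<in> onobj B Z" "pnt B Z (x 1) d = t1"
  using *(3)[of 0] *(3)[of 1] Go by (auto simp: J_def)
 moreover have "cm (m u) Z (x 0) = x 1" if "u \<in> K" for u using *(4)[of u 0 1] Ga(3)[OF that] that by (simp add: homJ)
 ultimately show ?thesis using *(1,2) by blast
qed

text \<open>The contravariant action of T on the fibres: P applied to the Yoneda morphism of
  u.\<close>

definition res :: "'a => 'u => 'u" where
 "res u d = pnt (yo (src T u)) (tgt T u) (kap (src T u) (tgt T u) u) d"

lemma res_eq: "u \<in> hom T X Z ==> res u d = pnt (yo X) Z (kap X Z u) d"
 by (simp add: res_def hom_def)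

lemma res_in: "u \<in> hom T X Z ==> d \<in> p Z ==> res u d \<in> p X"
 unfolding res_eq p_def[of X] by (rule pnt_in[OF hom_obj(2) yo(1)[OF hom_obj(1)] kap_in])

lemma res_cmp:
 assumes u: "u \<in> hom T X Z" and v: "v \<in> hom T Z W" and d: "d \<in> p W"
 shows "res (v \<odot> u) d = res u (res v d)"
proof -
 note X = hom_obj(1)[OF u] and Z = hom_obj(2)[OF u] and W = hom_obj(2)[OF v]
 have y: "yoh Z (yo X) (kap X Z u) \<in> hom E (yo Z) (yo X)" by (rule yoh[OF Z yo(1)[OF X] kap_in[OF u]])
 have "res u (res v d) = app (onarr P (yoh Z (yo X) (kap X Z u))) (pnt (yo Z) W (kap Z W v) d)"
  unfolding res_eq[OF u] res_eq[OF v] by (simp add: pnt_def)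
 also have "\<dots> = pnt (yo X) W (cm (yoh Z (yo X) (kap X Z u)) W (kap Z W v)) d"
  by (rule pnt_nat[OF W y kap_in[OF v] d])
 also have "cm (yoh Z (yo X) (kap X Z u)) W (kap Z W v) = kap X W (v \<odot> u)"
  unfolding yoh_eq[OF Z v] by (rule yo(4)[OF X v u])
 finally show ?thesis using res_eq[OF cmp_hom[OF u v]] by simp
qed

text \<open>One element suffices to cover \<open>yo X\<close>, namely the name of f, because sheaves
  act injectively along f: in the atomic topology every arrow covers.\<close>

lemma res_surj:
 assumes f: "f \<in> hom T X Y" and e: "e \<in> p X"
 shows "\<exists>d\<in>p Y. res f d = e"
proof -
 note X = hom_obj(1)[OF f] and Y = hom_obj(2)[OF f]
 have "\<exists>Z x d. (Z, x) \<in> {(Y, kap X Y f)} \<and> d \<in> p Z \<and> e = pnt (yo X) Z x d"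
 proof (rule pnt_cover[OF yo(1)[OF X]])
  show "e \<in> onobj P (yo X)" using e by (simp add: p_def)
  show "Z \<in> obj T \<and> x \<in> onobj (yo X) Z" if "(Z, x) \<in> {(Y, kap X Y f)}" for Z x using that Y kap_in[OF f] by simp
  fix K \<alpha> \<beta> assume \<alpha>: "\<alpha> \<in> hom E (yo X) K" and \<beta>: "\<beta> \<in> hom E (yo X) K"
   and eq: "\<And>Z x. (Z, x) \<in> {(Y, kap X Y f)} ==> cm \<alpha> Z x = cm \<beta> Z x"
  note k = kap_in[OF idn_hom[OF X]]
  have "kap X Y f = act (yo X) f (kap X X (idn T X))" using yo(4)[OF X f idn_hom[OF X]] cmp_idn_right[OF f] by simp
  then have "act K f (cm \<alpha> X (kap X X (idn T X))) = act K f (cm \<beta> X (kap X X (idn T X)))"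
   using cm_nat[OF \<alpha> f k] cm_nat[OF \<beta> f k] eq by simp
  then have "cm \<alpha> X (kap X X (idn T X)) = cm \<beta> X (kap X X (idn T X))"
   by (rule E_inj[OF E_hom_obj(2)[OF \<alpha>] f cm_in[OF \<alpha> X k] cm_in[OF \<beta> X k]])
  then show "\<alpha> = \<beta>" by (rule yo_ext[OF X \<alpha> \<beta>])
 qed
 then show ?thesis using res_eq[OF f] by auto
qed

lemma res_joint:
 assumes X: "X \<in> obj T" and Y: "Y \<in> obj T" and d: "d \<in> p X" and e: "e \<in> p Y"
 shows "\<exists>Z c u v. c \<in> p Z \<and> u \<in> hom T X Z \<and> v \<in> hom T Y Z \<and> res u c = d \<and> res v c = e"
proof -
 have "d \<in> onobj P (yo X)" "e \<in> onobj P (yo Y)" using d e by (auto simp: p_def)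
 from pair_element[OF yo(1)[OF X] yo(1)[OF Y] empty_subsetI _ this] obtain Z c x0 x1 where
  *: "Z \<in> obj T" "c \<in> p Z" "x0 \<in> onobj (yo X) Z" "x1 \<in> onobj (yo Y) Z" "pnt (yo X) Z x0 c = d" "pnt (yo Y) Z x1 c = e" by blast
 then obtain u v where "u \<in> hom T X Z" "x0 = kap X Z u" "v \<in> hom T Y Z" "x1 = kap Y Z v"
  using yo(2)[OF X *(1)] yo(2)[OF Y *(1)] by auto
 then show ?thesis using * res_eq by metis
qed

text \<open>Lifting the coincidence at d to a stage gives an arrow w with
  \<open>w \<odot> u = w \<odot> v\<close>, and w is monic.\<close>

lemma res_faithful:
 assumes u: "u \<in> hom T X Z" and v: "v \<in> hom T X Z" and d: "d \<in> p Z" and eq: "res u d = res v d"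
 shows "u = v"
proof -
 note X = hom_obj(1)[OF u] and Z = hom_obj(2)[OF u]
 define m where "m n = (if n = 2 then yoh Z (yo X) (kap X Z u) else yoh Z (yo X) (kap X Z v))" for n :: nat
 have "\<exists>W c x0 x1. W \<in> obj T \<and> c \<in> p W \<and> x0 \<in> onobj (yo Z) W \<and> x1 \<in> onobj (yo X) W \<and>
  pnt (yo Z) W x0 c = d \<and> pnt (yo X) W x1 c = res u d \<and> (\<forall>n\<in>{2, 3}. cm (m n) W x0 = x1)"
 proof (rule pair_element[OF yo(1)[OF Z] yo(1)[OF X] subset_refl])
  show "m n \<in> hom E (yo Z) (yo X)" for n
   unfolding m_def using yoh[OF Z yo(1)[OF X] kap_in[OF u]] yoh[OF Z yo(1)[OF X] kap_in[OF v]] by simp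
  show "d \<in> onobj P (yo Z)" using d by (simp add: p_def)
  show "res u d \<in> onobj P (yo X)" using res_in[OF u d] by (simp add: p_def)
  show "app (onarr P (m n)) d = res u d" if "n \<in> {2, 3}" for n
   using eq unfolding res_eq[OF u] res_eq[OF v] by (simp add: m_def pnt_def)
 qed
 then obtain W x0 where W: "W \<in> obj T" "x0 \<in> onobj (yo Z) W" "cm (m 2) W x0 = cm (m 3) W x0" by auto
 then obtain w where w: "w \<in> hom T Z W" "x0 = kap Z W w" using yo(2)[OF Z W(1)] by auto
 have "kap X W (w \<odot> u) = kap X W (w \<odot> v)"
  using W(3) yoh_eq[OF Z w(1)] yo(4)[OF X w(1) u] yo(4)[OF X w(1) v] by (simp add: w(2) m_def)
 then have "w \<odot> u = w \<odot> v" by (rule inj_onD[OF yo(3)[OF X W(1)] _ cmp_hom[OF u w(1)] cmp_hom[OF v w(1)]])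
 then show ?thesis by (rule mono[OF w(1) u v])
qed

end

section \<open>The category of finitary trees: factorisation, amalgamation and skeleton\<close>

section \<open>The category of finitary labelled trees\<close>

definition fn :: "'u itree \<times> ('u => 'u) \<times> 'u itree => 'u => 'u" where "fn m = fst (snd m)"

lemma full_subD:
 assumes "full_sub X A"
 shows "root X \<in> A" "A \<subseteq> nodes X" "(x, y) \<in> edge X ==> y \<in> A ==> x \<in> A"
  "(x, y) \<in> edge X ==> y \<in> A ==> (x, y') \<in> edge X ==> y' \<in> A"
 using assms unfolding full_sub_def by blast+

lemma (in embedding) pull_sides: "sides Y s ==> sides X (s \<circ> f)"
 unfolding sides_def
proof (intro allI impI)
 fix x y y' assume s: "\<forall>x y y'. (x, y) \<in> edge Y --> (x, y') \<in> edge Y --> y \<noteq> y' --> s y \<noteq> s y'"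
  and e: "(x, y) \<in> edge X" "(x, y') \<in> edge X" "y \<noteq> y'"
 have "f y \<noteq> f y'" using inj_onD[OF inj] X.edge_nodes(2) e by blast
 then have "s (f y) \<noteq> s (f y')" using s edge[OF e(1)] edge[OF e(2)] by blast
 then show "(s \<circ> f) y \<noteq> (s \<circ> f) y'" by simp
qed

text \<open>Sides given on X are carried to the range of f and extended by those of Y; siblings
  never lie on different sides of that boundary.\<close>

lemma (in embedding) push_sides:
 assumes sX: "sides X sX" and sY: "sides Y sY"
 shows "sides Y (\<lambda>y. if y \<in> f ` nodes X then sX (the_inv_into (nodes X) f y) else sY y)" (is "sides Y ?s")
 unfolding sides_def
proof (intro allI impI)
 fix z y y' assume e: "(z, y) \<in> edge Y" "(z, y') \<in> edge Y" "y \<noteq> y'"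
 have iff: "y \<in> f ` nodes X \<longleftrightarrow> y' \<in> f ` nodes X" using full_subD(4)[OF full_sub_range] e by blast
 show "?s y \<noteq> ?s y'"
 proof (cases "y \<in> f ` nodes X")
  case True
  then obtain x x' where x: "x \<in> nodes X" "y = f x" "x' \<in> nodes X" "y' = f x'" using iff by auto
  obtain v where v: "(v, x) \<in> edge X" "z = f v" using parent[OF x(1)] e(1) x(2) by metis
  obtain v' where v': "(v', x') \<in> edge X" "z = f v'" using parent[OF x(3)] e(2) x(4) by metis
  have "v = v'" using inj_onD[OF inj] v v' X.edge_nodes(1) by metis
  then have "sX x \<noteq> sX x'" using sX v(1) v'(1) e(3) x unfolding sides_def by blast
  then show ?thesis using x the_inv_into_f_f[OF inj] by auto
 next
  case False
  moreover have "sY y \<noteq> sY y'" using sY e unfolding sides_def by blast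
  ultimately show ?thesis using iff by auto
 qed
qed

text \<open>A branch that leaves A is no branch of the subtree, so its label is dropped.\<close>

definition sub :: "'u itree => 'u set => 'u itree" where
 "sub X A = \<lparr>nodes = A, root = root X, edge = {(x, y) \<in> edge X. y \<in> A}, label = (\<lambda>b. if range b \<subseteq> A then label X b else None)\<rparr>"

lemma sub_simps [simp]: "nodes (sub X A) = A" "root (sub X A) = root X" "(x, y) \<in> edge (sub X A) \<longleftrightarrow> (x, y) \<in> edge X \<and> y \<in> A"
 "label (sub X A) b = (if range b \<subseteq> A then label X b else None)"
 by (auto simp: sub_def)

lemma sub_sub: "A \<subseteq> B ==> sub (sub X B) A = sub X A"
 by (auto simp: sub_def fun_eq_iff)

lemma full_sub_sub: "full_sub X A ==> A \<subseteq> B ==> full_sub (sub X B) A"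
 unfolding full_sub_def by fastforce

lemma sub_branches:
 assumes A: "full_sub X A" shows "branches (sub X A) = {b \<in> branches X. range b \<subseteq> A}"
proof (intro equalityI subsetI)
 fix b assume b: "b \<in> branches (sub X A)"
 have "b n \<in> A" for n using b full_subD(1)[OF A] by (cases n) (auto simp: branches_def)
 then show "b \<in> {b \<in> branches X. range b \<subseteq> A}" using b by (auto simp: branches_def)
qed (auto simp: branches_def)

lemma (in fbt) sub_full: assumes A: "full_sub X A" shows "full_binary_tree (sub X A)"
proof (rule full_binary_treeI[where d = "depth X"])
 show "root (sub X A) \<in> nodes (sub X A)" using full_subD(1)[OF A] by simp
 show "x \<in> nodes (sub X A) \<and> y \<in> nodes (sub X A)" if "(x, y) \<in> edge (sub X A)" for x y
  using that full_subD(3)[OF A] by auto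
 show "kids (sub X A) x = {} \<or> card (kids (sub X A) x) = 2" if "x \<in> nodes (sub X A)" for x
 proof (cases "kids (sub X A) x = {}")
  case False
  then have "kids (sub X A) x = kids X x" using full_subD(4)[OF A] by auto
  then show ?thesis using kids_card by simp
 qed simp
 show "depth X (root (sub X A)) = 0" by (simp add: depth_root)
 show "depth X y = Suc (depth X x)" if "(x, y) \<in> edge (sub X A)" for x y using that depth_edge by simp
 show "x = x'" if "(x, y) \<in> edge (sub X A)" "(x', y) \<in> edge (sub X A)" for x x' y
  using that parent_unique[of x y x'] by simp
 show "\<exists>x. (x, y) \<in> edge (sub X A)" if "y \<in> nodes (sub X A)" "y \<noteq> root (sub X A)" for y
  using that parent_ex full_subD(2)[OF A] by auto
qed

context trees
begin

abbreviation T where "T \<equiv> T_cat I"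

lemma T_obj: "X \<in> obj T \<longleftrightarrow> ob X"
 by (simp add: T_cat_def ob_def)

lemma T_hom: "m \<in> hom T X Y \<longleftrightarrow> ob X \<and> ob Y \<and> (\<exists>f. m = (X, f, Y) \<and> itree_embedding X Y f)"
 by (auto simp: hom_def T_cat_def ob_def)

lemma T_homD:
 assumes "m \<in> hom T X Y"
 shows "ob X" "ob Y" "itree_embedding X Y (fn m)" "embedding X Y (fn m)" "m = (X, fn m, Y)"
 using assms emb_embedding by (auto simp: T_hom fn_def)

lemma fn_ext:
 assumes m: "m \<in> hom T X Y" and n: "n \<in> hom T X Y" and eq: "\<And>x. x \<in> nodes X ==> fn m x = fn n x"
 shows "m = n"
proof -
 have "fn m = fn n"
  by (rule PiE_ext[where k = "nodes X" and s = "\<lambda>_. nodes Y"])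
   (use T_homD(3)[OF m] T_homD(3)[OF n] eq in \<open>simp_all add: itree_embedding_def tree_embedding_def\<close>)
 then have "(X, fn m, Y) = (X, fn n, Y)" by simp
 then show ?thesis by (rule trans[OF T_homD(5)[OF m] trans[OF _ T_homD(5)[OF n, symmetric]]])
qed

definition mk :: "'u itree => ('u => 'u) => 'u itree => 'u itree \<times> ('u => 'u) \<times> 'u itree" where
 "mk X f Y = (X, restrict f (nodes X), Y)"

lemma fn_mk [simp]: "x \<in> nodes X ==> fn (mk X f Y) x = f x"
 by (simp add: fn_def mk_def)

lemma mkI:
 assumes "ob X" "ob Y" "\<And>x. x \<in> nodes X ==> g x \<in> nodes Y" "inj_on g (nodes X)" "g (root X) = root Y"
  and "\<And>x y. (x, y) \<in> edge X ==> (g x, g y) \<in> edge Y"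
  and "\<And>b. b \<in> branches X ==> label Y (g \<circ> b) = label X b"
 shows "mk X g Y \<in> hom T X Y"
 unfolding T_hom mk_def using assms(1,2) embI[OF assms] by blast

lemma idn_T: "idn T X = mk X (\<lambda>x. x) X"
 by (simp add: T_cat_def mk_def)

lemma idn_T_hom: "ob X ==> idn T X \<in> hom T X X"
 unfolding idn_T by (rule mkI) (auto simp: fbt.edge_nodes ob_fbt comp_def)

lemma cmp_T: "cmp T n m = (fst m, compose (nodes (fst m)) (fn n) (fn m), snd (snd n))"
 by (cases m; cases n) (simp add: T_cat_def fn_def)

lemma fn_cmp: "m \<in> hom T X Y ==> x \<in> nodes X ==> fn (cmp T n m) x = fn n (fn m x)"
 by (auto simp: cmp_T fn_def compose_def T_hom)

lemma cmp_T_hom: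
 assumes m: "m \<in> hom T X Y" and n: "n \<in> hom T Y Z"
 shows "cmp T n m \<in> hom T X Z"
proof -
 interpret m: embedding X Y "fn m" by (rule T_homD(4)[OF m])
 interpret n: embedding Y Z "fn n" by (rule T_homD(4)[OF n])
 have "mk X (fn n \<circ> fn m) Z \<in> hom T X Z"
 proof (rule mkI[OF T_homD(1)[OF m] T_homD(2)[OF n]])
  show "inj_on (fn n \<circ> fn m) (nodes X)"
   by (rule comp_inj_on[OF m.inj inj_on_subset[OF n.inj]]) (use m.node in auto)
  show "label Z ((fn n \<circ> fn m) \<circ> b) = label X b" if b: "b \<in> branches X" for b
   using emb_label[OF T_homD(1,3)[OF n] m.branch[OF b]] emb_label[OF T_homD(1,3)[OF m] b] by (simp add: comp_assoc)
 qed (simp_all add: m.node n.node m.root n.root m.edge n.edge)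
 moreover have "fst m = X" "snd (snd n) = Z" using m n by (auto simp: T_hom)
 then have "cmp T n m = mk X (fn n \<circ> fn m) Z" by (simp add: cmp_T mk_def compose_def comp_def)
 ultimately show ?thesis by (simp only:)
qed

lemma fn_idn [simp]: "x \<in> nodes X ==> fn (idn T X) x = x"
 by (simp add: idn_T)

lemma fn_node: "m \<in> hom T X Y ==> x \<in> nodes X ==> fn m x \<in> nodes Y"
 by (rule embedding.node[OF T_homD(4)])

lemma category_T: "category T"
proof
 show "src T f \<in> obj T" "tgt T f \<in> obj T" if "f \<in> arr T" for f
  using T_homD(1,2)[OF arr_hom[OF that]] by (simp_all add: T_obj)
 show idh: "idn T X \<in> hom T X X" if "X \<in> obj T" for X using that idn_T_hom T_obj by simp
 show "cmp T g f \<in> hom T X Z" if "f \<in> hom T X Y" "g \<in> hom T Y Z" for f g X Y Z by (rule cmp_T_hom[OF that])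
 show "cmp T f (idn T X) = f" if f: "f \<in> hom T X Y" for f X Y
  by (rule fn_ext[OF cmp_T_hom[OF idn_T_hom[OF T_homD(1)[OF f]] f] f])
   (simp add: fn_cmp[OF idn_T_hom[OF T_homD(1)[OF f]]])
 show "cmp T (idn T Y) f = f" if f: "f \<in> hom T X Y" for f X Y
  by (rule fn_ext[OF cmp_T_hom[OF f idn_T_hom[OF T_homD(2)[OF f]]] f]) (simp add: fn_cmp[OF f] fn_node[OF f])
 show "cmp T h (cmp T g f) = cmp T (cmp T h g) f"
  if f: "f \<in> hom T W X" and g: "g \<in> hom T X Y" and h: "h \<in> hom T Y Z" for f g h W X Y Z
  by (rule fn_ext[OF cmp_T_hom[OF cmp_T_hom[OF f g] h] cmp_T_hom[OF f cmp_T_hom[OF g h]]])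
   (simp add: fn_cmp[OF f] fn_cmp[OF cmp_T_hom[OF f g]] fn_cmp[OF g] fn_node[OF f])
qed

lemma mono_T:
 assumes f: "f \<in> hom T Y Z" and a: "a \<in> hom T X Y" and b: "b \<in> hom T X Y" and eq: "cmp T f a = cmp T f b"
 shows "a = b"
proof (rule fn_ext[OF a b])
 fix x assume x: "x \<in> nodes X"
 from arg_cong[OF eq, of "\<lambda>m. fn m x"] have "fn f (fn a x) = fn f (fn b x)" unfolding fn_cmp[OF a x] fn_cmp[OF b x] .
 then show "fn a x = fn b x" by (rule inj_onD[OF embedding.inj[OF T_homD(4)[OF f]] _ fn_node[OF a x] fn_node[OF b x]])
qed

text \<open>\<open>iff\<close> says that W identifies nodes of A and B exactly as V does, so the
  induced map is well defined and injective. For labels: a branch not contained in the image of A is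
  eventually, hence by closure under parents entirely, in the image of B.\<close>

lemma joint_factor:
 assumes p: "p \<in> hom T A W" and q: "q \<in> hom T B W" and cover: "nodes W \<subseteq> fn p ` nodes A \<union> fn q ` nodes B"
  and g: "g \<in> hom T A V" and h: "h \<in> hom T B V"
  and iff: "\<And>x y. x \<in> nodes A ==> y \<in> nodes B ==> fn p x = fn q y \<longleftrightarrow> fn g x = fn h y"
 obtains w where "w \<in> hom T W V" "cmp T w p = g" "cmp T w q = h"
proof -
 interpret p: embedding A W "fn p" by (rule T_homD(4)[OF p])
 interpret q: embedding B W "fn q" by (rule T_homD(4)[OF q])
 interpret g: embedding A V "fn g" by (rule T_homD(4)[OF g])
 interpret h: embedding B V "fn h" by (rule T_homD(4)[OF h])
 define w where "w z = (if z \<in> fn p ` nodes A then fn g (the_inv_into (nodes A) (fn p) z)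
  else fn h (the_inv_into (nodes B) (fn q) z))" for z
 have wp: "w (fn p x) = fn g x" if "x \<in> nodes A" for x
  using that the_inv_into_f_f[OF p.inj] by (simp add: w_def)
 have wq: "w (fn q y) = fn h y" if y: "y \<in> nodes B" for y
 proof (cases "fn q y \<in> fn p ` nodes A")
  case True
  then obtain x where x: "x \<in> nodes A" "fn q y = fn p x" by blast
  show ?thesis unfolding x(2) wp[OF x(1)] by (rule iff[OF x(1) y, THEN iffD1, OF x(2)[symmetric]])
 qed (use y the_inv_into_f_f[OF q.inj] in \<open>simp add: w_def\<close>)
 have cv: "(\<exists>x\<in>nodes A. z = fn p x) \<or> (\<exists>y\<in>nodes B. z = fn q y)" if "z \<in> nodes W" for z using that cover by auto
 have "mk W w V \<in> hom T W V"
 proof (rule mkI[OF T_homD(2)[OF p] T_homD(2)[OF g]])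
  show "w z \<in> nodes V" if "z \<in> nodes W" for z using cv[OF that] wp wq g.node h.node by auto
  show "inj_on w (nodes W)"
  proof (rule inj_onI)
   fix z z' assume z: "z \<in> nodes W" "z' \<in> nodes W" "w z = w z'"
   from cv[OF z(1)] cv[OF z(2)] show "z = z'"
   proof (elim disjE bexE)
    fix x x' assume "x \<in> nodes A" "z = fn p x" "x' \<in> nodes A" "z' = fn p x'"
    then show ?thesis using z(3) wp inj_onD[OF g.inj] by metis
   next
    fix x x' assume "x \<in> nodes A" "z = fn p x" "x' \<in> nodes B" "z' = fn q x'"
    then show ?thesis using z(3) wp wq iff by metis
   next
    fix x x' assume "x \<in> nodes B" "z = fn q x" "x' \<in> nodes A" "z' = fn p x'"
    then show ?thesis using z(3) wp wq iff by metis
   next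
    fix x x' assume "x \<in> nodes B" "z = fn q x" "x' \<in> nodes B" "z' = fn q x'"
    then show ?thesis using z(3) wq inj_onD[OF h.inj] by metis
   qed
  qed
  show "w (root W) = root V" using wp[OF p.X.root_node] p.root g.root by simp
  show "(w z, w z') \<in> edge V" if e: "(z, z') \<in> edge W" for z z'
   using cv[OF p.Y.edge_nodes(2)[OF e]]
  proof (elim disjE bexE)
   fix x assume x: "x \<in> nodes A" "z' = fn p x"
   obtain x' where x': "(x', x) \<in> edge A" "z = fn p x'" using p.parent[OF x(1)] e x(2) by metis
   show ?thesis unfolding x(2) x'(2) wp[OF x(1)] wp[OF p.X.edge_nodes(1)[OF x'(1)]] by (rule g.edge[OF x'(1)])
  next
   fix x assume x: "x \<in> nodes B" "z' = fn q x"
   obtain x' where x': "(x', x) \<in> edge B" "z = fn q x'" using q.parent[OF x(1)] e x(2) by metis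
   show ?thesis unfolding x(2) x'(2) wq[OF x(1)] wq[OF q.X.edge_nodes(1)[OF x'(1)]] by (rule h.edge[OF x'(1)])
  qed
  show "label V (w \<circ> c) = label W c" if c: "c \<in> branches W" for c
  proof (cases "\<forall>n. c n \<in> fn p ` nodes A")
   case True
   then obtain b where b: "b \<in> branches A" "c = fn p \<circ> b" using p.branch_pre[OF c] by blast
   have "w \<circ> c = fn g \<circ> b" using b wp p.X.branch_node by auto
   then show ?thesis using b emb_label[OF T_homD(1,3)[OF g] b(1)] emb_label[OF T_homD(1,3)[OF p] b(1)] by simp
  next
   case False
   then obtain n where n: "c n \<notin> fn p ` nodes A" by blast
   have up: "c m \<in> fn q ` nodes B" if "m \<ge> n" for m
   proof -
    have "c m \<notin> fn p ` nodes A" by (rule p.Y.full_sub_branch[OF p.full_sub_range c n that])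
    then show ?thesis using cover p.Y.branch_node[OF c, of m] by blast
   qed
   have "c m \<in> fn q ` nodes B" for m
   proof (rule ccontr)
    assume m: "c m \<notin> fn q ` nodes B"
    then have "c (max m n) \<notin> fn q ` nodes B" by (rule p.Y.full_sub_branch[OF q.full_sub_range c]) simp
    then show False using up[of "max m n"] by simp
   qed
   then obtain b where b: "b \<in> branches B" "c = fn q \<circ> b" using q.branch_pre[OF c] by blast
   have "w \<circ> c = fn h \<circ> b" using b wq q.X.branch_node by auto
   then show ?thesis using b emb_label[OF T_homD(1,3)[OF h] b(1)] emb_label[OF T_homD(1,3)[OF q] b(1)] by simp
  qed
 qed
 moreover from this have "cmp T (mk W w V) p = g"
  by (intro fn_ext[OF cmp_T_hom[OF p] g]) (simp_all add: fn_cmp[OF p] fn_node[OF p] wp)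
 moreover from calculation(1) have "cmp T (mk W w V) q = h"
  by (intro fn_ext[OF cmp_T_hom[OF q] h]) (simp_all add: fn_cmp[OF q] fn_node[OF q] wq)
 ultimately show thesis by (rule that)
qed

lemma factor:
 assumes a: "a \<in> hom T X Z" and f: "f \<in> hom T Y Z" and range: "\<And>x. x \<in> nodes X ==> fn a x \<in> fn f ` nodes Y"
 obtains b where "b \<in> hom T X Y" "cmp T f b = a"
proof -
 interpret a: embedding X Z "fn a" by (rule T_homD(4)[OF a])
 interpret f: embedding Y Z "fn f" by (rule T_homD(4)[OF f])
 have "\<exists>y. y \<in> nodes Y \<and> fn f y = fn a x" if "x \<in> nodes X" for x using range[OF that] by force
 then obtain g where g: "\<And>x. x \<in> nodes X ==> g x \<in> nodes Y" "\<And>x. x \<in> nodes X ==> fn f (g x) = fn a x" by metis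
 have edge: "(g x, g y) \<in> edge Y" if e: "(x, y) \<in> edge X" for x y
 proof -
  note xy = a.X.edge_nodes[OF e]
  have "(fn f (g x), fn f (g y)) \<in> edge Z" using a.edge[OF e] g(2)[OF xy(1)] g(2)[OF xy(2)] by simp
  then show ?thesis using f.emb g(1)[OF xy(1)] g(1)[OF xy(2)] unfolding tree_embedding_def by blast
 qed
 have root: "g (root X) = root Y"
  using inj_onD[OF f.inj, of "g (root X)" "root Y"] g[OF a.X.root_node] a.root f.root f.X.root_node by simp
 have "mk X g Y \<in> hom T X Y"
 proof (rule mkI[OF T_homD(1)[OF a] T_homD(1)[OF f] ])
  show "g (root X) = root Y" by (rule root)
  show "g x \<in> nodes Y" if "x \<in> nodes X" for x by (rule g(1)[OF that])
  show "(g x, g y) \<in> edge Y" if "(x, y) \<in> edge X" for x y by (rule edge[OF that])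
  show "inj_on g (nodes X)" using inj_onD[OF a.inj] g(2) by (intro inj_onI) metis
  show "label Y (g \<circ> b) = label X b" if b: "b \<in> branches X" for b
  proof -
   have "g \<circ> b \<in> branches Y" using b edge root by (simp add: branches_def)
   from emb_label[OF T_homD(1,3)[OF f] this] have "label Y (g \<circ> b) = label Z (fn f \<circ> (g \<circ> b))" ..
   also have "fn f \<circ> (g \<circ> b) = fn a \<circ> b" using g(2) a.X.branch_node[OF b] by auto
   also have "label Z (fn a \<circ> b) = label X b" by (rule emb_label[OF T_homD(1,3)[OF a] b])
   finally show ?thesis .
  qed
 qed
 moreover from this have "cmp T f (mk X g Y) = a"
  by (intro fn_ext[OF cmp_T_hom[OF _ f] a]) (simp_all add: fn_cmp g)
 ultimately show thesis by (rule that)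
qed

lemma surjective_inverse:
 assumes f: "f \<in> hom T X Y" and onto: "nodes Y \<subseteq> fn f ` nodes X"
 obtains g where "g \<in> hom T Y X" "cmp T f g = idn T Y" "cmp T g f = idn T X"
proof -
 note X = T_homD(1)[OF f] and Y = T_homD(2)[OF f]
 obtain g where g: "g \<in> hom T Y X" "cmp T f g = idn T Y"
  by (rule factor[OF idn_T_hom[OF Y] f]) (use onto in auto)
 have "cmp T f (cmp T g f) = cmp T f (idn T X)"
  using category.cmp_assoc[OF category_T f g(1) f] g(2) category.cmp_idn_left[OF category_T f]
   category.cmp_idn_right[OF category_T f] by simp
 then have "cmp T g f = idn T X" by (rule mono_T[OF f cmp_T_hom[OF f g(1)] idn_T_hom[OF X]])
 with g show thesis by (rule that)
qed

lemma amalgam_hom: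
 assumes f: "f \<in> hom T A B" and g: "g \<in> hom T A V" and sB: "sides B sB" and sV: "sides V sV"
  and s: "\<And>a. a \<in> nodes A ==> a \<noteq> root A ==> sB (fn f a) = sV (fn g a)"
 obtains W h k where "h \<in> hom T B W" "k \<in> hom T V W" "cmp T h f = cmp T k g"
  "\<And>x y. x \<in> nodes B ==> y \<in> nodes V ==> depth B x \<le> d ==> fn h x = fn k y ==> code B sB x = code V sV y"
proof -
 obtain W h k where W: "ob W" and h: "itree_embedding B W h" and k: "itree_embedding V W k"
  and eq: "\<And>a. a \<in> nodes A ==> h (fn f a) = k (fn g a)"
  and code: "\<And>x y. x \<in> nodes B ==> y \<in> nodes V ==> depth B x \<le> d ==> h x = k y ==> code B sB x = code V sV y"
  by (rule amalgam[OF T_homD(1)[OF f] T_homD(2)[OF f] T_homD(2)[OF g] T_homD(3)[OF f] T_homD(3)[OF g] sB sV s, where d = d])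
   blast+
 have hh: "(B, h, W) \<in> hom T B W" and kh: "(V, k, W) \<in> hom T V W"
  using W h k T_homD(2)[OF f] T_homD(2)[OF g] by (simp_all add: T_hom)
 show thesis
 proof (rule that[OF hh kh])
  show "cmp T (B, h, W) f = cmp T (V, k, W) g"
   by (rule fn_ext[OF cmp_T_hom[OF f hh] cmp_T_hom[OF g kh]]) (simp add: fn_cmp[OF f] fn_cmp[OF g], simp add: fn_def eq[unfolded fn_def])
  show "code B sB x = code V sV y" if "x \<in> nodes B" "y \<in> nodes V" "depth B x \<le> d" "fn (B, h, W) x = fn (V, k, W) y" for x y
   using code[OF that(1-3)] that(4) by (simp add: fn_def)
 qed
qed

text \<open>Sides of V are pulled back to A and extended over B, so that the two choices agree along
  A as \<open>amalgam_hom\<close> demands.\<close>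

lemma amalgamation_T:
 assumes f: "f \<in> hom T A B" and g: "g \<in> hom T A V"
 shows "\<exists>W. \<exists>h\<in>hom T B W. \<exists>k\<in>hom T V W. cmp T h f = cmp T k g"
proof -
 interpret f: embedding A B "fn f" by (rule T_homD(4)[OF f])
 interpret g: embedding A V "fn g" by (rule T_homD(4)[OF g])
 obtain sV where sV: "sides V sV" using g.Y.ex_sides by blast
 obtain sB where sB: "sides B sB" using f.Y.ex_sides by blast
 have eq: "(if fn f a \<in> fn f ` nodes A then (sV \<circ> fn g) (the_inv_into (nodes A) (fn f) (fn f a)) else sB (fn f a)) = sV (fn g a)"
  if "a \<in> nodes A" for a using that the_inv_into_f_f[OF f.inj that] by simp
 show ?thesis
  by (rule amalgam_hom[OF f g f.push_sides[OF g.pull_sides[OF sV] sB] sV, where d = 0], rule eq, assumption, blast)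
qed

text \<open>A node z reached by a but not by f is detected by amalgamating Z with itself over Y, all
  sides outside Y being flipped in one copy. The twist starts only deeper than z, so if both arrows
  agreed at z the codes would agree, yet their last bits differ.\<close>

lemma subcanonical_T:
 assumes f: "f \<in> hom T Y Z" and a: "a \<in> hom T X Z"
  and eq: "\<And>W g h. g \<in> hom T Z W ==> h \<in> hom T Z W ==> cmp T g f = cmp T h f ==> cmp T g a = cmp T h a"
 shows "\<exists>b\<in>hom T X Y. cmp T f b = a"
proof -
 interpret f: embedding Y Z "fn f" by (rule T_homD(4)[OF f])
 obtain s where s: "sides Z s" using f.Y.ex_sides by blast
 define s' where "s' y = (if y \<in> fn f ` nodes Y then s y else \<not> s y)" for y
 have s': "sides Z s'" by (rule f.Y.sides_flip[OF f.full_sub_range s]) (auto simp: s'_def)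
 have "fn a x \<in> fn f ` nodes Y" if x: "x \<in> nodes X" for x
 proof (rule ccontr)
  assume no: "fn a x \<notin> fn f ` nodes Y"
  define z where "z = fn a x"
  have z: "z \<in> nodes Z" unfolding z_def by (rule fn_node[OF a x])
  obtain W h k where hk: "h \<in> hom T Z W" "k \<in> hom T Z W" "cmp T h f = cmp T k f"
   and code: "\<And>x y. x \<in> nodes Z ==> y \<in> nodes Z ==> depth Z x \<le> depth Z z ==> fn h x = fn k y ==> code Z s' x = code Z s y"
   by (rule amalgam_hom[OF f f s' s, where d = "depth Z z"]) (auto simp: s'_def)
  have "fn h z = fn k z" using eq[OF hk] fn_cmp[OF a x] unfolding z_def by metis
  from code[OF z z order_refl this] have c: "code Z s' z = code Z s z" .
  have "z \<noteq> root Z" using no full_subD(1)[OF f.full_sub_range] unfolding z_def by metis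
  then obtain v where "(v, z) \<in> edge Z" using f.Y.parent_ex z by blast
  then have "s' z = s z" using c f.Y.code_edge by simp
  then show False using no by (simp add: s'_def z_def)
 qed
 then show ?thesis by (rule factor[OF a f]) blast+
qed

text \<open>The union of X with itself, for the same sides, is a copy of X whose nodes are
  codes.\<close>

lemma skeleton:
 assumes X: "ob X"
 shows "\<exists>W f g. ob W \<and> nodes W \<subseteq> range e \<and> f \<in> hom T X W \<and> g \<in> hom T W X \<and> cmp T g f = idn T X \<and> cmp T f g = idn T W"
proof -
 interpret X: fbt X by (rule ob_fbt[OF X])
 obtain s where s: "sides X s" using X.ex_sides by blast
 obtain W where W: "ob W" "itree_embedding X W (restrict (e \<circ> code X s) (nodes X))"
  and n: "nodes W = e ` code X s ` nodes X \<union> e ` code X s ` nodes X"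
  by (rule union_tree[OF X X s s]) (use X.bcode_inj[OF s] in blast)+
 have f: "mk X (e \<circ> code X s) W \<in> hom T X W" using X W by (simp add: T_hom mk_def)
 obtain g where "g \<in> hom T W X" "cmp T (mk X (e \<circ> code X s) W) g = idn T W" "cmp T g (mk X (e \<circ> code X s) W) = idn T X"
  by (rule surjective_inverse[OF f]) (auto simp: n)
 moreover have "nodes W \<subseteq> range e" using n by auto
 ultimately show ?thesis using W(1) f by blast
qed

definition T0 where "T0 = can e {[]} (\<lambda>_. None)"

lemma T0_ob: "ob T0"
 unfolding ob_def T0_def
proof (rule can_obj[OF e])
 have "map sg [0..<Suc 0] \<notin> {[]}" for sg :: "nat => bool" by simp
 then have "ends {[]} = {}" unfolding ends_def by blast
 then show "finite (ends {[]})" "\<And>sg. sg \<in> ends {[]} ==> \<exists>i\<in>I. None = Some i" by auto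
qed (simp_all add: tree_set_def)

lemma T0_initial:
 assumes X: "ob X" shows "\<exists>!f. f \<in> hom T T0 X"
proof (rule ex1I)
 interpret X: fbt X by (rule ob_fbt[OF X])
 have nod: "nodes T0 = {root T0}" "edge T0 = {}" by (auto simp: T0_def can_def)
 have br: "branches T0 = {}" using nod by (auto simp: branches_def)
 show "mk T0 (\<lambda>_. root X) X \<in> hom T T0 X"
  by (rule mkI[OF T0_ob X]) (use nod br X.root_node in auto)
 fix f assume f: "f \<in> hom T T0 X"
 show "f = mk T0 (\<lambda>_. root X) X"
  by (rule fn_ext[OF f \<open>mk T0 (\<lambda>_. root X) X \<in> hom T T0 X\<close>]) (use nod embedding.root[OF T_homD(4)[OF f]] in auto)
qed

text \<open>Cutting a branch may put new nodes off the branches. These are children of the part of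
  some old branch before it leaves A, and there are finitely many such parts, all finite.\<close>

lemma sub_ob:
 assumes X: "ob X" and A: "full_sub X A" shows "ob (sub X A)"
proof -
 interpret X: fbt X by (rule ob_fbt[OF X])
 note br = sub_branches[OF A]
 have "label (sub X A) b \<noteq> None \<longleftrightarrow> b \<in> branches (sub X A)" for b
  using X unfolding br ob_def finitary_def by (simp add: dom_def set_eq_iff)
 then have dom: "Map.dom (label (sub X A)) = branches (sub X A)" by (simp add: dom_def)
 have ran: "Map.ran (label (sub X A)) \<subseteq> I"
  using X unfolding ob_def is_itree_def ran_def by (auto split: if_splits)
 let ?off = "{y \<in> nodes X. \<exists>x. (x, y) \<in> edge X \<and> \<not> (\<exists>b\<in>branches X. x \<in> range b)}"
 \<comment> \<open>An index by which b has left A.\<close>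
 define k where "k b = (SOME n. b n \<notin> A)" for b :: "nat => 'u"
 have k: "b (k b) \<notin> A" if "\<not> range b \<subseteq> A" for b unfolding k_def by (rule someI_ex) (use that in auto)
 have fink: "finite (kids X x)" for x using X.kids_card[of x] by (metis card.infinite finite.emptyI zero_neq_numeral)
 have "finite {y \<in> nodes (sub X A). \<exists>x. (x, y) \<in> edge (sub X A) \<and> \<not> (\<exists>b\<in>branches (sub X A). x \<in> range b)}" (is "finite ?O")
 proof (rule finite_subset)
  show "?O \<subseteq> ?off \<union> (\<Union>b\<in>branches X. \<Union>n<k b. kids X (b n))"
  proof
   fix y assume "y \<in> ?O"
   then obtain x where y: "y \<in> A" "(x, y) \<in> edge X" and x: "\<not> (\<exists>b\<in>branches (sub X A). x \<in> range b)" by auto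
   show "y \<in> ?off \<union> (\<Union>b\<in>branches X. \<Union>n<k b. kids X (b n))"
   proof (cases "\<exists>b\<in>branches X. x \<in> range b")
    case True
    then obtain b n where b: "b \<in> branches X" "x = b n" by auto
    then have "k b \<le> n ==> b n \<notin> A" using x k[of b] X.full_sub_branch[OF A b(1)] unfolding br by blast
    moreover have "b n \<in> A" using full_subD(3)[OF A y(2,1)] b(2) by simp
    ultimately have "n < k b" by (meson not_le)
    then show ?thesis using b y by blast
   next
    case False
    show ?thesis by (intro UnI1 CollectI conjI exI[of _ x]) (rule X.edge_nodes(2)[OF y(2)], rule y(2), rule False)
   qed
  qed
  show "finite (?off \<union> (\<Union>b\<in>branches X. \<Union>n<k b. kids X (b n)))"
  proof (intro finite_UnI finite_UN_I)
   show "finite ?off" by (rule X[unfolded ob_def finitary_def, THEN conjunct2, THEN conjunct2, THEN conjunct1])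
  qed (rule ob_finite[OF X], rule finite_lessThan, rule fink)
 qed
 moreover have "finite (branches (sub X A))" unfolding br by (rule finite_subset[OF _ ob_finite[OF X]]) blast
 ultimately show ?thesis
  unfolding ob_def is_itree_def finitary_def using X.sub_full[OF A] dom ran by blast
qed

definition incl where "incl X A = mk (sub X A) (\<lambda>x. x) X"

lemma incl:
 assumes X: "ob X" and A: "full_sub X A" shows "incl X A \<in> hom T (sub X A) X"
 unfolding incl_def
proof (rule mkI[OF sub_ob[OF assms] X])
 show "label X ((\<lambda>x. x) \<circ> b) = label (sub X A) b" if "b \<in> branches (sub X A)" for b
  using that unfolding sub_branches[OF A] by (simp add: comp_def)
qed (use full_subD[OF A] in auto)

lemma fn_incl [simp]: "x \<in> A ==> fn (incl X A) x = x"
 by (simp add: incl_def)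

end

section \<open>Finite test sets for descent along tree embeddings\<close>

section \<open>Finite descent along embeddings of trees\<close>

locale tree_site = universe U + trees I e
 for U :: "'u itself" and I :: "'u set" and e +
 assumes small_I: "small U I"

sublocale tree_site \<subseteq> amalgamation_category U "T_cat I"
 by (intro amalgamation_category.intro universe_axioms category_T amalgamation_category_axioms.intro amalgamation_T)

context tree_site
begin

notation comp (infixr "\<odot>" 70)

lemma small_nodes: assumes X: "ob X" shows "small U (nodes X)"
proof -
 interpret X: fbt X by (rule ob_fbt[OF X])
 obtain s where s: "sides X s" using X.ex_sides by blast
 have "small U (lists (UNIV :: bool set))" by (intro small_lists small_finite) simp
 then have "small U (code X s ` nodes X)" by (rule small_subset) simp
 then show ?thesis by (rule small_inj_image[OF X.code_inj[OF s]])
qed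

lemma small_hom_T: "X \<in> obj T ==> Y \<in> obj T ==> small U (hom T X Y)"
 by (rule small_graph[of "nodes X" "nodes Y" _ fn]) (simp_all add: T_obj small_nodes fn_node, rule fn_ext)

lemma small_skeleton: "small U {W. ob W \<and> nodes W \<subseteq> range e}"
proof (rule small_inj_image)
 have re: "small U (range e)"
 proof (rule small_image)
  have "small U (lists (UNIV :: bool set))" by (intro small_lists small_finite finite)
  then show "small U (UNIV :: bool list set)" unfolding lists_UNIV .
 qed
 \<comment> \<open>The label map is stored as its graph: labels sit only on branches, which are
   sequences in \<open>range e\<close>, so the graph is a subset of a small set.\<close>
 define F where "F W = (nodes W, root W, edge W, {(b, i). label W b = Some i})" for W :: "'u itree"
 show "inj_on F {W. ob W \<and> nodes W \<subseteq> range e}"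
 proof (rule inj_onI)
  fix W W' :: "'u itree" assume "F W = F W'"
  then have eq: "nodes W = nodes W' \<and> root W = root W' \<and> edge W = edge W' \<and>
   {(b, i). label W b = Some i} = {(b, i). label W' b = Some i}" unfolding F_def prod.inject .
  then have l: "label W b = Some i \<longleftrightarrow> label W' b = Some i" for b i by blast
  have "label W = label W'"
  proof
   show "label W b = label W' b" for b using l[of b] by (metis option.exhaust)
  qed
  then show "W = W'"
   by (rule itree.equality[OF conjunct1[OF eq] eq[THEN conjunct2, THEN conjunct1] eq[THEN conjunct2, THEN conjunct2, THEN conjunct1]])
    (rule HOL.trans[OF unit_eq unit_eq[symmetric]])
 qed
 show "small U (F ` {W. ob W \<and> nodes W \<subseteq> range e})"
 proof (rule small_subset)
  show "small U (Pow (range e) \<times> range e \<times> Pow (range e \<times> range e) \<times> Pow ((\<Pi>\<^sub>E n\<in>UNIV :: nat set. range e) \<times> I))"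
   by (intro small_Times small_Pow small_PiE re small_I small_nat_set)
  show "F ` {W. ob W \<and> nodes W \<subseteq> range e} \<subseteq> Pow (range e) \<times> range e \<times> Pow (range e \<times> range e) \<times> Pow ((\<Pi>\<^sub>E n\<in>UNIV. range e) \<times> I)"
  proof (rule image_subsetI)
   fix W assume "W \<in> {W. ob W \<and> nodes W \<subseteq> range e}"
   then have W: "ob W" and r: "nodes W \<subseteq> range e" by blast+
   interpret W: fbt W by (rule ob_fbt[OF W])
   have "b \<in> (\<Pi>\<^sub>E n\<in>UNIV. range e) \<and> i \<in> I" if "label W b = Some i" for b i
   proof -
    have "b \<in> Map.dom (label W)" "i \<in> Map.ran (label W)" using that by (auto simp: ran_def)
    then have "b \<in> branches W" "i \<in> I" using W unfolding ob_def is_itree_def by blast+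
    then show ?thesis using W.branch_node r by (simp add: PiE_iff) blast
   qed
   then have "{(b, i). label W b = Some i} \<in> Pow ((\<Pi>\<^sub>E n\<in>UNIV. range e) \<times> I)" by blast
   moreover have "edge W \<subseteq> nodes W \<times> nodes W" using W.edge_nodes by auto
   then have "edge W \<in> Pow (range e \<times> range e)" using r by blast
   moreover have "root W \<in> range e" using W.root_node r by blast
   ultimately show "F W \<in> Pow (range e) \<times> range e \<times> Pow (range e \<times> range e) \<times> Pow ((\<Pi>\<^sub>E n\<in>UNIV. range e) \<times> I)"
    using r unfolding F_def by blast
  qed
 qed
qed

lemma site_T: "\<exists>S r \<phi> \<psi>. site U T S r \<phi> \<psi>"
proof -
 define S where "S = {W. ob W \<and> nodes W \<subseteq> range e}"
 \<comment> \<open>The choice is normalised on S, where each tree represents itself by the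
   identity.\<close>
 have "\<forall>X. \<exists>W f g. ob X --> W \<in> S \<and> f \<in> hom T X W \<and> g \<in> hom T W X \<and> cmp T g f = idn T X \<and> cmp T f g = idn T W \<and> (X \<in> S --> W = X \<and> f = idn T X)"
 proof
  fix X
  show "\<exists>W f g. ob X --> W \<in> S \<and> f \<in> hom T X W \<and> g \<in> hom T W X \<and> cmp T g f = idn T X \<and> cmp T f g = idn T W \<and> (X \<in> S --> W = X \<and> f = idn T X)"
  proof (cases "X \<in> S")
   case True
   then have X: "ob X" by (simp add: S_def)
   show ?thesis
    by (rule exI[of _ X], rule exI[of _ "idn T X"], rule exI[of _ "idn T X"])
     (use True idn_T_hom[OF X] cmp_idn_left[OF idn_T_hom[OF X]] in blast)
  next
   case False
   then show ?thesis using skeleton[of X] unfolding S_def by blast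
  qed
 qed
 then obtain r f g where *: "\<And>X. ob X ==> r X \<in> S \<and> f X \<in> hom T X (r X) \<and> g X \<in> hom T (r X) X \<and> cmp T (g X) (f X) = idn T X \<and>
  cmp T (f X) (g X) = idn T (r X) \<and> (X \<in> S --> r X = X \<and> f X = idn T X)" by metis
 have S: "ob X" if "X \<in> S" for X using that by (simp add: S_def)
 have "site U T S r f g"
  by (unfold_locales, unfold T_obj)
   (use * S small_skeleton small_hom_T in \<open>auto simp: S_def[symmetric] T_obj\<close>)
 then show ?thesis by blast
qed

text \<open>An embedding that reaches all nodes is invertible, and the empty list of pairs will
  do.\<close>

lemma surjective_descent:
 assumes f: "f \<in> hom T X Y" and onto: "nodes Y \<subseteq> fn f ` nodes X" shows "finite_descent f"
proof -
 obtain g where g: "g \<in> hom T Y X" "f \<odot> g = idn T Y" by (rule surjective_inverse[OF f onto])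
 have "\<exists>x\<in>onobj F X. act F f x = y" if F: "F \<in> obj E" and y: "y \<in> onobj F Y" for F y
  by (rule bexI[OF _ E_act[OF F g(1) y]])
   (use E_cmp[OF F g(1) f y] E_id[OF F hom_obj(2)[OF f] y] g(2) in metis)
 then show ?thesis unfolding finite_descent_def homD(2,3)[OF f] by (intro exI[of _ "{}"] conjI) blast+
qed

text \<open>If the equations in R imply those for every pair merged by f, the sheaf property
  supplies the preimage.\<close>

lemma finite_descentI:
 assumes f: "f \<in> hom T X Y" and R: "finite R" "\<And>g h. (g, h) \<in> R ==> \<exists>Z. g \<in> hom T Y Z \<and> h \<in> hom T Y Z \<and> g \<odot> f = h \<odot> f"
  and step: "\<And>F y Z g h. F \<in> obj E ==> y \<in> onobj F Y ==> (\<And>g h. (g, h) \<in> R ==> act F g y = act F h y) ==>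
   g \<in> hom T Y Z ==> h \<in> hom T Y Z ==> g \<odot> f = h \<odot> f ==> act F g y = act F h y"
 shows "finite_descent f"
 unfolding finite_descent_def homD(2,3)[OF f]
proof (rule exI[of _ R], intro conjI ballI impI)
 fix F y assume F: "F \<in> obj E" and y: "y \<in> onobj F Y" and eq: "\<forall>(g, h)\<in>R. act F g y = act F h y"
 obtain x where "x \<in> onobj F X" "act F f x = y"
  by (rule E_descent[OF F f y]) (rule step[OF F y], use eq in blast)
 then show "\<exists>x\<in>onobj F X. act F f x = y" by blast
qed (use R in auto)

text \<open>Two arrows that agree on the subtree without the caret differ at most by exchanging its two leaves.\<close>

lemma caret_descent:
 assumes X: "ob X" and A: "full_sub X A" and N: "nodes X \<subseteq> A \<union> kids X l" and l: "l \<in> A" and off: "kids X l \<inter> A = {}" "kids X l \<noteq> {}"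
 shows "finite_descent (incl X A)"
proof -
 interpret X: fbt X by (rule ob_fbt[OF X])
 note i = incl[OF X A]
 have "card (kids X l) = 2" using X.kids_card[of l] off(2) by blast
 then obtain u v where uv: "kids X l = {u, v}" "u \<noteq> v" by (meson card_2_iff)
 then have eu: "(l, u) \<in> edge X" and ev: "(l, v) \<in> edge X" by auto
 have uA: "u \<notin> A" "v \<notin> A" using uv off(1) by auto
 \<comment> \<open>The two new nodes are leaves: every edge of X starts in A.\<close>
 have src: "x \<in> A" if e: "(x, y) \<in> edge X" for x y
 proof (cases "y \<in> A")
  case False
  then have "(l, y) \<in> edge X" using N X.edge_nodes(2)[OF e] by blast
  then show ?thesis using X.parent_unique e l by blast
 qed (rule full_subD(3)[OF A e])
 \<comment> \<open>The automorphism exchanging the two new leaves, which together with the identity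
   is the universal pair.\<close>
 define sw where "sw x = (if x = u then v else if x = v then u else x)" for x
 have swA: "sw x = x" if "x \<in> A" for x using that uA by (auto simp: sw_def)
 have sw: "mk X sw X \<in> hom T X X"
 proof (rule mkI[OF X X])
  show "sw x \<in> nodes X" if "x \<in> nodes X" for x using that X.edge_nodes(2)[OF eu] X.edge_nodes(2)[OF ev] by (simp add: sw_def)
  show "inj_on sw (nodes X)" by (auto simp: inj_on_def sw_def split: if_splits)
  show "sw (root X) = root X" by (rule swA[OF full_subD(1)[OF A]])
  show "(sw x, sw y) \<in> edge X" if e: "(x, y) \<in> edge X" for x y
  proof -
   consider "y = u" | "y = v" | "sw y = y" unfolding sw_def by metis
   then have "(x, sw y) \<in> edge X"
   proof cases
    case 1
    then have "x = l" using X.parent_unique[OF e] eu by blast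
    then show ?thesis using 1 ev by (simp add: sw_def)
   next
    case 2
    then have "x = l" using X.parent_unique[OF e] ev by blast
    then show ?thesis using 2 uv(2) eu by (simp add: sw_def)
   qed (use e in simp)
   then show ?thesis unfolding swA[OF src[OF e]] .
  qed
  show "label X (sw \<circ> b) = label X b" if b: "b \<in> branches X" for b
  proof -
   have "sw \<circ> b = b" using swA[OF src[OF X.branch_edge[OF b]]] by auto
   then show ?thesis by simp
  qed
 qed
 have id: "idn T X \<in> hom T X X" by (rule idn_T_hom[OF X])
 show ?thesis
 proof (rule finite_descentI[OF i, of "{(idn T X, mk X sw X)}"])
  have "idn T X \<odot> incl X A = mk X sw X \<odot> incl X A"
  proof (rule fn_ext[OF cmp_hom[OF i id] cmp_hom[OF i sw]])
   fix x assume x: "x \<in> nodes (sub X A)"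
   then have "x \<in> A" "x \<in> nodes X" using full_subD(2)[OF A] by auto
   then show "fn (idn T X \<odot> incl X A) x = fn (mk X sw X \<odot> incl X A) x"
    unfolding fn_cmp[OF i x] by (simp add: swA)
  qed
  then show "\<exists>Z. g \<in> hom T X Z \<and> h \<in> hom T X Z \<and> g \<odot> incl X A = h \<odot> incl X A" if "(g, h) \<in> {(idn T X, mk X sw X)}" for g h
   using that id sw by blast
  fix F y Z g h assume F: "F \<in> obj E" and y: "y \<in> onobj F X"
   and R: "\<And>g h. (g, h) \<in> {(idn T X, mk X sw X)} ==> act F g y = act F h y"
   and g: "g \<in> hom T X Z" and h: "h \<in> hom T X Z" and eq: "g \<odot> incl X A = h \<odot> incl X A"
  interpret g: embedding X Z "fn g" by (rule T_homD(4)[OF g])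
  interpret h: embedding X Z "fn h" by (rule T_homD(4)[OF h])
  have gh: "fn g x = fn h x" if "x \<in> A" for x
   using arg_cong[OF eq, of "\<lambda>m. fn m x"] fn_cmp[OF i, of x] that by simp
  have "{fn g u, fn g v} = {fn h u, fn h v}"
   using g.kids_image[OF eu] h.kids_image[OF eu] gh[OF l] unfolding uv(1) by simp
  then consider "fn g u = fn h u" "fn g v = fn h v" | "fn g u = fn h v" "fn g v = fn h u" by (auto simp: doubleton_eq_iff)
  then show "act F g y = act F h y"
  proof cases
   case 1
   have "g = h"
   proof (rule fn_ext[OF g h])
    fix x assume "x \<in> nodes X"
    then have "x \<in> A \<or> x = u \<or> x = v" using N uv(1) by blast
    then show "fn g x = fn h x" using gh 1 by blast
   qed
   then show ?thesis by simp
  next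
   case 2
   have "h = g \<odot> mk X sw X"
   proof (rule fn_ext[OF h cmp_hom[OF sw g]])
    fix x assume x: "x \<in> nodes X"
    then have "x \<in> A \<or> x = u \<or> x = v" using N uv(1) by blast
    moreover have "fn h x = fn g (sw x)" if "x \<in> A" using swA[OF that] gh[OF that] by simp
    moreover have "sw u = v" "sw v = u" using uv(2) by (simp_all add: sw_def)
    ultimately have "fn h x = fn g (sw x)" using 2 by metis
    then show "fn h x = fn (g \<odot> mk X sw X) x" unfolding fn_cmp[OF sw x] fn_mk[OF x] .
   qed
   then have "act F h y = act F g (act F (mk X sw X) y)" using E_cmp[OF F sw g y] by simp
   also have "act F (mk X sw X) y = y" using R[of "idn T X" "mk X sw X"] E_id[OF F hom_obj(1)[OF sw] y] by simp
   finally show ?thesis ..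
  qed
 qed simp
qed

end

text \<open>Adding one branch \<open>b\<close>, all of whose siblings are leaves: arrows that agree on \<open>A\<close> but not at the first new
 node \<open>b n\<close> overlap in a way that does not depend on the arrows, hence they factor through the universal such pair.\<close>

locale comb = tree_site U I e for U :: "'u itself" and I e +
 fixes X A b n
 assumes X: "ob X" and A: "full_sub X A" and b: "b \<in> branches X" and N: "nodes X \<subseteq> A \<union> (\<Union>m. kids X (b m))"
  and b_in: "b n \<in> A" and b_out: "b (Suc n) \<notin> A"
begin

sublocale X: fbt X by (rule ob_fbt[OF X])

lemma b_mem: "b m \<in> A \<longleftrightarrow> m \<le> n"
proof
 show "m \<le> n" if "b m \<in> A" using X.full_sub_branch[OF A b b_out, of m] that by (meson not_less_eq_eq)
 show "b m \<in> A" if "m \<le> n" using X.full_sub_branch[OF A b, of m n] b_in that by blast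
qed

lemma new_node: assumes "y \<in> nodes X" "y \<notin> A" obtains m where "(b m, y) \<in> edge X" "m \<ge> n"
proof -
 obtain m where m: "(b m, y) \<in> edge X" using assms N by blast
 have "n \<le> m"
 proof (rule ccontr)
  assume "\<not> n \<le> m"
  then have "b (Suc m) \<in> A" by (simp add: b_mem)
  then show False using full_subD(4)[OF A X.branch_edge[OF b] _ m] assms(2) by blast
 qed
 with m show thesis by (rule that)
qed

lemma ex_sibling: "\<exists>c. kids X (b n) = {b (Suc n), c} \<and> c \<noteq> b (Suc n)"
proof -
 have 1: "b (Suc n) \<in> kids X (b n)" using X.branch_edge[OF b] by simp
 then have "card (kids X (b n)) = 2" using X.kids_card[of "b n"] by auto
 then obtain u v where "kids X (b n) = {u, v}" "u \<noteq> v" by (meson card_2_iff)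
 then show ?thesis using 1 by auto
qed

definition c where "c = (SOME c. kids X (b n) = {b (Suc n), c} \<and> c \<noteq> b (Suc n))"

lemma kids_b: "kids X (b n) = {b (Suc n), c}" and c_neq: "c \<noteq> b (Suc n)"
 using someI_ex[OF ex_sibling] unfolding c_def by blast+

lemma edge_c: "(b n, c) \<in> edge X" using kids_b by blast

lemma c_out: "c \<notin> A" using full_subD(4)[OF A edge_c _ X.branch_edge[OF b]] b_out by blast

lemma no_kids_c: "(c, y) \<notin> edge X"
proof
 assume e: "(c, y) \<in> edge X"
 then have "y \<notin> A" using full_subD(3)[OF A] c_out by blast
 then obtain m where m: "(b m, y) \<in> edge X" by (rule new_node[OF X.edge_nodes(2)[OF e]])
 then have c: "c = b m" using X.parent_unique e by blast
 have "m = Suc n" using X.depth_edge[OF edge_c] X.depth_branch[OF b] c by simp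
 then show False using c c_neq by simp
qed

definition overlap where "overlap x y \<longleftrightarrow> (x = y \<and> x \<in> A) \<or> (x = b (Suc n) \<and> y = c) \<or> (x = c \<and> y = b (Suc n))"

text \<open>Arrows that agree at \<open>b n\<close> but not at the next node must exchange its two
  children. From there on, the branch of each copy continues where the other copy has the leaf c, so
  no further nodes coincide.\<close>

lemma overlap_iff:
 assumes g: "embedding X V g" and h: "embedding X V h" and agree: "\<And>x. x \<in> A ==> g x = h x"
  and div: "g (b (Suc n)) \<noteq> h (b (Suc n))" and x: "x \<in> nodes X" and y: "y \<in> nodes X"
 shows "g x = h y \<longleftrightarrow> overlap x y"
proof -
 interpret g: embedding X V g by fact
 interpret h: embedding X V h by fact
 have "{g (b (Suc n)), g c} = {h (b (Suc n)), h c}"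
  using g.kids_image[OF edge_c] h.kids_image[OF edge_c] agree[OF b_in] unfolding kids_b by simp
 then have sw: "g (b (Suc n)) = h c" "g c = h (b (Suc n))" using div by (auto simp: doubleton_eq_iff)
 have "overlap x y" if "g x = h y" using x y that
 proof (induction arbitrary: y rule: X.tree_induct)
  case root
  then have "h (root X) = h y" using agree[OF full_subD(1)[OF A]] by simp
  then have "root X = y" by (rule inj_onD[OF h.inj _ X.root_node root(1)])
  then show ?case using full_subD(1)[OF A] by (simp add: overlap_def)
 next
  case (edge x0 x)
  show ?case
  proof (cases "x \<in> A \<or> y \<in> A")
   case True
   then have "x = y"
   proof
    assume "x \<in> A"
    then have "h x = h y" using agree edge.prems(2) by simp
    then show ?thesis by (rule inj_onD[OF h.inj _ X.edge_nodes(2)[OF edge.hyps] edge.prems(1)])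
   next
    assume "y \<in> A"
    then have "g x = g y" using agree edge.prems(2) by simp
    then show ?thesis by (rule inj_onD[OF g.inj _ X.edge_nodes(2)[OF edge.hyps] edge.prems(1)])
   qed
   then show ?thesis using True by (auto simp: overlap_def)
  next
   case False
   have "(g x0, h y) \<in> edge V" using g.edge[OF edge.hyps] edge.prems(2) by simp
   then obtain y0 where y0: "(y0, y) \<in> edge X" "g x0 = h y0" by (rule h.parent[OF edge.prems(1)])
   from edge.IH[OF X.edge_nodes(1)[OF y0(1)] y0(2)] consider "x0 = y0" "x0 \<in> A" | "y0 = c" | "x0 = c"
    unfolding overlap_def by blast
   then show ?thesis
   proof cases
    case 1
    obtain m where m: "(b m, x) \<in> edge X" "m \<ge> n" using new_node[OF X.edge_nodes(2)[OF edge.hyps]] False by blast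
    have "x0 = b m" using X.parent_unique[OF edge.hyps m(1)] .
    then have "x0 = b n" using 1 m(2) b_mem by (metis le_antisym)
    then have "x \<in> {b (Suc n), c}" "y \<in> {b (Suc n), c}" using edge.hyps y0(1) 1(1) kids_b by blast+
    then show ?thesis using edge.prems(2) div sw by (auto simp: overlap_def)
   qed (use no_kids_c y0(1) edge.hyps in auto)
  qed
 qed
 moreover have "g x = h y" if "overlap x y" using that sw agree unfolding overlap_def by auto
 ultimately show ?thesis by blast
qed

text \<open>The universal pair is the union of X with itself, sides being flipped outside A in the
  second copy. Any diverging pair overlaps in the same way and so factors through it by
  \<open>joint_factor\<close>. A pair that agrees at the first new node is compared twice, with an
  arrow that diverges from both members.\<close>

lemma descent: "finite_descent (incl X A)"
proof -
 note i = incl[OF X A]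
 interpret i: embedding "sub X A" X "fn (incl X A)" by (rule T_homD(4)[OF i])
 obtain s where s: "sides X s" using X.ex_sides by blast
 define s' where "s' y = (if y \<in> A then s y else \<not> s y)" for y
 have s': "sides X s'" by (rule X.sides_flip[OF A s]) (auto simp: s'_def)
 have codeA: "code X s a = code X s' a" if "a \<in> A" for a
  using code_eq[OF i.embedding_axioms i.embedding_axioms, of s s' a] that by (simp add: s'_def)
 \<comment> \<open>New nodes hang on b, so b is the only branch that leaves A.\<close>
 have out: "d = b" if d: "d \<in> branches X" and m: "d m \<notin> A" for d m
 proof
  fix k
  have up: "d j = b j" if j: "j \<ge> m" for j
  proof -
   have "d (Suc j) \<notin> A" by (rule X.full_sub_branch[OF A d m]) (use j in simp)
   then obtain k where k: "(b k, d (Suc j)) \<in> edge X" by (rule new_node[OF X.branch_node[OF d]])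
   have dj: "d j = b k" by (rule X.branch_parent[OF d k, symmetric])
   then have "j = k" using X.depth_branch[OF d, of j] X.depth_branch[OF b, of k] by simp
   then show ?thesis using dj by simp
  qed
  \<comment> \<open>Agreement far out is carried back towards the root, as parents are
    unique.\<close>
  have "d (m + j - i) = b (m + j - i)" for i j
  proof (induction i)
   case 0 show ?case using up[of "m + j"] by simp
  next
   case (Suc i)
   show ?case
   proof (cases "m + j - i")
    case (Suc k)
    then have "(d k, b (Suc k)) \<in> edge X" using X.branch_edge[OF d, of k] Suc.IH by simp
    then have "d k = b k" by (rule X.branch_parent[OF b])
    moreover have "m + j - Suc i = k" using Suc by simp
    ultimately show ?thesis by simp
   qed (use Suc.IH in simp)
  qed
  from this[of k m] show "d k = b k" by simp
 qed
 \<comment> \<open>If d' leaves A then it is b, and d shares its path up to \<open>b n\<close>; so d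
   leaves A as well and equals b, but the flip makes the next sides differ. Only branches inside A
   are identified.\<close>
 have lab: "label X d = label X d'" if d: "d \<in> branches X" "d' \<in> branches X" "bcode s d = bcode s' d'" for d d'
 proof (cases "\<forall>k. d' k \<in> A")
  case True
  then have "bcode s d' = bcode s' d'" by (simp add: bcode_def s'_def fun_eq_iff)
  then show ?thesis using X.bcode_inj[OF s d(1,2)] d(3) by simp
 next
  case False
  then have d': "d' = b" using out[OF d(2)] by blast
  have eq: "s (d (Suc k)) = s' (b (Suc k))" for k using fun_cong[OF d(3), of k] d' by (simp add: bcode_def)
  have "map (bcode s d) [0..<n] = map (bcode s b) [0..<n]"
   using eq b_mem by (auto simp: bcode_def s'_def)
  then have "code X s (d n) = code X s (b n)" unfolding X.code_branch[OF d(1)] X.code_branch[OF b] .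
  then have dn: "d n = b n" by (rule inj_onD[OF X.code_inj[OF s] _ X.branch_node[OF d(1)] X.branch_node[OF b]])
  then have "(b n, d (Suc n)) \<in> edge X" using X.branch_edge[OF d(1), of n] by simp
  then have "d (Suc n) \<notin> A" using full_subD(4)[OF A _ _ X.branch_edge[OF b]] b_out by blast
  then have "d = b" by (rule out[OF d(1)])
  then show ?thesis using eq[of n] b_out by (simp add: s'_def)
 qed
 obtain W where W: "ob W" "itree_embedding X W (restrict (e \<circ> code X s) (nodes X))"
  "itree_embedding X W (restrict (e \<circ> code X s') (nodes X))" "nodes W = e ` code X s ` nodes X \<union> e ` code X s' ` nodes X"
  by (rule union_tree[OF X X s s' lab])
 define g0 where "g0 = mk X (e \<circ> code X s) W"
 define h0 where "h0 = mk X (e \<circ> code X s') W"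
 have g0: "g0 \<in> hom T X W" and h0: "h0 \<in> hom T X W" using X W by (simp_all add: g0_def h0_def T_hom mk_def)
 have fg: "fn g0 x = e (code X s x)" "fn h0 x = e (code X s' x)" if "x \<in> nodes X" for x using that by (simp_all add: g0_def h0_def)
 have AN: "x \<in> nodes X" if "x \<in> A" for x using full_subD(2)[OF A] that by blast
 have agree0: "fn g0 x = fn h0 x" if "x \<in> A" for x using fg[OF AN[OF that]] codeA[OF that] by simp
 have eqA: "g \<odot> incl X A = h \<odot> incl X A \<longleftrightarrow> (\<forall>x\<in>A. fn g x = fn h x)" if g: "g \<in> hom T X V" and h: "h \<in> hom T X V" for g h V
 proof
  assume eq: "g \<odot> incl X A = h \<odot> incl X A"
  show "\<forall>x\<in>A. fn g x = fn h x"
  proof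
   fix x assume "x \<in> A"
   then show "fn g x = fn h x" using arg_cong[OF eq, of "\<lambda>m. fn m x"] fn_cmp[OF i, of x] by simp
  qed
 next
  assume "\<forall>x\<in>A. fn g x = fn h x"
  then show "g \<odot> incl X A = h \<odot> incl X A"
   by (intro fn_ext[OF cmp_hom[OF i g] cmp_hom[OF i h]]) (simp add: fn_cmp[OF i])
 qed
 define b1 where "b1 = b (Suc n)"
 have b1: "b1 \<in> nodes X" "b1 \<notin> A" "(b n, b1) \<in> edge X" unfolding b1_def by (rule X.branch_node[OF b], rule b_out, rule X.branch_edge[OF b])
 have "code X s b1 \<noteq> code X s' b1" using X.code_edge[OF b1(3)] b1(2) by (simp add: s'_def)
 then have div0: "fn g0 b1 \<noteq> fn h0 b1" unfolding fg[OF b1(1)] using injD[OF e] by blast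
 note emb0 = T_homD(4)[OF g0] T_homD(4)[OF h0]
 show ?thesis
 proof (rule finite_descentI[OF i, of "{(g0, h0)}"])
  show "\<exists>Z. g \<in> hom T X Z \<and> h \<in> hom T X Z \<and> g \<odot> incl X A = h \<odot> incl X A" if "(g, h) \<in> {(g0, h0)}" for g h
   using that g0 h0 eqA[OF g0 h0] agree0 by blast
  fix F y assume F: "F \<in> obj E" and y: "y \<in> onobj F X" and R: "\<And>g h. (g, h) \<in> {(g0, h0)} ==> act F g y = act F h y"
  have div: "act F g y = act F h y"
   if g: "g \<in> hom T X V" and h: "h \<in> hom T X V" and agree: "\<And>x. x \<in> A ==> fn g x = fn h x" and ne: "fn g b1 \<noteq> fn h b1" for g h V
  proof -
   obtain w where w: "w \<in> hom T W V" "w \<odot> g0 = g" "w \<odot> h0 = h"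
   proof (rule joint_factor[OF g0 h0 _ g h])
    show "nodes W \<subseteq> fn g0 ` nodes X \<union> fn h0 ` nodes X" unfolding W(4) image_image using fg by auto
    show "fn g0 x = fn h0 y \<longleftrightarrow> fn g x = fn h y" if that: "x \<in> nodes X" "y \<in> nodes X" for x y
    proof -
     have "fn g0 x = fn h0 y \<longleftrightarrow> overlap x y" by (rule overlap_iff[OF emb0 agree0 div0[unfolded b1_def] that])
     moreover have "fn g x = fn h y \<longleftrightarrow> overlap x y"
      by (rule overlap_iff[OF T_homD(4)[OF g] T_homD(4)[OF h] agree ne[unfolded b1_def] that])
     ultimately show ?thesis by blast
    qed
   qed
   show ?thesis using E_cmp[OF F g0 w(1) y] E_cmp[OF F h0 w(1) y] R[of g0 h0] w(2,3) by simp
  qed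
  fix V g h assume g: "g \<in> hom T X V" and h: "h \<in> hom T X V" and eq: "g \<odot> incl X A = h \<odot> incl X A"
  have agree: "fn g x = fn h x" if "x \<in> A" for x using eqA[OF g h] eq that by blast
  show "act F g y = act F h y"
  proof (cases "fn g b1 = fn h b1")
   case True
   interpret g: embedding X V "fn g" by (rule T_homD(4)[OF g])
   obtain sV where sV: "sides V sV" using g.Y.ex_sides by blast
   \<comment> \<open>The opposite of the sides met along g, outside A. Amalgamating X with V over A
     for these sides yields m, which diverges at \<open>b1\<close> from g followed by k, and hence
     also from h followed by k.\<close>
   define sB where "sB y = (if y \<in> A then sV (fn g y) else \<not> sV (fn g y))" for y
   have sB: "sides X sB" by (rule X.sides_flip[OF A g.pull_sides[OF sV]]) (auto simp: sB_def)
   obtain V' m k where m: "m \<in> hom T X V'" and k: "k \<in> hom T V V'" and mk: "m \<odot> incl X A = k \<odot> (g \<odot> incl X A)"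
    and code: "\<And>x y. x \<in> nodes X ==> y \<in> nodes V ==> depth X x \<le> depth X b1 ==> fn m x = fn k y ==> code X sB x = code V sV y"
    by (rule amalgam_hom[OF i cmp_hom[OF i g] sB sV, where d = "depth X b1"]) (auto simp: fn_cmp[OF i] sB_def)
   have kg: "k \<odot> g \<in> hom T X V'" and kh: "k \<odot> h \<in> hom T X V'" by (rule cmp_hom[OF g k], rule cmp_hom[OF h k])
   have "m \<odot> incl X A = (k \<odot> g) \<odot> incl X A" using mk assoc[OF i g k] by simp
   then have 1: "fn m x = fn (k \<odot> g) x" if "x \<in> A" for x using eqA[OF m kg] that by blast
   then have 2: "fn m x = fn (k \<odot> h) x" if "x \<in> A" for x using that agree fn_cmp[OF g AN[OF that]] fn_cmp[OF h AN[OF that]] by simp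
   have "fn m b1 \<noteq> fn k (fn g b1)"
   proof
    assume "fn m b1 = fn k (fn g b1)"
    from code[OF b1(1) g.node[OF b1(1)] order_refl this] have "code X sB b1 = code V sV (fn g b1)" .
    then show False using X.code_edge[OF b1(3)] g.Y.code_edge[OF g.edge[OF b1(3)]] b1(2) by (simp add: sB_def)
   qed
   then have "fn m b1 \<noteq> fn (k \<odot> g) b1" "fn m b1 \<noteq> fn (k \<odot> h) b1" using fn_cmp[OF g b1(1)] fn_cmp[OF h b1(1)] True by simp_all
   then have "act F (k \<odot> g) y = act F (k \<odot> h) y" using div[OF m kg 1] div[OF m kh 2] by metis
   then have "act F k (act F g y) = act F k (act F h y)" using E_cmp[OF F g k y] E_cmp[OF F h k y] by simp
   then show ?thesis by (rule E_inj[OF F k E_act[OF F g y] E_act[OF F h y]])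
  qed (rule div[OF g h agree])
 qed simp
qed

end

context tree_site
begin

lemma incl_descent_step:
 assumes X: "ob X" and A: "full_sub X A" and B: "full_sub X B" and AB: "A \<subseteq> B"
  and 1: "finite_descent (incl (sub X B) A)" and 2: "finite_descent (incl X B)"
 shows "finite_descent (incl X A)"
proof -
 note iB = incl[OF X B]
 have iA: "incl (sub X B) A \<in> hom T (sub X A) (sub X B)"
  using incl[OF sub_ob[OF X B] full_sub_sub[OF A AB]] unfolding sub_sub[OF AB] .
 have "incl X B \<odot> incl (sub X B) A = incl X A"
  by (rule fn_ext[OF cmp_hom[OF iA iB] incl[OF X A]]) (use AB in \<open>auto simp: fn_cmp[OF iA]\<close>)
 then show ?thesis using finite_descent_cmp[OF iA iB 1 2] by simp
qed

text \<open>Induction on the number of missing nodes. A missing node of least depth has its parent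
  in A, and adding all children of that parent is a caret step.\<close>

lemma cofinite_descent:
 assumes X: "ob X" and A: "full_sub X A" and fin: "finite (nodes X - A)" shows "finite_descent (incl X A)"
 using A fin
proof (induction "card (nodes X - A)" arbitrary: A rule: less_induct)
 case less
 interpret X: fbt X by (rule ob_fbt[OF X])
 note A = less.prems(1)
 show ?case
 proof (cases "nodes X \<subseteq> A")
  case True
  show ?thesis by (rule surjective_descent[OF incl[OF X A]]) (use True in force)
 next
  case False
  then obtain y0 where y0: "y0 \<in> nodes X - A" by blast
  have "is_arg_min (depth X) (\<lambda>y. y \<in> nodes X - A) (arg_min (depth X) (\<lambda>y. y \<in> nodes X - A))"
   by (rule is_arg_min_arg_min_nat[of "\<lambda>y. y \<in> nodes X - A", OF y0])
  then obtain y where y: "y \<in> nodes X" "y \<notin> A" and min: "\<And>z. z \<in> nodes X - A ==> \<not> depth X z < depth X y"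
   unfolding is_arg_min_def by blast
  have "y \<noteq> root X" using y full_subD(1)[OF A] by blast
  then obtain l where l: "(l, y) \<in> edge X" using X.parent_ex y by blast
  have lA: "l \<in> A" using min[of l] X.depth_edge[OF l] X.edge_nodes(1)[OF l] by auto
  have off: "kids X l \<inter> A = {}" using full_subD(4)[OF A _ _ l] y(2) by blast
  define B where "B = A \<union> kids X l"
  have AB: "A \<subseteq> B" by (simp add: B_def)
  have B: "full_sub X B"
   unfolding full_sub_def
  proof (intro conjI allI impI)
   show "root X \<in> B" using full_subD(1)[OF A] AB by blast
   show "B \<subseteq> nodes X" using full_subD(2)[OF A] X.edge_nodes(2) unfolding B_def by blast
   fix x z assume xz: "(x, z) \<in> edge X" "z \<in> B"
   then consider "z \<in> A" | "(l, z) \<in> edge X" unfolding B_def by blast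
   then show "x \<in> B"
   proof cases
    case 1 then show ?thesis using full_subD(3)[OF A xz(1)] AB by blast
   next
    case 2 then show ?thesis using X.parent_unique[OF xz(1)] lA AB by blast
   qed
   show "kids X x \<subseteq> B"
   proof (cases "z \<in> A")
    case True then show ?thesis using full_subD(4)[OF A xz(1)] AB by blast
   next
    case False
    then have "(l, z) \<in> edge X" using xz(2) unfolding B_def by blast
    then have "x = l" using X.parent_unique[OF xz(1)] by blast
    then show ?thesis unfolding B_def by blast
   qed
  qed
  have "nodes X - B \<subset> nodes X - A" using y l unfolding B_def by blast
  then have "card (nodes X - B) < card (nodes X - A)" by (rule psubset_card_mono[OF less.prems(2)])
  moreover have "finite (nodes X - B)" by (rule finite_subset[OF _ less.prems(2)]) (use AB in blast)
  ultimately have 2: "finite_descent (incl X B)" using less.hyps B by blast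
  have "finite_descent (incl (sub X B) A)"
  proof (rule caret_descent[OF sub_ob[OF X B] full_sub_sub[OF A AB] _ lA])
   have "kids (sub X B) l = kids X l" unfolding B_def by auto
   then show "nodes (sub X B) \<subseteq> A \<union> kids (sub X B) l" "kids (sub X B) l \<inter> A = {}" "kids (sub X B) l \<noteq> {}"
    using off l by (auto simp: B_def)
  qed
  from incl_descent_step[OF X A B AB this 2] show ?thesis .
 qed
qed

text \<open>Induction on the number of branches that leave A, adding one of them with its siblings
  each time. When none is left, the parent of a missing node lies on no branch, so only finitely
  many nodes are missing by finitarity.\<close>

lemma incl_descent:
 assumes X: "ob X" and A: "full_sub X A" shows "finite_descent (incl X A)"
 using A
proof (induction "card {b \<in> branches X. \<not> range b \<subseteq> A}" arbitrary: A rule: less_induct)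
 case less
 interpret X: fbt X by (rule ob_fbt[OF X])
 note A = less.prems
 show ?case
 proof (cases "{b \<in> branches X. \<not> range b \<subseteq> A} = {}")
  case True
  have "nodes X - A \<subseteq> {y \<in> nodes X. \<exists>x. (x, y) \<in> edge X \<and> \<not> (\<exists>b\<in>branches X. x \<in> range b)}"
  proof
   fix y assume y: "y \<in> nodes X - A"
   then have "y \<noteq> root X" using full_subD(1)[OF A] by blast
   then obtain x where x: "(x, y) \<in> edge X" using X.parent_ex y by blast
   have "\<not> (\<exists>b\<in>branches X. x \<in> range b)"
   proof
    assume "\<exists>b\<in>branches X. x \<in> range b"
    then obtain b m where b: "b \<in> branches X" "x = b m" by blast
    then have "b (Suc m) \<in> A" using True by blast
    then show False using full_subD(4)[OF A X.branch_edge[OF b(1)] _ x[unfolded b(2)]] y by blast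
   qed
   with x y show "y \<in> {y \<in> nodes X. \<exists>x. (x, y) \<in> edge X \<and> \<not> (\<exists>b\<in>branches X. x \<in> range b)}"
    by (intro CollectI conjI exI[of _ x]) blast+
  qed
  then have "finite (nodes X - A)"
   by (rule finite_subset) (rule X[unfolded ob_def finitary_def, THEN conjunct2, THEN conjunct2, THEN conjunct1])
  then show ?thesis by (rule cofinite_descent[OF X A])
 next
  case False
  then obtain b where b: "b \<in> branches X" "\<not> range b \<subseteq> A" by blast
  define B where "B = A \<union> (\<Union>m. kids X (b m))"
  have AB: "A \<subseteq> B" by (simp add: B_def)
  have bB: "b m \<in> B" for m
  proof (cases m)
   case 0 then show ?thesis using X.branch_root[OF b(1)] full_subD(1)[OF A] AB by auto
  next
   case (Suc k) then show ?thesis using X.branch_edge[OF b(1), of k] unfolding B_def by blast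
  qed
  have B: "full_sub X B"
   unfolding full_sub_def
  proof (intro conjI allI impI)
   show "root X \<in> B" using full_subD(1)[OF A] AB by blast
   show "B \<subseteq> nodes X" using full_subD(2)[OF A] X.edge_nodes(2) unfolding B_def by blast
   fix x z assume xz: "(x, z) \<in> edge X" "z \<in> B"
   then consider "z \<in> A" | m where "(b m, z) \<in> edge X" unfolding B_def by blast
   then have "(x \<in> B) \<and> kids X x \<subseteq> B"
   proof cases
    case 1 then show ?thesis using full_subD(3,4)[OF A xz(1)] AB by blast
   next
    case 2
    then have "x = b m" using X.parent_unique[OF xz(1)] by blast
    then show ?thesis using bB unfolding B_def by blast
   qed
   then show "x \<in> B" "kids X x \<subseteq> B" by blast+
  qed
  have "{b \<in> branches X. \<not> range b \<subseteq> B} \<subset> {b \<in> branches X. \<not> range b \<subseteq> A}" using AB b bB by blast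
  then have "card {b \<in> branches X. \<not> range b \<subseteq> B} < card {b \<in> branches X. \<not> range b \<subseteq> A}"
   by (rule psubset_card_mono[rotated]) (rule finite_subset[OF _ ob_finite[OF X]], blast)
  then have 2: "finite_descent (incl X B)" using less.hyps B by blast
  obtain k where k: "b k \<notin> A" using b(2) by blast
  \<comment> \<open>The first index at which b is outside A; it is not 0, because the root belongs
    to A.\<close>
  define n where "n = (LEAST k. b k \<notin> A)"
  have n: "b n \<notin> A" unfolding n_def using k by (rule LeastI)
  have "n \<noteq> 0" using n X.branch_root[OF b(1)] full_subD(1)[OF A] by metis
  then obtain n' where n': "n = Suc n'" by (cases n) auto
  have "b n' \<in> A" using not_less_Least[of n' "\<lambda>k. b k \<notin> A"] n' unfolding n_def by auto
  have bs: "b \<in> branches (sub X B)" unfolding sub_branches[OF B] using b(1) bB by blast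
  have "kids (sub X B) (b m) = kids X (b m)" for m unfolding B_def by auto
  then have N: "nodes (sub X B) \<subseteq> A \<union> (\<Union>m. kids (sub X B) (b m))" by (simp add: B_def)
  note step = incl_descent_step[OF X A B AB _ 2]
  interpret comb U I e "sub X B" A b n'
   by (intro comb.intro tree_site_axioms comb_axioms.intro sub_ob[OF X B] full_sub_sub[OF A AB] bs N)
    (use n n' \<open>b n' \<in> A\<close> in simp_all)
  show ?thesis by (rule step[OF descent])
 qed
qed

text \<open>An embedding is an isomorphism onto its range followed by an inclusion.\<close>

lemma descent_T:
 assumes f: "f \<in> hom T Z X" shows "finite_descent f"
proof -
 interpret f: embedding Z X "fn f" by (rule T_homD(4)[OF f])
 note X = T_homD(2)[OF f] and A = f.full_sub_range
 note i = incl[OF X A]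
 obtain f' where f': "f' \<in> hom T Z (sub X (fn f ` nodes Z))" "incl X (fn f ` nodes Z) \<odot> f' = f"
  by (rule factor[OF f i]) force
 have "finite_descent f'"
 proof (rule surjective_descent[OF f'(1)], rule subsetI)
  fix y assume "y \<in> nodes (sub X (fn f ` nodes Z))"
  then obtain z where z: "z \<in> nodes Z" "y = fn f z" by auto
  have "fn f' z \<in> fn f ` nodes Z" using fn_node[OF f'(1) z(1)] by simp
  then have "fn f' z = fn f z" using arg_cong[OF f'(2), of "\<lambda>m. fn m z"] fn_cmp[OF f'(1) z(1)] by simp
  then show "y \<in> fn f' ` nodes Z" using z by (intro image_eqI[of _ _ z]) simp_all
 qed
 from finite_descent_cmp[OF f'(1) i this incl_descent[OF X A]] show ?thesis unfolding f'(2) .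
qed

lemma finitary_site_T:
 assumes "site U T S r \<phi> \<psi>" shows "finitary_site U T S r \<phi> \<psi> T0"
proof -
 interpret site U T S r \<phi> \<psi> by fact
 show ?thesis
  by unfold_locales (simp only: T_obj T0_ob, rule T0_initial, simp only: T_obj, rule descent_T)
qed

lemma subcanonical_site_T:
 assumes "site U T S r \<phi> \<psi>" shows "subcanonical_site U T S r \<phi> \<psi>"
proof -
 interpret site U T S r \<phi> \<psi> by fact
 show ?thesis by unfold_locales (fact mono_T, fact subcanonical_T)
qed

end

section \<open>The bound on the number of labels forced by a point\<close>

section \<open>Labels as branches of a completed tree\<close>

lemma lepoll_sequences: "(UNIV :: (nat => 'x :: countable) set) \<lesssim> (UNIV :: nat set set)"
 unfolding lepoll_def
proof (intro exI conjI)
 show "inj (\<lambda>f :: nat => 'x. range (\<lambda>n. to_nat (n, f n)))"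
 proof (intro injI ext)
  fix f g :: "nat => 'x" and n assume eq: "range (\<lambda>n. to_nat (n, f n)) = range (\<lambda>n. to_nat (n, g n))"
  have "to_nat (n, f n) \<in> range (\<lambda>n. to_nat (n, g n))" unfolding eq[symmetric] by (rule rangeI)
  then show "f n = g n" by auto
 qed
qed simp

context trees
begin

text \<open>A single branch with a leaf at each of its nodes, the simplest tree in which the label i
  occurs.\<close>

definition comb_tree :: "'u => 'u itree" where
 "comb_tree i = can e ({replicate n False |n. True} \<union> {replicate n False @ [True] |n. True}) (\<lambda>_. Some i)"

abbreviation spine :: "nat => 'u" where "spine n \<equiv> e (replicate n False)"

lemma comb_tree:
 assumes i: "i \<in> I"
 shows "ob (comb_tree i)" "spine \<in> branches (comb_tree i)" "label (comb_tree i) spine = Some i"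
proof -
 let ?N = "{replicate n False |n. True} \<union> {replicate n False @ [True] |n. True}"
 have rep: "map (\<lambda>_. False) [0..<n] = replicate n False" for n by (simp add: map_replicate_const)
 have pre: "\<exists>n. xs = replicate n False" if "xs @ [b] \<in> ?N" for xs b
 proof -
  from that consider n where "xs @ [b] = replicate n False" | n where "xs @ [b] = replicate n False @ [True]" by blast
  then show ?thesis
  proof cases
   case 1
   then have "xs = take (length xs) (replicate n False)" by (metis append_eq_conv_conj)
   then show ?thesis by (metis take_replicate)
  qed auto
 qed
 have N: "tree_set ?N"
  unfolding tree_set_def
 proof (intro conjI allI impI)
  show "[] \<in> ?N" by (intro UnI1 CollectI exI[of _ 0]) simp
  fix xs b assume "xs @ [b] \<in> ?N"
  then obtain n where n: "xs = replicate n False" using pre by blast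
  then show "xs \<in> ?N" by blast
  show "xs @ [\<not> b] \<in> ?N"
  proof (cases b)
   case True
   then have "xs @ [\<not> b] = replicate (Suc n) False" by (simp add: n replicate_append_same)
   then show ?thesis by blast
  qed (use n in auto)
 qed
 have ends: "ends ?N = {\<lambda>_. False}"
 proof (rule set_eqI, rule iffI)
  fix sg assume sg: "sg \<in> ends ?N"
  have "sg n = False" for n
  proof -
   have "map sg [0..<Suc (Suc n)] \<in> ?N" using sg unfolding ends_def by blast
   then have "map sg [0..<Suc n] @ [sg (Suc n)] \<in> ?N" by simp
   then obtain m where m: "map sg [0..<Suc n] = replicate m False" using pre by blast
   have "sg n \<in> set (map sg [0..<Suc n])" by auto
   then show ?thesis unfolding m by auto
  qed
  then show "sg \<in> {\<lambda>_. False}" by auto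
 next
  fix sg :: "nat => bool" assume "sg \<in> {\<lambda>_. False}"
  then have "map sg [0..<n] = replicate n False" for n using rep by simp
  then show "sg \<in> ends ?N" unfolding ends_def by blast
 qed
 show ob: "ob (comb_tree i)"
  unfolding ob_def comb_tree_def
 proof (rule can_obj[OF e N])
  have "{xs @ [b] |xs b. xs @ [b] \<in> ?N \<and> \<not> (\<exists>sg\<in>ends ?N. \<exists>n. xs = map sg [0..<n])} = {}"
   unfolding ends using pre rep by fastforce
  then show "finite {xs @ [b] |xs b. xs @ [b] \<in> ?N \<and> \<not> (\<exists>sg\<in>ends ?N. \<exists>n. xs = map sg [0..<n])}" by (simp only: finite.emptyI)
  show "finite (ends ?N)" unfolding ends by simp
  show "\<exists>j\<in>I. Some i = Some j" using i by blast
 qed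
 have "(\<lambda>_. False) \<in> ends ?N" unfolding ends by simp
 from can_label[OF e this, of "\<lambda>_. Some i"] show l: "label (comb_tree i) spine = Some i"
  unfolding rep comb_tree_def .
 then have "spine \<in> Map.dom (label (comb_tree i))" by blast
 then show "spine \<in> branches (comb_tree i)" using ob unfolding ob_def is_itree_def by blast
qed

definition level_tree :: "nat => 'u itree" where "level_tree n = can e {xs. length xs \<le> n} (\<lambda>_. None)"

lemma level_tree: "ob (level_tree n)"
 unfolding ob_def level_tree_def
proof (rule can_obj[OF e])
 show "tree_set {xs. length xs \<le> n}" by (simp add: tree_set_def)
 have ends: "ends {xs. length xs \<le> n} = {}"
 proof (rule equals0I)
  fix sg assume "sg \<in> ends {xs. length xs \<le> n}"
  then have "map sg [0..<Suc n] \<in> {xs. length xs \<le> n}" unfolding ends_def by blast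
  then show False by simp
 qed
 show "finite (ends {xs. length xs \<le> n})" unfolding ends by simp
 show "\<exists>i\<in>I. None = Some i" if "sg \<in> ends {xs. length xs \<le> n}" for sg using that unfolding ends by blast
 have "finite {xs :: bool list. set xs \<subseteq> UNIV \<and> length xs \<le> n}" by (rule finite_lists_length_le) simp
 then show "finite {xs @ [b] |xs b. xs @ [b] \<in> {xs. length xs \<le> n} \<and> \<not> (\<exists>sg\<in>ends {xs. length xs \<le> n}. \<exists>n. xs = map sg [0..<n])}"
  by (rule rev_finite_subset) auto
qed

text \<open>An embedding maps the children of an inner node onto all children of its image, so the
  complete tree of height n reaches every node of depth at most n.\<close>

lemma level_tree_cover:
 assumes v: "v \<in> hom T (level_tree n) Z" and z: "z \<in> nodes Z" and d: "depth Z z \<le> n"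
 obtains xs where "length xs \<le> n" "z = fn v (e xs)"
proof -
 interpret v: embedding "level_tree n" Z "fn v" by (rule T_homD(4)[OF v])
 have "\<exists>xs. length xs = depth Z z \<and> z = fn v (e xs)" using z d
 proof (induction rule: v.Y.tree_induct)
  case root
  have "root Z = fn v (e [])" using v.root by (simp add: level_tree_def can_def)
  then show ?case using v.Y.depth_root by (intro exI[of _ "[]"]) simp
 next
  case (edge x y)
  have dy: "depth Z y = Suc (depth Z x)" by (rule v.Y.depth_edge[OF edge.hyps])
  then obtain xs where xs: "length xs = depth Z x" "x = fn v (e xs)" using edge by auto
  have "(e xs, e (xs @ [True])) \<in> edge (level_tree n)"
   using xs(1) dy edge.prems by (auto simp: level_tree_def can_def)
  from v.kids_image[OF this] have "y \<in> fn v ` kids (level_tree n) (e xs)" using edge.hyps xs(2) by blast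
  then obtain b where "y = fn v (e (xs @ [b]))" using injD[OF e] by (auto simp: level_tree_def can_def)
  then show ?case using xs(1) dy by (intro exI[of _ "xs @ [b]"]) simp
 qed
 then obtain xs where "length xs = depth Z z" "z = fn v (e xs)" by blast
 then show thesis using that[of xs] d by simp
qed

end

context tree_site
begin

text \<open>Choose one element of the fibre at each \<open>comb_tree i\<close> and each
  \<open>level_tree n\<close>. These choices name the n-th node of the branch labelled i by a bit
  list. Labels with the same names have the same branch at a common stage, and a branch has only one
  label there.\<close>

lemma lepoll_of_point:
 assumes site: "site U T S r \<phi> \<psi>" and pt: "is_point U E P Q"
 shows "I \<lesssim> (UNIV :: (nat => bool list) set)"
proof -
 interpret subcanonical_site U T S r \<phi> \<psi> by (rule subcanonical_site_T[OF site])
 interpret pointed_site U T S r \<phi> \<psi> P Q by unfold_locales (rule pt)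
 \<comment> \<open>X is joined to an inhabited stage over the initial tree; the element is lifted by
   surjectivity and then restricted to X.\<close>
 have p_ne: "\<exists>d. d \<in> p X" if X: "ob X" for X
 proof -
  obtain Z d where Z: "Z \<in> obj T" and d: "d \<in> p Z" using p_nonempty by blast
  obtain f g where f: "f \<in> hom T T0 Z" and g: "g \<in> hom T T0 X" using T0_initial[OF X] T0_initial[of Z] Z T_obj by blast
  obtain W h k where h: "h \<in> hom T Z W" and k: "k \<in> hom T X W" using amalgamation[OF f g] by blast
  obtain d' where "d' \<in> p W" using res_surj[OF h d] by blast
  then show ?thesis using res_in[OF k] by blast
 qed
 \<comment> \<open>Two stages over the same fibre elements are joined in a third one, where
   faithfulness makes the composite arrows equal. So whether two nodes coincide can be decided at
   either stage.\<close>
 have transfer: "fn u2 x = fn v2 y"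
  if w1: "u1 \<in> hom T X Z1" "v1 \<in> hom T Y Z1" "d1 \<in> p Z1" and w2: "u2 \<in> hom T X Z2" "v2 \<in> hom T Y Z2" "d2 \<in> p Z2"
   and eq: "res u1 d1 = res u2 d2" "res v1 d1 = res v2 d2" and x: "x \<in> nodes X" and y: "y \<in> nodes Y" and xy: "fn u1 x = fn v1 y"
  for X Y Z1 Z2 u1 v1 u2 v2 d1 d2 x y
 proof -
  obtain Z c a1 a2 where c: "c \<in> p Z" and a: "a1 \<in> hom T Z1 Z" "a2 \<in> hom T Z2 Z" and r: "res a1 c = d1" "res a2 c = d2"
   using res_joint[OF hom_obj(2)[OF w1(1)] hom_obj(2)[OF w2(1)] w1(3) w2(3)] by blast
  have "res (a1 \<odot> u1) c = res (a2 \<odot> u2) c" "res (a1 \<odot> v1) c = res (a2 \<odot> v2) c"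
   using res_cmp[OF w1(1) a(1) c] res_cmp[OF w2(1) a(2) c] res_cmp[OF w1(2) a(1) c] res_cmp[OF w2(2) a(2) c] r eq by metis+
  then have "a1 \<odot> u1 = a2 \<odot> u2" "a1 \<odot> v1 = a2 \<odot> v2"
   using res_faithful[OF cmp_hom[OF w1(1) a(1)] cmp_hom[OF w2(1) a(2)] c]
    res_faithful[OF cmp_hom[OF w1(2) a(1)] cmp_hom[OF w2(2) a(2)] c] by blast+
  then have "fn a1 (fn u1 x) = fn a2 (fn u2 x)" "fn a1 (fn v1 y) = fn a2 (fn v2 y)"
   using fn_cmp[OF w1(1) x] fn_cmp[OF w2(1) x] fn_cmp[OF w1(2) y] fn_cmp[OF w2(2) y] by metis+
  then have "fn a2 (fn u2 x) = fn a2 (fn v2 y)" using xy by metis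
  then show ?thesis by (rule inj_onD[OF embedding.inj[OF T_homD(4)[OF a(2)]] _ fn_node[OF w2(1) x] fn_node[OF w2(2) y]])
 qed
 define ee where "ee i = (SOME d. d \<in> p (comb_tree i))" for i
 have ee: "ee i \<in> p (comb_tree i)" if "i \<in> I" for i unfolding ee_def by (rule someI_ex[OF p_ne[OF comb_tree(1)[OF that]]])
 define cc where "cc n = (SOME d. d \<in> p (level_tree n))" for n
 have cc: "cc n \<in> p (level_tree n)" for n unfolding cc_def by (rule someI_ex[OF p_ne[OF level_tree]])
 have spine: "spine n \<in> nodes (comb_tree i)" if "i \<in> I" for i n
  by (rule fbt.branch_node[OF ob_fbt comb_tree(2)]) (simp_all add: that comb_tree)
 \<comment> \<open>At some stage, the n-th spine node of \<open>comb_tree i\<close> is the node of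
   \<open>level_tree n\<close> coded by xs.\<close>
 define wit where "wit i n xs \<longleftrightarrow> length xs \<le> n \<and> (\<exists>Z d u v. d \<in> p Z \<and> u \<in> hom T (comb_tree i) Z \<and> v \<in> hom T (level_tree n) Z \<and>
  res u d = ee i \<and> res v d = cc n \<and> fn v (e xs) = fn u (spine n))" for i n xs
 have "\<exists>xs. wit i n xs" if i: "i \<in> I" for i n
 proof -
  obtain Z d u v where w: "d \<in> p Z" "u \<in> hom T (comb_tree i) Z" "v \<in> hom T (level_tree n) Z" "res u d = ee i" "res v d = cc n"
   using res_joint[OF _ _ ee[OF i] cc[of n]] comb_tree(1)[OF i] level_tree T_obj by metis
  interpret u: embedding "comb_tree i" Z "fn u" by (rule T_homD(4)[OF w(2)])
  have "depth Z ((fn u \<circ> spine) n) = n" by (rule u.Y.depth_branch[OF u.branch[OF comb_tree(2)[OF i]]])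
  then have "depth Z (fn u (spine n)) \<le> n" by simp
  then obtain xs where "length xs \<le> n" "fn u (spine n) = fn v (e xs)"
   using level_tree_cover[OF w(3) fn_node[OF w(2) spine[OF i]]] by blast
  then show ?thesis using w unfolding wit_def by metis
 qed
 then have \<beta>: "wit i n (SOME xs. wit i n xs)" if "i \<in> I" for i n using that by (meson someI_ex)
 define \<beta> where "\<beta> i n = (SOME xs. wit i n xs)" for i n
 note \<beta> = \<beta>[folded \<beta>_def]
 have "inj_on \<beta> I"
 proof (rule inj_onI)
  fix i j assume i: "i \<in> I" and j: "j \<in> I" and eq: "\<beta> i = \<beta> j"
  obtain Z d u v where d: "d \<in> p Z" and u: "u \<in> hom T (comb_tree i) Z" and v: "v \<in> hom T (comb_tree j) Z"
   and r: "res u d = ee i" "res v d = ee j"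
   using res_joint[OF _ _ ee[OF i] ee[OF j]] comb_tree(1) i j T_obj by metis
  have "fn u (spine n) = fn v (spine n)" for n
  proof -
   \<comment> \<open>A stage above Z that also carries the chosen element of
     \<open>level_tree n\<close>, so that both spine nodes acquire their names there.\<close>
   obtain W c a w where c: "c \<in> p W" and a: "a \<in> hom T Z W" and w: "w \<in> hom T (level_tree n) W" and rc: "res a c = d" "res w c = cc n"
    using res_joint[OF hom_obj(2)[OF u] _ d cc[of n]] level_tree T_obj by metis
   have lev: "e xs \<in> nodes (level_tree n)" if "length xs \<le> n" for xs using that by (simp add: level_tree_def can_def)
   have *: "fn w (e (\<beta> k n)) = fn a (fn t (spine n))"
    if k: "k \<in> I" and t: "t \<in> hom T (comb_tree k) Z" and rt: "res t d = ee k" for k t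
   proof -
    obtain Z' d' u' v' where l: "length (\<beta> k n) \<le> n" and w': "d' \<in> p Z'" "u' \<in> hom T (comb_tree k) Z'" "v' \<in> hom T (level_tree n) Z'"
     "res u' d' = ee k" "res v' d' = cc n" "fn v' (e (\<beta> k n)) = fn u' (spine n)" using \<beta>[OF k, of n] unfolding wit_def by blast
    have "res (a \<odot> t) c = ee k" using res_cmp[OF t a c] rc(1) rt by simp
    then have "fn w (e (\<beta> k n)) = fn (a \<odot> t) (spine n)"
     using transfer[OF w'(3,2,1) w cmp_hom[OF t a] c _ _ lev[OF l] spine[OF k] w'(6)] w'(4,5) rc(2) by simp
    then show ?thesis unfolding fn_cmp[OF t spine[OF k]] .
   qed
   have "fn a (fn u (spine n)) = fn a (fn v (spine n))" using *[OF i u r(1)] *[OF j v r(2)] eq by metis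
   then show ?thesis
    by (rule inj_onD[OF embedding.inj[OF T_homD(4)[OF a]] _ fn_node[OF u spine[OF i]] fn_node[OF v spine[OF j]]])
  qed
  then have "fn u \<circ> spine = fn v \<circ> spine" by (simp add: fun_eq_iff)
  moreover have "label Z (fn u \<circ> spine) = Some i"
   using emb_label[OF T_homD(1,3)[OF u] comb_tree(2)[OF i]] comb_tree(3)[OF i] by metis
  moreover have "label Z (fn v \<circ> spine) = Some j"
   using emb_label[OF T_homD(1,3)[OF v] comb_tree(2)[OF j]] comb_tree(3)[OF j] by metis
  ultimately show "i = j" by (metis option.inject)
 qed
 then show ?thesis unfolding lepoll_def by blast
qed

lemma no_points:
 assumes "site U T S r \<phi> \<psi>" and large: "(UNIV :: nat set set) \<prec> I"
 shows "\<not> is_point U E P Q"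
proof
 assume "is_point U E P Q"
 from lepoll_of_point[OF assms(1) this] have "I \<lesssim> (UNIV :: nat set set)" by (rule lepoll_trans[OF _ lepoll_sequences])
 then show False using large lepoll_antisym unfolding lesspoll_def by blast
qed

end

theorem corollary3p7:
  fixes I :: "'u set"
  assumes "inaccessible TYPE('u)"
    and "small TYPE('u) I"
    and "(UNIV :: nat set set) \<prec> I"
  shows "let E = Sh TYPE('u) (opp (T_cat I)) (atomic_topology (opp (T_cat I)))
         in grothendieck_topos TYPE('u) E \<and>
            connected_topos TYPE('u) E \<and>
            locally_finitely_presentable TYPE('u) E \<and>
            atomic_topos TYPE('u) E \<and>
            (\<nexists>P Q. is_point TYPE('u) E P Q)"
proof -
  interpret universe "TYPE('u)" by (rule universe.intro) (rule assms(1))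
  \<comment> \<open>Bit lists form a small set, so they embed into the universe; \<open>e\<close>
    supplies the nodes of all canonical trees.\<close>
  have "small TYPE('u) (lists (UNIV :: bool set))" by (intro small_lists small_finite finite)
  then have "small TYPE('u) (UNIV :: bool list set)" unfolding lists_UNIV .
  then obtain e :: "bool list \<Rightarrow> 'u" where e: "inj e" by (rule small_embed)
  interpret tree_site "TYPE('u)" I e
    by (intro tree_site.intro universe_axioms trees.intro tree_site_axioms.intro e assms(2))
  obtain S r \<phi> \<psi> where site: "site TYPE('u) T S r \<phi> \<psi>" using site_T by blast
  interpret F: finitary_site "TYPE('u)" T S r \<phi> \<psi> T0 by (rule finitary_site_T[OF site])
  show ?thesis
    unfolding Let_def E_def[symmetric]
    using F.grothendieck_topos_E F.connected_topos_E F.locally_finitely_presentable_E F.atomic_topos_E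
      no_points[OF site assms(3)] by blast
qed

end
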